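(* Let $(\mathbf x_{0i})_{i\ge1}\subset\mathcal X(\delta)$ for some constant $\delta>0$ not depending on $n$, with $\sup_{\mathbf x\in\mathcal X}|F_n(\mathbf x)-F(\mathbf x)|\to0$, and let $\rho_n\equiv1$ or $\rho_n\to0$, $\rho=\lim_n\rho_n$. Put $$\boldsymbol\Sigma(\mathbf x)=\boldsymbol\Delta^{-1}\left[\int_{\mathcal X}\mathbf x_1^{\mathrm T}\mathbf x(1-\rho\mathbf x_1^{\mathrm T}\mathbf x)\mathbf x_1\mathbf x_1^{\mathrm T}F(d\mathbf x_1)\right]\boldsymbol\Delta^{-1},\qquad \mathbf G(\mathbf x)=\int_{\mathcal X}\frac{\mathbf x_1\mathbf x_1^{\mathrm T}}{\mathbf x^{\mathrm T}\mathbf x_1(1-\rho\mathbf x^{\mathrm T}\mathbf x_1)}F(d\mathbf x_1).$$ Then $\boldsymbol\Sigma(\mathbf x)-\mathbf G(\mathbf x)^{-1}$ is positive semidefinite for every $\mathbf x\in\mathcal X(\delta)$. Moreover, suppose $\mathbf A\sim\mathrm{RDPG}(\mathbf X_0)$ with sparsity factor $\rho_n$, $\boldsymbol\Sigma(\mathbf x)$ is strictly positive definite for all $\mathbf x\in\mathcal X$, either $\rho_n\equiv1$, or $\rho_n\to0$ with $(\log n)^4/(n\rho_n)\to0$ and $(\log n)^{2(1\vee\omega)}/(n\rho_n^5)\to0$, $\widehat{\mathbf X}^{(\mathrm{ASE})}$ is the adjacency spectral embedding of $\mathbf A$ into $\mathbb R^d$, and $\widehat{\mathbf X}$ is the one-step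 estimator initialized at an estimator satisfying the approximate linearization property with exponent $\omega\ge0$. Then there are sequences of orthogonal matrices $\mathbf W_n,\mathbf W_n'\in\mathbb O(d)$ such that $$\|\widehat{\mathbf X}^{(\mathrm{ASE})}\mathbf W_n-\rho_n^{1/2}\mathbf X_0\|_{\mathrm F}^2-\|\widehat{\mathbf X}\mathbf W_n'-\rho_n^{1/2}\mathbf X_0\|_{\mathrm F}^2\to\int_{\mathcal X}\mathrm{tr}\{\boldsymbol\Sigma(\mathbf x)-\mathbf G(\mathbf x)^{-1}\}F(d\mathbf x)\ge0$$ in $\mathbb P_0$-probability.
   Context: Setting: $d\ge1$ is fixed and $\mathcal X=\{\mathbf x=[x_1,\ldots,x_d]^{\mathrm T}\in\mathbb R^d: x_1,\ldots,x_d>0,\ \|\mathbf x\|<1\}$. $(\mathbf x_{0i})_{i\ge1}$ is a deterministic sequence in $\mathcal X$ and $\mathbf X_0=[\mathbf x_{01},\ldots,\mathbf x_{0n}]^{\mathrm T}\in\mathbb R^{n\times d}$; $\rho_n\in(0,1]$. $\mathbf A\sim\mathrm{RDPG}(\mathbf X_0)$ with sparsity factor $\rho_n$ means that $\mathbf A=[A_{ij}]$ is a random symmetric $n\times n$ $\{0,1\}$-matrix with zero diagonal and $A_{ij}\sim\mathrm{Bernoulli}(\rho_n\mathbf x_{0i}^{\mathrm T}\mathbf x_{0j})$ independently for $i<j$. $\mathbb P_0$ is the corresponding probability; $O_{\mathbb P_0},o_{\mathbb P_0}$ are stochastic orders as $n\to\infty$. $F$ is a probability distribution on $\mathcal X$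 (identified with its cumulative distribution function), $F_n(\mathbf x)=\frac1n\sum_{i=1}^n\mathbf 1\{\mathbf x_{0i}\le\mathbf x\}$ with $\le$ coordinatewise. The matrix $\boldsymbol\Delta=\int_{\mathcal X}\mathbf x\mathbf x^{\mathrm T}F(d\mathbf x)$ is assumed non-singular. For $\delta\in(0,1/2)$, $\mathcal X(\delta)$ is a compact convex subset of $\mathcal X$ with $\mathbf x^{\mathrm T}\mathbf u\in[\delta,1-\delta]$ for all $\mathbf x,\mathbf u\in\mathcal X(\delta)$. $\mathbb O(d)$ is the set of $d\times d$ orthogonal matrices; orthogonal alignment matrices depend on $n$ and may depend on $\mathbf A$. $a\vee b=\max(a,b)$; $a\lesssim b$ means $a\le Cb$ for a constant $C>0$. Adjacency spectral embedding (ASE): $\widehat{\mathbf X}^{(\mathrm{ASE})}=\arg\min_{\mathbf X\in\mathbb R^{n\times d}}\|\mathbf A-\mathbf X\mathbf X^{\mathrm T}\|_{\mathrm F}^2$. Approximate linearization property (exponent $\omega\ge0$): an estimator $\widetilde{\mathbf X}=[\widetilde{\mathbf x}_1,\ldots,\widetilde{\mathbf x}_n]^{\mathrm T}\in\mathbb R^{n\times d}$ (a function of $\mathbf A$) has this property if for all $n$ there exist $\mathbf W=\mathbf W_n\in\mathbb O(d)$ and an $n\times d$ matrix $\widetilde{\mathbf R}=[\widetilde{\mathbf R}_1,\ldots,\widetilde{\mathbf R}_n]^{\mathrm T}$ with $\|\widetilde{\mathbf R}\|_{\mathrm F}^2=O_{\mathbb P_0}((n\rho_n)^{-1}(\log n)^\omega)$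 such that $$\mathbf W^{\mathrm T}\widetilde{\mathbf x}_i-\rho_n^{1/2}\mathbf x_{0i}=\rho_n^{-1/2}\sum_{j=1}^n(A_{ij}-\rho_n\mathbf x_{0i}^{\mathrm T}\mathbf x_{0j})\boldsymbol\zeta_{ij}+\widetilde{\mathbf R}_i,\quad i=1,\ldots,n,$$ where $\{\boldsymbol\zeta_{ij}:i,j\in[n]\}$ are deterministic vectors in $\mathbb R^d$ with $\sup_{i,j\in[n]}\|\boldsymbol\zeta_{ij}\|\lesssim1/n$. One-step estimator $\widehat{\mathbf X}=[\widehat{\mathbf x}_1,\ldots,\widehat{\mathbf x}_n]^{\mathrm T}$ initialized at $\widetilde{\mathbf X}$: for $i=1,\ldots,n$, $$\widehat{\mathbf x}_i=\widetilde{\mathbf x}_i+\left\{\frac1n\sum_{j=1}^n\frac{\widetilde{\mathbf x}_j\widetilde{\mathbf x}_j^{\mathrm T}}{\widetilde{\mathbf x}_i^{\mathrm T}\widetilde{\mathbf x}_j(1-\widetilde{\mathbf x}_i^{\mathrm T}\widetilde{\mathbf x}_j)}\right\}^{-1}\left\{\frac1n\sum_{j=1}^n\frac{(A_{ij}-\widetilde{\mathbf x}_i^{\mathrm T}\widetilde{\mathbf x}_j)\widetilde{\mathbf x}_j}{\widetilde{\mathbf x}_i^{\mathrm T}\widetilde{\mathbf x}_j(1-\widetilde{\mathbf x}_i^{\mathrm T}\widetilde{\mathbf x}_j)}\right\}$$ (on the event that these expressions are well defined; arbitrary otherwise). *)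

theory Defs
  imports "HOL-Probability.Probability"
begin

(* Conventions. The dimension d is CARD('d). An n-by-d real matrix with rows x_0, ..., x_{n-1} is a
   function X :: nat => real^'d of which only the values at i < n matter, and an n-by-n matrix is
   a function nat => nat => real; rows and vertices are numbered from 0 instead of from 1. *)

definition latent_space :: "(real^'d) set" where
  "latent_space = {x. (\<forall>k. 0 < x $ k) \<and> norm x < 1}"

definition outer :: "real^'d \<Rightarrow> real^'d^'d" where
  "outer x = (\<chi> i j. x $ i * x $ j)"

definition psd_matrix :: "real^'d^'d \<Rightarrow> bool" where
  "psd_matrix S \<longleftrightarrow> transpose S = S \<and> (\<forall>v. 0 \<le> v \<bullet> (S *v v))"

definition pd_matrix :: "real^'d^'d \<Rightarrow> bool" where
  "pd_matrix S \<longleftrightarrow> transpose S = S \<and> (\<forall>v. v \<noteq> 0 \<longrightarrow> 0 < v \<bullet> (S *v v))"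

definition frob_sq :: "nat \<Rightarrow> (nat \<Rightarrow> real^'d) \<Rightarrow> real" where
  "frob_sq n X = (\<Sum>i<n. (norm (X i))\<^sup>2)"

definition Delta_mat :: "(real^'d) measure \<Rightarrow> real^'d^'d" where
  "Delta_mat F = (LINT y:latent_space|F. outer y)"

definition Sigma_mat :: "(real^'d) measure \<Rightarrow> real \<Rightarrow> real^'d \<Rightarrow> real^'d^'d" where
  "Sigma_mat F \<rho> x =
     matrix_inv (Delta_mat F)
     ** (LINT y:latent_space|F. ((y \<bullet> x) * (1 - \<rho> * (y \<bullet> x))) *\<^sub>R outer y)
     ** matrix_inv (Delta_mat F)"

definition G_mat :: "(real^'d) measure \<Rightarrow> real \<Rightarrow> real^'d \<Rightarrow> real^'d^'d" where
  "G_mat F \<rho> x =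
     (LINT y:latent_space|F. (1 / ((x \<bullet> y) * (1 - \<rho> * (x \<bullet> y)))) *\<^sub>R outer y)"

definition empirical_cdf :: "(nat \<Rightarrow> real^'d) \<Rightarrow> nat \<Rightarrow> real^'d \<Rightarrow> real" where
  "empirical_cdf x0 n x = (\<Sum>i<n. of_bool (x0 i \<le> x)) / real n"

(* The random adjacency matrix is extended by 0 outside the index range, so that it takes only
   finitely many values and every function of it is a random variable. *)
definition rdpg :: "'w measure \<Rightarrow> nat \<Rightarrow> real \<Rightarrow> (nat \<Rightarrow> real^'d) \<Rightarrow>
    ('w \<Rightarrow> nat \<Rightarrow> nat \<Rightarrow> real) \<Rightarrow> bool" where
  "rdpg M n r x0 A \<longleftrightarrow>
     prob_space M \<and>
     (\<forall>w\<in>space M. \<forall>i j. A w i j \<in> {0, 1} \<and> A w i j = A w j i \<and> A w i i = 0 \<and>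
        (n \<le> i \<or> n \<le> j \<longrightarrow> A w i j = 0)) \<and>
     prob_space.indep_vars M (\<lambda>_. borel) (\<lambda>(i, j) w. A w i j) {(i, j). i < j \<and> j < n} \<and>
     (\<forall>i j. i < j \<and> j < n \<longrightarrow>
        distr M (count_space UNIV) (\<lambda>w. A w i j = 1)
          = measure_pmf (bernoulli_pmf (r * (x0 i \<bullet> x0 j))))"

(* Z n = O_P(a n) and Z n --> l in probability, where the n-th variable lives on the n-th
   probability space. *)
definition bigO_in_prob :: "(nat \<Rightarrow> 'w measure) \<Rightarrow> (nat \<Rightarrow> 'w \<Rightarrow> real) \<Rightarrow> (nat \<Rightarrow> real) \<Rightarrow> bool" where
  "bigO_in_prob M Z a \<longleftrightarrow>
     (\<forall>\<epsilon>>0. \<exists>C>0. \<forall>\<^sub>F n in sequentially.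
        measure (M n) {w \<in> space (M n). C * a n < \<bar>Z n w\<bar>} \<le> \<epsilon>)"

definition tendsto_in_prob :: "(nat \<Rightarrow> 'w measure) \<Rightarrow> (nat \<Rightarrow> 'w \<Rightarrow> real) \<Rightarrow> real \<Rightarrow> bool" where
  "tendsto_in_prob M Z l \<longleftrightarrow>
     (\<forall>\<epsilon>>0. (\<lambda>n. measure (M n) {w \<in> space (M n). \<epsilon> < \<bar>Z n w - l\<bar>}) \<longlonglongrightarrow> 0)"

(* A predicate, because the minimiser is not unique: any right orthogonal factor can be applied. *)
definition is_ase :: "nat \<Rightarrow> (nat \<Rightarrow> nat \<Rightarrow> real) \<Rightarrow> (nat \<Rightarrow> real^'d) \<Rightarrow> bool" where
  "is_ase n a X \<longleftrightarrow>
     is_arg_min (\<lambda>X :: nat \<Rightarrow> real^'d. \<Sum>i<n. \<Sum>j<n. (a i j - X i \<bullet> X j)\<^sup>2) (\<lambda>_. True) X"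

(* An estimator is a function of n and of the observed adjacency matrix; so are the alignment
   matrices W and the remainders R. The vectors zeta depend on n but not on the data. *)
definition approx_linearization :: "(nat \<Rightarrow> 'w measure) \<Rightarrow> (nat \<Rightarrow> 'w \<Rightarrow> nat \<Rightarrow> nat \<Rightarrow> real) \<Rightarrow>
    (nat \<Rightarrow> real) \<Rightarrow> (nat \<Rightarrow> real^'d) \<Rightarrow> real \<Rightarrow>
    (nat \<Rightarrow> (nat \<Rightarrow> nat \<Rightarrow> real) \<Rightarrow> nat \<Rightarrow> real^'d) \<Rightarrow> bool" where
  "approx_linearization M A \<rho>n x0 \<omega> Xt \<longleftrightarrow>
     (\<exists>(W :: nat \<Rightarrow> (nat \<Rightarrow> nat \<Rightarrow> real) \<Rightarrow> real^'d^'d)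
       (R :: nat \<Rightarrow> (nat \<Rightarrow> nat \<Rightarrow> real) \<Rightarrow> nat \<Rightarrow> real^'d)
       (\<zeta> :: nat \<Rightarrow> nat \<Rightarrow> nat \<Rightarrow> real^'d).
        (\<forall>n a. orthogonal_matrix (W n a)) \<and>
        bigO_in_prob M (\<lambda>n w. frob_sq n (R n (A n w)))
          (\<lambda>n. (ln (real n)) powr \<omega> / (real n * \<rho>n n)) \<and>
        (\<exists>C>0. \<forall>n. \<forall>i<n. \<forall>j<n. norm (\<zeta> n i j) \<le> C / real n) \<and>
        (\<forall>n. \<forall>w\<in>space (M n). \<forall>i<n.
           transpose (W n (A n w)) *v Xt n (A n w) i - sqrt (\<rho>n n) *\<^sub>R x0 i =
             (1 / sqrt (\<rho>n n)) *\<^sub>R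
               (\<Sum>j<n. (A n w i j - \<rho>n n * (x0 i \<bullet> x0 j)) *\<^sub>R \<zeta> n i j)
             + R n (A n w) i))"

definition one_step_weight :: "(nat \<Rightarrow> real^'d) \<Rightarrow> nat \<Rightarrow> nat \<Rightarrow> real" where
  "one_step_weight X i j = (X i \<bullet> X j) * (1 - X i \<bullet> X j)"

definition one_step_info :: "nat \<Rightarrow> (nat \<Rightarrow> real^'d) \<Rightarrow> nat \<Rightarrow> real^'d^'d" where
  "one_step_info n X i =
     (1 / real n) *\<^sub>R (\<Sum>j<n. (1 / one_step_weight X i j) *\<^sub>R outer (X j))"

definition one_step_score ::
    "nat \<Rightarrow> (nat \<Rightarrow> nat \<Rightarrow> real) \<Rightarrow> (nat \<Rightarrow> real^'d) \<Rightarrow> nat \<Rightarrow> real^'d" where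
  "one_step_score n a X i =
     (1 / real n) *\<^sub>R (\<Sum>j<n. ((a i j - X i \<bullet> X j) / one_step_weight X i j) *\<^sub>R X j)"

(* Y is unconstrained if, for some row i < n, a denominator vanishes or the matrix to be inverted
   is singular. *)
definition is_one_step ::
    "nat \<Rightarrow> (nat \<Rightarrow> nat \<Rightarrow> real) \<Rightarrow> (nat \<Rightarrow> real^'d) \<Rightarrow> (nat \<Rightarrow> real^'d) \<Rightarrow> bool" where
  "is_one_step n a X Y \<longleftrightarrow>
     ((\<forall>i<n. (\<forall>j<n. one_step_weight X i j \<noteq> 0) \<and> invertible (one_step_info n X i)) \<longrightarrow>
      (\<forall>i<n. Y i = X i + matrix_inv (one_step_info n X i) *v one_step_score n a X i))"

end

theory Submission imports Defs begin

text \<open>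
  Let \<open>E\<close> be the off-diagonal noise in \<open>A\<close>. The products of centred independent entries of \<open>E\<close> are orthogonal, which
  gives second moment bounds for all the polynomials in \<open>E\<close> that occur; on the event that these polynomials have their
  typical size, the two estimators are analysed deterministically.

  For the spectral embedding, rotated optimally towards \<open>X = \<rho>\<^sup>1\<^sup>/\<^sup>2 X\<^sub>0\<close>, minimality bounds the Frobenius distance to \<open>X\<close>,
  because Gram matrices determine configurations up to rotation; the stationarity equation then shows that
  \<open>E X (X\<^sup>T X)\<^sup>-\<^sup>1\<close> is the leading term of the error. The one-step estimator solves a weighted least squares equation
  with weights \<open>\<phi>(s) = 1 / (s (1 - \<rho> s))\<close>. A Taylor expansion of \<open>\<phi>\<close> shows that the error of the initial estimator
  contributes to it only at second order, or through products of its linear part with \<open>E\<close>, so that the leading term is a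
  linear function of \<open>E\<close> again.

  The squared norms of both linear terms concentrate around their means. These are averages over pairs of latent
  positions, and converge because convergence of the distribution functions implies a uniform law of large numbers
  for continuous functions on the compact set that contains the positions. The comparison of the limits is a matrix
  Cauchy-Schwarz inequality.\<close>

subsection \<open>The random graph as a finite probability mass function\<close>

text \<open>No matrix concentration inequality is used. Bounds uniform over the rows come from
  fourth moments summed over all rows: the fourth root of \<open>n ^ 3 * r ^ 2\<close>, with r the
  sparsity factor, is \<open>n * r\<close> times \<open>n * r ^ 2\<close> to the power -1/4, so
  polynomial rates in r pay for uniformity. Two obstacles shape the perturbation arguments. For the
  embedding, stationarity produces the term X K with K = X^T (Z - X). Cauchy-Schwarz bounds K only
  by the order of sqrt(n r), which would make this term as large as the leading one. The optimal
  rotation makes K symmetric, and testing the stationarity equation against K itself gives a bound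
  that does not grow with n. For the one-step estimator, the noise multiplies initial errors that
  depend on the same noise. Their linear part turns the products into sums over two-step walks,
  whose second moments are small; their remainder, known only in Frobenius norm, is paired with the
  Frobenius norm of the noise and must therefore be of smaller order than sqrt r.\<close>

definition edges :: "nat \<Rightarrow> (nat \<times> nat) set" where
  "edges n = {(i, j). i < j \<and> j < n}"

text \<open>Independence and the edge probabilities enter only through this product formula for
  expectations. Finite support makes every function integrable without any measurability
  condition.\<close>

definition edge_model ::
    "nat \<Rightarrow> (nat \<Rightarrow> nat \<Rightarrow> real) \<Rightarrow> (nat \<Rightarrow> nat \<Rightarrow> real) pmf \<Rightarrow> bool" where
  "edge_model n q p \<longleftrightarrow>
     finite (set_pmf p) \<and>
     (\<forall>a\<in>set_pmf p. \<forall>i j. a i j \<in> {0, 1} \<and> a i j = a j i \<and> a i i = 0) \<and>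
     (\<forall>g :: nat \<times> nat \<Rightarrow> real \<Rightarrow> real.
        measure_pmf.expectation p (\<lambda>a. \<Prod>e\<in>edges n. g e (a (fst e) (snd e)))
          = (\<Prod>e\<in>edges n. q (fst e) (snd e) * g e 1 + (1 - q (fst e) (snd e)) * g e 0))"

lemma finite_edges [simp]: "finite (edges n)"
proof -
  have "edges n \<subseteq> {..<n} \<times> {..<n}" by (auto simp: edges_def)
  then show ?thesis by (rule finite_subset) auto
qed

text \<open>Only single entries are assumed measurable, but \<open>A w\<close> is determined by
  finitely many of them and takes finitely many values, so \<open>A\<close> is measurable into a
  discrete space. The third conclusion transfers hypotheses stated for sample points to the matrices
  in the support.\<close>

lemma rdpg_pmf:
  fixes x0 :: "nat \<Rightarrow> real^'d"
  assumes rd: "rdpg M n r x0 A"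
    and q01: "\<And>i j. i < j \<Longrightarrow> j < n \<Longrightarrow> r * (x0 i \<bullet> x0 j) \<in> {0..1}"
  obtains p where "edge_model n (\<lambda>i j. r * (x0 i \<bullet> x0 j)) p"
    and "\<And>Q. measure M {w \<in> space M. Q (A w)} = measure_pmf.prob p {a. Q a}"
    and "\<And>a. a \<in> set_pmf p \<Longrightarrow> \<exists>w\<in>space M. A w = a"
proof -
  define q where "q = (\<lambda>i j. r * (x0 i \<bullet> x0 j))"
  from rd interpret prob_space M by (simp add: rdpg_def)
  have ent: "A w i j \<in> {0, 1}" "A w i j = A w j i" "A w i i = 0"
       "n \<le> i \<or> n \<le> j \<Longrightarrow> A w i j = 0" if "w \<in> space M" for w i j
    using rd that unfolding rdpg_def by blast+
  have ind: "indep_vars (\<lambda>_. borel) (\<lambda>(i, j) w. A w i j) (edges n)"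
    using rd unfolding rdpg_def edges_def by blast
  have dis: "distr M (count_space UNIV) (\<lambda>w. A w i j = 1) = measure_pmf (bernoulli_pmf (q i j))"
    if "i < j" "j < n" for i j using rd that unfolding rdpg_def q_def by blast
  have meas: "(\<lambda>w. A w i j) \<in> borel_measurable M" if "(i, j) \<in> edges n" for i j
    using ind that unfolding indep_vars_def by fastforce
  \<comment> \<open>The 0-1 matrices that vanish outside the index square: finitely many, and all
    values of \<open>A\<close> are among them.\<close>
  define R where "R = (\<lambda>S i j. of_bool ((i, j) \<in> S) :: real) ` Pow ({..<n} \<times> {..<n})"
  have finR: "finite R" by (simp add: R_def)
  have AR: "A w \<in> R" if w: "w \<in> space M" for w
  proof -
    have "A w = (\<lambda>i j. of_bool ((i, j) \<in> {(i, j). i < n \<and> j < n \<and> A w i j = 1}))"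
    proof (intro ext)
      fix i j show "A w i j = of_bool ((i, j) \<in> {(i, j). i < n \<and> j < n \<and> A w i j = 1})"
        using ent(1)[OF w, of i j] ent(4)[OF w, of i j] by (cases "i < n"; cases "j < n") auto
    qed
    then show ?thesis unfolding R_def by (intro image_eqI[where x = "{(i, j). i < n \<and> j < n \<and> A w i j = 1}"]) auto
  qed
  have single: "{w \<in> space M. A w = b} \<in> sets M" for b
  proof (cases "\<exists>w\<in>space M. A w = b")
    case False then have "{w \<in> space M. A w = b} = {}" by auto
    then show ?thesis by (simp only: sets.empty_sets)
  next
    case True
    then obtain u where u: "u \<in> space M" "A u = b" by auto
    \<comment> \<open>By symmetry and the zero diagonal, equality with an attained matrix is
      equality above the diagonal, hence a finite intersection of events.\<close>
    have "{w \<in> space M. A w = b} = {w \<in> space M. \<forall>e\<in>edges n. A w (fst e) (snd e) = b (fst e) (snd e)}"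
    proof (intro Collect_cong conj_cong refl iffI)
      fix w assume w: "w \<in> space M" and *: "\<forall>e\<in>edges n. A w (fst e) (snd e) = b (fst e) (snd e)"
      show "A w = b"
      proof (intro ext)
        fix i j
        have lt: "A w i j = b i j" if "i < j" for i j
          using * that ent(4)[OF w, of i j] ent(4)[OF u(1), of i j] u(2)
          by (cases "j < n") (force simp: edges_def)+
        show "A w i j = b i j"
          using lt[of i j] lt[of j i] ent(2)[OF w, of i j] ent(2)[OF u(1), of i j] ent(3)[OF w, of i]
            ent(3)[OF u(1), of i] u(2) by (cases i j rule: linorder_cases) auto
      qed
    qed auto
    also have "\<dots> \<in> sets M"
    proof (rule sets.sets_Collect_finite_All)
      fix e assume "e \<in> edges n"
      then have "(\<lambda>w. A w (fst e) (snd e)) \<in> borel_measurable M" using meas[of "fst e" "snd e"] by simp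
      then show "{w \<in> space M. A w (fst e) (snd e) = b (fst e) (snd e)} \<in> sets M" by measurable
    qed simp
    finally show ?thesis .
  qed
  have Ameas[measurable]: "A \<in> measurable M (count_space UNIV)"
  proof (rule measurableI)
    fix S :: "(nat \<Rightarrow> nat \<Rightarrow> real) set"
    have "A -` S \<inter> space M = (\<Union>b\<in>R \<inter> S. {w \<in> space M. A w = b})" using AR by auto
    also have "\<dots> \<in> sets M" using finR single by (intro sets.finite_UN) auto
    finally show "A -` S \<inter> space M \<in> sets M" .
  qed simp
  define N where "N = distr M (count_space UNIV) A"
  have pN: "prob_space N" unfolding N_def by (rule prob_space_distr) simp
  have mN: "measure N Q = measure M {w \<in> space M. A w \<in> Q}" for Q
    unfolding N_def by (subst measure_distr) (auto simp: vimage_def Int_def conj_commute)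
  \<comment> \<open>Almost every point must be an atom of positive mass: the massless points of
    \<open>R\<close> are finitely many, and the complement of \<open>R\<close> is null.\<close>
  have Rnull: "AE a in N. measure N {a} \<noteq> 0"
  proof -
    define Z where "Z = {a\<in>R. measure N {a} = 0} \<union> - R"
    have "{w \<in> space M. A w \<in> - R} = {}" using AR by auto
    then have "measure N (- R) = 0" unfolding mN by (simp only: measure_empty)
    moreover have "measure N {a\<in>R. measure N {a} = 0} = 0"
    proof -
      have "measure N {a\<in>R. measure N {a} = 0} = (\<Sum>a\<in>{a\<in>R. measure N {a} = 0}. measure N {a})"
        using pN finR by (intro finite_measure.finite_measure_eq_sum_singleton prob_space.finite_measure) (auto simp: N_def)
      then show ?thesis by simp
    qed
    ultimately have "measure N Z \<le> 0"
      unfolding Z_def using measure_Un_le[of "{a\<in>R. measure N {a} = 0}" N "-R"]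
      by (simp add: N_def)
    then have "emeasure N Z = 0"
      using finite_measure.emeasure_eq_measure[OF prob_space.finite_measure[OF pN], of Z]
      by (simp add: measure_le_0_iff)
    then show ?thesis by (intro AE_I[of _ _ Z]) (auto simp: Z_def N_def)
  qed
  define p where "p = Abs_pmf N"
  have pN': "measure_pmf p = N"
    unfolding p_def by (rule Abs_pmf_inverse) (use pN Rnull in \<open>simp add: N_def[symmetric]\<close>, simp add: N_def)
  have prob: "measure M {w \<in> space M. Q (A w)} = measure_pmf.prob p {a. Q a}" for Q
    by (simp add: pN' mN)
  have supp: "\<exists>w\<in>space M. A w = a" if "a \<in> set_pmf p" for a
  proof (rule ccontr)
    assume "\<not> ?thesis"
    then have "{w \<in> space M. A w = a} = {}" by auto
    then have "measure M {w \<in> space M. A w = a} = 0" by (simp only: measure_empty)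
    then have "pmf p a = 0" using prob[of "\<lambda>b. b = a"] by (simp add: pmf.rep_eq)
    then show False using that by (simp add: set_pmf_iff)
  qed
  have fin: "finite (set_pmf p)" by (rule finite_subset[OF _ finR]) (use supp AR in blast)
  have expct: "measure_pmf.expectation p f = (\<integral>w. f (A w) \<partial>M)" for f :: "_ \<Rightarrow> real"
    unfolding pN' N_def by (rule integral_distr) auto
  have one: "(\<integral>w. h (A w i j) \<partial>M) = q i j * h 1 + (1 - q i j) * h 0" if ij: "i < j" "j < n" for h :: "real \<Rightarrow> real" and i j
  proof -
    have q1: "q i j \<in> {0..1}" using q01[OF ij] by (simp add: q_def)
    have mb: "(\<lambda>w. A w i j = 1) \<in> measurable M (count_space UNIV)"
    proof -
      have "(\<lambda>a::nat \<Rightarrow> nat \<Rightarrow> real. a i j = 1) \<in> measurable (count_space UNIV) (count_space UNIV)" by simp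
      from measurable_compose[OF Ameas this] show ?thesis .
    qed
    have "(\<integral>w. h (A w i j) \<partial>M) = (\<integral>w. (\<lambda>b. if b then h 1 else h 0) (A w i j = 1) \<partial>M)"
    proof (rule Bochner_Integration.integral_cong)
      fix w assume "w \<in> space M"
      from ent(1)[OF this, of i j] show "h (A w i j) = (if A w i j = 1 then h 1 else h 0)" by auto
    qed simp
    also have "\<dots> = (\<integral>b. (if b then h 1 else h 0) \<partial>distr M (count_space UNIV) (\<lambda>w. A w i j = 1))"
      by (rule integral_distr[symmetric]) (auto intro: mb)
    also have "\<dots> = q i j * h 1 + (1 - q i j) * h 0"
      unfolding dis[OF ij] using q1 by simp
    finally show ?thesis .
  qed
  have "edge_model n q p"
    unfolding edge_model_def
  proof (intro conjI allI ballI)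
    fix g :: "nat \<times> nat \<Rightarrow> real \<Rightarrow> real"
    \<comment> \<open>\<open>g e\<close> need not be measurable. Composed with the test for the
      value 1 it takes two values, so it is measurable and bounded, and it agrees with
      \<open>g e\<close> on the entries of \<open>A w\<close>.\<close>
    define X where "X = (\<lambda>e w. g e (if A w (fst e) (snd e) = 1 then 1 else 0))"
    have gX: "g e (A w (fst e) (snd e)) = X e w" if "w \<in> space M" for w e
      using ent(1)[OF that, of "fst e" "snd e"] by (auto simp: X_def)
    have i2: "indep_vars (\<lambda>_. borel) X (edges n)"
    proof -
      have "indep_vars (\<lambda>_. borel) (\<lambda>e w. (\<lambda>x. g e (if x = 1 then 1 else 0)) ((\<lambda>(i, j) w. A w i j) e w)) (edges n)"
        by (rule indep_vars_compose2[OF ind]) measurable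
      then show ?thesis by (rule iffD1[OF indep_vars_cong, rotated -1]) (auto simp: X_def fun_eq_iff)
    qed
    have bd: "\<bar>X e w\<bar> \<le> \<bar>g e 1\<bar> + \<bar>g e 0\<bar>" for e w by (auto simp: X_def)
    have intg: "integrable M (X e)" if "e \<in> edges n" for e
    proof (rule integrable_const_bound)
      show "AE w in M. norm (X e w) \<le> \<bar>g e 1\<bar> + \<bar>g e 0\<bar>" using bd by simp
      show "X e \<in> borel_measurable M" using i2 that unfolding indep_vars_def by auto
    qed
    have "measure_pmf.expectation p (\<lambda>a. \<Prod>e\<in>edges n. g e (a (fst e) (snd e))) = (\<integral>w. (\<Prod>e\<in>edges n. X e w) \<partial>M)"
      unfolding expct by (rule Bochner_Integration.integral_cong) (auto simp: gX)
    also have "\<dots> = (\<Prod>e\<in>edges n. \<integral>w. X e w \<partial>M)"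
      by (rule indep_vars_lebesgue_integral) (use i2 intg in auto)
    also have "\<dots> = (\<Prod>e\<in>edges n. q (fst e) (snd e) * g e 1 + (1 - q (fst e) (snd e)) * g e 0)"
    proof (rule prod.cong)
      fix e assume "e \<in> edges n"
      then have "fst e < snd e" "snd e < n" by (auto simp: edges_def)
      from one[OF this, of "g e"] show "(\<integral>w. X e w \<partial>M) = q (fst e) (snd e) * g e 1 + (1 - q (fst e) (snd e)) * g e 0"
        by (subst Bochner_Integration.integral_cong[OF refl gX[symmetric]]) auto
    qed simp
    finally show "measure_pmf.expectation p (\<lambda>a. \<Prod>e\<in>edges n. g e (a (fst e) (snd e)))
          = (\<Prod>e\<in>edges n. q (fst e) (snd e) * g e 1 + (1 - q (fst e) (snd e)) * g e 0)" .
  next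
    fix a i j assume "a \<in> set_pmf p"
    then obtain w where w: "w \<in> space M" "A w = a" using supp by blast
    show "a i j \<in> {0, 1}" "a i j = a j i" "a i i = 0" using ent(1,2)[OF w(1), of i j] ent(3)[OF w(1), of i] unfolding w(2) by blast+
  qed (rule fin)
  with that prob supp show thesis unfolding q_def by blast
qed

lemma edge_model_integrable [simp]:
  fixes f :: "(nat \<Rightarrow> nat \<Rightarrow> real) \<Rightarrow> 'b::{banach, second_countable_topology}"
  shows "edge_model n q p \<Longrightarrow> integrable (measure_pmf p) f"
  by (auto simp: edge_model_def intro: integrable_measure_pmf_finite)

section \<open>Centred entries and the second moments of polynomials in them\<close>

definition edge_noise :: "(nat \<Rightarrow> nat \<Rightarrow> real) \<Rightarrow> (nat \<Rightarrow> nat \<Rightarrow> real) \<Rightarrow> nat \<times> nat \<Rightarrow> real" where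
  "edge_noise q a e = a (fst e) (snd e) - q (fst e) (snd e)"

definition edge_var :: "(nat \<Rightarrow> nat \<Rightarrow> real) \<Rightarrow> nat \<times> nat \<Rightarrow> real" where
  "edge_var q e = q (fst e) (snd e) * (1 - q (fst e) (snd e))"

text \<open>The expectation factors over the edges: an edge in neither set contributes 1, an edge in
  exactly one of them a centred mean, which is 0, and an edge in both its variance.\<close>

lemma expectation_monomials:
  assumes em: "edge_model n q p" and S: "S \<subseteq> edges n" and T: "T \<subseteq> edges n"
  shows "measure_pmf.expectation p (\<lambda>a. (\<Prod>e\<in>S. edge_noise q a e) * (\<Prod>e\<in>T. edge_noise q a e))
    = (if S = T then \<Prod>e\<in>S. edge_var q e else 0)"
proof -
  define g where "g = (\<lambda>e x. (if e \<in> S then x - q (fst e) (snd e) else 1) * (if e \<in> T then x - q (fst e) (snd e) else (1::real)))"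
  define m where "m = (\<lambda>e. q (fst e) (snd e) * g e 1 + (1 - q (fst e) (snd e)) * g e 0)"
  have restr: "(\<Prod>e\<in>U. f e) = (\<Prod>e\<in>edges n. if e \<in> U then f e else 1)" if "U \<subseteq> edges n" for U and f :: "_ \<Rightarrow> real"
    using prod.inter_restrict[of "edges n" f U] that by (simp add: Int_absorb1)
  have "measure_pmf.expectation p (\<lambda>a. (\<Prod>e\<in>S. edge_noise q a e) * (\<Prod>e\<in>T. edge_noise q a e))
     = measure_pmf.expectation p (\<lambda>a. \<Prod>e\<in>edges n. g e (a (fst e) (snd e)))"
    by (simp add: restr[OF S] restr[OF T] prod.distrib[symmetric] g_def edge_noise_def)
  also have "\<dots> = (\<Prod>e\<in>edges n. m e)"
    using em unfolding edge_model_def m_def by blast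
  also have "\<dots> = (if S = T then \<Prod>e\<in>S. edge_var q e else 0)"
  proof (cases "S = T")
    case True
    have "m e = (if e \<in> S then edge_var q e else 1)" for e
      using True by (simp add: m_def g_def edge_var_def algebra_simps power2_eq_square)
    then show ?thesis using True by (simp add: restr[OF T])
  next
    case False
    then obtain e where "e \<in> S \<and> e \<notin> T \<or> e \<in> T \<and> e \<notin> S" by blast
    then have "e \<in> edges n" "m e = 0" using S T by (auto simp: m_def g_def algebra_simps)
    then have "(\<Prod>e\<in>edges n. m e) = 0" by (auto intro: prod_zero)
    then show ?thesis using False by simp
  qed
  finally show ?thesis .
qed

text \<open>The monomials are orthogonal in \<open>L\<^sup>2\<close>; \<open>m\<close> bounds how often one of them is repeated.\<close>
lemma second_moment_le:
  fixes c :: "'t \<Rightarrow> 'b::real_inner"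
  assumes em: "edge_model n q p" and I: "finite I" and S: "\<And>t. t \<in> I \<Longrightarrow> S t \<subseteq> edges n"
    and mult: "\<And>t. t \<in> I \<Longrightarrow> card {u \<in> I. S u = S t} \<le> m"
    and v0: "\<And>e. e \<in> edges n \<Longrightarrow> 0 \<le> edge_var q e"
  shows "measure_pmf.expectation p (\<lambda>a. (norm (\<Sum>t\<in>I. (\<Prod>e\<in>S t. edge_noise q a e) *\<^sub>R c t))\<^sup>2)
    \<le> real m * (\<Sum>t\<in>I. (norm (c t))\<^sup>2 * (\<Prod>e\<in>S t. edge_var q e))"
proof -
  define V where "V = (\<lambda>t. \<Prod>e\<in>S t. edge_var q e)"
  have V0: "0 \<le> V t" if "t \<in> I" for t unfolding V_def using S[OF that] v0 by (intro prod_nonneg) auto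
  define k where "k = (\<lambda>t u. if S t = S u then V t else 0)"
  have "measure_pmf.expectation p (\<lambda>a. (norm (\<Sum>t\<in>I. (\<Prod>e\<in>S t. edge_noise q a e) *\<^sub>R c t))\<^sup>2)
    = measure_pmf.expectation p (\<lambda>a. \<Sum>t\<in>I. \<Sum>u\<in>I. (c t \<bullet> c u) * ((\<Prod>e\<in>S t. edge_noise q a e) * (\<Prod>e\<in>S u. edge_noise q a e)))"
    by (simp add: power2_norm_eq_inner inner_sum_left inner_sum_right sum_distrib_left mult_ac inner_commute)
  also have "\<dots> = (\<Sum>t\<in>I. \<Sum>u\<in>I. (c t \<bullet> c u) * k t u)"
    using em by (auto simp: Bochner_Integration.integral_sum expectation_monomials[OF em S S] k_def V_def intro!: sum.cong)
  \<comment> \<open>\<open>k t u\<close> is symmetric and nonnegative, so Young's inequality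
    replaces the inner products by squares. What remains counts, for each \<open>t\<close>, the
    indices that carry the same monomial.\<close>
  also have "\<dots> \<le> (\<Sum>t\<in>I. \<Sum>u\<in>I. ((norm (c t))\<^sup>2 / 2) * k t u + ((norm (c u))\<^sup>2 / 2) * k u t)"
  proof (intro sum_mono)
    fix t u assume t: "t \<in> I" and u: "u \<in> I"
    have "c t \<bullet> c u \<le> norm (c t) * norm (c u)" by (rule norm_cauchy_schwarz)
    also have "\<dots> \<le> (norm (c t))\<^sup>2 / 2 + (norm (c u))\<^sup>2 / 2"
      using sum_squares_bound[of "norm (c t)" "norm (c u)"] by simp
    finally have "(c t \<bullet> c u) * k t u \<le> ((norm (c t))\<^sup>2 / 2 + (norm (c u))\<^sup>2 / 2) * k t u"
      using V0[OF t] by (intro mult_right_mono) (auto simp: k_def)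
    moreover have "k u t = k t u" by (simp add: k_def V_def)
    ultimately show "(c t \<bullet> c u) * k t u \<le> ((norm (c t))\<^sup>2 / 2) * k t u + ((norm (c u))\<^sup>2 / 2) * k u t"
      by (simp add: algebra_simps)
  qed
  also have "\<dots> = (\<Sum>t\<in>I. \<Sum>u\<in>I. (norm (c t))\<^sup>2 * k t u)"
  proof -
    have "(\<Sum>t\<in>I. \<Sum>u\<in>I. ((norm (c u))\<^sup>2 / 2) * k u t) = (\<Sum>t\<in>I. \<Sum>u\<in>I. ((norm (c t))\<^sup>2 / 2) * k t u)"
      by (rule sum.swap)
    then show ?thesis by (simp add: sum.distrib sum_divide_distrib[symmetric])
  qed
  also have "\<dots> = (\<Sum>t\<in>I. (norm (c t))\<^sup>2 * (V t * real (card {u \<in> I. S u = S t})))"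
  proof (intro sum.cong refl)
    fix t assume "t \<in> I"
    have "(\<Sum>u\<in>I. k t u) = (\<Sum>u\<in>{u \<in> I. S u = S t}. V t)"
      unfolding k_def using I by (intro sum.mono_neutral_cong_right) (auto)
    then show "(\<Sum>u\<in>I. (norm (c t))\<^sup>2 * k t u) = (norm (c t))\<^sup>2 * (V t * real (card {u \<in> I. S u = S t}))"
      by (simp add: sum_distrib_left[symmetric] sum_distrib_right[symmetric] mult.commute)
  qed
  also have "\<dots> \<le> (\<Sum>t\<in>I. (norm (c t))\<^sup>2 * (V t * real m))"
    using mult V0 by (intro sum_mono mult_left_mono) auto
  finally show ?thesis by (simp add: V_def sum_distrib_left mult_ac)
qed

text \<open>On the diagonal \<open>a i i - q i i\<close> is the constant \<open>- q i i\<close> on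
  the support, a bias and not noise. It is cut out here and carried along as a lower-order term
  (\<open>full_noise\<close>).\<close>

definition noise :: "(nat \<Rightarrow> nat \<Rightarrow> real) \<Rightarrow> (nat \<Rightarrow> nat \<Rightarrow> real) \<Rightarrow> nat \<Rightarrow> nat \<Rightarrow> real" where
  "noise q a i j = (if i = j then 0 else a i j - q i j)"

lemma noise_diag [simp]: "noise q a i i = 0" by (simp add: noise_def)

definition edge :: "nat \<Rightarrow> nat \<Rightarrow> nat \<times> nat" where
  "edge i j = (min i j, max i j)"

definition sparse_model ::
    "nat \<Rightarrow> (nat \<Rightarrow> nat \<Rightarrow> real) \<Rightarrow> real \<Rightarrow> (nat \<Rightarrow> nat \<Rightarrow> real) pmf \<Rightarrow> bool" where
  "sparse_model n q r p \<longleftrightarrow> edge_model n q p \<and> r \<le> 1 \<and> (\<forall>i j. q i j = q j i) \<and>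
     (\<forall>i<n. \<forall>j<n. 0 \<le> q i j \<and> q i j \<le> r)"

lemma sparse_modelD:
  assumes "sparse_model n q r p"
  shows "edge_model n q p" "r \<le> 1" "q i j = q j i"
    and "i < n \<Longrightarrow> j < n \<Longrightarrow> 0 \<le> q i j" "i < n \<Longrightarrow> j < n \<Longrightarrow> q i j \<le> r"
  using assms by (auto simp: sparse_model_def)

lemma edge_var_bounds:
  assumes sm: "sparse_model n q r p" and e: "e \<in> edges n"
  shows "0 \<le> edge_var q e" "edge_var q e \<le> r"
proof -
  have *: "fst e < n" "snd e < n" using e by (auto simp: edges_def)
  have "0 \<le> q (fst e) (snd e)" "q (fst e) (snd e) \<le> r" "r \<le> 1"
    using sparse_modelD(4,5)[OF sm *] sparse_modelD(2)[OF sm] by auto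
  moreover from this have "q (fst e) (snd e) * (1 - q (fst e) (snd e)) \<le> q (fst e) (snd e)"
    by (intro mult_left_le) auto
  ultimately show "0 \<le> edge_var q e" "edge_var q e \<le> r"
    unfolding edge_var_def by auto
qed

lemma noise_sym:
  assumes "sparse_model n q r p" "a \<in> set_pmf p"
  shows "noise q a i j = noise q a j i"
proof -
  have "a i j = a j i" using assms unfolding sparse_model_def edge_model_def by blast
  then show ?thesis using sparse_modelD(3)[OF assms(1), of i j] by (simp add: noise_def)
qed

lemma noise_edge:
  assumes "sparse_model n q r p" "a \<in> set_pmf p" "i \<noteq> j"
  shows "noise q a i j = edge_noise q a (edge i j)"
  using noise_sym[OF assms(1,2), of i j] assms(3) by (auto simp: noise_def edge_noise_def edge_def min_def max_def)

text \<open>An entry in {0, 1} equals its own square, so the square of a centred entry is affine in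
  that entry. This keeps all polynomials square-free, as \<open>expectation_monomials\<close>
  requires.\<close>

lemma noise_sq:
  assumes sm: "sparse_model n q r p" and "a \<in> set_pmf p" "i \<noteq> j"
  shows "(noise q a i j)\<^sup>2 = q i j * (1 - q i j) + (1 - 2 * q i j) * noise q a i j"
proof -
  have "a i j \<in> {0, 1}" using assms unfolding sparse_model_def edge_model_def by blast
  then show ?thesis using assms(3) by (auto simp: noise_def algebra_simps power2_eq_square)
qed

lemma edge_in: "i \<noteq> j \<Longrightarrow> i < n \<Longrightarrow> j < n \<Longrightarrow> edge i j \<in> edges n"
  by (auto simp: edge_def edges_def)

lemma edge_eq: "edge i j = edge k l \<longleftrightarrow> i = k \<and> j = l \<or> i = l \<and> j = k"
  by (auto simp: edge_def min_def max_def)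

text \<open>The pairs \<open>(i, j)\<close> and \<open>(j, i)\<close> name the same edge, so every
  monomial occurs at most twice; this is the factor 2.\<close>

lemma second_moment_linear:
  fixes c :: "nat \<Rightarrow> nat \<Rightarrow> 'b::real_inner"
  assumes sm: "sparse_model n q r p" and r: "0 \<le> r"
  shows "measure_pmf.expectation p (\<lambda>a. (norm (\<Sum>i<n. \<Sum>j<n. noise q a i j *\<^sub>R c i j))\<^sup>2)
    \<le> 2 * r * (\<Sum>i<n. \<Sum>j<n. (norm (c i j))\<^sup>2)"
proof -
  define I where "I = {(i, j). i < n \<and> j < n \<and> i \<noteq> j}"
  have fI: "finite I" by (rule finite_subset[of _ "{..<n} \<times> {..<n}"]) (auto simp: I_def)
  define S where "S = (\<lambda>(i, j). {edge i j})"
  have "measure_pmf.expectation p (\<lambda>a. (norm (\<Sum>i<n. \<Sum>j<n. noise q a i j *\<^sub>R c i j))\<^sup>2)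
    = measure_pmf.expectation p (\<lambda>a. (norm (\<Sum>t\<in>I. (\<Prod>e\<in>S t. edge_noise q a e) *\<^sub>R (case t of (i, j) \<Rightarrow> c i j)))\<^sup>2)"
  proof (rule integral_cong_AE)
    show "AE a in measure_pmf p. (norm (\<Sum>i<n. \<Sum>j<n. noise q a i j *\<^sub>R c i j))\<^sup>2 =
        (norm (\<Sum>t\<in>I. (\<Prod>e\<in>S t. edge_noise q a e) *\<^sub>R (case t of (i, j) \<Rightarrow> c i j)))\<^sup>2"
    proof (rule AE_pmfI)
      fix a assume a: "a \<in> set_pmf p"
      have "(\<Sum>i<n. \<Sum>j<n. noise q a i j *\<^sub>R c i j) = (\<Sum>t\<in>{..<n} \<times> {..<n}. noise q a (fst t) (snd t) *\<^sub>R c (fst t) (snd t))"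
        by (simp add: sum.cartesian_product')
      also have "\<dots> = (\<Sum>t\<in>I. (\<Prod>e\<in>S t. edge_noise q a e) *\<^sub>R (case t of (i, j) \<Rightarrow> c i j))"
        by (rule sum.mono_neutral_cong_right) (auto simp: I_def S_def noise_edge[OF sm a])
      finally show "(norm (\<Sum>i<n. \<Sum>j<n. noise q a i j *\<^sub>R c i j))\<^sup>2 =
        (norm (\<Sum>t\<in>I. (\<Prod>e\<in>S t. edge_noise q a e) *\<^sub>R (case t of (i, j) \<Rightarrow> c i j)))\<^sup>2" by simp
    qed
  qed auto
  also have "\<dots> \<le> real 2 * (\<Sum>t\<in>I. (norm (case t of (i, j) \<Rightarrow> c i j))\<^sup>2 * (\<Prod>e\<in>S t. edge_var q e))"
  proof (rule second_moment_le[OF sparse_modelD(1)[OF sm] fI])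
    fix t assume t: "t \<in> I"
    obtain i j where ij: "t = (i, j)" by (cases t)
    have "{u \<in> I. S u = S t} \<subseteq> {(i, j), (j, i)}" by (auto simp: S_def ij edge_eq)
    then have "card {u \<in> I. S u = S t} \<le> card {(i, j), (j, i)}" by (intro card_mono) auto
    also have "\<dots> \<le> 2" by (rule card_insert_le_m1) simp_all
    finally show "card {u \<in> I. S u = S t} \<le> 2" .
    show "S t \<subseteq> edges n" using t by (auto simp: I_def S_def intro: edge_in)
  qed (rule edge_var_bounds[OF sm])
  also have "\<dots> \<le> 2 * (\<Sum>t\<in>I. (norm (case t of (i, j) \<Rightarrow> c i j))\<^sup>2 * r)"
    by (auto simp: S_def I_def intro!: sum_mono mult_left_mono edge_var_bounds(2)[OF sm] edge_in)
  also have "\<dots> \<le> 2 * (\<Sum>t\<in>{..<n} \<times> {..<n}. (norm (case t of (i, j) \<Rightarrow> c i j))\<^sup>2 * r)"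
    using r by (intro mult_left_mono sum_mono2) (auto simp: I_def)
  also have "\<dots> = 2 * r * (\<Sum>i<n. \<Sum>j<n. (norm (c i j))\<^sup>2)"
    by (simp add: sum.cartesian_product' sum_distrib_left mult_ac)
  finally show ?thesis .
qed

text \<open>The two edges of a path j - i - k with distinct ends share only the centre i, so the
  monomial determines i and the unordered pair of ends. Again every monomial occurs at most
  twice.\<close>

lemma second_moment_paths:
  fixes c :: "nat \<Rightarrow> nat \<Rightarrow> nat \<Rightarrow> 'b::real_inner"
  assumes sm: "sparse_model n q r p" and r: "0 \<le> r"
  shows "measure_pmf.expectation p (\<lambda>a. (norm (\<Sum>i<n. \<Sum>j<n. \<Sum>k\<in>{..<n} - {j}. (noise q a i j * noise q a i k) *\<^sub>R c i j k))\<^sup>2)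
    \<le> 2 * r\<^sup>2 * (\<Sum>i<n. \<Sum>j<n. \<Sum>k<n. (norm (c i j k))\<^sup>2)"
proof -
  define I where "I = {(i, j, k). i < n \<and> j < n \<and> k < n \<and> i \<noteq> j \<and> i \<noteq> k \<and> k \<noteq> j}"
  have fI: "finite I" by (rule finite_subset[of _ "{..<n} \<times> {..<n} \<times> {..<n}"]) (auto simp: I_def)
  define S where "S = (\<lambda>(i, j, k). {edge i j, edge i k})"
  define C where "C = (\<lambda>(i, j, k). c i j k)"
  have "measure_pmf.expectation p (\<lambda>a. (norm (\<Sum>i<n. \<Sum>j<n. \<Sum>k\<in>{..<n} - {j}. (noise q a i j * noise q a i k) *\<^sub>R c i j k))\<^sup>2)
    = measure_pmf.expectation p (\<lambda>a. (norm (\<Sum>t\<in>I. (\<Prod>e\<in>S t. edge_noise q a e) *\<^sub>R C t))\<^sup>2)"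
  proof (rule integral_cong_AE)
    show "AE a in measure_pmf p. (norm (\<Sum>i<n. \<Sum>j<n. \<Sum>k\<in>{..<n} - {j}. (noise q a i j * noise q a i k) *\<^sub>R c i j k))\<^sup>2 =
        (norm (\<Sum>t\<in>I. (\<Prod>e\<in>S t. edge_noise q a e) *\<^sub>R C t))\<^sup>2"
    proof (rule AE_pmfI)
      fix a assume a: "a \<in> set_pmf p"
      have "(\<Sum>i<n. \<Sum>j<n. \<Sum>k\<in>{..<n} - {j}. (noise q a i j * noise q a i k) *\<^sub>R c i j k)
        = (\<Sum>(i, j, k)\<in>Sigma {..<n} (\<lambda>i. Sigma {..<n} (\<lambda>j. {..<n} - {j})). (noise q a i j * noise q a i k) *\<^sub>R c i j k)"
        by (simp add: sum.Sigma)
      also have "\<dots> = (\<Sum>t\<in>I. (\<Prod>e\<in>S t. edge_noise q a e) *\<^sub>R C t)"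
      proof (rule sum.mono_neutral_cong_right)
        fix t assume t: "t \<in> I"
        obtain i j k where ijk: "t = (i, j, k)" by (cases t)
        have "edge i j \<noteq> edge i k" using t by (auto simp: I_def ijk edge_eq)
        then show "(case t of (i, j, k) \<Rightarrow> (noise q a i j * noise q a i k) *\<^sub>R c i j k) = (\<Prod>e\<in>S t. edge_noise q a e) *\<^sub>R C t"
          using t by (auto simp: I_def ijk S_def C_def noise_edge[OF sm a])
      qed (auto simp: I_def)
      finally show "(norm (\<Sum>i<n. \<Sum>j<n. \<Sum>k\<in>{..<n} - {j}. (noise q a i j * noise q a i k) *\<^sub>R c i j k))\<^sup>2 =
        (norm (\<Sum>t\<in>I. (\<Prod>e\<in>S t. edge_noise q a e) *\<^sub>R C t))\<^sup>2" by simp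
    qed
  qed auto
  also have "\<dots> \<le> real 2 * (\<Sum>t\<in>I. (norm (C t))\<^sup>2 * (\<Prod>e\<in>S t. edge_var q e))"
  proof (rule second_moment_le[OF sparse_modelD(1)[OF sm] fI])
    fix t assume t: "t \<in> I"
    obtain i j k where ijk: "t = (i, j, k)" by (cases t)
    have "{u \<in> I. S u = S t} \<subseteq> {(i, j, k), (i, k, j)}"
    proof
      fix u assume "u \<in> {u \<in> I. S u = S t}"
      then have uI: "u \<in> I" "S u = S t" by auto
      obtain i' j' k' where u1: "u = (i', j', k')" by (cases u)
      have u: "u = (i', j', k')" "u \<in> I" "{edge i' j', edge i' k'} = {edge i j, edge i k}"
        using uI unfolding u1 S_def ijk by simp_all
      from u(3) have "edge i' j' = edge i j \<and> edge i' k' = edge i k \<or> edge i' j' = edge i k \<and> edge i' k' = edge i j"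
        by (simp only: doubleton_eq_iff)
      moreover have "i' \<noteq> j'" "i' \<noteq> k'" "i \<noteq> j" "i \<noteq> k" "j \<noteq> k"
        using u(1,2) t by (auto simp: I_def ijk)
      ultimately have "i' = i \<and> (j' = j \<and> k' = k \<or> j' = k \<and> k' = j)"
        unfolding edge_eq by metis
      then show "u \<in> {(i, j, k), (i, k, j)}" unfolding u(1) by blast
    qed
    then have "card {u \<in> I. S u = S t} \<le> card {(i, j, k), (i, k, j)}" by (intro card_mono) auto
    also have "\<dots> \<le> 2" by (rule card_insert_le_m1) simp_all
    finally show "card {u \<in> I. S u = S t} \<le> 2" .
    show "S t \<subseteq> edges n" using t by (auto simp: I_def S_def intro: edge_in)
  qed (rule edge_var_bounds[OF sm])
  also have "\<dots> \<le> 2 * (\<Sum>t\<in>I. (norm (C t))\<^sup>2 * r\<^sup>2)"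
  proof -
    have "(\<Prod>e\<in>S t. edge_var q e) \<le> r\<^sup>2" if t: "t \<in> I" for t
    proof -
      obtain i j k where ijk: "t = (i, j, k)" by (cases t)
      have e: "edge i j \<noteq> edge i k" "edge i j \<in> edges n" "edge i k \<in> edges n"
        using t by (auto simp: I_def ijk edge_eq intro: edge_in)
      have "(\<Prod>e\<in>S t. edge_var q e) = edge_var q (edge i j) * edge_var q (edge i k)"
        using e(1) by (simp add: S_def ijk)
      also have "\<dots> \<le> r * r" using edge_var_bounds[OF sm e(2)] edge_var_bounds[OF sm e(3)] r
        by (intro mult_mono) auto
      finally show ?thesis by (simp add: power2_eq_square)
    qed
    then show ?thesis by (auto intro!: sum_mono mult_left_mono)
  qed
  also have "\<dots> \<le> 2 * (\<Sum>t\<in>{..<n} \<times> {..<n} \<times> {..<n}. (norm (C t))\<^sup>2 * r\<^sup>2)"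
    using r by (intro mult_left_mono sum_mono2) (auto simp: I_def)
  also have "\<dots> = 2 * r\<^sup>2 * (\<Sum>i<n. \<Sum>j<n. \<Sum>k<n. (norm (c i j k))\<^sup>2)"
    by (simp add: sum.cartesian_product' sum_distrib_left mult_ac C_def)
  finally show ?thesis .
qed

lemma expectation_mono:
  assumes "edge_model n q p" and "\<And>a. a \<in> set_pmf p \<Longrightarrow> f a \<le> (g a :: real)"
  shows "measure_pmf.expectation p f \<le> measure_pmf.expectation p g"
  using assms by (intro integral_mono_AE) (auto intro: AE_pmfI)

lemma row_second_moment:
  fixes c :: "nat \<Rightarrow> 'b::real_inner"
  assumes sm: "sparse_model n q r p" and r: "0 \<le> r" and i: "i < n"
  shows "measure_pmf.expectation p (\<lambda>a. (norm (\<Sum>j<n. noise q a i j *\<^sub>R c j))\<^sup>2)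
    \<le> 2 * r * (\<Sum>j<n. (norm (c j))\<^sup>2)"
proof -
  have *: "(\<Sum>l<n. if l = i then g l else 0) = g i" for g :: "nat \<Rightarrow> 'c::comm_monoid_add"
    using i by simp
  have l: "(\<Sum>l<n. \<Sum>j<n. noise q a l j *\<^sub>R (if l = i then c j else 0)) = (\<Sum>j<n. noise q a i j *\<^sub>R c j)" for a
  proof -
    have "(\<Sum>l<n. \<Sum>j<n. noise q a l j *\<^sub>R (if l = i then c j else 0)) = (\<Sum>l<n. if l = i then \<Sum>j<n. noise q a l j *\<^sub>R c j else 0)"
      by (intro sum.cong) auto
    then show ?thesis by (simp only: *)
  qed
  have r': "(\<Sum>l<n. \<Sum>j<n. (norm (if l = i then c j else 0))\<^sup>2) = (\<Sum>j<n. (norm (c j))\<^sup>2)"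
  proof -
    have "(\<Sum>l<n. \<Sum>j<n. (norm (if l = i then c j else 0))\<^sup>2) = (\<Sum>l<n. if l = i then \<Sum>j<n. (norm (c j))\<^sup>2 else 0)"
      by (intro sum.cong) auto
    then show ?thesis by (simp only: *)
  qed
  show ?thesis
    using second_moment_linear[OF sm r, of "\<lambda>l j. if l = i then c j else 0"] unfolding l r' .
qed

lemma rows_second_moment:
  fixes c :: "nat \<Rightarrow> nat \<Rightarrow> 'b::real_inner"
  assumes sm: "sparse_model n q r p" and r: "0 \<le> r"
  shows "measure_pmf.expectation p (\<lambda>a. \<Sum>i<n. (norm (\<Sum>j<n. noise q a i j *\<^sub>R c i j))\<^sup>2)
    \<le> 2 * r * (\<Sum>i<n. \<Sum>j<n. (norm (c i j))\<^sup>2)"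
proof -
  have "measure_pmf.expectation p (\<lambda>a. \<Sum>i<n. (norm (\<Sum>j<n. noise q a i j *\<^sub>R c i j))\<^sup>2)
    = (\<Sum>i<n. measure_pmf.expectation p (\<lambda>a. (norm (\<Sum>j<n. noise q a i j *\<^sub>R c i j))\<^sup>2))"
    using sparse_modelD(1)[OF sm] by (intro Bochner_Integration.integral_sum) auto
  also have "\<dots> \<le> (\<Sum>i<n. 2 * r * (\<Sum>j<n. (norm (c i j))\<^sup>2))"
    by (intro sum_mono row_second_moment[OF sm r]) auto
  finally show ?thesis by (simp add: sum_distrib_left)
qed

lemma row_paths_second_moment:
  fixes c :: "nat \<Rightarrow> nat \<Rightarrow> 'b::real_inner"
  assumes sm: "sparse_model n q r p" and r: "0 \<le> r" and i: "i < n"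
  shows "measure_pmf.expectation p (\<lambda>a. (norm (\<Sum>j<n. \<Sum>k\<in>{..<n} - {j}. (noise q a i j * noise q a i k) *\<^sub>R c j k))\<^sup>2)
    \<le> 2 * r\<^sup>2 * (\<Sum>j<n. \<Sum>k<n. (norm (c j k))\<^sup>2)"
proof -
  have *: "(\<Sum>l<n. if l = i then g l else 0) = g i" for g :: "nat \<Rightarrow> 'c::comm_monoid_add"
    using i by simp
  have l: "(\<Sum>l<n. \<Sum>j<n. \<Sum>k\<in>{..<n} - {j}. (noise q a l j * noise q a l k) *\<^sub>R (if l = i then c j k else 0))
     = (\<Sum>j<n. \<Sum>k\<in>{..<n} - {j}. (noise q a i j * noise q a i k) *\<^sub>R c j k)" for a
  proof -
    have "(\<Sum>l<n. \<Sum>j<n. \<Sum>k\<in>{..<n} - {j}. (noise q a l j * noise q a l k) *\<^sub>R (if l = i then c j k else 0))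
     = (\<Sum>l<n. if l = i then \<Sum>j<n. \<Sum>k\<in>{..<n} - {j}. (noise q a l j * noise q a l k) *\<^sub>R c j k else 0)"
      by (intro sum.cong) auto
    then show ?thesis by (simp only: *)
  qed
  have r': "(\<Sum>l<n. \<Sum>j<n. \<Sum>k<n. (norm (if l = i then c j k else 0))\<^sup>2) = (\<Sum>j<n. \<Sum>k<n. (norm (c j k))\<^sup>2)"
  proof -
    have "(\<Sum>l<n. \<Sum>j<n. \<Sum>k<n. (norm (if l = i then c j k else 0))\<^sup>2) = (\<Sum>l<n. if l = i then \<Sum>j<n. \<Sum>k<n. (norm (c j k))\<^sup>2 else 0)"
      by (intro sum.cong) auto
    then show ?thesis by (simp only: *)
  qed
  show ?thesis
    using second_moment_paths[OF sm r, of "\<lambda>l j k. if l = i then c j k else 0"] unfolding l r' .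
qed

lemma norm_sum_scaleR_sq:
  fixes v :: "nat \<Rightarrow> 'b::real_inner"
  shows "(norm (\<Sum>j<n. x j *\<^sub>R v j))\<^sup>2
    = (\<Sum>j<n. \<Sum>k\<in>{..<n} - {j}. (x j * x k) *\<^sub>R (v j \<bullet> v k)) + (\<Sum>j<n. (x j)\<^sup>2 * (norm (v j))\<^sup>2)"
proof -
  have "(norm (\<Sum>j<n. x j *\<^sub>R v j))\<^sup>2 = (\<Sum>j<n. \<Sum>k<n. (x j * x k) * (v j \<bullet> v k))"
    by (simp add: power2_norm_eq_inner inner_sum_left inner_sum_right sum_distrib_left mult_ac inner_commute)
  also have "\<dots> = (\<Sum>j<n. (x j * x j) * (v j \<bullet> v j) + (\<Sum>k\<in>{..<n} - {j}. (x j * x k) * (v j \<bullet> v k)))"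
    by (intro sum.cong refl sum.remove) auto
  finally show ?thesis by (simp add: sum.distrib power2_eq_square flip: power2_norm_eq_inner)
qed

text \<open>Pairs j, k with distinct entries give square-free monomials, and \<open>noise_sq\<close>
  splits the diagonal terms into a variance and a linear term. The deterministic middle sum is thus
  the mean, and the other two sums are orthogonal expansions without constant term.\<close>

lemma row_square_expansion:
  fixes v :: "nat \<Rightarrow> 'b::real_inner"
  assumes sm: "sparse_model n q r p" and a: "a \<in> set_pmf p" and i: "i < n"
  shows "(norm (\<Sum>j<n. noise q a i j *\<^sub>R v j))\<^sup>2
    = (\<Sum>j<n. \<Sum>k\<in>{..<n} - {j}. (noise q a i j * noise q a i k) *\<^sub>R (v j \<bullet> v k))
      + (\<Sum>j\<in>{..<n} - {i}. q i j * (1 - q i j) * (norm (v j))\<^sup>2)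
      + (\<Sum>j<n. noise q a i j *\<^sub>R ((1 - 2 * q i j) * (norm (v j))\<^sup>2))"
proof -
  have "(\<Sum>j<n. (noise q a i j)\<^sup>2 * (norm (v j))\<^sup>2) = (\<Sum>j\<in>{..<n} - {i}. (noise q a i j)\<^sup>2 * (norm (v j))\<^sup>2)"
    using i by (subst sum.remove[of _ i]) auto
  also have "\<dots> = (\<Sum>j\<in>{..<n} - {i}. q i j * (1 - q i j) * (norm (v j))\<^sup>2 + noise q a i j *\<^sub>R ((1 - 2 * q i j) * (norm (v j))\<^sup>2))"
  proof (intro sum.cong refl)
    fix j assume "j \<in> {..<n} - {i}"
    then have "i \<noteq> j" by auto
    then show "(noise q a i j)\<^sup>2 * (norm (v j))\<^sup>2 = q i j * (1 - q i j) * (norm (v j))\<^sup>2 + noise q a i j *\<^sub>R ((1 - 2 * q i j) * (norm (v j))\<^sup>2)"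
      by (simp add: noise_sq[OF sm a] algebra_simps)
  qed
  also have "\<dots> = (\<Sum>j\<in>{..<n} - {i}. q i j * (1 - q i j) * (norm (v j))\<^sup>2)
      + (\<Sum>j\<in>{..<n} - {i}. noise q a i j *\<^sub>R ((1 - 2 * q i j) * (norm (v j))\<^sup>2))"
    by (rule sum.distrib)
  also have "(\<Sum>j\<in>{..<n} - {i}. noise q a i j *\<^sub>R ((1 - 2 * q i j) * (norm (v j))\<^sup>2)) = (\<Sum>j<n. noise q a i j *\<^sub>R ((1 - 2 * q i j) * (norm (v j))\<^sup>2))"
    using i by (subst sum.remove[of "{..<n}" i]) auto
  finally show ?thesis unfolding norm_sum_scaleR_sq by simp
qed

lemma variance_coeff_bound:
  assumes sm: "sparse_model n q r p" and ij: "i < n" "j < n" and x: "0 \<le> x" "x \<le> B\<^sup>2"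
  shows "0 \<le> q i j * (1 - q i j) * x" "q i j * (1 - q i j) * x \<le> r * B\<^sup>2"
    "(norm ((1 - 2 * q i j) * x))\<^sup>2 \<le> B ^ 4"
proof -
  have q: "0 \<le> q i j" "q i j \<le> r" "r \<le> 1" using sparse_modelD(4,5)[OF sm ij] sparse_modelD(2)[OF sm] by auto
  have v: "0 \<le> q i j * (1 - q i j)" "q i j * (1 - q i j) \<le> r"
    using q mult_left_le[of "1 - q i j" "q i j"] by auto
  show "0 \<le> q i j * (1 - q i j) * x" using v x by simp
  show "q i j * (1 - q i j) * x \<le> r * B\<^sup>2" using v x q by (intro mult_mono) auto
  have "\<bar>(1 - 2 * q i j) * x\<bar> \<le> 1 * B\<^sup>2" unfolding abs_mult using q x by (intro mult_mono) auto
  then have "\<bar>(1 - 2 * q i j) * x\<bar>\<^sup>2 \<le> (B\<^sup>2)\<^sup>2" by (intro power_mono) auto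
  then show "(norm ((1 - 2 * q i j) * x))\<^sup>2 \<le> B ^ 4" by (simp flip: power_mult)
qed

lemma inner_fourth_bound:
  fixes v w :: "'b::real_inner"
  assumes "norm v \<le> B" "norm w \<le> B"
  shows "(norm (v \<bullet> w))\<^sup>2 \<le> B ^ 4"
proof -
  have "\<bar>v \<bullet> w\<bar> \<le> B * B"
    using Cauchy_Schwarz_ineq2[of v w] assms mult_mono[OF assms] by (smt (verit) norm_ge_zero)
  then have "\<bar>v \<bullet> w\<bar>\<^sup>2 \<le> (B * B)\<^sup>2" by (intro power_mono) auto
  then show ?thesis by (simp add: power2_eq_square power4_eq_xxxx mult.assoc)
qed

text \<open>After the mean is subtracted, \<open>row_square_expansion\<close> leaves one sum over
  paths and one linear sum. For coefficients of size 1 / (n sqrt r), as used later with n r >= 1,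
  the bound is of order 1 / n.\<close>

lemma rows_square_concentration:
  fixes v :: "nat \<Rightarrow> nat \<Rightarrow> 'b::real_inner"
  assumes sm: "sparse_model n q r p" and r: "0 \<le> r"
    and B: "\<And>i j. i < n \<Longrightarrow> j < n \<Longrightarrow> norm (v i j) \<le> B"
  shows "measure_pmf.expectation p (\<lambda>a. ((\<Sum>i<n. (norm (\<Sum>j<n. noise q a i j *\<^sub>R v i j))\<^sup>2)
       - (\<Sum>i<n. \<Sum>j\<in>{..<n} - {i}. q i j * (1 - q i j) * (norm (v i j))\<^sup>2))\<^sup>2)
    \<le> 4 * r\<^sup>2 * real n ^ 3 * B ^ 4 + 4 * r * real n ^ 2 * B ^ 4"
proof -
  note em = sparse_modelD(1)[OF sm]
  have B2: "(norm (v i j))\<^sup>2 \<le> B\<^sup>2" if "i < n" "j < n" for i j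
    using B[OF that] by (intro power_mono) auto
  define P where "P = (\<lambda>a. \<Sum>i<n. \<Sum>j<n. \<Sum>k\<in>{..<n} - {j}. (noise q a i j * noise q a i k) *\<^sub>R (v i j \<bullet> v i k))"
  define L where "L = (\<lambda>a. \<Sum>i<n. \<Sum>j<n. noise q a i j *\<^sub>R ((1 - 2 * q i j) * (norm (v i j))\<^sup>2))"
  have "measure_pmf.expectation p (\<lambda>a. ((\<Sum>i<n. (norm (\<Sum>j<n. noise q a i j *\<^sub>R v i j))\<^sup>2)
       - (\<Sum>i<n. \<Sum>j\<in>{..<n} - {i}. q i j * (1 - q i j) * (norm (v i j))\<^sup>2))\<^sup>2)
    \<le> measure_pmf.expectation p (\<lambda>a. 2 * (norm (P a))\<^sup>2 + 2 * (norm (L a))\<^sup>2)"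
  proof (rule expectation_mono[OF em])
    fix a assume a: "a \<in> set_pmf p"
    have "(\<Sum>i<n. (norm (\<Sum>j<n. noise q a i j *\<^sub>R v i j))\<^sup>2)
       - (\<Sum>i<n. \<Sum>j\<in>{..<n} - {i}. q i j * (1 - q i j) * (norm (v i j))\<^sup>2) = P a + L a"
      by (simp only: row_square_expansion[OF sm a] P_def L_def sum.distrib cong: sum.cong_simp)
         (simp add: row_square_expansion[OF sm a] sum.distrib)
    also have "(P a + L a)\<^sup>2 \<le> 2 * (norm (P a))\<^sup>2 + 2 * (norm (L a))\<^sup>2"
      using sum_squares_bound[of "P a" "L a"] by (simp add: power2_sum)
    finally show "((\<Sum>i<n. (norm (\<Sum>j<n. noise q a i j *\<^sub>R v i j))\<^sup>2)
       - (\<Sum>i<n. \<Sum>j\<in>{..<n} - {i}. q i j * (1 - q i j) * (norm (v i j))\<^sup>2))\<^sup>2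
       \<le> 2 * (norm (P a))\<^sup>2 + 2 * (norm (L a))\<^sup>2" .
  qed
  also have "\<dots> = 2 * measure_pmf.expectation p (\<lambda>a. (norm (P a))\<^sup>2) + 2 * measure_pmf.expectation p (\<lambda>a. (norm (L a))\<^sup>2)"
    using em by simp
  also have "\<dots> \<le> 2 * (2 * r\<^sup>2 * (\<Sum>i<n. \<Sum>j<n. \<Sum>k<n. (norm (v i j \<bullet> v i k))\<^sup>2))
      + 2 * (2 * r * (\<Sum>i<n. \<Sum>j<n. (norm ((1 - 2 * q i j) * (norm (v i j))\<^sup>2))\<^sup>2))"
    unfolding P_def L_def
    by (intro add_mono mult_left_mono second_moment_paths[OF sm r] second_moment_linear[OF sm r]) auto
  also have "\<dots> \<le> 2 * (2 * r\<^sup>2 * (\<Sum>i<n. \<Sum>j<n. \<Sum>k<n. B ^ 4)) + 2 * (2 * r * (\<Sum>i<n. \<Sum>j<n. B ^ 4))"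
    using r by (intro add_mono mult_left_mono sum_mono inner_fourth_bound variance_coeff_bound(3)[OF sm] B B2) auto
  also have "\<dots> = 4 * r\<^sup>2 * real n ^ 3 * B ^ 4 + 4 * r * real n ^ 2 * B ^ 4"
    by (simp add: power3_eq_cube power2_eq_square)
  finally show ?thesis .
qed

text \<open>A fourth moment is the second moment of the squared norm, expanded by
  \<open>row_square_expansion\<close>. The condition 1 <= n r absorbs the linear part into the order
  (n r)^2, with total constant 3 (2 + 1 + 2) = 15. Summed over the rows it serves as a maximal
  inequality, since one row is bounded by the sum of all.\<close>

lemma row_fourth_moment:
  fixes v :: "nat \<Rightarrow> 'b::real_inner"
  assumes sm: "sparse_model n q r p" and r: "0 \<le> r" and nr: "1 \<le> real n * r" and i: "i < n"
    and B: "\<And>j. j < n \<Longrightarrow> norm (v j) \<le> B"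
  shows "measure_pmf.expectation p (\<lambda>a. (norm (\<Sum>j<n. noise q a i j *\<^sub>R v j)) ^ 4) \<le> 15 * r\<^sup>2 * real n ^ 2 * B ^ 4"
proof -
  note em = sparse_modelD(1)[OF sm]
  have B2: "(norm (v j))\<^sup>2 \<le> B\<^sup>2" if "j < n" for j
    using B[OF that] by (intro power_mono) auto
  define P where "P = (\<lambda>a. \<Sum>j<n. \<Sum>k\<in>{..<n} - {j}. (noise q a i j * noise q a i k) *\<^sub>R (v j \<bullet> v k))"
  define L where "L = (\<lambda>a. \<Sum>j<n. noise q a i j *\<^sub>R ((1 - 2 * q i j) * (norm (v j))\<^sup>2))"
  define m where "m = (\<Sum>j\<in>{..<n} - {i}. q i j * (1 - q i j) * (norm (v j))\<^sup>2)"
  have m0: "0 \<le> m" unfolding m_def using i by (intro sum_nonneg variance_coeff_bound(1)[OF sm]) (auto intro: B2)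
  have "m \<le> (\<Sum>j\<in>{..<n} - {i}. r * B\<^sup>2)"
    unfolding m_def using i by (intro sum_mono variance_coeff_bound(2)[OF sm]) (auto intro: B2)
  also have "\<dots> \<le> (\<Sum>j<n. r * B\<^sup>2)" using r by (intro sum_mono2) auto
  finally have m1: "m \<le> real n * r * B\<^sup>2" by simp
  have m2: "m\<^sup>2 \<le> (real n * r * B\<^sup>2)\<^sup>2" using m0 m1 by (intro power_mono) auto
  have "measure_pmf.expectation p (\<lambda>a. (norm (\<Sum>j<n. noise q a i j *\<^sub>R v j)) ^ 4)
    \<le> measure_pmf.expectation p (\<lambda>a. 3 * (norm (P a))\<^sup>2 + 3 * m\<^sup>2 + 3 * (norm (L a))\<^sup>2)"
  proof (rule expectation_mono[OF em])
    fix a assume a: "a \<in> set_pmf p"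
    have "(norm (\<Sum>j<n. noise q a i j *\<^sub>R v j)) ^ 4 = ((norm (\<Sum>j<n. noise q a i j *\<^sub>R v j))\<^sup>2)\<^sup>2"
      by (simp flip: power_mult)
    also have "\<dots> = (P a + m + L a)\<^sup>2"
      unfolding row_square_expansion[OF sm a i] P_def L_def m_def by simp
    also have "\<dots> \<le> 3 * (norm (P a))\<^sup>2 + 3 * m\<^sup>2 + 3 * (norm (L a))\<^sup>2"
      using sum_squares_bound[of "P a" "L a"] sum_squares_bound[of "P a" m] sum_squares_bound[of m "L a"]
      by (simp add: power2_eq_square algebra_simps)
    finally show "(norm (\<Sum>j<n. noise q a i j *\<^sub>R v j)) ^ 4 \<le> 3 * (norm (P a))\<^sup>2 + 3 * m\<^sup>2 + 3 * (norm (L a))\<^sup>2" .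
  qed
  also have "\<dots> = 3 * measure_pmf.expectation p (\<lambda>a. (norm (P a))\<^sup>2) + 3 * m\<^sup>2 + 3 * measure_pmf.expectation p (\<lambda>a. (norm (L a))\<^sup>2)"
    using em by simp
  also have "\<dots> \<le> 3 * (2 * r\<^sup>2 * (\<Sum>j<n. \<Sum>k<n. (norm (v j \<bullet> v k))\<^sup>2)) + 3 * (real n * r * B\<^sup>2)\<^sup>2
      + 3 * (2 * r * (\<Sum>j<n. (norm ((1 - 2 * q i j) * (norm (v j))\<^sup>2))\<^sup>2))"
    unfolding P_def L_def
    by (intro add_mono mult_left_mono row_paths_second_moment[OF sm r i] row_second_moment[OF sm r i] m2) auto
  also have "\<dots> \<le> 3 * (2 * r\<^sup>2 * (\<Sum>j<n. \<Sum>k<n. B ^ 4)) + 3 * (real n * r * B\<^sup>2)\<^sup>2 + 3 * (2 * r * (\<Sum>j<n. B ^ 4))"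
    using r i by (intro add_mono mult_left_mono sum_mono inner_fourth_bound variance_coeff_bound(3)[OF sm] B B2) auto
  also have "\<dots> = 9 * (real n * r)\<^sup>2 * B ^ 4 + 6 * (real n * r) * B ^ 4"
    by (simp add: power2_eq_square power4_eq_xxxx)
  also have "\<dots> \<le> 9 * (real n * r)\<^sup>2 * B ^ 4 + 6 * (real n * r)\<^sup>2 * B ^ 4"
    using self_le_power[OF nr, of 2] by (intro add_left_mono mult_right_mono) auto
  finally show ?thesis by (simp add: power_mult_distrib mult_ac)
qed

lemma rows_fourth_moment:
  fixes v :: "nat \<Rightarrow> nat \<Rightarrow> 'b::real_inner"
  assumes sm: "sparse_model n q r p" and r: "0 \<le> r" and nr: "1 \<le> real n * r"
    and B: "\<And>i j. i < n \<Longrightarrow> j < n \<Longrightarrow> norm (v i j) \<le> B"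
  shows "measure_pmf.expectation p (\<lambda>a. \<Sum>i<n. (norm (\<Sum>j<n. noise q a i j *\<^sub>R v i j)) ^ 4) \<le> 15 * r\<^sup>2 * real n ^ 3 * B ^ 4"
proof -
  have "measure_pmf.expectation p (\<lambda>a. \<Sum>i<n. (norm (\<Sum>j<n. noise q a i j *\<^sub>R v i j)) ^ 4)
    = (\<Sum>i<n. measure_pmf.expectation p (\<lambda>a. (norm (\<Sum>j<n. noise q a i j *\<^sub>R v i j)) ^ 4))"
    using sparse_modelD(1)[OF sm] by (intro Bochner_Integration.integral_sum) auto
  also have "\<dots> \<le> (\<Sum>i<n. 15 * r\<^sup>2 * real n ^ 2 * B ^ 4)"
    by (intro sum_mono row_fourth_moment[OF sm r nr] B) auto
  finally show ?thesis by (simp add: power2_eq_square power3_eq_cube mult_ac)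
qed

section \<open>Sums over walks of two steps\<close>

lemma row_square_sum_second_moment:
  assumes sm: "sparse_model n q r p" and r: "0 \<le> r" and nr: "1 \<le> real n * r" and i: "i < n"
  shows "measure_pmf.expectation p (\<lambda>a. (\<Sum>j<n. (noise q a i j)\<^sup>2)\<^sup>2) \<le> 6 * r\<^sup>2 * real n ^ 2"
proof -
  note em = sparse_modelD(1)[OF sm]
  define L where "L = (\<lambda>a. \<Sum>j<n. noise q a i j *\<^sub>R (1 - 2 * q i j))"
  define m where "m = (\<Sum>j\<in>{..<n} - {i}. q i j * (1 - q i j))"
  have one: "(1::real) \<le> 1\<^sup>2" by simp
  have m0: "0 \<le> m" unfolding m_def
    by (intro sum_nonneg) (use variance_coeff_bound(1)[OF sm i _ _ one] in force)
  have "m \<le> (\<Sum>j\<in>{..<n} - {i}. r)" unfolding m_def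
    by (intro sum_mono) (use variance_coeff_bound(2)[OF sm i _ _ one] in force)
  also have "\<dots> \<le> (\<Sum>j<n. r)" using r by (intro sum_mono2) auto
  finally have m1: "m \<le> real n * r" by simp
  have m2: "m\<^sup>2 \<le> (real n * r)\<^sup>2" using m0 m1 by (intro power_mono) auto
  have "measure_pmf.expectation p (\<lambda>a. (\<Sum>j<n. (noise q a i j)\<^sup>2)\<^sup>2)
    \<le> measure_pmf.expectation p (\<lambda>a. 2 * m\<^sup>2 + 2 * (norm (L a))\<^sup>2)"
  proof (rule expectation_mono[OF em])
    fix a assume a: "a \<in> set_pmf p"
    have "(\<Sum>j<n. (noise q a i j)\<^sup>2) = (\<Sum>j\<in>{..<n} - {i}. (noise q a i j)\<^sup>2)"
      using i by (subst sum.remove[of _ i]) auto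
    also have "\<dots> = (\<Sum>j\<in>{..<n} - {i}. q i j * (1 - q i j) + noise q a i j * (1 - 2 * q i j))"
      by (intro sum.cong refl) (auto simp: noise_sq[OF sm a] mult.commute)
    also have "\<dots> = m + (\<Sum>j\<in>{..<n} - {i}. noise q a i j * (1 - 2 * q i j))"
      by (simp add: sum.distrib m_def)
    also have "(\<Sum>j\<in>{..<n} - {i}. noise q a i j * (1 - 2 * q i j)) = L a"
      unfolding L_def using i by (subst (2) sum.remove[of _ i]) auto
    finally have "(\<Sum>j<n. (noise q a i j)\<^sup>2)\<^sup>2 = (m + L a)\<^sup>2" by simp
    also have "\<dots> \<le> 2 * m\<^sup>2 + 2 * (norm (L a))\<^sup>2"
      using sum_squares_bound[of m "L a"] by (simp add: power2_sum)
    finally show "(\<Sum>j<n. (noise q a i j)\<^sup>2)\<^sup>2 \<le> 2 * m\<^sup>2 + 2 * (norm (L a))\<^sup>2" .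
  qed
  also have "\<dots> = 2 * m\<^sup>2 + 2 * measure_pmf.expectation p (\<lambda>a. (norm (L a))\<^sup>2)"
    using em by simp
  also have "\<dots> \<le> 2 * (real n * r)\<^sup>2 + 2 * (2 * r * (\<Sum>j<n. (norm (1 - 2 * q i j))\<^sup>2))"
    unfolding L_def by (intro add_mono mult_left_mono row_second_moment[OF sm r i] m2) auto
  also have "\<dots> \<le> 2 * (real n * r)\<^sup>2 + 2 * (2 * r * (\<Sum>j<n. 1 ^ 4))"
    using r variance_coeff_bound(3)[OF sm i _ _ one] by (intro add_left_mono mult_left_mono sum_mono) force+
  also have "\<dots> = 2 * (real n * r)\<^sup>2 + 4 * (real n * r)" by simp
  also have "\<dots> \<le> 2 * (real n * r)\<^sup>2 + 4 * (real n * r)\<^sup>2"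
    using self_le_power[OF nr, of 2] by (intro add_left_mono mult_left_mono) auto
  finally show ?thesis by (simp add: power_mult_distrib)
qed

text \<open>Backtracking walks i - j - i give squares, controlled by the row sum of squares. For k
  distinct from i the walk i - j - k is a path centred at j, so \<open>second_moment_paths\<close>
  applies.\<close>

lemma two_step_second_moment:
  fixes c :: "nat \<Rightarrow> nat \<Rightarrow> 'b::{real_inner, banach, second_countable_topology}"
  assumes sm: "sparse_model n q r p" and r: "0 \<le> r" and nr: "1 \<le> real n * r" and i: "i < n"
    and B: "\<And>j k. j < n \<Longrightarrow> k < n \<Longrightarrow> norm (c j k) \<le> B"
  shows "measure_pmf.expectation p (\<lambda>a. (norm (\<Sum>j<n. \<Sum>k<n. (noise q a i j * noise q a j k) *\<^sub>R c j k))\<^sup>2)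
     \<le> 4 * r\<^sup>2 * (\<Sum>j<n. \<Sum>k<n. (norm (c j k))\<^sup>2) + 12 * r\<^sup>2 * real n ^ 2 * B\<^sup>2"
proof -
  note em = sparse_modelD(1)[OF sm]
  \<comment> \<open>The paths are indexed by their centre j; the indicator fixes the end l to be
    i.\<close>
  define P where "P = (\<lambda>a. \<Sum>j<n. \<Sum>l<n. \<Sum>k\<in>{..<n} - {l}. (noise q a j l * noise q a j k) *\<^sub>R (if l = i then c j k else 0))"
  define D where "D = (\<lambda>a. \<Sum>j<n. (noise q a i j)\<^sup>2)"
  have "measure_pmf.expectation p (\<lambda>a. (norm (\<Sum>j<n. \<Sum>k<n. (noise q a i j * noise q a j k) *\<^sub>R c j k))\<^sup>2)
    \<le> measure_pmf.expectation p (\<lambda>a. 2 * (norm (P a))\<^sup>2 + 2 * B\<^sup>2 * (D a)\<^sup>2)"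
  proof (rule expectation_mono[OF em])
    fix a assume a: "a \<in> set_pmf p"
    define E where "E = (\<Sum>j<n. (noise q a i j)\<^sup>2 *\<^sub>R c j i)"
    have P: "P a = (\<Sum>j<n. \<Sum>k\<in>{..<n} - {i}. (noise q a j i * noise q a j k) *\<^sub>R c j k)"
      unfolding P_def
    proof (rule sum.cong[OF refl])
      fix j
      have "(\<Sum>l<n. \<Sum>k\<in>{..<n} - {l}. (noise q a j l * noise q a j k) *\<^sub>R (if l = i then c j k else 0))
        = (\<Sum>l<n. if l = i then \<Sum>k\<in>{..<n} - {l}. (noise q a j l * noise q a j k) *\<^sub>R c j k else 0)"
        by (intro sum.cong) auto
      also have "\<dots> = (\<Sum>k\<in>{..<n} - {i}. (noise q a j i * noise q a j k) *\<^sub>R c j k)"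
        using i by simp
      finally show "(\<Sum>l<n. \<Sum>k\<in>{..<n} - {l}. (noise q a j l * noise q a j k) *\<^sub>R (if l = i then c j k else 0))
        = (\<Sum>k\<in>{..<n} - {i}. (noise q a j i * noise q a j k) *\<^sub>R c j k)" .
    qed
    have "(\<Sum>j<n. \<Sum>k<n. (noise q a i j * noise q a j k) *\<^sub>R c j k)
      = (\<Sum>j<n. (noise q a i j)\<^sup>2 *\<^sub>R c j i + (\<Sum>k\<in>{..<n} - {i}. (noise q a j i * noise q a j k) *\<^sub>R c j k))"
    proof (rule sum.cong[OF refl])
      fix j
      have s: "noise q a j i = noise q a i j" by (rule noise_sym[OF sm a])
      show "(\<Sum>k<n. (noise q a i j * noise q a j k) *\<^sub>R c j k)
        = (noise q a i j)\<^sup>2 *\<^sub>R c j i + (\<Sum>k\<in>{..<n} - {i}. (noise q a j i * noise q a j k) *\<^sub>R c j k)"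
        using i by (subst sum.remove[of _ i]) (auto simp: s power2_eq_square)
    qed
    also have "\<dots> = E + P a" by (simp add: sum.distrib E_def P)
    finally have eq: "(\<Sum>j<n. \<Sum>k<n. (noise q a i j * noise q a j k) *\<^sub>R c j k) = E + P a" .
    have "norm E \<le> (\<Sum>j<n. norm ((noise q a i j)\<^sup>2 *\<^sub>R c j i))" unfolding E_def by (rule norm_sum)
    also have "\<dots> \<le> (\<Sum>j<n. (noise q a i j)\<^sup>2 * B)" using B i by (intro sum_mono) (auto intro: mult_left_mono)
    finally have nE: "norm E \<le> B * D a" by (simp add: D_def sum_distrib_left mult.commute)
    have "norm (E + P a) \<le> B * D a + norm (P a)" using norm_triangle_ineq[of E "P a"] nE by linarith
    then have "(norm (E + P a))\<^sup>2 \<le> (B * D a + norm (P a))\<^sup>2" by (intro power_mono) auto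
    also have "\<dots> \<le> 2 * (norm (P a))\<^sup>2 + 2 * B\<^sup>2 * (D a)\<^sup>2"
      using sum_squares_bound[of "B * D a" "norm (P a)"] by (simp add: power2_eq_square algebra_simps)
    finally show "(norm (\<Sum>j<n. \<Sum>k<n. (noise q a i j * noise q a j k) *\<^sub>R c j k))\<^sup>2 \<le> 2 * (norm (P a))\<^sup>2 + 2 * B\<^sup>2 * (D a)\<^sup>2"
      unfolding eq .
  qed
  also have "\<dots> = 2 * measure_pmf.expectation p (\<lambda>a. (norm (P a))\<^sup>2) + 2 * B\<^sup>2 * measure_pmf.expectation p (\<lambda>a. (D a)\<^sup>2)"
    using em by simp
  also have "\<dots> \<le> 2 * (2 * r\<^sup>2 * (\<Sum>j<n. \<Sum>l<n. \<Sum>k<n. (norm (if l = i then c j k else 0))\<^sup>2)) + 2 * B\<^sup>2 * (6 * r\<^sup>2 * real n ^ 2)"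
    unfolding P_def D_def
    by (intro add_mono mult_left_mono second_moment_paths[OF sm r] row_square_sum_second_moment[OF sm r nr i]) auto
  also have "(\<Sum>j<n. \<Sum>l<n. \<Sum>k<n. (norm (if l = i then c j k else 0))\<^sup>2) = (\<Sum>j<n. \<Sum>k<n. (norm (c j k))\<^sup>2)"
  proof (rule sum.cong[OF refl])
    fix j
    have "(\<Sum>l<n. \<Sum>k<n. (norm (if l = i then c j k else 0))\<^sup>2) = (\<Sum>l<n. if l = i then \<Sum>k<n. (norm (c j k))\<^sup>2 else 0)"
      by (intro sum.cong) auto
    then show "(\<Sum>l<n. \<Sum>k<n. (norm (if l = i then c j k else 0))\<^sup>2) = (\<Sum>k<n. (norm (c j k))\<^sup>2)" using i by simp
  qed
  finally show ?thesis by (simp add: mult_ac)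
qed

lemma two_step_rows_second_moment:
  fixes c :: "nat \<Rightarrow> nat \<Rightarrow> nat \<Rightarrow> 'b::{real_inner, banach, second_countable_topology}"
  assumes sm: "sparse_model n q r p" and r: "0 \<le> r" and nr: "1 \<le> real n * r"
    and B: "\<And>i j k. i < n \<Longrightarrow> j < n \<Longrightarrow> k < n \<Longrightarrow> norm (c i j k) \<le> B"
  shows "measure_pmf.expectation p (\<lambda>a. \<Sum>i<n. (norm (\<Sum>j<n. \<Sum>k<n. (noise q a i j * noise q a j k) *\<^sub>R c i j k))\<^sup>2)
     \<le> 16 * r\<^sup>2 * real n ^ 3 * B\<^sup>2"
proof -
  have "measure_pmf.expectation p (\<lambda>a. \<Sum>i<n. (norm (\<Sum>j<n. \<Sum>k<n. (noise q a i j * noise q a j k) *\<^sub>R c i j k))\<^sup>2)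
     = (\<Sum>i<n. measure_pmf.expectation p (\<lambda>a. (norm (\<Sum>j<n. \<Sum>k<n. (noise q a i j * noise q a j k) *\<^sub>R c i j k))\<^sup>2))"
    using sparse_modelD(1)[OF sm] by (intro Bochner_Integration.integral_sum) auto
  also have "\<dots> \<le> (\<Sum>i<n. 4 * r\<^sup>2 * (\<Sum>j<n. \<Sum>k<n. B\<^sup>2) + 12 * r\<^sup>2 * real n ^ 2 * B\<^sup>2)"
  proof (intro sum_mono)
    fix i assume i: "i \<in> {..<n}"
    have "measure_pmf.expectation p (\<lambda>a. (norm (\<Sum>j<n. \<Sum>k<n. (noise q a i j * noise q a j k) *\<^sub>R c i j k))\<^sup>2)
      \<le> 4 * r\<^sup>2 * (\<Sum>j<n. \<Sum>k<n. (norm (c i j k))\<^sup>2) + 12 * r\<^sup>2 * real n ^ 2 * B\<^sup>2"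
      using i by (intro two_step_second_moment[OF sm r nr] B) auto
    also have "\<dots> \<le> 4 * r\<^sup>2 * (\<Sum>j<n. \<Sum>k<n. B\<^sup>2) + 12 * r\<^sup>2 * real n ^ 2 * B\<^sup>2"
      using i B by (intro add_right_mono mult_left_mono sum_mono power_mono) auto
    finally show "measure_pmf.expectation p (\<lambda>a. (norm (\<Sum>j<n. \<Sum>k<n. (noise q a i j * noise q a j k) *\<^sub>R c i j k))\<^sup>2)
      \<le> 4 * r\<^sup>2 * (\<Sum>j<n. \<Sum>k<n. B\<^sup>2) + 12 * r\<^sup>2 * real n ^ 2 * B\<^sup>2" .
  qed
  also have "\<dots> = 16 * r\<^sup>2 * real n ^ 3 * B\<^sup>2" by (simp add: power2_eq_square power3_eq_cube)
  finally show ?thesis .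
qed

text \<open>The squared Frobenius norm of \<open>E\<^sup>2\<close> dominates the fourth power of the operator norm of \<open>E\<close>.\<close>
lemma noise_square_frobenius:
  assumes sm: "sparse_model n q r p" and r: "0 \<le> r" and nr: "1 \<le> real n * r"
  shows "measure_pmf.expectation p (\<lambda>a. \<Sum>i<n. \<Sum>k<n. (\<Sum>j<n. noise q a i j * noise q a j k)\<^sup>2) \<le> 16 * r\<^sup>2 * real n ^ 3"
proof -
  note em = sparse_modelD(1)[OF sm]
  have one: "(\<Sum>k<n. measure_pmf.expectation p (\<lambda>a. (\<Sum>j<n. noise q a i j * noise q a j k)\<^sup>2)) \<le> 16 * r\<^sup>2 * real n ^ 2" if i: "i < n" for i
  proof -
    \<comment> \<open>An off-diagonal entry of the square of E is a sum of n distinct path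
      monomials, of second moment about n r^2. A diagonal entry is a sum of squares, with second
      moment about n^2 r^2, but there are only n of these. Both kinds contribute at most the order
      n^3 r^2.\<close>
    have offd: "measure_pmf.expectation p (\<lambda>a. (\<Sum>j<n. noise q a i j * noise q a j k)\<^sup>2) \<le> 2 * r\<^sup>2 * real n" if k: "k < n" "k \<noteq> i" for k
    proof -
      have eq: "(\<Sum>j<n. noise q a i j * noise q a j k)
         = (\<Sum>j<n. \<Sum>l<n. \<Sum>m\<in>{..<n} - {l}. (noise q a j l * noise q a j m) *\<^sub>R (if l = i \<and> m = k then 1 else 0))"
        if a: "a \<in> set_pmf p" for a
      proof (rule sum.cong[OF refl])
        fix j
        have "(\<Sum>l<n. \<Sum>m\<in>{..<n} - {l}. (noise q a j l * noise q a j m) *\<^sub>R (if l = i \<and> m = k then 1 else 0))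
          = (\<Sum>l<n. if l = i then \<Sum>m\<in>{..<n} - {l}. (if m = k then noise q a j l * noise q a j m else 0) else 0)"
          by (rule sum.cong[OF refl]) (auto simp: if_distrib[of "\<lambda>x. _ * x"] cong: if_cong)
        also have "\<dots> = noise q a j i * noise q a j k" using i k by simp
        finally show "noise q a i j * noise q a j k = (\<Sum>l<n. \<Sum>m\<in>{..<n} - {l}. (noise q a j l * noise q a j m) *\<^sub>R (if l = i \<and> m = k then 1 else 0))"
          by (simp add: noise_sym[OF sm a, of j i])
      qed
      have "measure_pmf.expectation p (\<lambda>a. (\<Sum>j<n. noise q a i j * noise q a j k)\<^sup>2)
        \<le> measure_pmf.expectation p (\<lambda>a. (norm (\<Sum>j<n. \<Sum>l<n. \<Sum>m\<in>{..<n} - {l}. (noise q a j l * noise q a j m) *\<^sub>R (if l = i \<and> m = k then 1 else 0 :: real)))\<^sup>2)"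
        by (rule expectation_mono[OF em]) (simp add: eq)
      also have "\<dots> \<le> 2 * r\<^sup>2 * (\<Sum>j<n. \<Sum>l<n. \<Sum>m<n. (norm (if l = i \<and> m = k then 1 else 0 :: real))\<^sup>2)"
        by (rule second_moment_paths[OF sm r])
      also have "(\<Sum>j<n. \<Sum>l<n. \<Sum>m<n. (norm (if l = i \<and> m = k then 1 else 0 :: real))\<^sup>2)
         = (\<Sum>j<n. \<Sum>l<n. if l = i then \<Sum>m<n. (if m = k then 1 else 0 :: real) else 0)"
        by (rule sum.cong[OF refl], rule sum.cong[OF refl]) (auto simp: if_distrib[of "\<lambda>x. x ^ 2"] cong: if_cong)
      also have "\<dots> = real n" using i k by simp
      finally show ?thesis .
    qed
    have diag: "measure_pmf.expectation p (\<lambda>a. (\<Sum>j<n. noise q a i j * noise q a j i)\<^sup>2) \<le> 6 * r\<^sup>2 * real n ^ 2"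
    proof -
      have "measure_pmf.expectation p (\<lambda>a. (\<Sum>j<n. noise q a i j * noise q a j i)\<^sup>2) \<le> measure_pmf.expectation p (\<lambda>a. (\<Sum>j<n. (noise q a i j)\<^sup>2)\<^sup>2)"
        by (rule expectation_mono[OF em]) (simp add: noise_sym[OF sm, of _ _ i] power2_eq_square)
      then show ?thesis using row_square_sum_second_moment[OF sm r nr i] by simp
    qed
    have "(\<Sum>k<n. measure_pmf.expectation p (\<lambda>a. (\<Sum>j<n. noise q a i j * noise q a j k)\<^sup>2))
      = measure_pmf.expectation p (\<lambda>a. (\<Sum>j<n. noise q a i j * noise q a j i)\<^sup>2)
       + (\<Sum>k\<in>{..<n} - {i}. measure_pmf.expectation p (\<lambda>a. (\<Sum>j<n. noise q a i j * noise q a j k)\<^sup>2))"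
      using i by (intro sum.remove) auto
    also have "\<dots> \<le> 6 * r\<^sup>2 * real n ^ 2 + (\<Sum>k\<in>{..<n} - {i}. 2 * r\<^sup>2 * real n)"
      using offd by (intro add_mono diag sum_mono) auto
    also have "\<dots> \<le> 6 * r\<^sup>2 * real n ^ 2 + (\<Sum>k<n. 2 * r\<^sup>2 * real n)"
      by (intro add_left_mono sum_mono2) auto
    also have "\<dots> = 8 * r\<^sup>2 * real n ^ 2" by (simp add: power2_eq_square)
    also have "\<dots> \<le> 16 * r\<^sup>2 * real n ^ 2" by (intro mult_right_mono) auto
    finally show ?thesis .
  qed
  have "measure_pmf.expectation p (\<lambda>a. \<Sum>i<n. \<Sum>k<n. (\<Sum>j<n. noise q a i j * noise q a j k)\<^sup>2)
    = (\<Sum>i<n. \<Sum>k<n. measure_pmf.expectation p (\<lambda>a. (\<Sum>j<n. noise q a i j * noise q a j k)\<^sup>2))"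
    using em by (simp add: Bochner_Integration.integral_sum)
  also have "\<dots> \<le> (\<Sum>i<n. 16 * r\<^sup>2 * real n ^ 2)" by (intro sum_mono one) auto
  finally show ?thesis by (simp add: power2_eq_square power3_eq_cube mult_ac)
qed

subsection \<open>Frobenius norms of matrices given by rows\<close>

definition fnorm :: "nat \<Rightarrow> (nat \<Rightarrow> 'a::real_normed_vector) \<Rightarrow> real" where
  "fnorm n X = L2_set (\<lambda>i. norm (X i)) {..<n}"

lemma frob_sq_fnorm: "frob_sq n X = (fnorm n X)\<^sup>2"
  by (simp add: frob_sq_def fnorm_def L2_set_def sum_nonneg)

lemma fnorm_sq: "(fnorm n X)\<^sup>2 = (\<Sum>i<n. (norm (X i))\<^sup>2)"
  by (simp add: fnorm_def L2_set_def sum_nonneg)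

lemma fnorm_nonneg [simp]: "0 \<le> fnorm n X"
  by (simp add: fnorm_def)

lemma fnorm_mono: "(\<And>i. i < n \<Longrightarrow> norm (X i) \<le> norm (Y i)) \<Longrightarrow> fnorm n X \<le> fnorm n Y"
  unfolding fnorm_def by (intro L2_set_mono) auto

lemma fnorm_cong: "(\<And>i. i < n \<Longrightarrow> X i = Y i) \<Longrightarrow> fnorm n X = fnorm n Y"
  unfolding fnorm_def by (intro L2_set_cong) auto

lemma fnorm_triangle: "fnorm n (\<lambda>i. X i + Y i) \<le> fnorm n X + fnorm n Y"
proof -
  have "fnorm n (\<lambda>i. X i + Y i) \<le> L2_set (\<lambda>i. norm (X i) + norm (Y i)) {..<n}"
    unfolding fnorm_def by (intro L2_set_mono norm_triangle_ineq) auto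
  also have "\<dots> \<le> fnorm n X + fnorm n Y" unfolding fnorm_def by (rule L2_set_triangle_ineq)
  finally show ?thesis .
qed

lemma fnorm_minus: "fnorm n (\<lambda>i. - X i) = fnorm n X"
  by (simp add: fnorm_def)

lemma fnorm_triangle_diff: "fnorm n (\<lambda>i. X i - Y i) \<le> fnorm n X + fnorm n Y"
  using fnorm_triangle[of n X "\<lambda>i. - Y i"] by (simp add: fnorm_minus)

lemma fnorm_le_mult:
  assumes "0 \<le> c" "\<And>i. i < n \<Longrightarrow> norm (X i) \<le> c * norm (Y i)"
  shows "fnorm n X \<le> c * fnorm n Y"
proof -
  have "fnorm n X \<le> L2_set (\<lambda>i. c * norm (Y i)) {..<n}"
    unfolding fnorm_def using assms by (intro L2_set_mono) auto
  also have "\<dots> = c * fnorm n Y"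
    unfolding fnorm_def using assms by (simp add: L2_set_right_distrib)
  finally show ?thesis .
qed

lemma fnorm_le_const:
  assumes "0 \<le> c" "\<And>i. i < n \<Longrightarrow> norm (X i) \<le> c"
  shows "(fnorm n X)\<^sup>2 \<le> real n * c\<^sup>2"
proof -
  have "(\<Sum>i<n. (norm (X i))\<^sup>2) \<le> (\<Sum>i<n. c\<^sup>2)" using assms by (intro sum_mono power_mono) auto
  then show ?thesis by (simp add: fnorm_sq)
qed

lemma norm_le_fnorm: "i < n \<Longrightarrow> norm (X i) \<le> fnorm n X"
  unfolding fnorm_def by (rule member_le_L2_set[where f = "\<lambda>i. norm (X i)"]) auto

lemma sum_norm_prod_le: "(\<Sum>i<n. norm (X i) * norm (Y i)) \<le> fnorm n X * fnorm n Y"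
  unfolding fnorm_def using L2_set_mult_ineq[of "\<lambda>i. norm (X i)" "\<lambda>i. norm (Y i)" "{..<n}"] by simp

lemma sum_inner_le_fnorm: "\<bar>\<Sum>i<n. X i \<bullet> Y i\<bar> \<le> fnorm n X * fnorm n Y"
proof -
  have "\<bar>\<Sum>i<n. X i \<bullet> Y i\<bar> \<le> (\<Sum>i<n. norm (X i) * norm (Y i))"
    by (intro order.trans[OF sum_abs] sum_mono Cauchy_Schwarz_ineq2)
  then show ?thesis using sum_norm_prod_le[of X Y n] by linarith
qed

lemma norm_sum_inner_scaleR_le:
  fixes X :: "nat \<Rightarrow> 'a::real_inner" and Y :: "nat \<Rightarrow> 'b::real_normed_vector"
  shows "norm (\<Sum>j<n. (X j \<bullet> v) *\<^sub>R Y j) \<le> fnorm n X * fnorm n Y * norm v"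
proof -
  have "norm (\<Sum>j<n. (X j \<bullet> v) *\<^sub>R Y j) \<le> (\<Sum>j<n. norm v * (norm (X j) * norm (Y j)))"
  proof (intro order.trans[OF norm_sum] sum_mono)
    fix j
    have "\<bar>X j \<bullet> v\<bar> * norm (Y j) \<le> (norm (X j) * norm v) * norm (Y j)"
      by (intro mult_right_mono Cauchy_Schwarz_ineq2) auto
    then show "norm ((X j \<bullet> v) *\<^sub>R Y j) \<le> norm v * (norm (X j) * norm (Y j))" by (simp add: mult_ac)
  qed
  also have "\<dots> = norm v * (\<Sum>j<n. norm (X j) * norm (Y j))" by (simp add: sum_distrib_left)
  also have "\<dots> \<le> norm v * (fnorm n X * fnorm n Y)" by (intro mult_left_mono sum_norm_prod_le) auto
  finally show ?thesis by (simp add: mult_ac)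
qed

lemma fnorm_le_sqrt: "(\<Sum>i<n. (norm (X i))\<^sup>2) \<le> S \<Longrightarrow> fnorm n X \<le> sqrt S"
  by (rule real_le_rsqrt) (simp add: fnorm_sq)

lemma fnorm_scaleR: "fnorm n (\<lambda>i. c *\<^sub>R X i) = \<bar>c\<bar> * fnorm n X"
  unfolding fnorm_def by (simp add: L2_set_right_distrib)

subsection \<open>Dyads\<close>

definition dyad :: "real^'d \<Rightarrow> real^'d \<Rightarrow> real^'d^'d" where
  "dyad x y = (\<chi> i j. x $ i * y $ j)"

lemma outer_dyad: "outer x = dyad x x"
  by (simp add: outer_def dyad_def)

lemma dyad_mult_vec: "dyad x y *v v = (y \<bullet> v) *\<^sub>R x"
  by (simp add: vec_eq_iff dyad_def matrix_vector_mult_def inner_vec_def sum_distrib_left sum_distrib_right mult_ac)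

lemma inner_dyad: "M \<bullet> dyad x y = x \<bullet> (M *v y)"
  by (simp add: inner_vec_def dyad_def matrix_vector_mult_def sum_distrib_left mult_ac)

lemma dyad_inner_dyad: "dyad u v \<bullet> dyad x y = (u \<bullet> x) * (v \<bullet> y)"
  by (simp add: inner_dyad dyad_mult_vec inner_commute)

lemma norm_dyad: "norm (dyad x y) = norm x * norm y"
proof -
  have "(norm (dyad x y))\<^sup>2 = (norm x * norm y)\<^sup>2"
    by (simp add: power2_norm_eq_inner dyad_inner_dyad power_mult_distrib)
  then show ?thesis by (simp add: power2_eq_iff_nonneg)
qed

text \<open>The norm of the matrix type is the Frobenius norm; Cauchy-Schwarz is applied in each
  row.\<close>

lemma norm_matrix_vector_le: "norm (M *v v) \<le> norm M * norm (v :: real^'d)" for M :: "real^'d^'e"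
proof -
  have "(norm (M *v v))\<^sup>2 = (\<Sum>i\<in>UNIV. (M $ i \<bullet> v)\<^sup>2)"
    unfolding power2_norm_eq_inner by (simp add: inner_vec_def matrix_vector_mult_def power2_eq_square)
  also have "\<dots> \<le> (\<Sum>i\<in>UNIV. (norm (M $ i))\<^sup>2 * (norm v)\<^sup>2)"
  proof (intro sum_mono)
    fix i
    have "\<bar>M $ i \<bullet> v\<bar>\<^sup>2 \<le> (norm (M $ i) * norm v)\<^sup>2" by (intro power_mono Cauchy_Schwarz_ineq2) auto
    then show "(M $ i \<bullet> v)\<^sup>2 \<le> (norm (M $ i))\<^sup>2 * (norm v)\<^sup>2" by (simp add: power_mult_distrib)
  qed
  also have "\<dots> = (norm M * norm v)\<^sup>2"
    by (simp add: power_mult_distrib sum_distrib_right norm_vec_def[of M] L2_set_def sum_nonneg)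
  finally show ?thesis by (rule power2_le_imp_le) auto
qed

lemma linear_matrix_vector_left: "linear (\<lambda>M :: real^'d^'e. M *v v)"
  by (intro linearI) (auto simp: matrix_vector_mult_add_rdistrib scaleR_matrix_vector_assoc)

lemma sum_matrix_vector: "(\<Sum>i\<in>I. f i) *v v = (\<Sum>i\<in>I. f i *v v)" for f :: "_ \<Rightarrow> real^'d^'e"
  using linear_sum[OF linear_matrix_vector_left, of f I] .

lemma scaleR_matrix_vector: "(c *\<^sub>R M) *v v = c *\<^sub>R (M *v v)" for M :: "real^'d^'e"
  by (simp add: scaleR_matrix_vector_assoc)

text \<open>The double sum is the squared norm of P^T W, that is, the trace of the product of two
  Gram matrices.\<close>

lemma gram_product_nonneg:
  fixes p w :: "nat \<Rightarrow> real^'d"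
  shows "0 \<le> (\<Sum>i<n. \<Sum>j<n. (p i \<bullet> p j) * (w i \<bullet> w j))"
proof -
  have "(norm (\<Sum>i<n. dyad (p i) (w i)))\<^sup>2 = (\<Sum>i<n. \<Sum>j<n. (p i \<bullet> p j) * (w i \<bullet> w j))"
    unfolding power2_norm_eq_inner inner_sum_left inner_sum_right dyad_inner_dyad
    by (subst sum.swap) simp
  then show ?thesis by (metis zero_le_power2)
qed

subsection \<open>Perturbation analysis of the adjacency spectral embedding\<close>

text \<open>A quantitative form of the fact that the Gram matrix determines a configuration up to rotation. The
  hypotheses say that \<open>X\<^sup>T Z\<close> is symmetric and positive semidefinite, i.e. \<open>Z\<close> is optimally rotated towards \<open>X\<close>.\<close>
lemma gram_distance_lower_bound:
  fixes x z :: "nat \<Rightarrow> real^'d"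
  defines "D \<equiv> \<lambda>i. z i - x i"
  assumes sym: "\<And>u v. (\<Sum>i<n. (x i \<bullet> u) * (z i \<bullet> v)) = (\<Sum>i<n. (x i \<bullet> v) * (z i \<bullet> u))"
    and psd: "\<And>v. 0 \<le> (\<Sum>i<n. (x i \<bullet> v) * (z i \<bullet> v))"
  shows "(\<Sum>i<n. \<Sum>j<n. (x i \<bullet> D j)\<^sup>2) / 2 \<le> (\<Sum>i<n. \<Sum>j<n. (z i \<bullet> z j - x i \<bullet> x j)\<^sup>2)"
proof -
  define a where "a = (\<lambda>i j. x i \<bullet> D j)"
  define t where "t = (\<lambda>i j. D i \<bullet> D j)"
  define g where "g = (\<lambda>i j. x i \<bullet> x j)"
  define SS where "SS = (\<lambda>f :: nat \<Rightarrow> nat \<Rightarrow> real. \<Sum>i<n. \<Sum>j<n. f i j)"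
  have SS_add: "SS (\<lambda>i j. f i j + h i j) = SS f + SS h" for f h by (simp add: SS_def sum.distrib)
  have SS_mult: "SS (\<lambda>i j. c * f i j) = c * SS f" for f c by (simp add: SS_def sum_distrib_left)
  have SS_swap: "SS (\<lambda>i j. f j i) = SS f" for f unfolding SS_def by (rule sum.swap)
  have z: "z i = x i + D i" for i by (simp add: D_def)
  \<comment> \<open>Symmetry of X^T D lets u and v change places in \<open>sym\<close>: the inner
    product of X X^T and D D^T becomes the trace of the square of X D^T.\<close>
  have gt: "SS (\<lambda>i j. g i j * t i j) = SS (\<lambda>i j. a i j * a j i)"
  proof -
    have "(\<Sum>i<n. (x i \<bullet> u) * (D i \<bullet> v)) = (\<Sum>i<n. (x i \<bullet> v) * (D i \<bullet> u))" for u v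
      using sym[of u v] unfolding z by (simp add: inner_add_left algebra_simps sum.distrib)
    then have "(\<Sum>j<n. \<Sum>i<n. (x i \<bullet> x j) * (D i \<bullet> D j)) = (\<Sum>j<n. \<Sum>i<n. (x i \<bullet> D j) * (D i \<bullet> x j))" by simp
    then show ?thesis
      unfolding SS_def g_def t_def a_def by (subst (1 2) sum.swap) (simp add: inner_commute)
  qed
  \<comment> \<open>Positivity of X^T Z, tested on every \<open>D j\<close> and summed: the cubic
    term is bounded below by minus the quadratic one.\<close>
  have at: "- SS (\<lambda>i j. (a i j)\<^sup>2) \<le> SS (\<lambda>i j. a i j * t i j)"
  proof -
    have "0 \<le> (\<Sum>j<n. \<Sum>i<n. (x i \<bullet> D j) * (z i \<bullet> D j))" by (intro sum_nonneg psd)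
    also have "\<dots> = SS (\<lambda>i j. (a i j)\<^sup>2 + a i j * t i j)"
      unfolding SS_def a_def t_def z by (subst sum.swap) (simp add: inner_add_left power2_eq_square algebra_simps)
    finally show ?thesis by (simp add: SS_add)
  qed
  \<comment> \<open>Gram positivity with a free constant c = 5/4. Write A, S, M, T for the sums of
    a_ij^2, a_ij a_ji, a_ij t_ij and t_ij^2. The inequality says T >= - 2 c M - c^2 S, so the target
    2 A + 2 S + 4 M + T is at least 2 A + (2 - c^2) S + (4 - 2 c) M. With S >= 0 and M >= - A this
    leaves (2 c - 2) A. Every c > 1 with c^2 <= 2 would do; 5/4 gives the constant 1/2.\<close>
  have "0 \<le> (\<Sum>i<n. \<Sum>j<n. ((D i + (5/4) *\<^sub>R x i) \<bullet> (D j + (5/4) *\<^sub>R x j)) * (D i \<bullet> D j))"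
    by (rule gram_product_nonneg)
  also have "\<dots> = SS (\<lambda>i j. (t i j)\<^sup>2 + ((5/4) * (a i j * t i j) + ((5/4) * (a j i * t j i) + (25/16) * (g i j * t i j))))"
    unfolding SS_def a_def t_def g_def
    by (intro sum.cong refl) (simp add: inner_add_left inner_add_right power2_eq_square inner_commute algebra_simps)
  also have "\<dots> = SS (\<lambda>i j. (t i j)\<^sup>2) + (5/2) * SS (\<lambda>i j. a i j * t i j) + (25/16) * SS (\<lambda>i j. a i j * a j i)"
    by (simp only: SS_add SS_mult gt SS_swap[of "\<lambda>i j. a i j * t i j"])
  finally have 1: "0 \<le> \<dots>" .
  have 2: "0 \<le> SS (\<lambda>i j. a i j * a j i)"
    unfolding gt[symmetric] unfolding SS_def g_def t_def by (rule gram_product_nonneg)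
  have "(\<Sum>i<n. \<Sum>j<n. (z i \<bullet> z j - x i \<bullet> x j)\<^sup>2)
     = SS (\<lambda>i j. (a i j)\<^sup>2 + ((a j i)\<^sup>2 + (2 * (a i j * a j i) + (2 * (a i j * t i j) + (2 * (a j i * t j i) + (t i j)\<^sup>2)))))"
    unfolding SS_def a_def t_def z
    by (intro sum.cong refl) (simp add: inner_add_left inner_add_right power2_eq_square inner_commute algebra_simps)
  also have "\<dots> = 2 * SS (\<lambda>i j. (a i j)\<^sup>2) + 2 * SS (\<lambda>i j. a i j * a j i) + 4 * SS (\<lambda>i j. a i j * t i j) + SS (\<lambda>i j. (t i j)\<^sup>2)"
    by (simp only: SS_add SS_mult SS_swap[of "\<lambda>i j. a i j * t i j"] SS_swap[of "\<lambda>i j. (a i j)\<^sup>2"])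
  finally have "(\<Sum>i<n. \<Sum>j<n. (z i \<bullet> z j - x i \<bullet> x j)\<^sup>2) \<ge> SS (\<lambda>i j. (a i j)\<^sup>2) / 2"
    using 1 2 at by linarith
  then show ?thesis by (simp add: SS_def a_def)
qed

text \<open>Here \<open>m = E X (X\<^sup>T X)\<^sup>-\<^sup>1\<close> is the first-order term of the embedding error \<open>z - x\<close>.\<close>
lemma embedding_linearization:
  fixes x z m :: "nat \<Rightarrow> real^'d" and E :: "nat \<Rightarrow> nat \<Rightarrow> real" and n :: nat
  defines "D \<equiv> \<lambda>i. z i - x i"
    and "EY \<equiv> \<lambda>i. \<Sum>j<n. E i j *\<^sub>R x j"
  assumes E_sym: "\<And>i j. E i j = E j i"
    and sym: "\<And>u v. (\<Sum>i<n. (x i \<bullet> u) * (z i \<bullet> v)) = (\<Sum>i<n. (x i \<bullet> v) * (z i \<bullet> u))"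
    and psd: "\<And>v. 0 \<le> (\<Sum>i<n. (x i \<bullet> v) * (z i \<bullet> v))"
    and opt: "(\<Sum>i<n. \<Sum>j<n. (x i \<bullet> x j + E i j - z i \<bullet> z j)\<^sup>2) \<le> (\<Sum>i<n. \<Sum>j<n. (E i j)\<^sup>2)"
    and stat: "\<And>i. i < n \<Longrightarrow> (\<Sum>j<n. (x i \<bullet> x j + E i j - z i \<bullet> z j) *\<^sub>R z j) = 0"
    and l: "0 < l" and s: "1 \<le> s" and B: "0 \<le> B" and eps: "0 \<le> \<epsilon>" "\<epsilon> \<le> l / 8"
    and low: "\<And>v. l * s * (norm v)\<^sup>2 \<le> (\<Sum>j<n. (x j \<bullet> v)\<^sup>2)"
    and up: "(fnorm n x)\<^sup>2 \<le> s"
    and EXb: "fnorm n EY \<le> B * s"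
    and XEX: "norm (\<Sum>i<n. \<Sum>j<n. E i j *\<^sub>R dyad (x i) (x j)) \<le> B * s"
    and Eop: "\<And>U :: nat \<Rightarrow> real^'d. fnorm n (\<lambda>i. \<Sum>j<n. E i j *\<^sub>R U j) \<le> \<epsilon> * s * fnorm n U"
    and m: "\<And>i. i < n \<Longrightarrow> (\<Sum>j<n. (x j \<bullet> m i) *\<^sub>R x j) = EY i"
    and b: "b = 16 * B / l" and k: "k = (B + B * b + b\<^sup>2) / l"
  shows "fnorm n D \<le> b"
    and "fnorm n (\<lambda>i. D i - m i) \<le> (\<epsilon> * b + (3 * b\<^sup>2 + b ^ 3 + k) / sqrt s) / l"
proof -
  have z: "z i = x i + D i" for i by (simp add: D_def)
  have b0: "0 \<le> b" using B l by (simp add: b)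
  have k0: "0 \<le> k" using B l b0 by (simp add: k)
  define d where "d = fnorm n D"
  have d0: "0 \<le> d" by (simp add: d_def)
  have Dlow: "l * s * d\<^sup>2 \<le> (\<Sum>i<n. \<Sum>j<n. (x i \<bullet> D j)\<^sup>2)"
  proof -
    have "l * s * d\<^sup>2 = (\<Sum>j<n. l * s * (norm (D j))\<^sup>2)" by (simp add: d_def fnorm_sq sum_distrib_left)
    also have "\<dots> \<le> (\<Sum>j<n. \<Sum>i<n. (x i \<bullet> D j)\<^sup>2)" by (intro sum_mono low)
    finally show ?thesis by (subst sum.swap)
  qed
  define Z where "Z = (\<lambda>i j. z i \<bullet> z j - x i \<bullet> x j)"
  have Zexp: "Z i j = D i \<bullet> x j + D j \<bullet> x i + D i \<bullet> D j" for i j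
    unfolding Z_def z by (simp add: inner_add_left inner_add_right inner_commute)
  define ED where "ED = (\<lambda>i. \<Sum>j<n. E i j *\<^sub>R D j)"
  have EDb: "fnorm n ED \<le> \<epsilon> * s * d" unfolding ED_def d_def by (rule Eop)
  \<comment> \<open>Minimality against the true configuration: the energy of the noise cancels, and
    the squared Gram error is bounded by twice its inner product with the noise.\<close>
  have "(\<Sum>i<n. \<Sum>j<n. (Z i j)\<^sup>2) \<le> 2 * (\<Sum>i<n. \<Sum>j<n. E i j * Z i j)"
  proof -
    have "(\<Sum>i<n. \<Sum>j<n. (x i \<bullet> x j + E i j - z i \<bullet> z j)\<^sup>2) = (\<Sum>i<n. \<Sum>j<n. (E i j)\<^sup>2 - 2 * (E i j * Z i j) + (Z i j)\<^sup>2)"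
      unfolding Z_def by (intro sum.cong refl) (simp add: power2_eq_square algebra_simps)
    also have "\<dots> = (\<Sum>i<n. \<Sum>j<n. (E i j)\<^sup>2) - 2 * (\<Sum>i<n. \<Sum>j<n. E i j * Z i j) + (\<Sum>i<n. \<Sum>j<n. (Z i j)\<^sup>2)"
      by (simp add: sum.distrib sum_subtractf sum_distrib_left)
    finally show ?thesis using opt by linarith
  qed
  also have "(\<Sum>i<n. \<Sum>j<n. E i j * Z i j) = 2 * (\<Sum>i<n. D i \<bullet> EY i) + (\<Sum>i<n. D i \<bullet> ED i)"
  proof -
    have 1: "(\<Sum>i<n. D i \<bullet> EY i) = (\<Sum>i<n. \<Sum>j<n. E i j * (D i \<bullet> x j))"
      by (simp add: EY_def inner_sum_right)
    have 2: "(\<Sum>i<n. D i \<bullet> ED i) = (\<Sum>i<n. \<Sum>j<n. E i j * (D i \<bullet> D j))"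
      by (simp add: ED_def inner_sum_right)
    have 3: "(\<Sum>i<n. \<Sum>j<n. E i j * (D j \<bullet> x i)) = (\<Sum>i<n. \<Sum>j<n. E i j * (D i \<bullet> x j))"
      by (subst sum.swap) (simp add: E_sym)
    show ?thesis unfolding 1 2 Zexp using 3 by (simp add: algebra_simps sum.distrib)
  qed
  also have "2 * (2 * (\<Sum>i<n. D i \<bullet> EY i) + (\<Sum>i<n. D i \<bullet> ED i)) \<le> 2 * (2 * (d * (B * s)) + d * (\<epsilon> * s * d))"
  proof -
    have "(\<Sum>i<n. D i \<bullet> EY i) \<le> d * (B * s)"
      using sum_inner_le_fnorm[where n=n and X=D and Y=EY] mult_left_mono[OF EXb d0] unfolding d_def by linarith
    moreover have "(\<Sum>i<n. D i \<bullet> ED i) \<le> d * (\<epsilon> * s * d)"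
      using sum_inner_le_fnorm[where n=n and X=D and Y=ED] mult_left_mono[OF EDb d0] unfolding d_def by linarith
    ultimately show ?thesis by (intro mult_left_mono add_mono) auto
  qed
  finally have "l * s * d\<^sup>2 / 2 \<le> 2 * (2 * (d * (B * s)) + d * (\<epsilon> * s * d))"
    using gram_distance_lower_bound[OF sym psd] Dlow unfolding D_def Z_def by linarith
  then have "s * (l * d\<^sup>2 / 2) \<le> s * (4 * d * B + 2 * \<epsilon> * d\<^sup>2)" by (simp add: power2_eq_square algebra_simps)
  then have "l * d\<^sup>2 / 2 \<le> 4 * d * B + 2 * \<epsilon> * d\<^sup>2" using s by (simp only: mult_le_cancel_left_pos)
  \<comment> \<open>Because \<epsilon> <= l / 8, the quadratic term on the right takes only half of
    the left side. The remaining inequality l d^2 / 4 <= 4 d B is the origin of b = 16 B /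
    l.\<close>
  also have "\<dots> \<le> 4 * d * B + 2 * (l / 8) * d\<^sup>2" using eps by (intro add_left_mono mult_right_mono mult_left_mono) auto
  finally have "d * (l * d) \<le> d * (16 * B)" by (simp add: power2_eq_square algebra_simps)
  then have db: "d \<le> b"
    using l d0 B by (cases "d = 0") (auto simp: b field_simps)
  then show "fnorm n D \<le> b" by (simp add: d_def)
  define rs where "rs = sqrt s"
  have rs: "1 \<le> rs" "rs\<^sup>2 = s" using s by (auto simp: rs_def)
  have xrs: "fnorm n x \<le> rs" unfolding rs_def using up by (intro real_le_rsqrt) auto
  \<comment> \<open>K = X^T (Z - X). Cauchy-Schwarz alone gives a bound of order sqrt s, and K x_i
    would then be as large as the leading term; a bound independent of s is needed.\<close>
  define K where "K = (\<Sum>i<n. dyad (x i) (D i))"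
  define kk where "kk = norm K"
  have Kv: "K *v v = (\<Sum>i<n. (D i \<bullet> v) *\<^sub>R x i)" for v by (simp add: K_def sum_matrix_vector dyad_mult_vec)
  have Ksym': "(\<Sum>i<n. (x i \<bullet> u) * (D i \<bullet> v)) = (\<Sum>i<n. (x i \<bullet> v) * (D i \<bullet> u))" for u v
    using sym[of u v] unfolding z by (simp add: inner_add_left algebra_simps sum.distrib)
  have Ksym: "u \<bullet> (K *v v) = v \<bullet> (K *v u)" for u v
    using Ksym'[of u v] by (simp add: Kv inner_sum_right inner_commute mult_ac)
  have row: "(\<Sum>j<n. E i j *\<^sub>R z j) = (\<Sum>j<n. (D i \<bullet> z j) *\<^sub>R z j) + (\<Sum>j<n. (x i \<bullet> D j) *\<^sub>R z j)" if "i < n" for i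
  proof -
    have "(\<Sum>j<n. (x i \<bullet> x j + E i j - z i \<bullet> z j) *\<^sub>R z j)
       = (\<Sum>j<n. E i j *\<^sub>R z j) - ((\<Sum>j<n. (D i \<bullet> z j) *\<^sub>R z j) + (\<Sum>j<n. (x i \<bullet> D j) *\<^sub>R z j))"
      unfolding sum.distrib[symmetric] sum_subtractf[symmetric]
      by (intro sum.cong refl) (simp add: z inner_add_left inner_add_right algebra_simps)
    then show ?thesis using stat[OF that] by simp
  qed
  \<comment> \<open>The rows of the stationarity equation are tested against K x_i. The terms |K
    z_j|^2 are dropped, the terms |K x_i|^2 sum to at least l s |K|^2, and the noise enters only
    through X^T E X, of size B s, and through the product of E X with K D. Division by s |K| leaves
    the constant k.\<close>
  have kb: "kk \<le> k"
  proof -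
    have "l * s * kk\<^sup>2 \<le> (\<Sum>i<n. (norm (K *v x i))\<^sup>2)"
    proof -
      have "kk\<^sup>2 = (\<Sum>r\<in>UNIV. (norm (K $ r))\<^sup>2)"
        by (simp add: kk_def norm_vec_def[of K] L2_set_def sum_nonneg)
      then have "l * s * kk\<^sup>2 = (\<Sum>r\<in>UNIV. l * s * (norm (K $ r))\<^sup>2)" by (simp add: sum_distrib_left)
      also have "\<dots> \<le> (\<Sum>r\<in>UNIV. \<Sum>i<n. (x i \<bullet> K $ r)\<^sup>2)" by (intro sum_mono low)
      also have "\<dots> = (\<Sum>i<n. \<Sum>r\<in>UNIV. (x i \<bullet> K $ r)\<^sup>2)" by (rule sum.swap)
      also have "\<dots> = (\<Sum>i<n. (norm (K *v x i))\<^sup>2)"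
        unfolding power2_norm_eq_inner
        by (intro sum.cong refl) (simp add: inner_vec_def matrix_vector_mult_def power2_eq_square mult_ac)
      finally show ?thesis .
    qed
    also have "\<dots> \<le> (\<Sum>i<n. x i \<bullet> (K *v (\<Sum>j<n. E i j *\<^sub>R z j))) - (\<Sum>i<n. \<Sum>j<n. (x i \<bullet> D j) * (x i \<bullet> (K *v D j)))"
    proof -
      have "(\<Sum>i<n. x i \<bullet> (K *v (\<Sum>j<n. E i j *\<^sub>R z j)))
        = (\<Sum>i<n. \<Sum>j<n. (D i \<bullet> z j) * (x i \<bullet> (K *v z j))) + (\<Sum>i<n. \<Sum>j<n. (x i \<bullet> D j) * (x i \<bullet> (K *v z j)))"
        by (simp add: row matrix_vector_right_distrib inner_add_right sum.distrib vec.sum vec.scale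
              matrix_vector_mult_scaleR inner_sum_right linear_sum[OF matrix_vector_mul_linear])
      also have "(\<Sum>i<n. \<Sum>j<n. (D i \<bullet> z j) * (x i \<bullet> (K *v z j))) = (\<Sum>j<n. (norm (K *v z j))\<^sup>2)"
        by (subst sum.swap) (simp add: power2_norm_eq_inner Kv[of "z _"] inner_sum_left)
      also have "(\<Sum>i<n. \<Sum>j<n. (x i \<bullet> D j) * (x i \<bullet> (K *v z j)))
         = (\<Sum>i<n. \<Sum>j<n. (x i \<bullet> D j) * (x i \<bullet> (K *v x j))) + (\<Sum>i<n. \<Sum>j<n. (x i \<bullet> D j) * (x i \<bullet> (K *v D j)))"
        by (simp add: z matrix_vector_right_distrib inner_add_right sum.distrib algebra_simps)
      also have "(\<Sum>i<n. \<Sum>j<n. (x i \<bullet> D j) * (x i \<bullet> (K *v x j))) = (\<Sum>i<n. (norm (K *v x i))\<^sup>2)"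
      proof (rule sum.cong[OF refl])
        fix i
        have "(\<Sum>j<n. (x i \<bullet> D j) * (x i \<bullet> (K *v x j))) = (\<Sum>j<n. (D j \<bullet> x i) * (x j \<bullet> (K *v x i)))"
          using Ksym[of "x i"] by (intro sum.cong refl) (simp add: inner_commute)
        also have "\<dots> = (\<Sum>j<n. (D j \<bullet> x i) *\<^sub>R x j) \<bullet> (K *v x i)" by (simp only: inner_sum_left inner_scaleR_left)
        also have "\<dots> = (K *v x i) \<bullet> (K *v x i)" by (simp only: Kv)
        finally show "(\<Sum>j<n. (x i \<bullet> D j) * (x i \<bullet> (K *v x j))) = (norm (K *v x i))\<^sup>2" by (simp add: power2_norm_eq_inner)
      qed
      finally show ?thesis using sum_nonneg[of "{..<n}" "\<lambda>j. (norm (K *v z j))\<^sup>2"] by simp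
    qed
    also have "(\<Sum>i<n. x i \<bullet> (K *v (\<Sum>j<n. E i j *\<^sub>R z j)))
        = K \<bullet> (\<Sum>i<n. \<Sum>j<n. E i j *\<^sub>R dyad (x i) (x j)) + (\<Sum>j<n. EY j \<bullet> (K *v D j))"
    proof -
      have "(\<Sum>i<n. x i \<bullet> (K *v (\<Sum>j<n. E i j *\<^sub>R z j))) = (\<Sum>i<n. \<Sum>j<n. E i j * (x i \<bullet> (K *v x j))) + (\<Sum>i<n. \<Sum>j<n. E i j * (x i \<bullet> (K *v D j)))"
        by (simp add: z matrix_vector_right_distrib inner_add_right sum.distrib
              matrix_vector_mult_scaleR inner_sum_right linear_sum[OF matrix_vector_mul_linear] algebra_simps)
      also have "(\<Sum>i<n. \<Sum>j<n. E i j * (x i \<bullet> (K *v x j))) = K \<bullet> (\<Sum>i<n. \<Sum>j<n. E i j *\<^sub>R dyad (x i) (x j))"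
        by (simp add: inner_sum_right inner_dyad)
      also have "(\<Sum>i<n. \<Sum>j<n. E i j * (x i \<bullet> (K *v D j))) = (\<Sum>j<n. EY j \<bullet> (K *v D j))"
        by (subst sum.swap) (simp add: EY_def inner_sum_left E_sym)
      finally show ?thesis .
    qed
    also have "\<dots> - (\<Sum>i<n. \<Sum>j<n. (x i \<bullet> D j) * (x i \<bullet> (K *v D j))) \<le> kk * (B * s) + kk * (B * s * b) + kk * (s * b\<^sup>2)"
    proof -
      have KD: "fnorm n (\<lambda>j. K *v D j) \<le> kk * d"
        unfolding d_def kk_def by (rule fnorm_le_mult) (auto intro: norm_matrix_vector_le)
      have 1: "K \<bullet> (\<Sum>i<n. \<Sum>j<n. E i j *\<^sub>R dyad (x i) (x j)) \<le> kk * (B * s)"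
        unfolding kk_def by (rule order.trans[OF norm_cauchy_schwarz mult_left_mono[OF XEX]]) auto
      have "(\<Sum>j<n. EY j \<bullet> (K *v D j)) \<le> fnorm n EY * fnorm n (\<lambda>j. K *v D j)"
        using sum_inner_le_fnorm[of EY "\<lambda>j. K *v D j" n] by linarith
      also have "\<dots> \<le> (B * s) * (kk * b)"
        using EXb KD db B s by (intro mult_mono order.trans[OF KD] mult_left_mono) (auto simp: kk_def)
      finally have 2: "(\<Sum>j<n. EY j \<bullet> (K *v D j)) \<le> kk * (B * s * b)" by (simp add: mult_ac)
      have "- (\<Sum>i<n. \<Sum>j<n. (x i \<bullet> D j) * (x i \<bullet> (K *v D j))) \<le> (\<Sum>i<n. \<Sum>j<n. kk * ((norm (x i))\<^sup>2 * (norm (D j))\<^sup>2))"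
        unfolding sum_negf[symmetric]
      proof (intro sum_mono)
        fix i j
        have "\<bar>(x i \<bullet> D j) * (x i \<bullet> (K *v D j))\<bar> \<le> (norm (x i) * norm (D j)) * (norm (x i) * (kk * norm (D j)))"
          unfolding abs_mult kk_def
          by (intro mult_mono Cauchy_Schwarz_ineq2 order.trans[OF Cauchy_Schwarz_ineq2] mult_left_mono norm_matrix_vector_le) auto
        then show "- ((x i \<bullet> D j) * (x i \<bullet> (K *v D j))) \<le> kk * ((norm (x i))\<^sup>2 * (norm (D j))\<^sup>2)"
          by (simp add: power2_eq_square mult_ac)
      qed
      also have "\<dots> = kk * ((fnorm n x)\<^sup>2 * d\<^sup>2)"
        unfolding fnorm_sq d_def sum_product by (simp only: sum_distrib_left)
      also have "\<dots> \<le> kk * (s * b\<^sup>2)"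
        using up db d0 by (intro mult_left_mono mult_mono power_mono) (auto simp: kk_def intro: order.trans[OF zero_le_power2])
      finally show ?thesis using 1 2 by linarith
    qed
    finally have "(kk * s) * (l * kk) \<le> (kk * s) * (B + B * b + b\<^sup>2)"
      by (simp add: power2_eq_square algebra_simps)
    show ?thesis
    proof (cases "kk = 0")
      case False
      then have "0 < kk * s" using s by (simp add: kk_def)
      with \<open>(kk * s) * (l * kk) \<le> _\<close> have "l * kk \<le> B + B * b + b\<^sup>2"
        by (simp only: mult_le_cancel_left_pos)
      then show ?thesis using l by (simp add: k field_simps)
    qed (use k0 in simp)
  qed
  have Sinv: "l * s * norm v \<le> norm (\<Sum>j<n. (x j \<bullet> v) *\<^sub>R x j)" for v
  proof -
    have "l * s * (norm v)\<^sup>2 \<le> v \<bullet> (\<Sum>j<n. (x j \<bullet> v) *\<^sub>R x j)"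
      using low[of v] by (simp add: inner_sum_right power2_eq_square inner_commute)
    also have "\<dots> \<le> norm v * norm (\<Sum>j<n. (x j \<bullet> v) *\<^sub>R x j)" by (rule norm_cauchy_schwarz)
    finally have "norm v * (l * s * norm v) \<le> norm v * norm (\<Sum>j<n. (x j \<bullet> v) *\<^sub>R x j)"
      by (simp add: power2_eq_square mult_ac)
    then show ?thesis by (cases "v = 0") auto
  qed
  \<comment> \<open>Expansion of z = x + D in E Z = D Z^T Z + X D^T Z: \<open>R1\<close> is the part
    of D Z^T Z beyond D X^T X, quadratic and cubic in D, and \<open>R2\<close> is X D^T Z, whose
    part linear in D is X K.\<close>
  define R1 where "R1 = (\<lambda>i. (\<Sum>j<n. (x j \<bullet> D i) *\<^sub>R D j) + (\<Sum>j<n. (D j \<bullet> D i) *\<^sub>R x j) + (\<Sum>j<n. (D j \<bullet> D i) *\<^sub>R D j))"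
  define R2 where "R2 = (\<lambda>i. K *v x i + (\<Sum>j<n. (D j \<bullet> x i) *\<^sub>R D j))"
  have eq: "(\<Sum>j<n. (x j \<bullet> (D i - m i)) *\<^sub>R x j) = ED i - (R1 i + R2 i)" if i: "i < n" for i
  proof -
    have "(\<Sum>j<n. (x j \<bullet> (D i - m i)) *\<^sub>R x j) = (\<Sum>j<n. (x j \<bullet> D i) *\<^sub>R x j) - EY i"
      using m[OF i] by (simp add: inner_diff_right scaleR_diff_left sum_subtractf)
    moreover have "EY i + ED i = (\<Sum>j<n. (D i \<bullet> z j) *\<^sub>R z j) + (\<Sum>j<n. (x i \<bullet> D j) *\<^sub>R z j)"
      using row[OF i] by (simp add: z EY_def ED_def scaleR_add_right sum.distrib)
    moreover have "(\<Sum>j<n. (D i \<bullet> z j) *\<^sub>R z j) = (\<Sum>j<n. (x j \<bullet> D i) *\<^sub>R x j) + R1 i"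
      by (simp add: z R1_def inner_add_right scaleR_add_right scaleR_add_left sum.distrib inner_commute)
    moreover have "(\<Sum>j<n. (x i \<bullet> D j) *\<^sub>R z j) = R2 i"
      by (simp add: z R2_def scaleR_add_right sum.distrib Kv inner_commute)
    moreover have "Q = e' - (r1 + r2)" if "Q = P - e" "e + e' = Y + X" "Y = P + r1" "X = r2"
      for Q P e e' Y X r1 r2 :: "real^'d"
    proof -
      have "e' = (P + r1) + r2 - e" using that(2-4) by (metis add_diff_cancel_left')
      then show ?thesis using that(1) by simp
    qed
    ultimately show ?thesis by blast
  qed
  have R1b: "fnorm n R1 \<le> rs * (2 * b\<^sup>2 + b ^ 3)"
  proof -
    have "fnorm n R1 \<le> (rs * b + b * rs + b * b) * d"
      unfolding d_def
    proof (rule fnorm_le_mult)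
      show "0 \<le> rs * b + b * rs + b * b" using rs b0 by simp
      fix i
      have "norm (R1 i) \<le> norm (\<Sum>j<n. (x j \<bullet> D i) *\<^sub>R D j) + norm (\<Sum>j<n. (D j \<bullet> D i) *\<^sub>R x j) + norm (\<Sum>j<n. (D j \<bullet> D i) *\<^sub>R D j)"
        unfolding R1_def by (intro norm_triangle_le add_mono) auto
      also have "\<dots> \<le> fnorm n x * fnorm n D * norm (D i) + fnorm n D * fnorm n x * norm (D i) + fnorm n D * fnorm n D * norm (D i)"
        by (intro add_mono norm_sum_inner_scaleR_le)
      also have "\<dots> \<le> rs * b * norm (D i) + b * rs * norm (D i) + b * b * norm (D i)"
        using xrs db rs b0 unfolding d_def by (intro add_mono mult_right_mono mult_mono) auto
      finally show "norm (R1 i) \<le> (rs * b + b * rs + b * b) * norm (D i)" by (simp add: algebra_simps)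
    qed
    also have "\<dots> \<le> (rs * b + b * rs + b * b) * b" using db rs b0 by (intro mult_left_mono) auto
    also have "\<dots> \<le> (rs * b + b * rs + rs * (b * b)) * b"
      using rs b0 by (intro mult_right_mono add_left_mono mult_right_mono[of 1 rs, simplified]) auto
    finally show ?thesis by (simp add: power2_eq_square power3_eq_cube algebra_simps)
  qed
  have R2b: "fnorm n R2 \<le> rs * (k + b\<^sup>2)"
  proof -
    have "fnorm n R2 \<le> (k + b * b) * fnorm n x"
    proof (rule fnorm_le_mult)
      show "0 \<le> k + b * b" using k0 by simp
      fix i
      have "norm (R2 i) \<le> norm (K *v x i) + norm (\<Sum>j<n. (D j \<bullet> x i) *\<^sub>R D j)"
        unfolding R2_def by (rule norm_triangle_ineq)
      also have "\<dots> \<le> kk * norm (x i) + fnorm n D * fnorm n D * norm (x i)"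
        unfolding kk_def by (intro add_mono norm_sum_inner_scaleR_le norm_matrix_vector_le)
      also have "\<dots> \<le> k * norm (x i) + b * b * norm (x i)"
        using kb db b0 unfolding d_def by (intro add_mono mult_right_mono mult_mono) auto
      finally show "norm (R2 i) \<le> (k + b * b) * norm (x i)" by (simp add: algebra_simps)
    qed
    also have "\<dots> \<le> (k + b * b) * rs" using xrs k0 by (intro mult_left_mono) auto
    finally show ?thesis by (simp add: power2_eq_square mult_ac)
  qed
  define V where "V = (\<lambda>i. ED i - (R1 i + R2 i))"
  have "fnorm n V \<le> fnorm n ED + (fnorm n R1 + fnorm n R2)"
    unfolding V_def using fnorm_triangle_diff[of n ED "\<lambda>i. R1 i + R2 i"] fnorm_triangle[of n R1 R2] by linarith
  also have "\<dots> \<le> \<epsilon> * s * b + (rs * (2 * b\<^sup>2 + b ^ 3) + rs * (k + b\<^sup>2))"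
    using eps s db by (intro add_mono R1b R2b order.trans[OF EDb] mult_left_mono) auto
  also have "\<dots> = s * (\<epsilon> * b + (3 * b\<^sup>2 + b ^ 3 + k) / rs)"
    using rs by (simp add: rs(2)[symmetric] field_simps power2_eq_square)
  finally have Vb: "fnorm n V \<le> s * (\<epsilon> * b + (3 * b\<^sup>2 + b ^ 3 + k) / rs)" .
  have "fnorm n (\<lambda>i. D i - m i) \<le> (1 / (l * s)) * fnorm n V"
  proof (rule fnorm_le_mult)
    fix i assume "i < n"
    from Sinv[of "D i - m i"] eq[OF this] have "l * s * norm (D i - m i) \<le> norm (V i)" by (simp add: V_def)
    then show "norm (D i - m i) \<le> 1 / (l * s) * norm (V i)" using l s by (simp add: field_simps)
  qed (use l s in auto)
  also have "\<dots> \<le> (1 / (l * s)) * (s * (\<epsilon> * b + (3 * b\<^sup>2 + b ^ 3 + k) / rs))"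
    using Vb l s by (intro mult_left_mono) auto
  also have "\<dots> = (\<epsilon> * b + (3 * b\<^sup>2 + b ^ 3 + k) / rs) / l" using l s by simp
  finally show "fnorm n (\<lambda>i. D i - m i) \<le> (\<epsilon> * b + (3 * b\<^sup>2 + b ^ 3 + k) / sqrt s) / l"
    by (simp add: rs_def)
qed

subsection \<open>Optimal rotations\<close>

lemma inner_orthogonal_matrix:
  fixes x y :: "real^'d"
  assumes "orthogonal_matrix W"
  shows "(x v* W) \<bullet> (y v* W) = x \<bullet> y"
proof -
  have "(x v* W) \<bullet> (y v* W) = x \<bullet> (W *v (transpose W *v y))"
    by (simp add: dot_lmul_matrix)
  also have "\<dots> = x \<bullet> ((W ** transpose W) *v y)" by (simp only: matrix_vector_mul_assoc)
  also have "\<dots> = x \<bullet> y" using assms by (simp add: orthogonal_matrix_def)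
  finally show ?thesis .
qed

lemma compact_orthogonal_matrices: "compact {W :: real^'d^'d. orthogonal_matrix W}"
  unfolding compact_eq_bounded_closed
proof
  have "norm W \<le> real CARD('d)" if "orthogonal_matrix W" for W :: "real^'d^'d"
  proof -
    have "norm (W $ i) = 1" for i
      using that orthogonal_matrix_orthonormal_rows[of W] by (auto simp: row_def)
    moreover have "norm W \<le> (\<Sum>i\<in>UNIV. norm (W $ i))" unfolding norm_vec_def by (rule L2_set_le_sum) auto
    ultimately show ?thesis by simp
  qed
  then show "bounded {W :: real^'d^'d. orthogonal_matrix W}" by (auto simp: bounded_iff)
  have "closed {W :: real^'d^'d. transpose W ** W = mat 1}"
    by (intro closed_Collect_eq continuous_intros) (auto simp: transpose_def matrix_matrix_mult_def intro!: continuous_intros)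
  then show "closed {W :: real^'d^'d. orthogonal_matrix W}" by (simp add: orthogonal_matrix)
qed

definition reflection :: "real^'d \<Rightarrow> real^'d \<Rightarrow> real^'d" where
  "reflection u z = z - (2 * (u \<bullet> z) / (u \<bullet> u)) *\<^sub>R u"

lemma reflection_matrix:
  fixes u :: "real^'d"
  assumes "u \<noteq> 0"
  obtains Q :: "real^'d^'d" where "orthogonal_matrix Q" "\<And>z. z v* Q = reflection u z"
proof -
  have lin: "linear (reflection u)"
    by (intro linearI) (auto simp: reflection_def inner_add_right algebra_simps add_divide_distrib)
  have "reflection u v \<bullet> reflection u w = v \<bullet> w" for v w
    using assms by (simp add: reflection_def inner_diff_left inner_diff_right inner_commute field_simps)
  then have "orthogonal_transformation (reflection u)"
    using lin by (simp add: orthogonal_transformation_def)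
  then have "orthogonal_matrix (matrix (reflection u))" by (simp add: orthogonal_transformation_matrix)
  then have "orthogonal_matrix (transpose (matrix (reflection u)))" by (simp add: orthogonal_matrix_transpose)
  then show thesis by (rule that) (simp add: matrix_works lin)
qed

text \<open>Comparing the best rotation with its products with one or two reflections shows that it makes
  \<open>X\<^sup>T Y W\<close> positive semidefinite and symmetric, as the polar decomposition would.\<close>
lemma procrustes:
  fixes x y :: "nat \<Rightarrow> real^'d"
  obtains W :: "real^'d^'d" where "orthogonal_matrix W"
    and "\<And>u v. (\<Sum>i<n. (x i \<bullet> u) * ((y i v* W) \<bullet> v)) = (\<Sum>i<n. (x i \<bullet> v) * ((y i v* W) \<bullet> u))"
    and "\<And>v. 0 \<le> (\<Sum>i<n. (x i \<bullet> v) * ((y i v* W) \<bullet> v))"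
proof -
  define f where "f = (\<lambda>W :: real^'d^'d. \<Sum>i<n. x i \<bullet> (y i v* W))"
  have cont: "continuous_on {W. orthogonal_matrix W} f"
    unfolding f_def vector_matrix_mult_def inner_vec_def by (intro continuous_intros)
  obtain W where W: "orthogonal_matrix W" and max: "\<And>V. orthogonal_matrix V \<Longrightarrow> f V \<le> f W"
    using continuous_attains_sup[OF compact_orthogonal_matrices _ cont] orthogonal_matrix_id by blast
  define z where "z = (\<lambda>i. y i v* W)"
  define h where "h = (\<lambda>u v. \<Sum>i<n. (x i \<bullet> u) * (z i \<bullet> v))"
  have maxQ: "(\<Sum>i<n. x i \<bullet> (z i v* Q)) \<le> (\<Sum>i<n. x i \<bullet> z i)" if "orthogonal_matrix Q" for Q
    using max[OF orthogonal_matrix_mul[OF W that]] by (simp add: f_def z_def vector_matrix_mul_assoc)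
  have refl1: "(\<Sum>i<n. x i \<bullet> reflection u (z i)) = (\<Sum>i<n. x i \<bullet> z i) - 2 / (u \<bullet> u) * h u u" for u
    by (simp add: reflection_def h_def inner_diff_right sum_subtractf sum_distrib_left inner_commute mult_ac)
  have psd: "0 \<le> h u u" for u
  proof (cases "u = 0")
    case False
    obtain Q where "orthogonal_matrix Q" "\<And>z. z v* Q = reflection u z" using reflection_matrix[OF False] by blast
    then have "0 \<le> 2 / (u \<bullet> u) * h u u" using maxQ[of Q] refl1[of u] by simp
    moreover have "0 < 2 / (u \<bullet> u)" using False by simp
    ultimately show ?thesis by (meson mult_pos_neg not_le)
  qed (simp add: h_def)
  \<comment> \<open>Two reflections compose to a rotation in the plane of u and v, which probes the
    mixed value \<open>h v u\<close>; single reflections see only the diagonal values of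
    \<open>h\<close>.\<close>
  have two: "2 * (u \<bullet> v) * h v u \<le> (v \<bullet> v) * h u u + (u \<bullet> u) * h v v" for u v
  proof (cases "u = 0 \<or> v = 0")
    case False
    obtain Q where Q: "orthogonal_matrix Q" "\<And>z. z v* Q = reflection u z" using False reflection_matrix[of u] by blast
    obtain R where R: "orthogonal_matrix R" "\<And>z. z v* R = reflection v z" using False reflection_matrix[of v] by blast
    have pos: "0 < u \<bullet> u" "0 < v \<bullet> v" using False by auto
    have "(\<Sum>i<n. x i \<bullet> reflection v (reflection u (z i))) \<le> (\<Sum>i<n. x i \<bullet> z i)"
      using maxQ[OF orthogonal_matrix_mul[OF Q(1) R(1)]] by (simp add: Q(2) R(2) flip: vector_matrix_mul_assoc)
    also have "(\<Sum>i<n. x i \<bullet> reflection v (reflection u (z i)))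
      = (\<Sum>i<n. x i \<bullet> z i - 2 / (u \<bullet> u) * ((x i \<bullet> u) * (z i \<bullet> u)) - 2 / (v \<bullet> v) * ((x i \<bullet> v) * (z i \<bullet> v))
          + 4 * (u \<bullet> v) / ((u \<bullet> u) * (v \<bullet> v)) * ((x i \<bullet> v) * (z i \<bullet> u)))"
      using pos by (intro sum.cong refl) (simp add: reflection_def inner_diff_right inner_commute, simp add: field_simps)
    also have "\<dots> = (\<Sum>i<n. x i \<bullet> z i) - 2 / (u \<bullet> u) * h u u - 2 / (v \<bullet> v) * h v v + 4 * (u \<bullet> v) / ((u \<bullet> u) * (v \<bullet> v)) * h v u"
      by (simp only: sum.distrib sum_subtractf h_def sum_distrib_left)
    finally have "4 * (u \<bullet> v) / ((u \<bullet> u) * (v \<bullet> v)) * h v u \<le> 2 / (u \<bullet> u) * h u u + 2 / (v \<bullet> v) * h v v" by simp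
    then show ?thesis using pos by (simp add: field_simps)
  qed (auto simp: h_def)
  have h_lin: "h (u + t *\<^sub>R v) w = h u w + t * h v w" "h w (u + t *\<^sub>R v) = h w u + t * h w v" for u v w t
    by (simp_all add: h_def inner_add_right distrib_left distrib_right sum.distrib sum_distrib_left mult_ac)
  have sym: "h a b = h b a" for a b
  proof (cases "a = 0")
    case False
    \<comment> \<open>Placing the second mirror at \<open>a + t *\<^sub>R b\<close> makes the gap in
      \<open>two\<close> vanish at t = 0. Its derivative there is \<open>c1\<close>, a multiple of
      the antisymmetric part of \<open>h\<close>, and must be zero because the gap is nonnegative on
      both sides.\<close>
    define c1 where "c1 = (a \<bullet> a) * (h a b - h b a)"
    define c2 where "c2 = (b \<bullet> b) * h a a + (a \<bullet> a) * h b b - 2 * (a \<bullet> b) * h b a"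
    have poly: "0 \<le> t * c1 + t\<^sup>2 * c2" for t
      using two[of a "a + t *\<^sub>R b"]
      by (simp add: h_lin c1_def c2_def inner_add_left inner_add_right inner_commute power2_eq_square algebra_simps)
    have "c1 = 0"
    proof (rule DERIV_local_min[of "\<lambda>t. t * c1 + t\<^sup>2 * c2" c1 0 1])
      show "((\<lambda>t. t * c1 + t\<^sup>2 * c2) has_real_derivative c1) (at 0)"
        by (auto intro!: derivative_eq_intros)
    qed (use poly in auto)
    then show ?thesis using False by (simp add: c1_def)
  qed (simp add: h_def)
  show thesis
    using that[OF W] psd sym unfolding h_def z_def by blast
qed

subsection \<open>Optimality conditions for the spectral embedding\<close>

lemma ase_optimality:
  fixes X Y :: "nat \<Rightarrow> real^'d"
  assumes ase: "is_ase n a X" and W: "orthogonal_matrix W"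
  shows "(\<Sum>i<n. \<Sum>j<n. (a i j - (X i v* W) \<bullet> (X j v* W))\<^sup>2) \<le> (\<Sum>i<n. \<Sum>j<n. (a i j - Y i \<bullet> Y j)\<^sup>2)"
  using ase unfolding is_ase_def is_arg_min_linorder by (simp add: inner_orthogonal_matrix[OF W])

text \<open>Only row l is varied, in the direction of its own residual w. The derivative of the
  objective is then - 4 |w|^2, where the row and the column of the symmetric matrix each count once,
  and it vanishes at a minimum.\<close>

lemma ase_stationarity:
  fixes X :: "nat \<Rightarrow> real^'d"
  assumes ase: "is_ase n a X" and W: "orthogonal_matrix W"
    and a_sym: "\<And>i j. a i j = a j i" and l: "l < n"
  shows "(\<Sum>j<n. (a l j - (X l v* W) \<bullet> (X j v* W)) *\<^sub>R (X j v* W)) = 0"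
proof -
  define z where "z = (\<lambda>i. X i v* W)"
  define r where "r = (\<lambda>i j. a i j - z i \<bullet> z j)"
  define w where "w = (\<Sum>j<n. r l j *\<^sub>R z j)"
  define V where "V = (\<lambda>i. if i = l then w else 0)"
  define f where "f = (\<lambda>t. \<Sum>i<n. \<Sum>j<n. (a i j - (z i + t *\<^sub>R V i) \<bullet> (z j + t *\<^sub>R V j))\<^sup>2)"
  have r_sym: "r i j = r j i" for i j using a_sym[of i j] by (simp add: r_def inner_commute)
  define D where "D = (\<Sum>i<n. \<Sum>j<n. 2 * r i j * (- (z i \<bullet> V j + V i \<bullet> z j)))"
  have deriv: "(f has_real_derivative D) (at 0)"
    unfolding f_def D_def r_def inner_add_left inner_add_right inner_scaleR_left inner_scaleR_right
    by (auto intro!: derivative_eq_intros sum.cong simp: algebra_simps)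
  have min: "f 0 \<le> f t" for t
    using ase_optimality[OF ase W, of "\<lambda>i. z i + t *\<^sub>R V i"] by (simp add: f_def z_def)
  have "D = 0" by (rule DERIV_local_min[OF deriv, of 1]) (use min in auto)
  moreover have "D = - 4 * (norm w)\<^sup>2"
  proof -
    have "D = - 2 * (\<Sum>i<n. \<Sum>j<n. r i j * (z i \<bullet> V j)) - 2 * (\<Sum>i<n. \<Sum>j<n. r i j * (V i \<bullet> z j))"
      by (simp add: D_def sum.distrib sum_subtractf sum_distrib_left sum_negf algebra_simps)
    also have "(\<Sum>i<n. \<Sum>j<n. r i j * (z i \<bullet> V j)) = (\<Sum>i<n. \<Sum>j<n. r i j * (V i \<bullet> z j))"
      by (subst sum.swap) (simp add: r_sym inner_commute)
    also have "(\<Sum>i<n. \<Sum>j<n. r i j * (V i \<bullet> z j)) = (\<Sum>i<n. if i = l then \<Sum>j<n. r i j * (w \<bullet> z j) else 0)"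
      by (rule sum.cong[OF refl]) (auto simp: V_def)
    also have "\<dots> = (\<Sum>j<n. r l j * (w \<bullet> z j))" using l by simp
    also have "\<dots> = (norm w)\<^sup>2"
      unfolding power2_norm_eq_inner by (subst (3) w_def) (simp add: inner_sum_right)
    finally show ?thesis by simp
  qed
  ultimately have "w = 0" by simp
  then show ?thesis by (simp add: w_def r_def z_def)
qed

subsection \<open>The one-step weights\<close>

text \<open>The reciprocal Bernoulli variance at edge probability r s with the factor 1 / r removed,
  so that it stays bounded as r tends to 0.\<close>

definition phi :: "real \<Rightarrow> real \<Rightarrow> real" where
  "phi r s = 1 / (s * (1 - r * s))"

text \<open>The derivative of \<open>phi r\<close>, read off from the partial fractions 1 / s + r /
  (1 - r s).\<close>

definition dphi :: "real \<Rightarrow> real \<Rightarrow> real" where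
  "dphi r s = r\<^sup>2 / (1 - r * s)\<^sup>2 - 1 / s\<^sup>2"

text \<open>This separates the two poles in s, so that the following bounds can be proved for each
  pole alone.\<close>

lemma phi_partial_fractions:
  assumes "s \<noteq> 0" "1 - r * s \<noteq> 0"
  shows "phi r s = 1 / s + r / (1 - r * s)"
  using assms by (simp add: phi_def field_simps)

text \<open>It makes every weighted Gram matrix dominate the unweighted one, so that one eigenvalue
  bound serves for all information matrices.\<close>

lemma phi_ge_1:
  assumes "0 < s" "s < 1" "0 \<le> r" "r \<le> 1"
  shows "1 \<le> phi r s"
proof -
  have "r * s < 1" using assms mult_left_le_one_le[of s r] by linarith
  moreover have "s * (1 - r * s) \<le> 1 * 1" using assms calculation by (intro mult_mono) auto
  ultimately show ?thesis using assms by (simp add: phi_def divide_simps)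
qed

lemma one_minus_mult_ge:
  fixes r s e :: real
  assumes "e \<le> s" "s \<le> 1 - e" "0 \<le> r" "r \<le> 1" "0 < e"
  shows "e \<le> 1 - r * s"
  using mult_right_mono[of r 1 s] assms by linarith

context
  fixes e r s s0 :: real
  assumes e: "0 < e" and r: "0 \<le> r" "r \<le> 1"
    and s: "e \<le> s" "s \<le> 1 - e" and s0: "e \<le> s0" "s0 \<le> 1 - e"
begin

lemma phi_aux:
  "0 < s" "0 < s0" "e \<le> 1 - r * s" "e \<le> 1 - r * s0" "0 < 1 - r * s" "0 < 1 - r * s0"
  using s s0 e one_minus_mult_ge[OF s r e] one_minus_mult_ge[OF s0 r e] by auto

lemma abs_phi_le: "\<bar>phi r s0\<bar> \<le> 2 / e"
proof -
  have "1 / s0 \<le> 1 / e" "r / (1 - r * s0) \<le> 1 / e"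
    using s0 e r phi_aux by (auto intro!: frac_le)
  moreover have "0 \<le> 1 / s0" using phi_aux(2) by simp
  moreover have "0 \<le> r / (1 - r * s0)" using r(1) phi_aux(6) by (rule divide_nonneg_pos)
  moreover have "phi r s0 = 1 / s0 + r / (1 - r * s0)" using phi_aux(2,6) by (intro phi_partial_fractions) auto
  moreover have "2 / e = 1 / e + 1 / e" by simp
  ultimately show ?thesis by (simp only: abs_of_nonneg add_nonneg_nonneg add_mono)
qed

lemma abs_dphi_le: "\<bar>dphi r s0\<bar> \<le> 1 / e\<^sup>2"
proof -
  have "1 / s0\<^sup>2 \<le> 1 / e\<^sup>2" "r\<^sup>2 / (1 - r * s0)\<^sup>2 \<le> 1 / e\<^sup>2"
    using s0 e r phi_aux by (auto intro!: frac_le power_mono simp: power_le_one)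
  moreover have "0 \<le> 1 / s0\<^sup>2" "0 \<le> r\<^sup>2 / (1 - r * s0)\<^sup>2" by auto
  moreover have "\<bar>A - C\<bar> \<le> E" if "C \<le> E" "A \<le> E" "0 \<le> C" "0 \<le> A" for A C E :: real
    using that by linarith
  ultimately show ?thesis unfolding dphi_def by blast
qed

lemma phi_lipschitz: "\<bar>phi r s - phi r s0\<bar> \<le> 2 / e\<^sup>2 * \<bar>s - s0\<bar>"
proof -
  have eq: "phi r s - phi r s0 = (r\<^sup>2 / ((1 - r * s) * (1 - r * s0)) - 1 / (s * s0)) * (s - s0)"
  proof -
    have "1 / s - 1 / s0 = - (1 / (s * s0)) * (s - s0)" using phi_aux(1,2) by (simp add: field_simps)
    moreover have "r / (1 - r * s) - r / (1 - r * s0) = r\<^sup>2 / ((1 - r * s) * (1 - r * s0)) * (s - s0)"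
    proof -
      define A where "A = 1 - r * s" define C where "C = 1 - r * s0"
      have "A \<noteq> 0" "C \<noteq> 0" using phi_aux by (auto simp: A_def C_def)
      then have "r / A - r / C = r * (C - A) / (A * C)" by (simp add: field_simps)
      also have "C - A = r * (s - s0)" by (simp add: A_def C_def algebra_simps)
      finally show ?thesis by (simp add: A_def C_def power2_eq_square)
    qed
    ultimately show ?thesis
      using phi_aux by (simp add: phi_partial_fractions algebra_simps)
  qed
  have "1 / (s * s0) \<le> 1 / e\<^sup>2" "r\<^sup>2 / ((1 - r * s) * (1 - r * s0)) \<le> 1 / e\<^sup>2"
    using s s0 e r phi_aux by (auto intro!: frac_le mult_mono simp: power_le_one power2_eq_square[of e])
  moreover have "0 \<le> 1 / (s * s0)" "0 \<le> r\<^sup>2 / ((1 - r * s) * (1 - r * s0))" using phi_aux by auto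
  moreover have "2 / e\<^sup>2 = 1 / e\<^sup>2 + 1 / e\<^sup>2" by simp
  moreover have "\<bar>A - C\<bar> \<le> E + E" if "C \<le> E" "A \<le> E" "0 \<le> C" "0 \<le> A" for A C E :: real
    using that by linarith
  ultimately have "\<bar>r\<^sup>2 / ((1 - r * s) * (1 - r * s0)) - 1 / (s * s0)\<bar> \<le> 2 / e\<^sup>2" by metis
  then show ?thesis unfolding eq abs_mult by (intro mult_right_mono) auto
qed

text \<open>For a simple pole the first-order Taylor remainder is exactly a rational coefficient
  times (s - s0)^2. Each of the two coefficients is at most 1 / e^3 on the given range.\<close>

lemma phi_taylor: "\<bar>phi r s - phi r s0 - dphi r s0 * (s - s0)\<bar> \<le> 2 / e ^ 3 * (s - s0)\<^sup>2"
proof -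
  define c where "c = 1 / (s * s0\<^sup>2) + r ^ 3 / ((1 - r * s) * (1 - r * s0)\<^sup>2)"
  have eq: "phi r s - phi r s0 - dphi r s0 * (s - s0) = c * (s - s0)\<^sup>2"
  proof -
    have "1 / s - 1 / s0 + 1 / s0\<^sup>2 * (s - s0) = 1 / (s * s0\<^sup>2) * (s - s0)\<^sup>2"
      using phi_aux(1,2) by (simp add: field_simps power2_eq_square)
    moreover have "r / (1 - r * s) - r / (1 - r * s0) - r\<^sup>2 / (1 - r * s0)\<^sup>2 * (s - s0)
       = r ^ 3 / ((1 - r * s) * (1 - r * s0)\<^sup>2) * (s - s0)\<^sup>2"
    proof -
      define A where "A = 1 - r * s" define C where "C = 1 - r * s0"
      have nz: "A \<noteq> 0" "C \<noteq> 0" using phi_aux by (auto simp: A_def C_def)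
      have h: "r * (s - s0) = C - A" by (simp add: A_def C_def algebra_simps)
      have "r / A - r / C - r\<^sup>2 / C\<^sup>2 * (s - s0) = r / A - r / C - r / C\<^sup>2 * (r * (s - s0))"
        by (simp add: power2_eq_square)
      also have "\<dots> = r / (A * C\<^sup>2) * (r * (s - s0))\<^sup>2"
        unfolding h using nz by (simp add: field_simps power2_eq_square)
      also have "\<dots> = r ^ 3 / (A * C\<^sup>2) * (s - s0)\<^sup>2" by (simp add: power2_eq_square power3_eq_cube)
      finally show ?thesis by (simp add: A_def C_def)
    qed
    ultimately show ?thesis
      using phi_aux by (simp add: phi_partial_fractions dphi_def c_def algebra_simps)
  qed
  have e3: "e * e\<^sup>2 = e ^ 3" by (simp add: power2_eq_square power3_eq_cube)
  have "e * e\<^sup>2 \<le> s * s0\<^sup>2" using s s0 e by (intro mult_mono power_mono) auto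
  then have 1: "1 / (s * s0\<^sup>2) \<le> 1 / e ^ 3" unfolding e3 using e phi_aux(1,2) by (intro divide_left_mono) auto
  have "e * e\<^sup>2 \<le> (1 - r * s) * (1 - r * s0)\<^sup>2" using phi_aux e by (intro mult_mono power_mono) auto
  then have 2: "r ^ 3 / ((1 - r * s) * (1 - r * s0)\<^sup>2) \<le> 1 / e ^ 3"
    unfolding e3 using e r by (intro frac_le) (auto simp: power_le_one)
  have 3: "0 \<le> 1 / (s * s0\<^sup>2)" "0 \<le> r ^ 3 / ((1 - r * s) * (1 - r * s0)\<^sup>2)"
    using phi_aux r by (auto intro!: divide_nonneg_pos mult_pos_pos less_imp_le)
  have "\<bar>A + C\<bar> \<le> 2 * E" if "A \<le> E" "C \<le> E" "0 \<le> C" "0 \<le> A" for A C E :: real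
    using that by linarith
  from this[OF 1 2 3(2,1)] have "\<bar>c\<bar> \<le> 2 / e ^ 3" unfolding c_def by simp
  then show ?thesis unfolding eq abs_mult using e by (intro mult_mono) auto
qed

end

subsection \<open>The estimating equation of the one-step estimator\<close>

lemma invertible_matrix_inv:
  assumes "invertible A"
  shows "A ** matrix_inv A = mat 1" "matrix_inv A ** A = mat 1"
  using someI_ex[OF assms[unfolded invertible_def]] unfolding matrix_inv_def by auto

lemma transpose_orthogonal_inner:
  fixes W :: "real^'d^'d"
  assumes "orthogonal_matrix W"
  shows "(transpose W *v u) \<bullet> (transpose W *v v) = u \<bullet> v"
  using inner_orthogonal_matrix[OF assms, of u v] by simp

text \<open>The definition is multiplied by the information matrix and written in the coordinates y
  = W^T Xt / sqrt r, where the weights become \<open>phi r (y i \<bullet> y j)\<close>. Adding the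
  initial error of row i to both sides removes y_i from the residual: a_ij - r y_i.y_j + r y_j.(y_i
  - x_i) = (a_ij - r x_i.x_j) - r x_i.(y_j - x_j). Apart from the weights, only the initial errors
  of the other rows remain.\<close>

lemma one_step_equation:
  fixes Xt Xh x y :: "nat \<Rightarrow> real^'d" and r :: real
  defines "t \<equiv> \<lambda>W i. transpose W *v Xh i - sqrt r *\<^sub>R x i"
  assumes os: "is_one_step n a Xt Xh" and W: "orthogonal_matrix W"
    and y: "\<And>i. i < n \<Longrightarrow> transpose W *v Xt i = sqrt r *\<^sub>R y i"
    and s: "\<And>i j. i < n \<Longrightarrow> j < n \<Longrightarrow> 0 < y i \<bullet> y j \<and> y i \<bullet> y j < 1"
    and r: "0 < r" "r \<le> 1"
    and pd: "\<And>v. v \<noteq> 0 \<Longrightarrow> 0 < (\<Sum>j<n. (y j \<bullet> v)\<^sup>2)"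
    and i: "i < n"
  shows "(\<Sum>j<n. phi r (y i \<bullet> y j) *\<^sub>R (y j \<bullet> t W i) *\<^sub>R y j)
    = (\<Sum>j<n. (((a i j - r * (x i \<bullet> x j)) / sqrt r - sqrt r * (x i \<bullet> (y j - x j))) * phi r (y i \<bullet> y j)) *\<^sub>R y j)"
proof -
  have n: "0 < real n" using i by simp
  have Xin: "Xt j \<bullet> v = sqrt r * (y j \<bullet> (transpose W *v v))" if "j < n" for j v
    using transpose_orthogonal_inner[OF W, of "Xt j" v, symmetric] unfolding y[OF that] by simp
  have XX: "Xt i \<bullet> Xt j = r * (y i \<bullet> y j)" if "i < n" "j < n" for i j
    using r unfolding Xin[OF that(1)] y[OF that(2)] by simp
  have wgt: "one_step_weight Xt i j = r / phi r (y i \<bullet> y j)" if "i < n" "j < n" for i j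
    by (simp add: one_step_weight_def XX that phi_def)
  have ph: "0 < phi r (y i \<bullet> y j)" if "i < n" "j < n" for i j
    using phi_ge_1[of "y i \<bullet> y j" r] s[OF that] r by simp
  have info: "one_step_info n Xt i *v v = (1 / real n) *\<^sub>R (\<Sum>j<n. (phi r (y i \<bullet> y j) / r * (Xt j \<bullet> v)) *\<^sub>R Xt j)" if "i < n" for i v
    unfolding one_step_info_def scaleR_matrix_vector sum_matrix_vector outer_dyad dyad_mult_vec
    using that by (simp add: wgt)
  \<comment> \<open>\<open>is_one_step\<close> constrains the estimator only if all rows are
    nondegenerate, so invertibility is shown for every row. A kernel vector would make the weighted
    Gram form vanish, although the weights are at least 1.\<close>
  have inv: "invertible (one_step_info n Xt i)" if i: "i < n" for i
  proof -
    have "v = 0" if "one_step_info n Xt i *v v = 0" for v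
    proof (rule ccontr)
      assume v: "v \<noteq> 0"
      have "0 = v \<bullet> (one_step_info n Xt i *v v)" using that by simp
      also have "\<dots> = (1 / real n) * (\<Sum>j<n. phi r (y i \<bullet> y j) / r * (Xt j \<bullet> v)\<^sup>2)"
        unfolding info[OF i] by (simp add: inner_sum_right power2_eq_square inner_commute mult_ac)
      also have "\<dots> = (1 / real n) * (\<Sum>j<n. phi r (y i \<bullet> y j) * (y j \<bullet> (transpose W *v v))\<^sup>2)"
        using r by (intro arg_cong[where f="\<lambda>v. (1 / real n) * v"] sum.cong) (simp_all add: Xin power_mult_distrib)
      also have "\<dots> \<ge> (1 / real n) * (\<Sum>j<n. 1 * (y j \<bullet> (transpose W *v v))\<^sup>2)"
        using s i r by (intro mult_left_mono sum_mono mult_right_mono phi_ge_1) auto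
      finally have "(\<Sum>j<n. (y j \<bullet> (transpose W *v v))\<^sup>2) \<le> 0" using n by (simp add: divide_le_0_iff)
      moreover have "transpose W *v v \<noteq> 0"
        using transpose_orthogonal_inner[OF W, of v v] v by auto
      ultimately show False using pd[of "transpose W *v v"] by simp
    qed
    then show ?thesis
      unfolding invertible_left_inverse matrix_left_invertible_ker by blast
  qed
  have "one_step_weight Xt i j \<noteq> 0" if "i < n" "j < n" for i j
    using ph[OF that] r unfolding wgt[OF that] by simp
  then have "Xh i = Xt i + matrix_inv (one_step_info n Xt i) *v one_step_score n a Xt i"
    using os inv i unfolding is_one_step_def by blast
  then have "one_step_info n Xt i *v (Xh i - Xt i) = (one_step_info n Xt i ** matrix_inv (one_step_info n Xt i)) *v one_step_score n a Xt i"
    by (simp add: matrix_vector_mul_assoc)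
  also have "\<dots> = one_step_score n a Xt i" by (simp only: invertible_matrix_inv(1)[OF inv[OF i]] matrix_vector_mul_lid)
  finally have eq: "one_step_info n Xt i *v (Xh i - Xt i) = one_step_score n a Xt i" .
  define u where "u = transpose W *v (Xh i - Xt i)"
  have u: "u = t W i - sqrt r *\<^sub>R (y i - x i)"
    by (simp only: u_def t_def matrix_vector_mult_diff_distrib y[OF i]) (simp add: scaleR_diff_right)
  have linW: "linear ((*v) (transpose W))" by (rule matrix_vector_mul_linear)
  have "transpose W *v (one_step_info n Xt i *v (Xh i - Xt i)) = (1 / real n) *\<^sub>R (\<Sum>j<n. (phi r (y i \<bullet> y j) * (y j \<bullet> u)) *\<^sub>R y j)"
  proof -
    have "transpose W *v (one_step_info n Xt i *v (Xh i - Xt i))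
      = (1 / real n) *\<^sub>R (\<Sum>j<n. (phi r (y i \<bullet> y j) / r * (Xt j \<bullet> (Xh i - Xt i))) *\<^sub>R (transpose W *v Xt j))"
      unfolding info[OF i] by (simp only: linear_scale[OF linW] linear_sum[OF linW])
    also have "\<dots> = (1 / real n) *\<^sub>R (\<Sum>j<n. (phi r (y i \<bullet> y j) * (y j \<bullet> u)) *\<^sub>R y j)"
    proof (rule arg_cong[where f="\<lambda>v. (1 / real n) *\<^sub>R v"], rule sum.cong[OF refl])
      fix j assume "j \<in> {..<n}"
      then have j: "j < n" by simp
      have "phi r (y i \<bullet> y j) / r * (sqrt r * (y j \<bullet> u)) * sqrt r = phi r (y i \<bullet> y j) * (y j \<bullet> u) * ((sqrt r * sqrt r) / r)"
        by simp
      also have "\<dots> = phi r (y i \<bullet> y j) * (y j \<bullet> u)" using r by simp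
      finally show "(phi r (y i \<bullet> y j) / r * (Xt j \<bullet> (Xh i - Xt i))) *\<^sub>R (transpose W *v Xt j) = (phi r (y i \<bullet> y j) * (y j \<bullet> u)) *\<^sub>R y j"
        unfolding Xin[OF j] y[OF j] u_def[symmetric] by simp
    qed
    finally show ?thesis .
  qed
  moreover have "transpose W *v one_step_score n a Xt i
     = (1 / real n) *\<^sub>R (\<Sum>j<n. ((a i j - r * (y i \<bullet> y j)) / sqrt r * phi r (y i \<bullet> y j)) *\<^sub>R y j)"
  proof -
    have "transpose W *v one_step_score n a Xt i
      = (1 / real n) *\<^sub>R (\<Sum>j<n. ((a i j - Xt i \<bullet> Xt j) / one_step_weight Xt i j) *\<^sub>R (transpose W *v Xt j))"
      unfolding one_step_score_def by (simp only: linear_scale[OF linW] linear_sum[OF linW])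
    also have "\<dots> = (1 / real n) *\<^sub>R (\<Sum>j<n. ((a i j - r * (y i \<bullet> y j)) / sqrt r * phi r (y i \<bullet> y j)) *\<^sub>R y j)"
    proof (rule arg_cong[where f="\<lambda>v. (1 / real n) *\<^sub>R v"], rule sum.cong[OF refl])
      fix j assume "j \<in> {..<n}"
      then have j: "j < n" by simp
      have "(a i j - Xt i \<bullet> Xt j) / one_step_weight Xt i j * sqrt r = (a i j - r * (y i \<bullet> y j)) / sqrt r * phi r (y i \<bullet> y j)"
      proof -
        have "(a i j - r * (y i \<bullet> y j)) / (r / phi r (y i \<bullet> y j)) * sqrt r = (a i j - r * (y i \<bullet> y j)) * phi r (y i \<bullet> y j) * (sqrt r / r)"
          by simp
        also have "sqrt r / r = 1 / sqrt r" using r by (simp add: sqrt_divide_self_eq inverse_eq_divide)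
        finally show ?thesis unfolding wgt[OF i j] XX[OF i j] by simp
      qed
      then show "((a i j - Xt i \<bullet> Xt j) / one_step_weight Xt i j) *\<^sub>R (transpose W *v Xt j) = ((a i j - r * (y i \<bullet> y j)) / sqrt r * phi r (y i \<bullet> y j)) *\<^sub>R y j"
        unfolding y[OF j] by simp
    qed
    finally show ?thesis .
  qed
  ultimately have "(\<Sum>j<n. (phi r (y i \<bullet> y j) * (y j \<bullet> u)) *\<^sub>R y j) = (\<Sum>j<n. ((a i j - r * (y i \<bullet> y j)) / sqrt r * phi r (y i \<bullet> y j)) *\<^sub>R y j)"
    using eq n by simp
  moreover have "(\<Sum>j<n. phi r (y i \<bullet> y j) *\<^sub>R (y j \<bullet> t W i) *\<^sub>R y j)
    = (\<Sum>j<n. (phi r (y i \<bullet> y j) * (y j \<bullet> u)) *\<^sub>R y j) + (\<Sum>j<n. (sqrt r * (y j \<bullet> (y i - x i)) * phi r (y i \<bullet> y j)) *\<^sub>R y j)"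
    unfolding sum.distrib[symmetric] u
    by (intro sum.cong refl) (simp add: inner_diff_right algebra_simps)
  ultimately have "(\<Sum>j<n. phi r (y i \<bullet> y j) *\<^sub>R (y j \<bullet> t W i) *\<^sub>R y j)
    = (\<Sum>j<n. ((a i j - r * (y i \<bullet> y j)) / sqrt r * phi r (y i \<bullet> y j)) *\<^sub>R y j)
      + (\<Sum>j<n. (sqrt r * (y j \<bullet> (y i - x i)) * phi r (y i \<bullet> y j)) *\<^sub>R y j)" by simp
  also have "\<dots> = (\<Sum>j<n. (((a i j - r * (x i \<bullet> x j)) / sqrt r - sqrt r * (x i \<bullet> (y j - x j))) * phi r (y i \<bullet> y j)) *\<^sub>R y j)"
    unfolding sum.distrib[symmetric] scaleR_add_left[symmetric] distrib_right[symmetric]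
  proof (rule sum.cong[OF refl], rule arg_cong[where f="\<lambda>v. (v * _) *\<^sub>R _"])
    fix j
    have sq: "r / sqrt r = sqrt r" using r by (simp add: real_div_sqrt)
    have "(a i j - r * (y i \<bullet> y j)) / sqrt r + sqrt r * (y j \<bullet> (y i - x i))
      = a i j / sqrt r - (r / sqrt r) * (y i \<bullet> y j) + sqrt r * (y j \<bullet> (y i - x i))" by (simp add: diff_divide_distrib)
    also have "\<dots> = a i j / sqrt r - (r / sqrt r) * (x i \<bullet> x j) - sqrt r * (x i \<bullet> (y j - x j))"
      unfolding sq by (simp add: inner_diff_right inner_commute algebra_simps)
    finally show "(a i j - r * (y i \<bullet> y j)) / sqrt r + sqrt r * (y j \<bullet> (y i - x i))
      = (a i j - r * (x i \<bullet> x j)) / sqrt r - sqrt r * (x i \<bullet> (y j - x j))" by (simp add: diff_divide_distrib)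
  qed
  finally show ?thesis .
qed

text \<open>The inner product moves by at most 3 \<eta> <= \<delta> / 2 and so stays between
  \<delta> / 2 and 1 - \<delta> / 2. There \<open>phi r\<close> is at most 2 / (\<delta> / 2) =
  \<kappa>, and \<kappa>^2 and \<kappa>^3 dominate its Lipschitz and Taylor constants; \<kappa> >= 8
  absorbs lower powers.\<close>

lemma weight_perturbation:
  fixes xi xj di dj :: "real^'d"
  defines "s0 \<equiv> xi \<bullet> xj" and "s \<equiv> (xi + di) \<bullet> (xj + dj)"
  assumes \<delta>: "0 < \<delta>" "\<delta> < 1 / 2" and r: "0 \<le> r" "r \<le> 1"
    and s0: "\<delta> \<le> xi \<bullet> xj" "xi \<bullet> xj \<le> 1 - \<delta>" and x: "norm xi \<le> 1" "norm xj \<le> 1"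
    and d: "norm di \<le> \<eta>" "norm dj \<le> \<eta>" and \<eta>: "\<eta> \<le> \<delta> / 6" and \<kappa>: "\<kappa> = 4 / \<delta>"
  shows "\<delta> / 2 \<le> s" "s \<le> 1 - \<delta> / 2"
    and "norm (phi r s *\<^sub>R (xj + dj) - phi r s0 *\<^sub>R xj) \<le> 5 * \<kappa>\<^sup>2 * (norm di + norm dj)"
    and "norm (phi r s *\<^sub>R (xj + dj) - phi r s0 *\<^sub>R xj
           - ((dphi r s0 * (di \<bullet> xj + xi \<bullet> dj)) *\<^sub>R xj + phi r s0 *\<^sub>R dj))
        \<le> 9 * \<kappa> ^ 3 * ((norm di)\<^sup>2 + (norm dj)\<^sup>2)"
    and "\<bar>phi r s\<bar> \<le> \<kappa>" "\<bar>phi r s0\<bar> \<le> \<kappa>" "\<bar>dphi r s0\<bar> \<le> \<kappa>\<^sup>2"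
proof -
  define u where "u = norm di"
  define v where "v = norm dj"
  have uv: "0 \<le> u" "0 \<le> v" "u \<le> \<eta>" "v \<le> \<eta>" "\<eta> \<le> 1 / 12" "u \<le> 1" "v \<le> 1" using d \<eta> \<delta> by (auto simp: u_def v_def)
  have k8: "8 \<le> \<kappa>" using \<delta> by (simp add: \<kappa> field_simps)
  define h where "h = s - s0"
  have h: "h = xi \<bullet> dj + di \<bullet> xj + di \<bullet> dj"
    by (simp add: h_def s_def s0_def inner_add_left inner_add_right)
  have i1: "\<bar>xi \<bullet> dj\<bar> \<le> v" "\<bar>di \<bullet> xj\<bar> \<le> u" "\<bar>di \<bullet> dj\<bar> \<le> u * v"
  proof -
    show "\<bar>xi \<bullet> dj\<bar> \<le> v" unfolding v_def
      using Cauchy_Schwarz_ineq2[of xi dj] mult_right_mono[OF x(1) norm_ge_zero[of dj]] by simp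
    show "\<bar>di \<bullet> xj\<bar> \<le> u" unfolding u_def
      using Cauchy_Schwarz_ineq2[of di xj] mult_left_mono[OF x(2) norm_ge_zero[of di]] by simp
    show "\<bar>di \<bullet> dj\<bar> \<le> u * v" unfolding u_def v_def by (rule Cauchy_Schwarz_ineq2)
  qed
  have uvu: "u * v \<le> u" "u * v \<le> v" using uv mult_left_le[of v u] mult_left_le_one_le[of v u] by auto
  have "\<bar>h1 + h2 + h3\<bar> \<le> v + u + u * v" if "\<bar>h1\<bar> \<le> v" "\<bar>h2\<bar> \<le> u" "\<bar>h3\<bar> \<le> u * v" for h1 h2 h3
    using that by linarith
  from this[OF i1] have h3: "\<bar>h\<bar> \<le> v + u + u * v" unfolding h .
  have h1: "\<bar>h\<bar> \<le> 2 * (u + v)"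
  proof -
    have "v + u + p \<le> 2 * (u + v)" if "p \<le> u" for p using that uv(2) by argo
    from this[OF uvu(1)] show ?thesis using h3 by linarith
  qed
  have h2: "\<bar>h\<bar> \<le> \<delta> / 2" by (rule order.trans[OF h3]) (use uvu(1) uv(3,4) \<eta> in linarith)
  have "s = s0 + h" by (simp add: h_def)
  then show s: "\<delta> / 2 \<le> s" "s \<le> 1 - \<delta> / 2" using h2 s0 unfolding s0_def by linarith+
  have s0': "\<delta> / 2 \<le> s0" "s0 \<le> 1 - \<delta> / 2" using s0 \<delta> by (auto simp: s0_def)
  have e: "0 < \<delta> / 2" using \<delta> by simp
  have p0: "\<bar>phi r s0\<bar> \<le> \<kappa>" using abs_phi_le[OF e r s0' s0'] by (simp add: \<kappa>)
  have p1: "\<bar>phi r s\<bar> \<le> \<kappa>" using abs_phi_le[OF e r s s] by (simp add: \<kappa>)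
  have dp: "\<bar>dphi r s0\<bar> \<le> \<kappa>\<^sup>2"
    by (rule order.trans[OF abs_dphi_le[OF e r s0' s0']]) (use \<delta> in \<open>simp add: \<kappa> power_divide divide_right_mono\<close>)
  have lip: "\<bar>phi r s - phi r s0\<bar> \<le> \<kappa>\<^sup>2 * \<bar>h\<bar>"
    unfolding h_def
    by (rule order.trans[OF phi_lipschitz[OF e r s s0']]) (use \<delta> in \<open>intro mult_right_mono, simp_all add: \<kappa> power_divide divide_right_mono\<close>)
  have tay: "\<bar>phi r s - phi r s0 - dphi r s0 * h\<bar> \<le> \<kappa> ^ 3 * h\<^sup>2"
    unfolding h_def
    by (rule order.trans[OF phi_taylor[OF e r s s0']]) (use \<delta> in \<open>intro mult_right_mono, simp_all add: \<kappa> power_divide divide_right_mono\<close>)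
  show "\<bar>phi r s\<bar> \<le> \<kappa>" "\<bar>phi r s0\<bar> \<le> \<kappa>" "\<bar>dphi r s0\<bar> \<le> \<kappa>\<^sup>2" by fact+
  have k2: "0 \<le> \<kappa>\<^sup>2" "8 * \<kappa> \<le> \<kappa>\<^sup>2" "8 * \<kappa>\<^sup>2 \<le> \<kappa> ^ 3"
    using k8 mult_right_mono[OF k8, of \<kappa>] mult_right_mono[OF k8, of "\<kappa>\<^sup>2"] by (auto simp: power2_eq_square power3_eq_cube)
  have lip2: "\<bar>phi r s - phi r s0\<bar> \<le> 2 * \<kappa>\<^sup>2 * (u + v)"
    using lip mult_left_mono[OF h1 k2(1)] by linarith
  have "norm (phi r s *\<^sub>R (xj + dj) - phi r s0 *\<^sub>R xj) = norm ((phi r s - phi r s0) *\<^sub>R (xj + dj) + phi r s0 *\<^sub>R dj)"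
    by (simp add: algebra_simps)
  also have "\<dots> \<le> \<bar>phi r s - phi r s0\<bar> * norm (xj + dj) + \<bar>phi r s0\<bar> * v"
    unfolding v_def by (rule order.trans[OF norm_triangle_ineq]) simp
  also have "\<dots> \<le> (2 * \<kappa>\<^sup>2 * (u + v)) * 2 + \<kappa> * v"
  proof (intro add_mono mult_mono lip2 p0)
    show "norm (xj + dj) \<le> 2" using norm_triangle_ineq[of xj dj] x uv by (simp add: v_def)
  qed (use uv k8 in auto)
  also have "\<dots> \<le> 5 * \<kappa>\<^sup>2 * (u + v)"
  proof -
    have "\<kappa> * v \<le> \<kappa>\<^sup>2 * (u + v)" using k2 k8 uv by (intro mult_mono) auto
    then show ?thesis by linarith
  qed
  finally show "norm (phi r s *\<^sub>R (xj + dj) - phi r s0 *\<^sub>R xj) \<le> 5 * \<kappa>\<^sup>2 * (norm di + norm dj)"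
    by (simp add: u_def v_def)
  have uvs: "u * v \<le> (u\<^sup>2 + v\<^sup>2) / 2" using sum_squares_bound[of u v] by simp
  \<comment> \<open>The second-order remainder has three sources: the Taylor remainder of the
    weight, the bilinear part di.dj of the inner product, and the change of the weight times the
    change of the vector.\<close>
  have "norm (phi r s *\<^sub>R (xj + dj) - phi r s0 *\<^sub>R xj
           - ((dphi r s0 * (di \<bullet> xj + xi \<bullet> dj)) *\<^sub>R xj + phi r s0 *\<^sub>R dj))
      = norm ((phi r s - phi r s0 - dphi r s0 * h) *\<^sub>R xj + (dphi r s0 * (di \<bullet> dj)) *\<^sub>R xj + (phi r s - phi r s0) *\<^sub>R dj)"
    by (simp add: h algebra_simps)
  also have "\<dots> \<le> \<bar>phi r s - phi r s0 - dphi r s0 * h\<bar> * norm xj + \<bar>dphi r s0\<bar> * \<bar>di \<bullet> dj\<bar> * norm xj + \<bar>phi r s - phi r s0\<bar> * v"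
    unfolding v_def by (rule order.trans[OF norm_triangle_ineq add_mono[OF order.trans[OF norm_triangle_ineq]]]) (auto simp: abs_mult)
  also have "\<dots> \<le> (\<kappa> ^ 3 * h\<^sup>2) * 1 + \<kappa>\<^sup>2 * (u * v) * 1 + (2 * \<kappa>\<^sup>2 * (u + v)) * v"
    using k8 uv by (intro add_mono mult_mono tay dp i1 lip2 x) auto
  also have "\<dots> \<le> \<kappa> ^ 3 * (8 * (u\<^sup>2 + v\<^sup>2)) + \<kappa>\<^sup>2 * ((u\<^sup>2 + v\<^sup>2) / 2) + \<kappa>\<^sup>2 * (3 * (u\<^sup>2 + v\<^sup>2))"
  proof -
    have "h\<^sup>2 \<le> (2 * (u + v))\<^sup>2" using h1 uv by (intro power2_le_iff_abs_le[THEN iffD2]) auto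
    also have "\<dots> = 4 * (u\<^sup>2 + v\<^sup>2) + 8 * (u * v)" by (simp add: power2_eq_square algebra_simps)
    also have "\<dots> \<le> 8 * (u\<^sup>2 + v\<^sup>2)" using uvs by linarith
    finally have 1: "h\<^sup>2 \<le> 8 * (u\<^sup>2 + v\<^sup>2)" .
    have "2 * ((u + v) * v) = 2 * (u * v) + 2 * v\<^sup>2" by (simp add: power2_eq_square algebra_simps)
    also have "\<dots> \<le> 3 * (u\<^sup>2 + v\<^sup>2)" using uvs zero_le_power2[of u] zero_le_power2[of v] by argo
    finally have 2: "\<kappa>\<^sup>2 * (2 * ((u + v) * v)) \<le> \<kappa>\<^sup>2 * (3 * (u\<^sup>2 + v\<^sup>2))" by (rule mult_left_mono) simp
    have 3: "\<kappa> ^ 3 * h\<^sup>2 \<le> \<kappa> ^ 3 * (8 * (u\<^sup>2 + v\<^sup>2))" using 1 k8 by (intro mult_left_mono) auto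
    have 4: "\<kappa>\<^sup>2 * (u * v) \<le> \<kappa>\<^sup>2 * ((u\<^sup>2 + v\<^sup>2) / 2)" using uvs by (intro mult_left_mono) auto
    show ?thesis using 2 3 4 by (simp add: mult.assoc)
  qed
  also have "\<dots> \<le> 9 * \<kappa> ^ 3 * (u\<^sup>2 + v\<^sup>2)"
  proof -
    have "8 * \<kappa>\<^sup>2 * (u\<^sup>2 + v\<^sup>2) \<le> \<kappa> ^ 3 * (u\<^sup>2 + v\<^sup>2)" using k2 by (intro mult_right_mono) auto
    moreover have "0 \<le> \<kappa>\<^sup>2 * (u\<^sup>2 + v\<^sup>2)" by simp
    moreover have "\<kappa> ^ 3 * (8 * X) + \<kappa>\<^sup>2 * (X / 2) + \<kappa>\<^sup>2 * (3 * X) \<le> 9 * \<kappa> ^ 3 * X"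
      if "8 * \<kappa>\<^sup>2 * X \<le> \<kappa> ^ 3 * X" "0 \<le> \<kappa>\<^sup>2 * X" for X
    proof -
      have "\<kappa> ^ 3 * (8 * X) + \<kappa>\<^sup>2 * (X / 2) + \<kappa>\<^sup>2 * (3 * X) = 8 * (\<kappa> ^ 3 * X) + 7 / 2 * (\<kappa>\<^sup>2 * X)"
        by (simp add: field_simps)
      also have "\<dots> \<le> 9 * (\<kappa> ^ 3 * X)" using that by linarith
      finally show ?thesis by simp
    qed
    ultimately show ?thesis by blast
  qed
  finally show "norm (phi r s *\<^sub>R (xj + dj) - phi r s0 *\<^sub>R xj
           - ((dphi r s0 * (di \<bullet> xj + xi \<bullet> dj)) *\<^sub>R xj + phi r s0 *\<^sub>R dj))
        \<le> 9 * \<kappa> ^ 3 * ((norm di)\<^sup>2 + (norm dj)\<^sup>2)" by (simp add: u_def v_def)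
qed

lemma fnorm_le_const':
  assumes "0 \<le> c" "\<And>i. i < n \<Longrightarrow> norm (X i) \<le> c"
  shows "fnorm n X \<le> sqrt (real n) * c"
  using real_sqrt_le_mono[OF fnorm_le_const[OF assms]] assms(1) by (simp add: real_sqrt_mult)

lemma sum_norm_le_fnorm: "(\<Sum>j<n. norm (X j)) \<le> sqrt (real n) * fnorm n X"
proof -
  have "(\<Sum>j<n. norm (1::real) * norm (X j)) \<le> fnorm n (\<lambda>_. 1::real) * fnorm n X" by (rule sum_norm_prod_le)
  also have "fnorm n (\<lambda>_. 1::real) = sqrt (real n)" by (simp add: fnorm_def L2_set_def)
  finally show ?thesis by simp
qed

text \<open>Termwise, (p + e)^2 >= p^2 / 2 - e^2. This halves l, and \<eta>^2 <= l / 4 costs another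
  quarter, which leaves l / 4.\<close>

lemma gram_perturb:
  fixes x d :: "nat \<Rightarrow> 'a::real_inner"
  assumes d: "\<And>j. j < n \<Longrightarrow> norm (d j) \<le> \<eta>" and \<eta>: "\<eta>\<^sup>2 \<le> l / 4"
    and low: "l * real n * (norm v)\<^sup>2 \<le> (\<Sum>j<n. (x j \<bullet> v)\<^sup>2)"
  shows "real n * ((l / 4) * (norm v)\<^sup>2) \<le> (\<Sum>j<n. ((x j + d j) \<bullet> v)\<^sup>2)"
proof -
  define N where "N = real n"
  have N: "0 \<le> N" by (simp add: N_def)
  have "(\<Sum>j<n. (x j \<bullet> v)\<^sup>2 / 2 - \<eta>\<^sup>2 * (norm v)\<^sup>2) \<le> (\<Sum>j<n. ((x j + d j) \<bullet> v)\<^sup>2)"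
  proof (intro sum_mono)
    fix j assume "j \<in> {..<n}" then have j: "j < n" by simp
    have "\<bar>d j \<bullet> v\<bar> \<le> \<eta> * norm v"
      using d[OF j] by (intro order.trans[OF Cauchy_Schwarz_ineq2] mult_right_mono) auto
    then have "\<bar>d j \<bullet> v\<bar>\<^sup>2 \<le> (\<eta> * norm v)\<^sup>2" by (intro power_mono) auto
    then have dv: "(d j \<bullet> v)\<^sup>2 \<le> \<eta>\<^sup>2 * (norm v)\<^sup>2" by (simp add: power_mult_distrib)
    have "0 \<le> (x j \<bullet> v + 2 * (d j \<bullet> v))\<^sup>2" by simp
    then have "(x j \<bullet> v)\<^sup>2 / 2 - (d j \<bullet> v)\<^sup>2 \<le> (x j \<bullet> v + d j \<bullet> v)\<^sup>2"
      by (simp add: power2_eq_square algebra_simps)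
    then show "(x j \<bullet> v)\<^sup>2 / 2 - \<eta>\<^sup>2 * (norm v)\<^sup>2 \<le> ((x j + d j) \<bullet> v)\<^sup>2"
      using dv by (simp add: inner_add_left)
  qed
  moreover have "(\<Sum>j<n. (x j \<bullet> v)\<^sup>2 / 2 - \<eta>\<^sup>2 * (norm v)\<^sup>2) = (\<Sum>j<n. (x j \<bullet> v)\<^sup>2) / 2 - N * (\<eta>\<^sup>2 * (norm v)\<^sup>2)"
    by (simp add: sum_subtractf sum_divide_distrib N_def)
  moreover have "N * (\<eta>\<^sup>2 * (norm v)\<^sup>2) \<le> N * (l / 4 * (norm v)\<^sup>2)"
    using \<eta> N by (intro mult_left_mono mult_right_mono) auto
  moreover have "l * N * (norm v)\<^sup>2 \<le> (\<Sum>j<n. (x j \<bullet> v)\<^sup>2)" using low by (simp add: N_def)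
  moreover have "l * N * (norm v)\<^sup>2 / 2 - N * (l / 4 * (norm v)\<^sup>2) = N * ((l / 4) * (norm v)\<^sup>2)" by (simp add: field_simps)
  ultimately show ?thesis unfolding N_def by linarith
qed

text \<open>The pairs \<open>L\<close>, \<open>R\<close> are the linear part and the remainder of the initial estimator, \<open>t\<close> is the error of
  the one-step estimator and \<open>m\<close> its linearization.\<close>
lemma one_step_linearization:
  fixes x d L R t m :: "nat \<Rightarrow> real^'d" and E :: "nat \<Rightarrow> nat \<Rightarrow> real" and n :: nat and r :: real
  defines "y \<equiv> \<lambda>i. x i + d i"
  assumes \<delta>: "0 < \<delta>" "\<delta> < 1 / 2" and r: "0 < r" "r \<le> 1" and n: "0 < n"
    and x: "\<And>i j. i < n \<Longrightarrow> j < n \<Longrightarrow> \<delta> \<le> x i \<bullet> x j \<and> x i \<bullet> x j \<le> 1 - \<delta>"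
    and x1: "\<And>i. i < n \<Longrightarrow> norm (x i) \<le> 1"
    and d\<eta>: "\<And>i. i < n \<Longrightarrow> norm (d i) \<le> \<eta>" and \<eta>: "0 \<le> \<eta>" "\<eta> \<le> \<delta> / 6" "\<eta>\<^sup>2 \<le> l / 4"
    and l: "0 < l" and low: "\<And>v. l * real n * (norm v)\<^sup>2 \<le> (\<Sum>j<n. (x j \<bullet> v)\<^sup>2)"
    and LR: "\<And>i. i < n \<Longrightarrow> sqrt r *\<^sub>R d i = L i + R i"
    and E1: "\<And>i j. i < n \<Longrightarrow> j < n \<Longrightarrow> \<bar>E i j\<bar> \<le> 1"
    and t: "\<And>i. i < n \<Longrightarrow> (\<Sum>j<n. phi r (y i \<bullet> y j) *\<^sub>R (y j \<bullet> t i) *\<^sub>R y j)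
      = (\<Sum>j<n. (((E i j - (if i = j then r * (x i \<bullet> x j) else 0)) / sqrt r - sqrt r * (x i \<bullet> d j)) * phi r (y i \<bullet> y j)) *\<^sub>R y j)"
    and m: "\<And>i. i < n \<Longrightarrow> (\<Sum>j<n. phi r (x i \<bullet> x j) *\<^sub>R (x j \<bullet> m i) *\<^sub>R x j)
      = (\<Sum>j<n. (E i j / sqrt r * phi r (x i \<bullet> x j)) *\<^sub>R x j)"
    and A1: "\<And>i. i < n \<Longrightarrow> norm (\<Sum>j<n. E i j *\<^sub>R dphi r (x i \<bullet> x j) *\<^sub>R dyad (x j) (x j)) \<le> real n * \<alpha>1"
    and A2: "fnorm n (\<lambda>i. \<Sum>j<n. E i j *\<^sub>R (dphi r (x i \<bullet> x j) *\<^sub>R (x i \<bullet> L j) *\<^sub>R x j + phi r (x i \<bullet> x j) *\<^sub>R L j)) \<le> real n * r * \<alpha>2"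
    and A3: "\<And>i. i < n \<Longrightarrow> (\<Sum>j<n. \<bar>E i j\<bar>) \<le> 3 * real n * r"
    and A4: "fnorm n (\<lambda>i. \<Sum>j<n. phi r (x i \<bullet> x j) *\<^sub>R (x i \<bullet> L j) *\<^sub>R x j) \<le> real n * \<alpha>4"
    and A5: "(\<Sum>i<n. \<Sum>j<n. (E i j)\<^sup>2) \<le> (real n)\<^sup>2 * r * \<alpha>5\<^sup>2" and \<alpha>5: "0 \<le> \<alpha>5"
    and b: "sqrt r * fnorm n d \<le> b" and \<kappa>: "\<kappa> = 4 / \<delta>"
  shows "fnorm n (\<lambda>i. t i - m i) \<le> (4 / l) *
     (2 * \<kappa> / sqrt (real n) + \<alpha>1 * b / r + (\<alpha>2 + 2 * \<kappa>\<^sup>2 * \<alpha>5 * fnorm n R / sqrt r)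
      + (27 * \<kappa> ^ 3 * \<eta> * b + 9 * \<kappa> ^ 3 * b\<^sup>2 / (sqrt (real n) * sqrt r ^ 3))
      + (\<alpha>4 + \<kappa> * fnorm n R) + 10 * \<kappa>\<^sup>2 * b\<^sup>2 / (sqrt r * sqrt (real n)) + 21 * \<kappa>\<^sup>2 * \<eta> * fnorm n m)"
proof -
  define sr where "sr = sqrt r"
  define sn where "sn = sqrt (real n)"
  define N where "N = real n"
  have sr: "0 < sr" "sr * sr = r" "sr \<le> 1" using r by (auto simp: sr_def)
  have N: "1 \<le> N" "0 < N" using n by (auto simp: N_def)
  have sn: "0 < sn" "sn * sn = N" using n by (auto simp: sn_def N_def)
  have k8: "8 \<le> \<kappa>" using \<delta> by (simp add: \<kappa> field_simps)
  have k2: "8 * \<kappa> \<le> \<kappa>\<^sup>2" using mult_right_mono[OF k8, of \<kappa>] k8 by (simp add: power2_eq_square)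
  define dn where "dn = fnorm n d"
  have dn: "0 \<le> dn" "sr * dn \<le> b" using b by (auto simp: dn_def sr_def)
  \<comment> \<open>The change of the weighted vector
    \<open>phi r (x i \<bullet> x j) *\<^sub>R x j\<close> caused by the initial error, and on the
    next line its first-order part in \<open>d i\<close> and \<open>d j\<close>.\<close>
  define w where "w = (\<lambda>i j. phi r (y i \<bullet> y j) *\<^sub>R y j - phi r (x i \<bullet> x j) *\<^sub>R x j)"
  define lin where "lin = (\<lambda>i j. (dphi r (x i \<bullet> x j) * (d i \<bullet> x j + x i \<bullet> d j)) *\<^sub>R x j + phi r (x i \<bullet> x j) *\<^sub>R d j)"
  have W: "\<delta> / 2 \<le> y i \<bullet> y j" "y i \<bullet> y j \<le> 1 - \<delta> / 2"
     "norm (w i j) \<le> 5 * \<kappa>\<^sup>2 * (norm (d i) + norm (d j))"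
     "norm (w i j - lin i j) \<le> 9 * \<kappa> ^ 3 * ((norm (d i))\<^sup>2 + (norm (d j))\<^sup>2)"
     "\<bar>phi r (y i \<bullet> y j)\<bar> \<le> \<kappa>" "\<bar>phi r (x i \<bullet> x j)\<bar> \<le> \<kappa>" "\<bar>dphi r (x i \<bullet> x j)\<bar> \<le> \<kappa>\<^sup>2"
    if i: "i < n" and j: "j < n" for i j
    using weight_perturbation[OF \<delta> less_imp_le[OF r(1)] r(2) conjunct1[OF x[OF i j]] conjunct2[OF x[OF i j]] x1[OF i] x1[OF j] d\<eta>[OF i] d\<eta>[OF j] \<eta>(2) \<kappa>]
    by (simp_all add: y_def w_def lin_def)
  define bb where "bb = (\<lambda>i. (1 / N) *\<^sub>R (\<Sum>j<n. (((E i j - (if i = j then r * (x i \<bullet> x j) else 0)) / sr - sr * (x i \<bullet> d j)) * phi r (y i \<bullet> y j)) *\<^sub>R y j))"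
  define b0' where "b0' = (\<lambda>i. (1 / N) *\<^sub>R (\<Sum>j<n. (E i j / sr * phi r (x i \<bullet> x j)) *\<^sub>R x j))"
  \<comment> \<open>The difference of the two score vectors is sorted by its cause:
    \<open>T0\<close> is the diagonal bias, \<open>T1\<close> the error of row i against a noise
    average, \<open>T2\<close> the errors of the other rows against the noise, \<open>T3\<close> the
    second-order remainder of the weights, \<open>T4\<close> the weighted average of the other
    errors, and \<open>T5\<close> these errors times the change of the weights.\<close>
  define T0 where "T0 = (\<lambda>i. - ((1 / N) * (r * (x i \<bullet> x i) / sr) * phi r (y i \<bullet> y i)) *\<^sub>R y i)"
  define T1 where "T1 = (\<lambda>i. (1 / (N * sr)) *\<^sub>R ((\<Sum>j<n. E i j *\<^sub>R dphi r (x i \<bullet> x j) *\<^sub>R dyad (x j) (x j)) *v d i))"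
  define T2 where "T2 = (\<lambda>i. (1 / (N * sr)) *\<^sub>R (\<Sum>j<n. E i j *\<^sub>R (dphi r (x i \<bullet> x j) *\<^sub>R (x i \<bullet> d j) *\<^sub>R x j + phi r (x i \<bullet> x j) *\<^sub>R d j)))"
  define T3 where "T3 = (\<lambda>i. (1 / (N * sr)) *\<^sub>R (\<Sum>j<n. E i j *\<^sub>R (w i j - lin i j)))"
  define T4 where "T4 = (\<lambda>i. (sr / N) *\<^sub>R (\<Sum>j<n. phi r (x i \<bullet> x j) *\<^sub>R (x i \<bullet> d j) *\<^sub>R x j))"
  define T5 where "T5 = (\<lambda>i. (sr / N) *\<^sub>R (\<Sum>j<n. (x i \<bullet> d j) *\<^sub>R w i j))"
  have decomp: "bb i - b0' i = T0 i + T1 i + T2 i + T3 i - T4 i - T5 i" if i: "i < n" for i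
  proof -
    have T1': "T1 i = (1 / N) *\<^sub>R (\<Sum>j<n. (E i j / sr) *\<^sub>R (dphi r (x i \<bullet> x j) *\<^sub>R (d i \<bullet> x j) *\<^sub>R x j))"
      by (simp add: T1_def sum_matrix_vector scaleR_matrix_vector dyad_mult_vec scaleR_sum_right inner_commute mult_ac)
    have T2': "T2 i = (1 / N) *\<^sub>R (\<Sum>j<n. (E i j / sr) *\<^sub>R (dphi r (x i \<bullet> x j) *\<^sub>R (x i \<bullet> d j) *\<^sub>R x j + phi r (x i \<bullet> x j) *\<^sub>R d j))"
      by (simp add: T2_def scaleR_sum_right)
    have T3': "T3 i = (1 / N) *\<^sub>R (\<Sum>j<n. (E i j / sr) *\<^sub>R (w i j - lin i j))"
      by (simp add: T3_def scaleR_sum_right)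
    have T4': "T4 i = (1 / N) *\<^sub>R (\<Sum>j<n. sr *\<^sub>R (phi r (x i \<bullet> x j) *\<^sub>R (x i \<bullet> d j) *\<^sub>R x j))"
      by (simp add: T4_def scaleR_sum_right)
    have T5': "T5 i = (1 / N) *\<^sub>R (\<Sum>j<n. sr *\<^sub>R ((x i \<bullet> d j) *\<^sub>R w i j))"
      by (simp add: T5_def scaleR_sum_right)
    have "T0 i = (1 / N) *\<^sub>R (\<Sum>j<n. if i = j then - (((r * (x i \<bullet> x j)) / sr) * phi r (y i \<bullet> y j)) *\<^sub>R y j else 0)"
      using i by (simp add: T0_def)
    also have "(\<Sum>j<n. if i = j then - (((r * (x i \<bullet> x j)) / sr) * phi r (y i \<bullet> y j)) *\<^sub>R y j else 0)
      = (\<Sum>j<n. - (((if i = j then r * (x i \<bullet> x j) else 0) / sr) * phi r (y i \<bullet> y j)) *\<^sub>R y j)"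
      by (intro sum.cong refl) auto
    finally have T0': "T0 i = (1 / N) *\<^sub>R \<dots>" .
    show ?thesis
      unfolding T0' T1' T2' T3' T4' T5' bb_def b0'_def scaleR_right_diff_distrib[symmetric] scaleR_add_right[symmetric]
        sum.distrib[symmetric] sum_subtractf[symmetric]
      by (intro arg_cong[where f="\<lambda>v. (1 / N) *\<^sub>R v"] sum.cong refl)
         (simp add: w_def lin_def algebra_simps diff_divide_distrib)
  qed
  have f0: "fnorm n T0 \<le> 2 * \<kappa> / sn"
  proof -
    have "fnorm n T0 \<le> sn * (2 * \<kappa> / N)"
      unfolding sn_def
    proof (rule fnorm_le_const')
      fix i assume i: "i < n"
      have y2: "norm (y i) \<le> 2" unfolding y_def
        using norm_triangle_ineq[of "x i" "d i"] x1[OF i] d\<eta>[OF i] \<eta> \<delta> by linarith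
      have "norm (T0 i) = (1 / N) * (\<bar>sr * (x i \<bullet> x i)\<bar> * \<bar>phi r (y i \<bullet> y i)\<bar> * norm (y i))"
        unfolding T0_def sr(2)[symmetric] using sr(1) N(2) by (simp add: abs_mult)
      also have "\<dots> \<le> (1 / N) * (1 * \<kappa> * 2)"
      proof (intro mult_left_mono mult_mono y2 W i)
        have "sr * (x i \<bullet> x i) \<le> 1 * 1" using sr x[OF i i] \<delta> by (intro mult_mono) auto
        then show "\<bar>sr * (x i \<bullet> x i)\<bar> \<le> 1" using sr by simp
      qed (use N k8 in auto)
      finally show "norm (T0 i) \<le> 2 * \<kappa> / N" by (simp add: mult.commute)
    qed (use k8 N in auto)
    also have "\<dots> = 2 * \<kappa> / sn" unfolding sn(2)[symmetric] using sn(1) by simp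
    finally show ?thesis .
  qed
  have f1: "fnorm n T1 \<le> \<alpha>1 * b / r"
  proof -
    have "0 \<le> real n * \<alpha>1" using A1[OF n] norm_ge_zero order.trans by blast
    then have a1: "0 \<le> \<alpha>1" using n by (simp add: zero_le_mult_iff)
    have "fnorm n T1 \<le> (\<alpha>1 / sr) * fnorm n d"
    proof (rule fnorm_le_mult)
      show "0 \<le> \<alpha>1 / sr" using a1 sr by simp
      fix i assume i: "i < n"
      define S where "S = (\<Sum>j<n. E i j *\<^sub>R dphi r (x i \<bullet> x j) *\<^sub>R dyad (x j) (x j))"
      have "norm (S *v d i) \<le> (N * \<alpha>1) * norm (d i)"
        using A1[OF i] unfolding S_def N_def by (intro order.trans[OF norm_matrix_vector_le] mult_right_mono) auto
      then have "(1 / (N * sr)) * norm (S *v d i) \<le> (1 / (N * sr)) * ((N * \<alpha>1) * norm (d i))"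
        using N sr by (intro mult_left_mono) auto
      moreover have "norm (T1 i) = (1 / (N * sr)) * norm (S *v d i)" using N sr by (simp add: T1_def S_def)
      ultimately have "norm (T1 i) \<le> (1 / (N * sr)) * ((N * \<alpha>1) * norm (d i))" by simp
      then show "norm (T1 i) \<le> \<alpha>1 / sr * norm (d i)" using N by simp
    qed
    also have "\<dots> = \<alpha>1 * (sr * dn) / r" unfolding sr(2)[symmetric] using sr(1) by (simp add: dn_def field_simps)
    also have "\<dots> \<le> \<alpha>1 * b / r" using dn a1 r by (intro divide_right_mono mult_left_mono) auto
    finally show ?thesis .
  qed
  \<comment> \<open>Here \<open>d j\<close> depends on the noise that it multiplies. Its linear part
    \<open>L j\<close> is covered by the moment bound \<open>A2\<close>; its remainder
    \<open>R j\<close> is separated from the noise by Cauchy-Schwarz, at the cost of the full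
    Frobenius norm of \<open>E\<close>.\<close>
  have f2: "fnorm n T2 \<le> \<alpha>2 + 2 * \<kappa>\<^sup>2 * \<alpha>5 * fnorm n R / sr"
  proof -
    define g where "g = (\<lambda>i j v. dphi r (x i \<bullet> x j) *\<^sub>R (x i \<bullet> v) *\<^sub>R x j + phi r (x i \<bullet> x j) *\<^sub>R (v :: real^'d))"
    have gn: "norm (g i j v) \<le> 2 * \<kappa>\<^sup>2 * norm v" if i: "i < n" and j: "j < n" for i j v
    proof -
      have "norm (g i j v) \<le> \<bar>dphi r (x i \<bullet> x j)\<bar> * (\<bar>x i \<bullet> v\<bar> * norm (x j)) + \<bar>phi r (x i \<bullet> x j)\<bar> * norm v"
        unfolding g_def by (rule order.trans[OF norm_triangle_ineq]) (simp add: abs_mult)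
      also have "\<dots> \<le> \<kappa>\<^sup>2 * ((1 * norm v) * 1) + \<kappa> * norm v"
        using W[OF i j] x1[OF i] x1[OF j]
        by (intro add_mono mult_mono order.trans[OF Cauchy_Schwarz_ineq2] mult_right_mono) auto
      also have "\<dots> \<le> \<kappa>\<^sup>2 * norm v + \<kappa>\<^sup>2 * norm v" using k2 k8 by (intro add_mono mult_right_mono) auto
      finally show ?thesis by (simp add: mult_ac)
    qed
    define P where "P = (\<lambda>i. \<Sum>j<n. E i j *\<^sub>R g i j (L j))"
    define Q where "Q = (\<lambda>i. \<Sum>j<n. E i j *\<^sub>R g i j (R j))"
    have g_app: "g i j v = dphi r (x i \<bullet> x j) *\<^sub>R (x i \<bullet> v) *\<^sub>R x j + phi r (x i \<bullet> x j) *\<^sub>R v" for i j v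
      by (simp add: g_def)
    have g_add: "g i j (u + v) = g i j u + g i j v" "g i j (c *\<^sub>R v) = c *\<^sub>R g i j v" for i j u v c
      by (simp_all add: g_def inner_add_right algebra_simps)
    have T2e: "T2 i = (1 / (N * r)) *\<^sub>R (P i + Q i)" if i: "i < n" for i
    proof -
      have "d j = (1 / sr) *\<^sub>R (L j + R j)" if "j < n" for j
        using sr unfolding LR[OF that, symmetric] sr_def by simp
      then have "T2 i = (1 / (N * sr)) *\<^sub>R (\<Sum>j<n. (1 / sr) *\<^sub>R (E i j *\<^sub>R g i j (L j) + E i j *\<^sub>R g i j (R j)))"
        unfolding T2_def g_app[symmetric] by (simp add: g_add scaleR_add_right mult.commute)
      also have "\<dots> = (1 / (N * sr) * (1 / sr)) *\<^sub>R (P i + Q i)"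
        by (simp add: P_def Q_def sum.distrib flip: scaleR_sum_right)
      finally show ?thesis using sr(2) by (simp add: mult.assoc)
    qed
    have Qb: "fnorm n Q \<le> 2 * \<kappa>\<^sup>2 * (N * sr * \<alpha>5) * fnorm n R"
    proof -
      have "norm (Q i) \<le> norm ((2 * \<kappa>\<^sup>2 * fnorm n R) * L2_set (\<lambda>j. E i j) {..<n})" if i: "i < n" for i
      proof -
        have "norm (Q i) \<le> (\<Sum>j<n. norm (E i j) * (2 * \<kappa>\<^sup>2 * norm (R j)))"
          unfolding Q_def by (intro order.trans[OF norm_sum] sum_mono) (auto intro!: mult_left_mono gn i)
        also have "\<dots> = 2 * \<kappa>\<^sup>2 * (\<Sum>j<n. norm (E i j) * norm (R j))" by (simp add: sum_distrib_left mult_ac)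
        also have "\<dots> \<le> 2 * \<kappa>\<^sup>2 * (fnorm n (E i) * fnorm n R)" by (intro mult_left_mono sum_norm_prod_le) auto
        also have "fnorm n (E i) = L2_set (\<lambda>j. E i j) {..<n}" by (simp add: fnorm_def L2_set_def)
        finally show ?thesis by (simp add: abs_mult mult_ac)
      qed
      then have "fnorm n Q \<le> fnorm n (\<lambda>i. (2 * \<kappa>\<^sup>2 * fnorm n R) * L2_set (\<lambda>j. E i j) {..<n})" by (rule fnorm_mono)
      also have "\<dots> \<le> (2 * \<kappa>\<^sup>2 * fnorm n R) * fnorm n (\<lambda>i. L2_set (\<lambda>j. E i j) {..<n})"
        by (rule fnorm_le_mult) (auto simp: abs_mult)
      finally have 1: "fnorm n Q \<le> (2 * \<kappa>\<^sup>2 * fnorm n R) * fnorm n (\<lambda>i. L2_set (\<lambda>j. E i j) {..<n})" .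
      have 2: "fnorm n (\<lambda>i. L2_set (\<lambda>j. E i j) {..<n}) \<le> N * sr * \<alpha>5"
      proof (rule power2_le_imp_le)
        have "(fnorm n (\<lambda>i. L2_set (\<lambda>j. E i j) {..<n}))\<^sup>2 = (\<Sum>i<n. \<Sum>j<n. (E i j)\<^sup>2)"
          unfolding fnorm_sq by (simp add: L2_set_def sum_nonneg)
        also have "\<dots> \<le> (N * sr * \<alpha>5)\<^sup>2" using A5 sr(2) by (simp add: N_def power_mult_distrib power2_eq_square[of sr])
        finally show "(fnorm n (\<lambda>i. L2_set (\<lambda>j. E i j) {..<n}))\<^sup>2 \<le> (N * sr * \<alpha>5)\<^sup>2" .
      qed (use N sr \<alpha>5 in auto)
      have "fnorm n Q \<le> (2 * \<kappa>\<^sup>2 * fnorm n R) * (N * sr * \<alpha>5)"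
        by (rule order.trans[OF 1 mult_left_mono[OF 2]]) simp
      then show ?thesis by (simp add: mult_ac)
    qed
    have "fnorm n T2 \<le> (1 / (N * r)) * fnorm n (\<lambda>i. P i + Q i)"
      using N r by (intro fnorm_le_mult) (auto simp: T2e)
    also have "\<dots> \<le> (1 / (N * r)) * (N * r * \<alpha>2 + 2 * \<kappa>\<^sup>2 * (N * sr * \<alpha>5) * fnorm n R)"
      using N r A2 by (intro mult_left_mono order.trans[OF fnorm_triangle] add_mono Qb) (auto simp: P_def g_def N_def)
    also have "\<dots> = \<alpha>2 + 2 * \<kappa>\<^sup>2 * \<alpha>5 * fnorm n R / sr"
      unfolding sr(2)[symmetric] using N(2) sr(1) by (simp add: field_simps)
    finally show ?thesis .
  qed
  \<comment> \<open>In the term with the square of \<open>norm (d i)\<close> one factor is replaced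
    by \<eta> and the entries of the row are summed by \<open>A3\<close>; in the term with the
    squares of \<open>norm (d j)\<close> the bound 1 for an entry is enough.\<close>
  have f3: "fnorm n T3 \<le> 27 * \<kappa> ^ 3 * \<eta> * b + 9 * \<kappa> ^ 3 * b\<^sup>2 / (sn * sr ^ 3)"
  proof -
    define c where "c = 9 * \<kappa> ^ 3 / (N * sr)"
    have c0: "0 \<le> c" using k8 N sr by (simp add: c_def)
    have "norm (T3 i) \<le> norm (c * (3 * N * r * \<eta>) * norm (d i) + c * dn\<^sup>2)" if i: "i < n" for i
    proof -
      have "norm (T3 i) \<le> (1 / (N * sr)) * (\<Sum>j<n. \<bar>E i j\<bar> * (9 * \<kappa> ^ 3 * ((norm (d i))\<^sup>2 + (norm (d j))\<^sup>2)))"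
        unfolding T3_def norm_scaleR using N sr
        by (simp del: times_divide_eq_left times_divide_eq_right)
           (intro mult_left_mono order.trans[OF norm_sum] sum_mono, auto intro!: mult_left_mono W i)
      also have "\<dots> = c * ((\<Sum>j<n. \<bar>E i j\<bar>) * (norm (d i))\<^sup>2 + (\<Sum>j<n. \<bar>E i j\<bar> * (norm (d j))\<^sup>2))"
        by (simp add: c_def sum_distrib_left sum_distrib_right algebra_simps sum.distrib)
      also have "\<dots> \<le> c * ((3 * N * r) * (\<eta> * norm (d i)) + (\<Sum>j<n. 1 * (norm (d j))\<^sup>2))"
        using c0 A3[OF i] E1[OF i] d\<eta>[OF i] N r unfolding N_def power2_eq_square[of "norm (d i)"]
        by (intro mult_left_mono add_mono mult_mono sum_mono mult_right_mono) auto
      also have "\<dots> = c * (3 * N * r * \<eta>) * norm (d i) + c * dn\<^sup>2" by (simp add: dn_def fnorm_sq algebra_simps)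
      finally show ?thesis by (rule order.trans) simp
    qed
    then have "fnorm n T3 \<le> fnorm n (\<lambda>i. c * (3 * N * r * \<eta>) * norm (d i) + c * dn\<^sup>2)" by (rule fnorm_mono)
    also have "\<dots> \<le> fnorm n (\<lambda>i. c * (3 * N * r * \<eta>) * norm (d i)) + fnorm n (\<lambda>i::nat. c * dn\<^sup>2)" by (rule fnorm_triangle)
    also have "\<dots> \<le> c * (3 * N * r * \<eta>) * dn + sn * (c * dn\<^sup>2)"
      unfolding dn_def sn_def using c0 N r \<eta> by (intro add_mono fnorm_le_mult fnorm_le_const') (auto simp: abs_mult)
    also have "\<dots> = 27 * \<kappa> ^ 3 * \<eta> * (sr * dn) + 9 * \<kappa> ^ 3 * (sr * dn)\<^sup>2 / (sn * sr ^ 3)"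
    proof -
      have "c * (3 * N * r * \<eta>) * dn = 27 * \<kappa> ^ 3 * \<eta> * (sr * dn)"
        unfolding c_def sr(2)[symmetric] using N(2) sr(1) by simp
      moreover have "sn * (c * dn\<^sup>2) = 9 * \<kappa> ^ 3 * (sr * dn)\<^sup>2 / (sn * sr ^ 3)"
        unfolding c_def sn(2)[symmetric] using sn(1) sr(1)
        by (simp add: field_simps power2_eq_square power3_eq_cube)
      ultimately show ?thesis by simp
    qed
    also have "\<dots> \<le> 27 * \<kappa> ^ 3 * \<eta> * b + 9 * \<kappa> ^ 3 * b\<^sup>2 / (sn * sr ^ 3)"
      using dn sr sn k8 \<eta> by (intro add_mono mult_left_mono divide_right_mono power_mono) auto
    finally show ?thesis .
  qed
  \<comment> \<open>No noise multiplies the errors here, and no Taylor expansion helps. The term is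
    small because averaging over j the linear parts \<open>L j\<close> averages independent entries
    of \<open>E\<close>.\<close>
  have f4: "fnorm n T4 \<le> \<alpha>4 + \<kappa> * fnorm n R"
  proof -
    define P where "P = (\<lambda>i. \<Sum>j<n. phi r (x i \<bullet> x j) *\<^sub>R (x i \<bullet> L j) *\<^sub>R x j)"
    define Q where "Q = (\<lambda>i. \<Sum>j<n. phi r (x i \<bullet> x j) *\<^sub>R (x i \<bullet> R j) *\<^sub>R x j)"
    have T4e: "T4 i = (1 / N) *\<^sub>R (P i + Q i)" for i
    proof -
      have "T4 i = (1 / N) *\<^sub>R (\<Sum>j<n. phi r (x i \<bullet> x j) *\<^sub>R (x i \<bullet> (sr *\<^sub>R d j)) *\<^sub>R x j)"
        by (simp add: T4_def scaleR_sum_right mult_ac)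
      also have "(\<Sum>j<n. phi r (x i \<bullet> x j) *\<^sub>R (x i \<bullet> (sr *\<^sub>R d j)) *\<^sub>R x j) = P i + Q i"
        unfolding P_def Q_def sum.distrib[symmetric] sr_def
        by (intro sum.cong refl) (simp only: LR lessThan_iff inner_add_right scaleR_add_left scaleR_add_right)
      finally show ?thesis .
    qed
    have Qb: "fnorm n Q \<le> sn * (\<kappa> * (sn * fnorm n R))"
      unfolding sn_def
    proof (rule fnorm_le_const')
      fix i assume i: "i < n"
      have "norm (Q i) \<le> (\<Sum>j<n. \<kappa> * norm (R j))"
        unfolding Q_def
      proof (intro order.trans[OF norm_sum] sum_mono)
        fix j assume "j \<in> {..<n}" then have j: "j < n" by simp
        have "\<bar>phi r (x i \<bullet> x j)\<bar> * (\<bar>x i \<bullet> R j\<bar> * norm (x j)) \<le> \<kappa> * ((1 * norm (R j)) * 1)"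
          using W[OF i j] x1[OF i] x1[OF j] k8
          by (intro mult_mono order.trans[OF Cauchy_Schwarz_ineq2] mult_right_mono) auto
        then show "norm (phi r (x i \<bullet> x j) *\<^sub>R (x i \<bullet> R j) *\<^sub>R x j) \<le> \<kappa> * norm (R j)" by (simp add: abs_mult mult.assoc)
      qed
      also have "\<dots> \<le> \<kappa> * (sqrt (real n) * fnorm n R)"
        using k8 sum_norm_le_fnorm[where X=R and n=n] by (simp add: mult_left_mono flip: sum_distrib_left)
      finally show "norm (Q i) \<le> \<kappa> * (sqrt (real n) * fnorm n R)" .
    qed (use k8 in auto)
    have "fnorm n T4 \<le> (1 / N) * fnorm n (\<lambda>i. P i + Q i)"
      using N by (intro fnorm_le_mult) (auto simp: T4e)
    also have "\<dots> \<le> (1 / N) * (N * \<alpha>4 + sn * (\<kappa> * (sn * fnorm n R)))"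
      using N A4 by (intro mult_left_mono order.trans[OF fnorm_triangle] add_mono Qb) (auto simp: P_def N_def)
    also have "sn * (\<kappa> * (sn * fnorm n R)) = N * (\<kappa> * fnorm n R)" by (simp flip: sn(2))
    also have "(1 / N) * (N * \<alpha>4 + N * (\<kappa> * fnorm n R)) = \<alpha>4 + \<kappa> * fnorm n R" using N by (simp add: field_simps)
    finally show ?thesis .
  qed
  have f5: "fnorm n T5 \<le> 10 * \<kappa>\<^sup>2 * b\<^sup>2 / (sr * sn)"
  proof -
    define c where "c = 5 * \<kappa>\<^sup>2 * sr / N"
    have c0: "0 \<le> c" using N sr by (simp add: c_def)
    have "norm (T5 i) \<le> norm (c * (sn * dn) * norm (d i) + c * dn\<^sup>2)" if i: "i < n" for i
    proof -
      have "norm (T5 i) \<le> (sr / N) * (\<Sum>j<n. norm (d j) * (5 * \<kappa>\<^sup>2 * (norm (d i) + norm (d j))))"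
        unfolding T5_def norm_scaleR
      proof -
        have "norm (\<Sum>j<n. (x i \<bullet> d j) *\<^sub>R w i j) \<le> (\<Sum>j<n. norm (d j) * (5 * \<kappa>\<^sup>2 * (norm (d i) + norm (d j))))"
        proof (intro order.trans[OF norm_sum] sum_mono)
          fix j assume "j \<in> {..<n}" then have j: "j < n" by simp
          have "\<bar>x i \<bullet> d j\<bar> * norm (w i j) \<le> (1 * norm (d j)) * (5 * \<kappa>\<^sup>2 * (norm (d i) + norm (d j)))"
            using W[OF i j] x1[OF i]
            by (intro mult_mono order.trans[OF Cauchy_Schwarz_ineq2] mult_right_mono) auto
          then show "norm ((x i \<bullet> d j) *\<^sub>R w i j) \<le> norm (d j) * (5 * \<kappa>\<^sup>2 * (norm (d i) + norm (d j)))" by simp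
        qed
        moreover have "\<bar>sr / N\<bar> = sr / N" "0 \<le> sr / N" using sr N by auto
        ultimately show "\<bar>sr / N\<bar> * norm (\<Sum>j<n. (x i \<bullet> d j) *\<^sub>R w i j) \<le> (sr / N) * (\<Sum>j<n. norm (d j) * (5 * \<kappa>\<^sup>2 * (norm (d i) + norm (d j))))"
          by (simp only: mult_left_mono)
      qed
      also have "\<dots> = c * ((\<Sum>j<n. norm (d j)) * norm (d i) + (\<Sum>j<n. (norm (d j))\<^sup>2))"
        by (simp add: c_def sum_distrib_left sum_distrib_right sum_divide_distrib algebra_simps sum.distrib power2_eq_square)
      also have "\<dots> \<le> c * ((sn * dn) * norm (d i) + dn\<^sup>2)"
        using c0 sum_norm_le_fnorm[where X=d and n=n] unfolding dn_def sn_def fnorm_sq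
        by (intro mult_left_mono add_mono mult_right_mono) auto
      finally have "norm (T5 i) \<le> c * (sn * dn) * norm (d i) + c * dn\<^sup>2" by (simp add: algebra_simps)
      then show ?thesis by (rule order.trans) simp
    qed
    then have "fnorm n T5 \<le> fnorm n (\<lambda>i. c * (sn * dn) * norm (d i) + c * dn\<^sup>2)" by (rule fnorm_mono)
    also have "\<dots> \<le> fnorm n (\<lambda>i. c * (sn * dn) * norm (d i)) + fnorm n (\<lambda>i::nat. c * dn\<^sup>2)" by (rule fnorm_triangle)
    also have "\<dots> \<le> c * (sn * dn) * dn + sn * (c * dn\<^sup>2)"
    proof (intro add_mono)
      show "fnorm n (\<lambda>i. c * (sn * dn) * norm (d i)) \<le> c * (sn * dn) * dn"
        unfolding dn_def using c0 sn by (intro fnorm_le_mult) (auto simp: abs_mult)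
      show "fnorm n (\<lambda>i::nat. c * dn\<^sup>2) \<le> sn * (c * dn\<^sup>2)"
        unfolding sn_def using c0 by (intro fnorm_le_const') auto
    qed
    also have "\<dots> = 10 * \<kappa>\<^sup>2 * (sr * dn)\<^sup>2 / (sr * sn)"
      unfolding c_def sn(2)[symmetric] using sn(1) sr(1) by (simp add: field_simps power2_eq_square)
    also have "\<dots> \<le> 10 * \<kappa>\<^sup>2 * b\<^sup>2 / (sr * sn)"
      using dn sr sn by (intro mult_left_mono divide_right_mono power_mono) auto
    finally show ?thesis .
  qed
  \<comment> \<open>The information matrix at y has lower bound l / 4 by
    \<open>gram_perturb\<close>, since its weights are at least 1; hence the factor 4 / l. Replacing
    it by the one at x costs 20 \<kappa>^2 \<eta> from the change of the weighted vectors and one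
    more \<kappa>^2 \<eta> from the other factor y_j.\<close>
  have key: "norm (t i - m i) \<le> (4 / l) * norm (norm (bb i - b0' i) + 21 * \<kappa>\<^sup>2 * \<eta> * norm (m i))" if i: "i < n" for i
  proof -
    define v where "v = t i - m i"
    define Iv where "Iv = (\<lambda>u. (1 / N) *\<^sub>R (\<Sum>j<n. phi r (y i \<bullet> y j) *\<^sub>R (y j \<bullet> u) *\<^sub>R y j))"
    define Gm where "Gm = (1 / N) *\<^sub>R (\<Sum>j<n. phi r (x i \<bullet> x j) *\<^sub>R (x j \<bullet> m i) *\<^sub>R x j)"
    have It: "Iv (t i) = bb i" unfolding Iv_def bb_def using t[OF i] by (simp add: sr_def)
    have Gm: "Gm = b0' i" unfolding Gm_def b0'_def using m[OF i] by (simp add: sr_def)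
    have "Iv v = Iv (t i) - Iv (m i)"
      unfolding Iv_def v_def by (simp add: inner_diff_right algebra_simps sum_subtractf)
    also have "\<dots> = (bb i - b0' i) - (Iv (m i) - Gm)" by (simp add: It Gm)
    finally have Iv: "Iv v = (bb i - b0' i) - (Iv (m i) - Gm)" .
    have diff: "norm (Iv (m i) - Gm) \<le> 21 * \<kappa>\<^sup>2 * \<eta> * norm (m i)"
    proof -
      have "Iv (m i) - Gm = (1 / N) *\<^sub>R (\<Sum>j<n. (y j \<bullet> m i) *\<^sub>R w i j + (phi r (x i \<bullet> x j) * (d j \<bullet> m i)) *\<^sub>R x j)"
        unfolding Iv_def Gm_def scaleR_right_diff_distrib[symmetric] sum_subtractf[symmetric]
        by (intro arg_cong[where f="\<lambda>v. (1 / N) *\<^sub>R v"] sum.cong refl) (simp add: w_def y_def inner_add_left algebra_simps)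
      also have "norm \<dots> \<le> (1 / N) * (\<Sum>j<n. 21 * \<kappa>\<^sup>2 * \<eta> * norm (m i))"
      proof -
        have "norm (\<Sum>j<n. (y j \<bullet> m i) *\<^sub>R w i j + (phi r (x i \<bullet> x j) * (d j \<bullet> m i)) *\<^sub>R x j) \<le> (\<Sum>j<n. 21 * \<kappa>\<^sup>2 * \<eta> * norm (m i))"
        proof (intro order.trans[OF norm_sum] sum_mono)
          fix j assume "j \<in> {..<n}" then have j: "j < n" by simp
          have y2: "norm (y j) \<le> 2" unfolding y_def
            using norm_triangle_ineq[of "x j" "d j"] x1[OF j] d\<eta>[OF j] \<eta> \<delta> by linarith
          have "norm ((y j \<bullet> m i) *\<^sub>R w i j + (phi r (x i \<bullet> x j) * (d j \<bullet> m i)) *\<^sub>R x j)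
             \<le> \<bar>y j \<bullet> m i\<bar> * norm (w i j) + \<bar>phi r (x i \<bullet> x j)\<bar> * \<bar>d j \<bullet> m i\<bar> * norm (x j)"
            by (rule order.trans[OF norm_triangle_ineq]) (simp add: abs_mult)
          also have "\<dots> \<le> (2 * norm (m i)) * (5 * \<kappa>\<^sup>2 * (\<eta> + \<eta>)) + \<kappa> * (\<eta> * norm (m i)) * 1"
            using W[OF i j] x1[OF j] d\<eta>[OF i] d\<eta>[OF j] y2 \<eta> k8
            by (intro add_mono mult_mono order.trans[OF Cauchy_Schwarz_ineq2] order.trans[OF W(3)[OF i j]] mult_left_mono) auto
          also have "\<dots> \<le> 20 * \<kappa>\<^sup>2 * \<eta> * norm (m i) + \<kappa>\<^sup>2 * \<eta> * norm (m i)"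
            using k2 k8 \<eta> mult_right_mono[of \<kappa> "\<kappa>\<^sup>2" "\<eta> * norm (m i)"] by (simp add: mult_ac)
          finally show "norm ((y j \<bullet> m i) *\<^sub>R w i j + (phi r (x i \<bullet> x j) * (d j \<bullet> m i)) *\<^sub>R x j) \<le> 21 * \<kappa>\<^sup>2 * \<eta> * norm (m i)" by (simp add: mult_ac)
        qed
        then show ?thesis using N by (simp add: divide_right_mono)
      qed
      finally show ?thesis using N by (simp add: N_def)
    qed
    have "(l / 4) * (norm v)\<^sup>2 \<le> v \<bullet> Iv v"
    proof -
      have "N * ((l / 4) * (norm v)\<^sup>2) \<le> (\<Sum>j<n. (y j \<bullet> v)\<^sup>2)"
        unfolding y_def N_def by (rule gram_perturb[OF d\<eta> \<eta>(3) low])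
      also have "(\<Sum>j<n. (y j \<bullet> v)\<^sup>2) \<le> (\<Sum>j<n. phi r (y i \<bullet> y j) * (y j \<bullet> v)\<^sup>2)"
      proof (intro sum_mono)
        fix j assume "j \<in> {..<n}" then have j: "j < n" by simp
        have "1 \<le> phi r (y i \<bullet> y j)" using W(1,2)[OF i j] \<delta> r by (intro phi_ge_1) auto
        then show "(y j \<bullet> v)\<^sup>2 \<le> phi r (y i \<bullet> y j) * (y j \<bullet> v)\<^sup>2" using mult_right_mono[of 1 "phi r (y i \<bullet> y j)" "(y j \<bullet> v)\<^sup>2"] by simp
      qed
      also have "\<dots> = N * (v \<bullet> Iv v)"
        using N by (simp add: Iv_def inner_sum_right power2_eq_square inner_commute mult_ac)
      finally show ?thesis using N by simp
    qed
    also have "\<dots> \<le> norm v * norm (Iv v)" by (rule norm_cauchy_schwarz)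
    finally have "norm v * ((l / 4) * norm v) \<le> norm v * norm (Iv v)" by (simp add: power2_eq_square mult_ac)
    then have "(l / 4) * norm v \<le> norm (Iv v)" by (cases "v = 0") auto
    also have "\<dots> \<le> norm (bb i - b0' i) + 21 * \<kappa>\<^sup>2 * \<eta> * norm (m i)"
      unfolding Iv using diff norm_triangle_ineq4[of "bb i - b0' i" "Iv (m i) - Gm"] by linarith
    finally have "norm v \<le> (4 / l) * (norm (bb i - b0' i) + 21 * \<kappa>\<^sup>2 * \<eta> * norm (m i))"
      using l by (simp add: field_simps)
    also have "\<dots> \<le> (4 / l) * norm (norm (bb i - b0' i) + 21 * \<kappa>\<^sup>2 * \<eta> * norm (m i))"
      using l by (intro mult_left_mono) auto
    finally show ?thesis by (simp add: v_def)
  qed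
  have "fnorm n (\<lambda>i. t i - m i) \<le> (4 / l) * fnorm n (\<lambda>i. norm (bb i - b0' i) + 21 * \<kappa>\<^sup>2 * \<eta> * norm (m i))"
    using l key by (intro fnorm_le_mult) auto
  also have "\<dots> \<le> (4 / l) * (fnorm n (\<lambda>i. norm (bb i - b0' i)) + fnorm n (\<lambda>i. 21 * \<kappa>\<^sup>2 * \<eta> * norm (m i)))"
    using l by (intro mult_left_mono fnorm_triangle) auto
  also have "fnorm n (\<lambda>i. norm (bb i - b0' i)) = fnorm n (\<lambda>i. T0 i + T1 i + T2 i + T3 i - T4 i - T5 i)"
    unfolding fnorm_def by (intro L2_set_cong refl) (simp add: decomp)
  also have "\<dots> \<le> fnorm n T0 + fnorm n T1 + fnorm n T2 + fnorm n T3 + fnorm n T4 + fnorm n T5"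
    using fnorm_triangle_diff[of n "\<lambda>i. T0 i + T1 i + T2 i + T3 i - T4 i" T5] fnorm_triangle_diff[of n "\<lambda>i. T0 i + T1 i + T2 i + T3 i" T4]
      fnorm_triangle[of n "\<lambda>i. T0 i + T1 i + T2 i" T3] fnorm_triangle[of n "\<lambda>i. T0 i + T1 i" T2] fnorm_triangle[of n T0 T1]
    by linarith
  also have "fnorm n (\<lambda>i. 21 * \<kappa>\<^sup>2 * \<eta> * norm (m i)) \<le> 21 * \<kappa>\<^sup>2 * \<eta> * fnorm n m"
    using \<eta> by (intro fnorm_le_mult) (auto simp: abs_mult)
  finally have "fnorm n (\<lambda>i. t i - m i) \<le> (4 / l) * (fnorm n T0 + fnorm n T1 + fnorm n T2 + fnorm n T3 + fnorm n T4 + fnorm n T5 + 21 * \<kappa>\<^sup>2 * \<eta> * fnorm n m)"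
    using l by (simp add: divide_right_mono mult_left_mono)
  also have "\<dots> \<le> (4 / l) *
     (2 * \<kappa> / sn + \<alpha>1 * b / r + (\<alpha>2 + 2 * \<kappa>\<^sup>2 * \<alpha>5 * fnorm n R / sr)
      + (27 * \<kappa> ^ 3 * \<eta> * b + 9 * \<kappa> ^ 3 * b\<^sup>2 / (sn * sr ^ 3))
      + (\<alpha>4 + \<kappa> * fnorm n R) + 10 * \<kappa>\<^sup>2 * b\<^sup>2 / (sr * sn) + 21 * \<kappa>\<^sup>2 * \<eta> * fnorm n m)"
    using l by (intro mult_left_mono add_mono f0 f1 f2 f3 f4 f5 order.refl) auto
  finally show ?thesis by (simp add: sn_def sr_def)
qed

subsection \<open>A uniform law of large numbers for the latent positions\<close>

definition avg :: "nat \<Rightarrow> (nat \<Rightarrow> 'b::real_vector) \<Rightarrow> 'b" where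
  "avg n f = (1 / real n) *\<^sub>R (\<Sum>i<n. f i)"

lemma avg_diff: "avg n f - avg n g = avg n (\<lambda>i. f i - g i)"
  by (simp add: avg_def sum_subtractf scaleR_diff_right)

lemma norm_avg_le:
  fixes f :: "nat \<Rightarrow> 'b::real_normed_vector"
  assumes "0 < n" "\<And>i. i < n \<Longrightarrow> norm (f i) \<le> e"
  shows "norm (avg n f) \<le> e"
proof -
  have "norm (\<Sum>i<n. f i) \<le> (\<Sum>i<n. e)" using assms(2) by (intro sum_norm_le) auto
  then show ?thesis using assms(1) by (simp add: avg_def field_simps)
qed

definition emp :: "(nat \<Rightarrow> 'a) \<Rightarrow> nat \<Rightarrow> 'a set \<Rightarrow> real" where
  "emp x0 n B = (\<Sum>i<n. of_bool (x0 i \<in> B)) / real n"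

lemma emp_bounds: "0 \<le> emp x0 n B" "emp x0 n B \<le> 1"
proof -
  show "0 \<le> emp x0 n B" by (auto simp: emp_def intro!: divide_nonneg_nonneg sum_nonneg)
  have "(\<Sum>i<n. of_bool (x0 i \<in> B) :: real) \<le> (\<Sum>i<n. 1)" by (intro sum_mono) auto
  then show "emp x0 n B \<le> 1" by (auto simp: emp_def divide_le_eq_1)
qed

lemma emp_Diff: "B \<subseteq> A \<Longrightarrow> emp x0 n (A - B) = emp x0 n A - emp x0 n B"
  unfolding emp_def diff_divide_distrib[symmetric] sum_subtractf[symmetric]
  by (intro arg_cong[where f="\<lambda>t. t / real n"] sum.cong) auto

locale latent_sample =
  fixes F :: "(real^'d) measure" and \<delta> :: real and K :: "(real^'d) set" and x0 :: "nat \<Rightarrow> real^'d"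
  assumes prob_F: "prob_space F" and sets_F: "sets F = sets borel" and F_latent: "measure F latent_space = 1"
    and delta: "0 < \<delta>" "\<delta> < 1 / 2"
    and K_latent: "K \<subseteq> latent_space" and K_compact: "compact K"
    and K_inner: "\<And>x u. x \<in> K \<Longrightarrow> u \<in> K \<Longrightarrow> x \<bullet> u \<in> {\<delta>..1 - \<delta>}"
    and x0_K: "\<And>i. x0 i \<in> K"
    and cdf: "(\<lambda>n. SUP x\<in>latent_space. \<bar>empirical_cdf x0 n x - measure F {..x}\<bar>) \<longlonglongrightarrow> 0"
begin

sublocale F: prob_space F by (rule prob_F)

lemma space_F [simp]: "space F = UNIV"
  using sets_eq_imp_space_eq[OF sets_F] by simp

lemma prob_UNIV: "measure F UNIV = 1"
  using F.prob_space by simp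

lemma borel_F [measurable_cong]: "sets F = sets borel" by (rule sets_F)

section \<open>Convergence of the empirical masses of boxes and grid cells\<close>

definition conv :: "(real^'d) set \<Rightarrow> bool" where
  "conv B \<longleftrightarrow> B \<in> sets borel \<and> (\<lambda>n. emp x0 n B) \<longlonglongrightarrow> measure F B"

text \<open>The hypothesis on the distribution functions covers only corners in the latent space. A
  corner with a zero coordinate has a lower orthant disjoint from it, so both masses vanish; such
  corners occur as lower corners of grid cells.\<close>

lemma conv_atMost:
  assumes b: "\<And>k. 0 \<le> b $ k" "norm b < 1"
  shows "conv {..b}"
proof -
  have borel: "{..b} \<in> sets borel" by (rule borel_closed) (rule closed_eucl_atMost)
  show ?thesis
  proof (cases "b \<in> latent_space")
    case True
    have bdd: "bdd_above ((\<lambda>x. \<bar>empirical_cdf x0 n x - measure F {..x}\<bar>) ` latent_space)" for n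
    proof (rule bdd_aboveI2)
      fix x :: "real^'d"
      have "empirical_cdf x0 n x = emp x0 n {..x}" by (simp add: empirical_cdf_def emp_def)
      moreover have "\<bar>e - p\<bar> \<le> 1" if "0 \<le> e" "e \<le> 1" "0 \<le> p" "p \<le> 1" for e p :: real
        using that by linarith
      ultimately show "\<bar>empirical_cdf x0 n x - measure F {..x}\<bar> \<le> 1"
        by (simp add: emp_bounds)
    qed
    have "(\<lambda>n. emp x0 n {..b} - measure F {..b}) \<longlonglongrightarrow> 0"
    proof (rule Lim_null_comparison[OF _ cdf], rule always_eventually, rule allI)
      fix n
      have "\<bar>empirical_cdf x0 n b - measure F {..b}\<bar> \<le> (SUP x\<in>latent_space. \<bar>empirical_cdf x0 n x - measure F {..x}\<bar>)"
        using True bdd by (rule cSUP_upper)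
      then show "norm (emp x0 n {..b} - measure F {..b}) \<le> (SUP x\<in>latent_space. \<bar>empirical_cdf x0 n x - measure F {..x}\<bar>)"
        by (simp add: empirical_cdf_def emp_def)
    qed
    then show ?thesis unfolding conv_def using borel by (simp add: LIM_zero_iff)
  next
    case False
    then obtain k where k: "b $ k = 0" using b by (force simp: latent_space_def not_less intro: antisym)
    have disj: "{..b} \<inter> latent_space = {}"
    proof (rule equals0I)
      fix y assume "y \<in> {..b} \<inter> latent_space"
      then have "y $ k \<le> b $ k" "0 < y $ k" by (auto simp: less_eq_vec_def latent_space_def)
      then show False using k by simp
    qed
    have "emp x0 n {..b} = 0" for n
      using disj x0_K K_latent by (auto simp: emp_def intro!: sum.neutral)
    moreover have "measure F {..b} = 0"
    proof -
      have ls: "latent_space \<in> sets F"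
        using F_latent by (metis measure_notin_sets zero_neq_one)
      have "measure F {..b} \<le> measure F (space F - latent_space)"
        using disj ls borel by (intro F.finite_measure_mono) (auto simp: sets_F)
      also have "\<dots> = 0" using F.prob_compl[OF ls] F_latent by simp
      finally show ?thesis by (simp add: measure_le_0_iff)
    qed
    ultimately show ?thesis using borel by (simp add: conv_def)
  qed
qed

text \<open>Inclusion-exclusion one coordinate at a time: opening the box below in coordinate k
  removes the box whose upper corner is lowered to \<open>a $ k\<close>. The lowered corner has no
  larger norm, so the induction stays in the unit ball.\<close>

lemma conv_box:
  assumes "finite S" and a: "\<And>k. 0 \<le> a $ k" and b: "\<And>k. a $ k \<le> b $ k" "norm b < 1"
  shows "conv {y. (\<forall>k. y $ k \<le> b $ k) \<and> (\<forall>k\<in>S. a $ k < y $ k)}"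
  using assms(1) b
proof (induction S arbitrary: b)
  case empty
  have "{y. \<forall>k. y $ k \<le> b $ k} = {..b}" by (auto simp: less_eq_vec_def)
  then show ?case using conv_atMost[of b] a empty order.trans by (auto intro: order.trans)
next
  case (insert k S)
  define b' where "b' = (\<chi> j. if j = k then a $ k else b $ j)"
  define P where "P = {y. (\<forall>k. y $ k \<le> b $ k) \<and> (\<forall>k\<in>S. a $ k < y $ k)}"
  define Q where "Q = {y. (\<forall>k. y $ k \<le> b' $ k) \<and> (\<forall>k\<in>S. a $ k < y $ k)}"
  have b0: "0 \<le> b $ j" for j using a insert.prems(1) order.trans by blast
  have "norm b' \<le> norm b"
    unfolding norm_vec_def using a b0 insert.prems(1) by (intro L2_set_mono) (auto simp: b'_def)
  then have Q: "conv Q" unfolding Q_def using insert.prems by (intro insert.IH) (auto simp: b'_def)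
  have P: "conv P" unfolding P_def using insert.prems by (intro insert.IH) auto
  have QP: "Q \<subseteq> P"
  proof
    fix y assume y: "y \<in> Q"
    have "y $ j \<le> b $ j" for j
    proof -
      have "y $ j \<le> b' $ j" using y by (auto simp: Q_def)
      also have "\<dots> \<le> b $ j" using insert.prems(1) by (auto simp: b'_def)
      finally show ?thesis .
    qed
    then show "y \<in> P" using y by (auto simp: P_def Q_def)
  qed
  have eq: "{y. (\<forall>j. y $ j \<le> b $ j) \<and> (\<forall>j\<in>insert k S. a $ j < y $ j)} = P - Q"
  proof (intro set_eqI iffI)
    fix y assume "y \<in> {y. (\<forall>j. y $ j \<le> b $ j) \<and> (\<forall>j\<in>insert k S. a $ j < y $ j)}"
    moreover from this have "\<not> y $ k \<le> b' $ k" by (simp add: b'_def)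
    ultimately show "y \<in> P - Q" by (auto simp: P_def Q_def)
  next
    fix y assume y: "y \<in> P - Q"
    then have "\<exists>j. \<not> y $ j \<le> b' $ j" by (auto simp: P_def Q_def)
    then obtain j where "\<not> y $ j \<le> b' $ j" by blast
    moreover have "y $ j \<le> b $ j" using y by (auto simp: P_def)
    ultimately have "\<not> y $ k \<le> a $ k" by (auto simp: b'_def split: if_splits)
    then show "y \<in> {y. (\<forall>j. y $ j \<le> b $ j) \<and> (\<forall>j\<in>insert k S. a $ j < y $ j)}"
      using y by (auto simp: P_def)
  qed
  have "measure F (P - Q) = measure F P - measure F Q"
    using P Q QP by (intro F.finite_measure_Diff) (auto simp: conv_def sets_F)
  then show ?case
    unfolding eq using P Q QP by (auto simp: conv_def emp_Diff intro!: tendsto_diff)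
qed

text \<open>The ceiling makes the cubes of the grid open below and closed above, the shape that
  differences of lower orthants produce.\<close>

definition cell :: "real \<Rightarrow> real^'d \<Rightarrow> 'd \<Rightarrow> int" where
  "cell h y = (\<lambda>k. \<lceil>y $ k / h\<rceil>)"

lemma cell_near:
  assumes "0 < h" "cell h y = cell h z"
  shows "norm (y - z) \<le> real CARD('d) * h"
proof -
  have "norm (y - z) \<le> (\<Sum>k\<in>UNIV. norm ((y - z) $ k))" unfolding norm_vec_def by (rule L2_set_le_sum) auto
  also have "\<dots> \<le> (\<Sum>k\<in>(UNIV :: 'd set). h)"
  proof (rule sum_mono)
    fix k
    have "\<lceil>y $ k / h\<rceil> = \<lceil>z $ k / h\<rceil>" using assms(2) by (simp add: cell_def fun_eq_iff)
    then have "\<bar>y $ k / h - z $ k / h\<bar> \<le> 1" by linarith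
    then show "norm ((y - z) $ k) \<le> h" using assms(1) by (simp add: field_simps abs_if split: if_splits)
  qed
  finally show ?thesis by simp
qed

text \<open>The inner product bound with u = x keeps \<open>K\<close> away from the unit sphere, so
  that for a fine grid the upper corners of the cells meeting \<open>K\<close> remain in the open
  ball.\<close>

lemma K_norm:
  obtains c where "c < 1" "\<And>x. x \<in> K \<Longrightarrow> norm x \<le> c"
proof
  show "sqrt (1 - \<delta>) < 1" using delta by simp
  fix x assume "x \<in> K"
  then have "x \<bullet> x \<le> 1 - \<delta>" using K_inner by auto
  then show "norm x \<le> sqrt (1 - \<delta>)" by (simp add: norm_eq_sqrt_inner)
qed

lemma finite_cells: "0 < h \<Longrightarrow> finite (cell h ` K)"
proof -
  assume h: "0 < h"
  have "cell h ` K \<subseteq> {f. \<forall>k. f k \<in> {0..\<lceil>1 / h\<rceil>}}"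
  proof
    fix f assume "f \<in> cell h ` K"
    then obtain y where y: "y \<in> K" "f = cell h y" by auto
    have "0 < y $ k" "y $ k \<le> 1" for k
      using y K_latent component_le_norm_cart[of y k] by (force simp: latent_space_def)+
    then have "0 < y $ k / h" "y $ k / h \<le> 1 / h" for k using h by (auto intro: divide_right_mono)
    then have "0 \<le> \<lceil>y $ k / h\<rceil>" "\<lceil>y $ k / h\<rceil> \<le> \<lceil>1 / h\<rceil>" for k
      by (auto intro!: ceiling_mono simp: zero_le_ceiling intro: order.strict_trans[of "-1" 0])
    then show "f \<in> {f. \<forall>k. f k \<in> {0..\<lceil>1 / h\<rceil>}}" unfolding y(2) cell_def by simp
  qed
  moreover have "finite {f :: 'd \<Rightarrow> int. \<forall>k. f k \<in> {0..\<lceil>1 / h\<rceil>}}"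
    using finite_PiE[of "UNIV :: 'd set" "\<lambda>_. {0..\<lceil>1 / h\<rceil>}"] by (simp add: PiE_UNIV_domain Pi_def)
  ultimately show ?thesis by (rule finite_subset)
qed

lemma conv_cell:
  assumes h: "0 < h" and small: "\<And>x. x \<in> K \<Longrightarrow> norm x + real CARD('d) * h < 1" and \<kappa>: "\<kappa> \<in> cell h ` K"
  shows "conv {y. cell h y = \<kappa>}"
proof -
  obtain z where z: "z \<in> K" "\<kappa> = cell h z" using \<kappa> by auto
  define b where "b = (\<chi> k. h * of_int (\<kappa> k))"
  define a where "a = (\<chi> k. h * (of_int (\<kappa> k) - 1))"
  have zpos: "0 < z $ k" for k using z K_latent by (auto simp: latent_space_def)
  have kap: "1 \<le> \<kappa> k" for k using zpos[of k] h by (simp add: z(2) cell_def one_le_ceiling)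
  \<comment> \<open>The upper corner belongs to its own cube, so it is close to \<open>z\<close> and
    inside the unit ball. The lower corner is nonnegative because \<open>z\<close> has positive
    coordinates.\<close>
  have "cell h b = cell h z"
    unfolding cell_def b_def using h by (simp add: z(2) cell_def)
  then have "norm (b - z) \<le> real CARD('d) * h" by (rule cell_near[OF h])
  then have "norm b < 1" using small[OF z(1)] norm_triangle_ineq[of "b - z" z] by simp
  moreover have "0 \<le> a $ k" for k using kap[of k] h by (simp add: a_def)
  moreover have "a $ k \<le> b $ k" for k using h by (simp add: a_def b_def)
  ultimately have "conv {y. (\<forall>k. y $ k \<le> b $ k) \<and> (\<forall>k\<in>UNIV. a $ k < y $ k)}"
    by (intro conv_box) auto
  also have "{y. (\<forall>k. y $ k \<le> b $ k) \<and> (\<forall>k\<in>UNIV. a $ k < y $ k)} = {y. cell h y = \<kappa>}"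
    using h by (auto simp: cell_def fun_eq_iff a_def b_def ceiling_eq_iff field_simps)
  finally show ?thesis .
qed

lemma emp_cells:
  assumes h: "0 < h" and n: "0 < n"
  shows "(\<Sum>\<kappa>\<in>cell h ` K. emp x0 n {y. cell h y = \<kappa>}) = 1"
proof -
  have "(\<Sum>\<kappa>\<in>cell h ` K. \<Sum>i<n. of_bool (cell h (x0 i) = \<kappa>)) = (\<Sum>i<n. \<Sum>\<kappa>\<in>cell h ` K. of_bool (\<kappa> = cell h (x0 i)) :: real)"
    by (subst sum.swap) (simp add: eq_commute)
  also have "\<dots> = (\<Sum>i<n. 1)"
    using x0_K finite_cells[OF h] by (intro sum.cong refl) (simp add: of_bool_def)
  finally show ?thesis using n by (simp add: emp_def flip: sum_divide_distrib)
qed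

lemma small_mesh:
  obtains h0 where "0 < h0" "\<And>h x. h \<le> h0 \<Longrightarrow> x \<in> K \<Longrightarrow> norm x + real CARD('d) * h < 1"
proof -
  obtain c where c: "c < 1" "\<And>x. x \<in> K \<Longrightarrow> norm x \<le> c" by (rule K_norm) blast
  define h0 where "h0 = (1 - c) / (2 * real CARD('d))"
  show thesis
  proof (rule that[of h0])
    show "0 < h0" using c by (simp add: h0_def)
    fix h x assume "h \<le> h0" "x \<in> K"
    then have "real CARD('d) * h \<le> real CARD('d) * h0" by (intro mult_left_mono) auto
    also have "\<dots> = (1 - c) / 2" by (simp add: h0_def)
    finally show "norm x + real CARD('d) * h < 1" using c(2)[OF \<open>x \<in> K\<close>] c(1) by (simp add: field_simps)
  qed
qed

text \<open>The empirical masses of the finitely many cells meeting \<open>K\<close> always sum to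
  1, and each of them converges, so no mass of \<open>F\<close> escapes from these cells.\<close>

lemma F_cells:
  assumes h: "0 < h" and small: "\<And>x. x \<in> K \<Longrightarrow> norm x + real CARD('d) * h < 1"
  shows "(\<Sum>\<kappa>\<in>cell h ` K. measure F {y. cell h y = \<kappa>}) = 1"
proof -
  have "(\<lambda>n. \<Sum>\<kappa>\<in>cell h ` K. emp x0 n {y. cell h y = \<kappa>}) \<longlonglongrightarrow> (\<Sum>\<kappa>\<in>cell h ` K. measure F {y. cell h y = \<kappa>})"
    using conv_cell[OF h small] unfolding conv_def by (intro tendsto_sum) auto
  moreover have "(\<lambda>n. \<Sum>\<kappa>\<in>cell h ` K. emp x0 n {y. cell h y = \<kappa>}) \<longlonglongrightarrow> 1"
    by (rule tendsto_eventually, rule eventually_mono[OF eventually_gt_at_top[of 0] emp_cells[OF h]])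
  ultimately show ?thesis by (rule LIMSEQ_unique)
qed

text \<open>The support of \<open>F\<close> is not assumed to lie in \<open>K\<close>; it is forced
  by the convergence. For each mesh almost every point lies in a cell meeting \<open>K\<close>, and
  for a sequence of meshes tending to 0 such a point is a limit of points of the closed set
  \<open>K\<close>.\<close>

lemma AE_K: "AE y in F. y \<in> K"
proof -
  obtain h0 where h0: "0 < h0" "\<And>h x. h \<le> h0 \<Longrightarrow> x \<in> K \<Longrightarrow> norm x + real CARD('d) * h < 1" by (rule small_mesh) blast
  define h where "h = (\<lambda>m. h0 / real (Suc m))"
  have hpos: "0 < h m" for m using h0 by (simp add: h_def)
  have hle: "h m \<le> h0" for m using h0(1) by (simp add: h_def field_simps)
  have "AE y in F. cell (h m) y \<in> cell (h m) ` K" for m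
  proof -
    have sm: "\<And>x. x \<in> K \<Longrightarrow> norm x + real CARD('d) * h m < 1" using h0(2)[OF hle] .
    define U where "U = (\<Union>\<kappa>\<in>cell (h m) ` K. {y. cell (h m) y = \<kappa>})"
    have meas: "{y. cell (h m) y = \<kappa>} \<in> sets F" if "\<kappa> \<in> cell (h m) ` K" for \<kappa>
      using conv_cell[OF hpos sm that] by (simp add: conv_def sets_F)
    have "measure F U = (\<Sum>\<kappa>\<in>cell (h m) ` K. measure F {y. cell (h m) y = \<kappa>})"
      unfolding U_def using meas finite_cells[OF hpos]
      by (intro F.finite_measure_finite_Union) (auto simp: disjoint_family_on_def)
    then have "measure F U = 1" using F_cells[OF hpos sm] by simp
    moreover have "U \<in> sets F" unfolding U_def using meas finite_cells[OF hpos] by (intro sets.finite_UN) auto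
    ultimately have "AE y in F. y \<in> U" by (subst F.prob_eq_1[symmetric])
    then show ?thesis by (rule AE_mp) (auto simp: U_def)
  qed
  then have "AE y in F. \<forall>m. cell (h m) y \<in> cell (h m) ` K" by (simp add: AE_all_countable)
  then show ?thesis
  proof (rule AE_mp, intro AE_I2 impI)
    fix y assume y: "\<forall>m. cell (h m) y \<in> cell (h m) ` K"
    have lim: "(\<lambda>m. real CARD('d) * h m) \<longlonglongrightarrow> 0"
      unfolding h_def by (intro tendsto_mult_right_zero LIMSEQ_Suc[OF lim_const_over_n])
    have "y \<in> closure K"
      unfolding closure_approachable
    proof (intro allI impI)
      fix e :: real assume "0 < e"
      then obtain m where m: "real CARD('d) * h m < e"
        using order_tendstoD(2)[OF lim] by (auto simp: eventually_sequentially)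
      obtain z where z: "z \<in> K" "cell (h m) y = cell (h m) z" using y by auto
      have "dist z y < e" using cell_near[OF hpos z(2)] m by (simp add: dist_norm norm_minus_commute)
      then show "\<exists>z\<in>K. dist z y < e" using z by auto
    qed
    then show "y \<in> K" using K_compact by (simp add: compact_imp_closed)
  qed
qed

lemma K_sets [measurable]: "K \<in> sets borel"
  using K_compact by (simp add: borel_compact)

section \<open>Averages and integrals of continuous functions over \<open>K\<close>\<close>

lemma continuous_on_K_integrable:
  fixes f :: "real^'d \<Rightarrow> 'b::{banach, second_countable_topology}"
  assumes "continuous_on K f"
  shows "integrable F (\<lambda>y. indicator K y *\<^sub>R f y)"
proof -
  obtain B where B: "\<And>y. y \<in> K \<Longrightarrow> norm (f y) \<le> B"
    using compact_imp_bounded[OF compact_continuous_image[OF assms K_compact]] by (auto simp: bounded_iff)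
  have "(\<lambda>y. indicator K y *\<^sub>R f y) \<in> borel_measurable borel"
    using assms K_sets by (rule borel_measurable_continuous_on_indicator[rotated])
  moreover have "norm (indicator K y *\<^sub>R f y) \<le> max B 0" for y
    using B[of y] by (cases "y \<in> K") auto
  ultimately show ?thesis
    by (intro F.integrable_const_bound[of _ "max B 0"]) (auto simp: measurable_cong_sets[OF sets_F refl])
qed

lemma continuous_on_section:
  assumes "continuous_on (\<Theta> \<times> K) (\<lambda>(\<theta>, y). f \<theta> y)" "\<theta> \<in> \<Theta>"
  shows "continuous_on K (f \<theta>)"
proof -
  have "continuous_on K (\<lambda>y. (\<lambda>(\<theta>, y). f \<theta> y) (\<theta>, y))"
    by (rule continuous_on_compose2[OF assms(1)]) (use assms(2) in \<open>auto intro!: continuous_intros\<close>)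
  then show ?thesis by simp
qed

text \<open>Uniform continuity on the compact product replaces the average and the integral by step
  functions on the same grid, with an error that does not depend on the parameter. Only finitely
  many cell masses then have to converge.\<close>

theorem uniform_LLN:
  fixes f :: "'c::metric_space \<Rightarrow> real^'d \<Rightarrow> 'b::{banach, second_countable_topology}"
  assumes \<Theta>: "compact \<Theta>" and cont: "continuous_on (\<Theta> \<times> K) (\<lambda>(\<theta>, y). f \<theta> y)" and \<epsilon>: "0 < \<epsilon>"
  shows "\<forall>\<^sub>F n in sequentially. \<forall>\<theta>\<in>\<Theta>. norm (avg n (\<lambda>i. f \<theta> (x0 i)) - (LINT y:K|F. f \<theta> y)) \<le> \<epsilon>"
proof -
  define e where "e = \<epsilon> / 3"
  have e: "0 < e" using \<epsilon> by (simp add: e_def)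
  have comp: "compact (\<Theta> \<times> K)" by (intro compact_Times \<Theta> K_compact)
  obtain B where B: "\<And>\<theta> y. \<theta> \<in> \<Theta> \<Longrightarrow> y \<in> K \<Longrightarrow> norm (f \<theta> y) \<le> B"
    using compact_imp_bounded[OF compact_continuous_image[OF cont comp]] by (fastforce simp: bounded_iff)
  define B' where "B' = max B 0"
  have B': "0 \<le> B'" "\<And>\<theta> y. \<theta> \<in> \<Theta> \<Longrightarrow> y \<in> K \<Longrightarrow> norm (f \<theta> y) \<le> B'" using B by (auto simp: B'_def intro: max.coboundedI1)
  obtain d where d: "0 < d" "\<And>u v. u \<in> \<Theta> \<times> K \<Longrightarrow> v \<in> \<Theta> \<times> K \<Longrightarrow> dist v u < d \<Longrightarrow> dist (case v of (\<theta>, y) \<Rightarrow> f \<theta> y) (case u of (\<theta>, y) \<Rightarrow> f \<theta> y) < e"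
    using compact_uniformly_continuous[OF cont comp] e unfolding uniformly_continuous_on_def by metis
  have d': "norm (f \<theta> y - f \<theta> z) \<le> e" if "\<theta> \<in> \<Theta>" "y \<in> K" "z \<in> K" "norm (y - z) < d" for \<theta> y z
    using d(2)[of "(\<theta>, z)" "(\<theta>, y)"] that by (simp add: dist_Pair_Pair dist_norm)
  obtain h0 where h0: "0 < h0" "\<And>h x. h \<le> h0 \<Longrightarrow> x \<in> K \<Longrightarrow> norm x + real CARD('d) * h < 1" by (rule small_mesh) blast
  define h where "h = min h0 (d / (2 * real CARD('d)))"
  have h: "0 < h" "h \<le> h0" "real CARD('d) * h < d"
  proof -
    show "0 < h" "h \<le> h0" using h0 d by (auto simp: h_def)
    have "real CARD('d) * h \<le> real CARD('d) * (d / (2 * real CARD('d)))" by (intro mult_left_mono) (auto simp: h_def)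
    also have "\<dots> < d" using d by simp
    finally show "real CARD('d) * h < d" .
  qed
  note sm = h0(2)[OF h(2)]
  define I where "I = cell h ` K"
  have finI: "finite I" unfolding I_def by (rule finite_cells[OF h(1)])
  define C where "C = (\<lambda>\<kappa>. {y. cell h y = \<kappa>})"
  have C: "conv (C \<kappa>)" if "\<kappa> \<in> I" for \<kappa> unfolding C_def using conv_cell[OF h(1) sm] that by (simp add: I_def)
  have Cm: "C \<kappa> \<in> sets F" if "\<kappa> \<in> I" for \<kappa> using C[OF that] by (simp add: conv_def sets_F)
  define rep where "rep = (\<lambda>\<kappa>. SOME y. y \<in> K \<and> cell h y = \<kappa>)"
  have rep: "rep \<kappa> \<in> K" "cell h (rep \<kappa>) = \<kappa>" if "\<kappa> \<in> I" for \<kappa>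
    using that someI_ex[of "\<lambda>y. y \<in> K \<and> cell h y = \<kappa>"] unfolding I_def rep_def by auto
  have near: "norm (f \<theta> y - f \<theta> (rep (cell h y))) \<le> e" if "\<theta> \<in> \<Theta>" "y \<in> K" for \<theta> y
  proof (rule d')
    have yI: "cell h y \<in> I" using that by (simp add: I_def)
    show "norm (y - rep (cell h y)) < d" using cell_near[OF h(1), of y "rep (cell h y)"] rep(2)[OF yI] h(3) by simp
    show "rep (cell h y) \<in> K" by (rule rep(1)[OF yI])
  qed (use that in auto)
  have step: "norm (avg n (\<lambda>i. f \<theta> (x0 i)) - (\<Sum>\<kappa>\<in>I. emp x0 n (C \<kappa>) *\<^sub>R f \<theta> (rep \<kappa>))) \<le> e" if "\<theta> \<in> \<Theta>" "0 < n" for \<theta> n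
  proof -
    have "(\<Sum>\<kappa>\<in>I. emp x0 n (C \<kappa>) *\<^sub>R f \<theta> (rep \<kappa>)) = avg n (\<lambda>i. f \<theta> (rep (cell h (x0 i))))"
    proof -
      have "(\<Sum>\<kappa>\<in>I. emp x0 n (C \<kappa>) *\<^sub>R f \<theta> (rep \<kappa>)) = (\<Sum>\<kappa>\<in>I. (1 / real n) *\<^sub>R (\<Sum>i<n. if \<kappa> = cell h (x0 i) then f \<theta> (rep \<kappa>) else 0))"
      proof (intro sum.cong refl)
        fix \<kappa>
        have "emp x0 n (C \<kappa>) *\<^sub>R f \<theta> (rep \<kappa>) = (1 / real n) *\<^sub>R (\<Sum>i<n. of_bool (x0 i \<in> C \<kappa>) *\<^sub>R f \<theta> (rep \<kappa>))"
          unfolding emp_def scaleR_sum_left[symmetric] scaleR_scaleR by simp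
        also have "(\<Sum>i<n. of_bool (x0 i \<in> C \<kappa>) *\<^sub>R f \<theta> (rep \<kappa>)) = (\<Sum>i<n. if \<kappa> = cell h (x0 i) then f \<theta> (rep \<kappa>) else 0)"
          by (intro sum.cong) (auto simp: C_def)
        finally show "emp x0 n (C \<kappa>) *\<^sub>R f \<theta> (rep \<kappa>) = (1 / real n) *\<^sub>R (\<Sum>i<n. if \<kappa> = cell h (x0 i) then f \<theta> (rep \<kappa>) else 0)" .
      qed
      also have "\<dots> = (1 / real n) *\<^sub>R (\<Sum>i<n. \<Sum>\<kappa>\<in>I. if \<kappa> = cell h (x0 i) then f \<theta> (rep \<kappa>) else 0)"
        by (subst sum.swap) (simp add: scaleR_sum_right)
      also have "\<dots> = avg n (\<lambda>i. f \<theta> (rep (cell h (x0 i))))"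
        unfolding avg_def using finI x0_K by (intro arg_cong[where f="\<lambda>v. _ *\<^sub>R v"] sum.cong) (auto simp: I_def)
      finally show ?thesis .
    qed
    then show ?thesis using near[OF that(1) x0_K] that(2) by (simp add: avg_diff norm_avg_le)
  qed
  \<comment> \<open>Outside \<open>K\<close> the step function need not approximate f;
    \<open>AE_K\<close> makes this irrelevant for the integral.\<close>
  have stepF: "norm ((LINT y:K|F. f \<theta> y) - (\<Sum>\<kappa>\<in>I. measure F (C \<kappa>) *\<^sub>R f \<theta> (rep \<kappa>))) \<le> e" if \<theta>: "\<theta> \<in> \<Theta>" for \<theta>
  proof -
    have cf: "continuous_on K (f \<theta>)" using continuous_on_section[OF cont \<theta>] .
    have int2: "integrable F (\<lambda>y. \<Sum>\<kappa>\<in>I. indicator (C \<kappa>) y *\<^sub>R f \<theta> (rep \<kappa>))"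
      using Cm by (intro Bochner_Integration.integrable_sum) (auto simp: F.emeasure_eq_measure)
    have "(\<Sum>\<kappa>\<in>I. measure F (C \<kappa>) *\<^sub>R f \<theta> (rep \<kappa>)) = (\<integral>y. (\<Sum>\<kappa>\<in>I. indicator (C \<kappa>) y *\<^sub>R f \<theta> (rep \<kappa>)) \<partial>F)"
      using Cm by (subst Bochner_Integration.integral_sum) (auto simp: F.emeasure_eq_measure)
    then have "(LINT y:K|F. f \<theta> y) - (\<Sum>\<kappa>\<in>I. measure F (C \<kappa>) *\<^sub>R f \<theta> (rep \<kappa>))
       = (\<integral>y. indicator K y *\<^sub>R f \<theta> y - (\<Sum>\<kappa>\<in>I. indicator (C \<kappa>) y *\<^sub>R f \<theta> (rep \<kappa>)) \<partial>F)"
      unfolding set_lebesgue_integral_def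
      by (subst Bochner_Integration.integral_diff[OF continuous_on_K_integrable[OF cf] int2]) simp
    also have "norm \<dots> \<le> (\<integral>y. e \<partial>F)"
    proof (rule order.trans[OF integral_norm_bound integral_mono_AE])
      show "integrable F (\<lambda>y. norm (indicator K y *\<^sub>R f \<theta> y - (\<Sum>\<kappa>\<in>I. indicator (C \<kappa>) y *\<^sub>R f \<theta> (rep \<kappa>))))"
        by (rule integrable_norm, rule Bochner_Integration.integrable_diff[OF continuous_on_K_integrable[OF cf] int2])
      show "AE y in F. norm (indicator K y *\<^sub>R f \<theta> y - (\<Sum>\<kappa>\<in>I. indicator (C \<kappa>) y *\<^sub>R f \<theta> (rep \<kappa>))) \<le> e"
        using AE_K
      proof (rule AE_mp, intro AE_I2 impI)
        fix y assume y: "y \<in> K"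
        have "(\<Sum>\<kappa>\<in>I. indicator (C \<kappa>) y *\<^sub>R f \<theta> (rep \<kappa>)) = (\<Sum>\<kappa>\<in>I. if \<kappa> = cell h y then f \<theta> (rep \<kappa>) else 0)"
          by (intro sum.cong) (auto simp: C_def indicator_def)
        also have "\<dots> = f \<theta> (rep (cell h y))" using y finI by (simp add: I_def)
        finally show "norm (indicator K y *\<^sub>R f \<theta> y - (\<Sum>\<kappa>\<in>I. indicator (C \<kappa>) y *\<^sub>R f \<theta> (rep \<kappa>))) \<le> e"
          using y near[OF \<theta> y] by simp
      qed
    qed auto
    finally show ?thesis by (simp add: prob_UNIV)
  qed
  \<comment> \<open>The only estimate that depends on n. The bound \<open>B'\<close> for f holds for
    all parameters, so the convergence is uniform in them.\<close>
  have "(\<lambda>n. \<Sum>\<kappa>\<in>I. \<bar>emp x0 n (C \<kappa>) - measure F (C \<kappa>)\<bar> * B') \<longlonglongrightarrow> (\<Sum>\<kappa>\<in>I. \<bar>measure F (C \<kappa>) - measure F (C \<kappa>)\<bar> * B')"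
    using C unfolding conv_def by (intro tendsto_intros) auto
  then have "\<forall>\<^sub>F n in sequentially. (\<Sum>\<kappa>\<in>I. \<bar>emp x0 n (C \<kappa>) - measure F (C \<kappa>)\<bar> * B') < e"
    using e by (intro order_tendstoD(2)) auto
  then show ?thesis
    using eventually_gt_at_top[of 0]
  proof eventually_elim
    case (elim n)
    show ?case
    proof
      fix \<theta> assume \<theta>: "\<theta> \<in> \<Theta>"
      have "norm ((\<Sum>\<kappa>\<in>I. emp x0 n (C \<kappa>) *\<^sub>R f \<theta> (rep \<kappa>)) - (\<Sum>\<kappa>\<in>I. measure F (C \<kappa>) *\<^sub>R f \<theta> (rep \<kappa>)))
         \<le> (\<Sum>\<kappa>\<in>I. \<bar>emp x0 n (C \<kappa>) - measure F (C \<kappa>)\<bar> * B')"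
        unfolding sum_subtractf[symmetric] scaleR_diff_left[symmetric]
        by (intro order.trans[OF norm_sum] sum_mono) (auto intro!: mult_left_mono B' \<theta> rep)
      also have "\<dots> \<le> e" using elim by simp
      finally have mid: "norm ((\<Sum>\<kappa>\<in>I. emp x0 n (C \<kappa>) *\<^sub>R f \<theta> (rep \<kappa>)) - (\<Sum>\<kappa>\<in>I. measure F (C \<kappa>) *\<^sub>R f \<theta> (rep \<kappa>))) \<le> e" .
      have tri: "norm (p - s) \<le> e + e + e" if "norm (p - q) \<le> e" "norm (q - r) \<le> e" "norm (s - r) \<le> e" for p q r s :: 'b
      proof -
        have "norm (p - s) = norm ((p - q) + (q - r) - (s - r))" by simp
        also have "\<dots> \<le> norm (p - q) + norm (q - r) + norm (s - r)"
          using norm_triangle_ineq4[of "(p - q) + (q - r)" "s - r"] norm_triangle_ineq[of "p - q" "q - r"] by linarith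
        finally show ?thesis using that by linarith
      qed
      show "norm (avg n (\<lambda>i. f \<theta> (x0 i)) - (LINT y:K|F. f \<theta> y)) \<le> \<epsilon>"
        using tri[OF step[OF \<theta> elim(2)] mid stepF[OF \<theta>]] by (simp add: e_def)
    qed
  qed
qed

lemma continuous_on_param_integral:
  fixes f :: "'c::metric_space \<Rightarrow> real^'d \<Rightarrow> 'b::{banach, second_countable_topology}"
  assumes \<Theta>: "compact \<Theta>" and cont: "continuous_on (\<Theta> \<times> K) (\<lambda>(\<theta>, y). f \<theta> y)"
  shows "continuous_on \<Theta> (\<lambda>\<theta>. LINT y:K|F. f \<theta> y)"
proof -
  have comp: "compact (\<Theta> \<times> K)" by (intro compact_Times \<Theta> K_compact)
  have cf: "continuous_on K (f \<theta>)" if "\<theta> \<in> \<Theta>" for \<theta>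
    using continuous_on_section[OF cont that] .
  show ?thesis
    unfolding continuous_on_iff
  proof (intro ballI allI impI)
    fix \<theta> and e :: real assume \<theta>: "\<theta> \<in> \<Theta>" and e: "0 < e"
    obtain d where d: "0 < d" "\<And>u v. u \<in> \<Theta> \<times> K \<Longrightarrow> v \<in> \<Theta> \<times> K \<Longrightarrow> dist v u < d \<Longrightarrow> dist (case v of (\<theta>, y) \<Rightarrow> f \<theta> y) (case u of (\<theta>, y) \<Rightarrow> f \<theta> y) < e / 2"
      using compact_uniformly_continuous[OF cont comp] e unfolding uniformly_continuous_on_def by (metis half_gt_zero)
    show "\<exists>d>0. \<forall>\<theta>'\<in>\<Theta>. dist \<theta>' \<theta> < d \<longrightarrow> dist (LINT y:K|F. f \<theta>' y) (LINT y:K|F. f \<theta> y) < e"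
    proof (intro exI[of _ d] conjI ballI impI d(1))
      fix \<theta>' assume \<theta>': "\<theta>' \<in> \<Theta>" "dist \<theta>' \<theta> < d"
      have near: "norm (f \<theta>' y - f \<theta> y) \<le> e / 2" if "y \<in> K" for y
        using d(2)[of "(\<theta>, y)" "(\<theta>', y)"] \<theta> \<theta>' that by (simp add: dist_Pair_Pair dist_norm)
      have "(LINT y:K|F. f \<theta>' y) - (LINT y:K|F. f \<theta> y) = (\<integral>y. indicator K y *\<^sub>R f \<theta>' y - indicator K y *\<^sub>R f \<theta> y \<partial>F)"
        unfolding set_lebesgue_integral_def
        by (subst Bochner_Integration.integral_diff[OF continuous_on_K_integrable[OF cf[OF \<theta>'(1)]] continuous_on_K_integrable[OF cf[OF \<theta>]]]) simp
      also have "norm \<dots> \<le> (\<integral>y. e / 2 \<partial>F)"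
        using near e by (intro Bochner_Integration.integral_norm_bound_integral Bochner_Integration.integrable_diff
            continuous_on_K_integrable cf \<theta> \<theta>' AE_I2) (auto simp: indicator_def)
      finally show "dist (LINT y:K|F. f \<theta>' y) (LINT y:K|F. f \<theta> y) < e"
        using e by (simp add: prob_UNIV dist_norm)
    qed
  qed
qed

text \<open>The kernels may depend on \<open>n\<close>, and the diagonal is left out because the adjacency matrix has none.\<close>
lemma double_LLN:
  fixes k :: "real^'d \<Rightarrow> real^'d \<Rightarrow> real"
  assumes cont: "continuous_on (K \<times> K) (\<lambda>(x, y). k x y)"
    and unif: "\<And>\<epsilon>. 0 < \<epsilon> \<Longrightarrow> \<forall>\<^sub>F n in sequentially. \<forall>x\<in>K. \<forall>y\<in>K. \<bar>kn n x y - k x y\<bar> \<le> \<epsilon>"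
  shows "(\<lambda>n. (\<Sum>i<n. \<Sum>j\<in>{..<n} - {i}. kn n (x0 i) (x0 j)) / (real n)\<^sup>2) \<longlonglongrightarrow> (LINT x:K|F. LINT y:K|F. k x y)"
proof (rule tendstoI)
  fix \<epsilon> :: real assume \<epsilon>: "0 < \<epsilon>"
  define e where "e = \<epsilon> / 5"
  have e: "0 < e" using \<epsilon> by (simp add: e_def)
  obtain B0 where B0: "\<And>x y. x \<in> K \<Longrightarrow> y \<in> K \<Longrightarrow> \<bar>k x y\<bar> \<le> B0"
    using compact_imp_bounded[OF compact_continuous_image[OF cont compact_Times[OF K_compact K_compact]]]
    by (fastforce simp: bounded_iff)
  define B where "B = max B0 0"
  have B: "0 \<le> B" "\<And>x y. x \<in> K \<Longrightarrow> y \<in> K \<Longrightarrow> \<bar>k x y\<bar> \<le> B" using B0 by (auto simp: B_def intro: max.coboundedI1)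
  define H where "H = (\<lambda>x. LINT y:K|F. k x y)"
  have Hcont: "continuous_on K H" unfolding H_def by (rule continuous_on_param_integral[OF K_compact cont])
  \<comment> \<open>A parameter space with one point turns \<open>uniform_LLN\<close> into the
    ordinary law of large numbers, here for the inner integral \<open>H\<close>.\<close>
  have "continuous_on ({0} \<times> K) (\<lambda>p :: real \<times> (real^'d). H (snd p))"
    by (rule continuous_on_compose2[OF Hcont]) (auto intro: continuous_on_snd continuous_on_id)
  then have Hc: "continuous_on ({0} \<times> K) (\<lambda>(u::real, y). H y)"
    by (simp only: split_def)
  have dm: "(\<lambda>n. B / real n) \<longlonglongrightarrow> 0" by (rule lim_const_over_n)
  show "\<forall>\<^sub>F n in sequentially. dist ((\<Sum>i<n. \<Sum>j\<in>{..<n} - {i}. kn n (x0 i) (x0 j)) / (real n)\<^sup>2) (LINT x:K|F. LINT y:K|F. k x y) < \<epsilon>"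
    using uniform_LLN[OF K_compact cont e] uniform_LLN[OF compact_sing Hc e] unif[OF e] order_tendstoD(2)[OF dm e] eventually_gt_at_top[of 0]
  proof (eventually_elim)
    case (elim n)
    have n: "0 < real n" using elim by simp
    have "norm (avg n (\<lambda>i. H (x0 i)) - (LINT y:K|F. H y)) \<le> e" using elim(2) by simp
    then have 1: "\<bar>avg n (\<lambda>i. H (x0 i)) - (LINT x:K|F. LINT y:K|F. k x y)\<bar> \<le> e" by (simp add: H_def)
    have 2: "\<bar>avg n (\<lambda>i. avg n (\<lambda>j. k (x0 i) (x0 j))) - avg n (\<lambda>i. H (x0 i))\<bar> \<le> e"
    proof -
      have "norm (avg n (\<lambda>j. k (x0 i) (x0 j)) - H (x0 i)) \<le> e" for i
        using elim(1) x0_K unfolding H_def by blast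
      then show ?thesis using norm_avg_le[of n "\<lambda>i. avg n (\<lambda>j. k (x0 i) (x0 j)) - H (x0 i)" e] n by (simp add: avg_diff)
    qed
    have 3: "\<bar>(\<Sum>i<n. \<Sum>j\<in>{..<n} - {i}. kn n (x0 i) (x0 j)) / (real n)\<^sup>2 - (\<Sum>i<n. \<Sum>j\<in>{..<n} - {i}. k (x0 i) (x0 j)) / (real n)\<^sup>2\<bar> \<le> e"
    proof -
      have "(\<Sum>i<n. \<Sum>j\<in>{..<n} - {i}. kn n (x0 i) (x0 j)) / (real n)\<^sup>2 - (\<Sum>i<n. \<Sum>j\<in>{..<n} - {i}. k (x0 i) (x0 j)) / (real n)\<^sup>2
         = (\<Sum>i<n. \<Sum>j\<in>{..<n} - {i}. kn n (x0 i) (x0 j) - k (x0 i) (x0 j)) / (real n)\<^sup>2"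
        by (simp add: sum_subtractf diff_divide_distrib)
      also have "\<bar>\<dots>\<bar> \<le> (\<Sum>i<n. \<Sum>j<n. e) / (real n)\<^sup>2"
      proof -
        have "\<bar>\<Sum>i<n. \<Sum>j\<in>{..<n} - {i}. kn n (x0 i) (x0 j) - k (x0 i) (x0 j)\<bar> \<le> (\<Sum>i<n. \<Sum>j\<in>{..<n} - {i}. e)"
          using elim(3) x0_K by (intro order.trans[OF sum_abs] sum_mono) auto
        also have "\<dots> \<le> (\<Sum>i<n. \<Sum>j<n. e)" using e by (intro sum_mono sum_mono2) auto
        finally show ?thesis using n by (simp add: divide_right_mono)
      qed
      finally show ?thesis using n by (simp add: power2_eq_square)
    qed
    have 4: "\<bar>(\<Sum>i<n. \<Sum>j\<in>{..<n} - {i}. k (x0 i) (x0 j)) / (real n)\<^sup>2 - avg n (\<lambda>i. avg n (\<lambda>j. k (x0 i) (x0 j)))\<bar> \<le> e"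
    proof -
      have dd: "avg n (\<lambda>i. avg n (\<lambda>j. k (x0 i) (x0 j))) = (\<Sum>i<n. \<Sum>j<n. k (x0 i) (x0 j)) / (real n)\<^sup>2"
        by (simp add: avg_def power2_eq_square sum_divide_distrib[symmetric])
      have "(\<Sum>i<n. \<Sum>j<n. k (x0 i) (x0 j)) = (\<Sum>i<n. k (x0 i) (x0 i) + (\<Sum>j\<in>{..<n} - {i}. k (x0 i) (x0 j)))"
        by (intro sum.cong refl sum.remove) auto
      then have "avg n (\<lambda>i. avg n (\<lambda>j. k (x0 i) (x0 j))) = ((\<Sum>i<n. k (x0 i) (x0 i)) + (\<Sum>i<n. \<Sum>j\<in>{..<n} - {i}. k (x0 i) (x0 j))) / (real n)\<^sup>2"
        unfolding dd by (simp only: sum.distrib)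
      then have "\<bar>(\<Sum>i<n. \<Sum>j\<in>{..<n} - {i}. k (x0 i) (x0 j)) / (real n)\<^sup>2 - avg n (\<lambda>i. avg n (\<lambda>j. k (x0 i) (x0 j)))\<bar>
         = \<bar>\<Sum>i<n. k (x0 i) (x0 i)\<bar> / (real n)\<^sup>2"
        by (simp add: add_divide_distrib)
      also have "\<dots> \<le> (\<Sum>i<n. B) / (real n)\<^sup>2"
        using B x0_K by (intro divide_right_mono order.trans[OF sum_abs] sum_mono) auto
      also have "\<dots> = B / real n" using n by (simp add: power2_eq_square)
      finally show ?thesis using elim(4) by simp
    qed
    have "\<bar>a - s\<bar> \<le> 4 * e" if "\<bar>a - b\<bar> \<le> e" "\<bar>b - c\<bar> \<le> e" "\<bar>c - q\<bar> \<le> e" "\<bar>q - s\<bar> \<le> e" for a b c q s :: real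
    proof -
      have "a - s \<le> 4 * e" "s - a \<le> 4 * e" using that unfolding abs_le_iff by linarith+
      then show ?thesis by (simp add: abs_le_iff)
    qed
    from this[OF 3 4 2 1] show ?case using e unfolding dist_real_def e_def by linarith
  qed
qed

end

subsection \<open>Positive definite matrices\<close>

lemma matrix_ext_inner:
  fixes A B :: "real^'d^'d"
  shows "(\<And>u v. u \<bullet> (A *v v) = u \<bullet> (B *v v)) \<Longrightarrow> A = B"
  by (metis matrix_eq vector_eq_ldot)

lemma inner_transpose: "u \<bullet> (transpose A *v v) = v \<bullet> (A *v u)" for A :: "real^'d^'d"
  by (metis dot_lmul_matrix inner_commute transpose_matrix_vector)

lemma symmetric_iff_inner:
  fixes A :: "real^'d^'d"
  shows "transpose A = A \<longleftrightarrow> (\<forall>u v. u \<bullet> (A *v v) = v \<bullet> (A *v u))"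
  using inner_transpose[of _ A] matrix_ext_inner[of "transpose A" A] by metis

lemma symmetric_inner: "transpose A = A \<Longrightarrow> u \<bullet> (A *v v) = (A *v u) \<bullet> v" for A :: "real^'d^'d"
  by (metis inner_commute symmetric_iff_inner)

lemma invertible_matrix_inv_mult:
  fixes A :: "real^'d^'d"
  assumes "invertible A"
  shows "A *v (matrix_inv A *v v) = v" "matrix_inv A *v (A *v v) = v"
  using invertible_matrix_inv[OF assms] by (simp_all add: matrix_vector_mul_assoc)

lemma symmetric_matrix_inv:
  fixes A :: "real^'d^'d"
  assumes "invertible A" "transpose A = A"
  shows "transpose (matrix_inv A) = matrix_inv A"
  unfolding symmetric_iff_inner
proof (intro allI)
  fix u v
  have "u \<bullet> (matrix_inv A *v v) = (A *v (matrix_inv A *v u)) \<bullet> (matrix_inv A *v v)"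
    by (simp only: invertible_matrix_inv_mult[OF assms(1)])
  also have "\<dots> = (matrix_inv A *v u) \<bullet> (A *v (matrix_inv A *v v))"
    by (rule symmetric_inner[OF assms(2), symmetric])
  also have "\<dots> = v \<bullet> (matrix_inv A *v u)" by (simp add: invertible_matrix_inv_mult[OF assms(1)] inner_commute)
  finally show "u \<bullet> (matrix_inv A *v v) = v \<bullet> (matrix_inv A *v u)" .
qed

lemma lower_bound_norm:
  fixes A :: "real^'d^'d"
  assumes low: "\<And>v. l * (norm v)\<^sup>2 \<le> v \<bullet> (A *v v)"
  shows "l * norm v \<le> norm (A *v v)"
proof (cases "v = 0")
  case False
  have "norm v * (l * norm v) \<le> norm v * norm (A *v v)"
    using order.trans[OF low norm_cauchy_schwarz, of v] by (simp add: power2_eq_square mult_ac)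
  then show ?thesis using False by simp
qed simp

lemma lower_bound_invertible:
  fixes A :: "real^'d^'d"
  assumes "0 < l" and low: "\<And>v. l * (norm v)\<^sup>2 \<le> v \<bullet> (A *v v)"
  shows "invertible A"
proof -
  have "v = 0" if "A *v v = 0" for v
    using lower_bound_norm[OF low, of v] that assms(1) by (simp add: mult_le_0_iff)
  then show ?thesis unfolding invertible_left_inverse matrix_left_invertible_ker by blast
qed

lemma lower_bound_matrix_inv:
  fixes A :: "real^'d^'d"
  assumes l: "0 < l" and low: "\<And>v. l * (norm v)\<^sup>2 \<le> v \<bullet> (A *v v)"
  shows "norm (matrix_inv A *v v) \<le> norm v / l"
  using lower_bound_norm[OF low, of "matrix_inv A *v v"] l
  by (simp add: invertible_matrix_inv_mult[OF lower_bound_invertible[OF l low]] field_simps)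

text \<open>The resolvent identity: the difference of the inverses is the inverse of A times (B - A)
  times the inverse of B.\<close>

lemma matrix_inv_diff:
  fixes A B :: "real^'d^'d"
  assumes l: "0 < l" and A: "\<And>v. l * (norm v)\<^sup>2 \<le> v \<bullet> (A *v v)" and B: "\<And>v. l * (norm v)\<^sup>2 \<le> v \<bullet> (B *v v)"
  shows "norm (matrix_inv A *v w - matrix_inv B *v w) \<le> norm (A - B) * norm w / l\<^sup>2"
proof -
  note iA = invertible_matrix_inv_mult[OF lower_bound_invertible[OF l A]]
  note iB = invertible_matrix_inv_mult[OF lower_bound_invertible[OF l B]]
  have "matrix_inv A *v w - matrix_inv B *v w = matrix_inv A *v ((B - A) *v (matrix_inv B *v w))"
    by (simp add: matrix_vector_mult_diff_rdistrib matrix_vector_mult_diff_distrib iA iB)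
  also have "norm \<dots> \<le> norm ((B - A) *v (matrix_inv B *v w)) / l" by (rule lower_bound_matrix_inv[OF l A])
  also have "\<dots> \<le> (norm (B - A) * norm (matrix_inv B *v w)) / l"
    using l by (intro divide_right_mono norm_matrix_vector_le) auto
  also have "\<dots> \<le> (norm (B - A) * (norm w / l)) / l"
    using l by (intro divide_right_mono mult_left_mono lower_bound_matrix_inv[OF l B]) auto
  finally show ?thesis by (simp add: power2_eq_square norm_minus_commute)
qed

lemma lower_bound_perturb:
  fixes A B :: "real^'d^'d"
  assumes low: "\<And>v. l * (norm v)\<^sup>2 \<le> v \<bullet> (A *v v)" and d: "norm (B - A) \<le> l / 2"
  shows "(l / 2) * (norm v)\<^sup>2 \<le> v \<bullet> (B *v v)"
proof -
  have "\<bar>v \<bullet> ((B - A) *v v)\<bar> \<le> norm v * (norm (B - A) * norm v)"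
    by (rule order.trans[OF Cauchy_Schwarz_ineq2 mult_left_mono[OF norm_matrix_vector_le]]) simp
  also have "\<dots> \<le> norm v * (l / 2 * norm v)" using d by (intro mult_left_mono mult_right_mono) auto
  finally have "\<bar>v \<bullet> ((B - A) *v v)\<bar> \<le> (l / 2) * (norm v)\<^sup>2" by (simp add: power2_eq_square mult_ac)
  moreover have "v \<bullet> (B *v v) = v \<bullet> (A *v v) + v \<bullet> ((B - A) *v v)"
    by (simp add: matrix_vector_mult_diff_rdistrib inner_diff_right)
  moreover have "l * (norm v)\<^sup>2 = (l / 2) * (norm v)\<^sup>2 + (l / 2) * (norm v)\<^sup>2" by (simp add: field_simps)
  ultimately show ?thesis using low[of v] by linarith
qed

lemma continuous_on_matrix_vector:
  assumes "continuous_on S A" "continuous_on S v"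
  shows "continuous_on S (\<lambda>x. A x *v (v x :: real^'d) :: real^'e)"
  unfolding matrix_vector_mult_def by (intro continuous_intros assms)

text \<open>With a common lower bound l, \<open>matrix_inv_diff\<close> makes inversion Lipschitz on
  each column.\<close>

lemma continuous_on_matrix_inv:
  fixes A :: "'c::metric_space \<Rightarrow> real^'d^'d"
  assumes l: "0 < l" and low: "\<And>x v. x \<in> S \<Longrightarrow> l * (norm v)\<^sup>2 \<le> v \<bullet> (A x *v v)" and cont: "continuous_on S A"
  shows "continuous_on S (\<lambda>x. matrix_inv (A x))"
proof -
  have col: "continuous_on S (\<lambda>x. matrix_inv (A x) *v w)" for w
  proof (rule continuous_on_iff[THEN iffD2], intro ballI allI impI)
    fix x and e :: real assume x: "x \<in> S" and e: "0 < e"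
    define c where "c = (norm w + 1) / l\<^sup>2"
    have c: "0 < c" using l by (auto simp: c_def intro!: divide_pos_pos add_nonneg_pos)
    obtain d where d: "0 < d" "\<And>x'. x' \<in> S \<Longrightarrow> dist x' x < d \<Longrightarrow> dist (A x') (A x) < e / c"
      using cont[unfolded continuous_on_iff, rule_format, OF x divide_pos_pos[OF e c]] by blast
    show "\<exists>d>0. \<forall>x'\<in>S. dist x' x < d \<longrightarrow> dist (matrix_inv (A x') *v w) (matrix_inv (A x) *v w) < e"
    proof (intro exI[of _ d] conjI ballI impI d(1))
      fix x' assume x': "x' \<in> S" "dist x' x < d"
      have "norm (matrix_inv (A x') *v w - matrix_inv (A x) *v w) \<le> norm (A x' - A x) * norm w / l\<^sup>2"
        by (rule matrix_inv_diff[OF l low[OF x'(1)] low[OF x]])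
      also have "\<dots> \<le> norm (A x' - A x) * c" by (simp add: c_def divide_right_mono mult_left_mono)
      also have "\<dots> < e" using d(2)[OF x'] c by (simp add: dist_norm field_simps)
      finally show "dist (matrix_inv (A x') *v w) (matrix_inv (A x) *v w) < e" by (simp add: dist_norm)
    qed
  qed
  have ent: "matrix_inv (A x) $ i $ j = (matrix_inv (A x) *v axis j 1) $ i" for x i j
    by (simp add: matrix_vector_mult_basis column_def)
  have "continuous_on S (\<lambda>x. \<chi> i j. (matrix_inv (A x) *v axis j 1) $ i)"
    by (intro continuous_intros col)
  moreover have "(\<chi> i j. (matrix_inv (A x) *v axis j 1) $ i) = matrix_inv (A x)" for x
    unfolding vec_eq_iff vec_lambda_beta by (intro allI ent[symmetric])
  ultimately show ?thesis by simp
qed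

text \<open>For symmetric B the conjugate of y y^T is (B y)(B y)^T. This turns traces of conjugated
  moments into integrals of squared norms.\<close>

lemma trace_conjugate_outer:
  fixes B :: "real^'d^'d"
  assumes "transpose B = B"
  shows "trace (B ** outer y ** B) = (norm (B *v y))\<^sup>2"
proof -
  have sym: "B $ i $ j = B $ j $ i" for i j using assms by (metis transpose_def vec_lambda_beta)
  have e: "(B ** outer y ** B) $ i $ i = (B *v y) $ i * (B *v y) $ i" for i
  proof -
    have "(B ** outer y ** B) $ i $ i = (\<Sum>k\<in>UNIV. (\<Sum>j\<in>UNIV. B $ i $ j * (y $ j * y $ k)) * B $ k $ i)"
      by (simp add: matrix_matrix_mult_def outer_def)
    also have "\<dots> = (\<Sum>k\<in>UNIV. (B *v y) $ i * (B $ i $ k * y $ k))"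
    proof (rule sum.cong[OF refl])
      fix k
      show "(\<Sum>j\<in>UNIV. B $ i $ j * (y $ j * y $ k)) * B $ k $ i = (B *v y) $ i * (B $ i $ k * y $ k)"
        unfolding sym[of k i] by (simp add: matrix_vector_mult_def sum_distrib_left sum_distrib_right mult_ac)
    qed
    also have "\<dots> = (B *v y) $ i * (B *v y) $ i" by (simp add: matrix_vector_mult_def sum_distrib_left)
    finally show ?thesis .
  qed
  show ?thesis unfolding trace_def e power2_norm_eq_inner by (simp add: inner_vec_def)
qed

lemma linear_trace_conjugate: "linear (\<lambda>M :: real^'d^'d. trace (B ** M ** B))"
  by (intro linearI)
     (simp_all add: trace_def matrix_matrix_mult_def sum_distrib_left sum_distrib_right distrib_left distrib_right sum.distrib mult_ac)

lemma trace_diff: "trace (A - B) = trace A - trace (B :: real^'d^'d)"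
  by (simp add: trace_def sum_subtractf)

lemma trace_psd_nonneg: "psd_matrix S \<Longrightarrow> 0 \<le> trace (S :: real^'d^'d)"
proof -
  assume S: "psd_matrix S"
  have "S $ i $ i = axis i 1 \<bullet> (S *v axis i 1)" for i
    by (simp add: matrix_vector_mult_basis column_def inner_axis')
  then show ?thesis using S unfolding trace_def psd_matrix_def by (auto intro: sum_nonneg)
qed

subsection \<open>The limiting matrices\<close>

lemma latent_inner:
  assumes "x \<in> latent_space" "y \<in> latent_space"
  shows "0 < x \<bullet> y" "x \<bullet> y < 1"
proof -
  show "0 < x \<bullet> y" unfolding inner_vec_def
    using assms by (intro sum_pos) (auto simp: latent_space_def)
  have "x \<bullet> y \<le> norm x * norm y" by (rule norm_cauchy_schwarz)
  also have "\<dots> < 1" using assms mult_strict_mono'[of "norm x" 1 "norm y" 1] by (simp add: latent_space_def)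
  finally show "x \<bullet> y < 1" .
qed

lemma latent_weight_pos:
  assumes "x \<in> latent_space" "y \<in> latent_space" "0 \<le> r" "r \<le> 1"
  shows "0 < 1 - r * (x \<bullet> y)"
  using latent_inner[OF assms(1,2)] mult_left_le_one_le[of "x \<bullet> y" r] assms(3,4) by linarith

lemma open_latent_space: "open (latent_space :: (real^'d) set)"
proof -
  have eq: "latent_space = (\<Inter>k. {x :: real^'d. 0 < x $ k}) \<inter> {x. norm x < 1}" by (auto simp: latent_space_def)
  have 1: "open {x :: real^'d. 0 < x $ k}" for k by (intro open_Collect_less continuous_intros)
  have 2: "open {x :: real^'d. norm x < 1}" by (intro open_Collect_less continuous_intros)
  show ?thesis unfolding eq by (intro open_Int open_INT 2 ballI 1) simp
qed

lemma continuous_on_outer [continuous_intros]: "continuous_on S f \<Longrightarrow> continuous_on S (\<lambda>x. outer (f x))"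
  unfolding outer_def by (intro continuous_intros)

context latent_sample
begin

lemma K_in_latent: "x \<in> K \<Longrightarrow> x \<in> latent_space"
  using K_latent by blast

lemma K_norm_le_1: "x \<in> K \<Longrightarrow> norm x \<le> 1"
  using K_latent by (auto simp: latent_space_def)

lemma latent_borel: "latent_space \<in> sets (borel :: (real^'d) measure)"
  by (rule borel_open[OF open_latent_space])

text \<open>\<open>F\<close> lives on \<open>K\<close>, so integrals over the open latent space,
  where the integrand may be unbounded, become integrals over a compact set.\<close>

lemma set_integral_latent:
  fixes f :: "real^'d \<Rightarrow> 'b::{banach, second_countable_topology}"
  assumes "continuous_on latent_space f"
  shows "(LINT y:latent_space|F. f y) = (LINT y:K|F. f y)"
  unfolding set_lebesgue_integral_def
proof (rule integral_cong_AE)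
  show "(\<lambda>y. indicator latent_space y *\<^sub>R f y) \<in> borel_measurable F"
    unfolding measurable_cong_sets[OF sets_F refl]
    by (rule borel_measurable_continuous_on_indicator[OF latent_borel assms])
  show "(\<lambda>y. indicator K y *\<^sub>R f y) \<in> borel_measurable F"
    unfolding measurable_cong_sets[OF sets_F refl]
    by (rule borel_measurable_continuous_on_indicator[OF K_sets continuous_on_subset[OF assms K_latent]])
  show "AE y in F. indicator latent_space y *\<^sub>R f y = indicator K y *\<^sub>R f y"
    using AE_K by (rule AE_mp) (use K_latent in \<open>auto simp: indicator_def\<close>)
qed

text \<open>The common shape of \<open>Delta_mat\<close>, \<open>G_mat\<close> and the middle factor
  of \<open>Sigma_mat\<close>.\<close>

definition moment :: "(real^'d \<Rightarrow> real) \<Rightarrow> real^'d^'d" where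
  "moment c = (LINT y:K|F. c y *\<^sub>R outer y)"

lemma bounded_linear_integral_K:
  fixes L :: "real^'d^'d \<Rightarrow> real"
  assumes "linear L" "continuous_on K c"
  shows "L (moment c) = (LINT y:K|F. c y * L (outer y))"
proof -
  have bl: "bounded_linear L" using assms(1) by (simp add: linear_conv_bounded_linear)
  have "continuous_on K (\<lambda>y. c y *\<^sub>R outer y)" by (intro continuous_intros assms)
  note int = continuous_on_K_integrable[OF this]
  have "L (moment c) = (\<integral>y. L (indicator K y *\<^sub>R c y *\<^sub>R outer y) \<partial>F)"
    unfolding moment_def set_lebesgue_integral_def by (rule integral_bounded_linear[OF bl int, symmetric])
  also have "\<dots> = (LINT y:K|F. c y * L (outer y))"
    unfolding set_lebesgue_integral_def by (simp add: linear_scale[OF assms(1)] mult.assoc)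
  finally show ?thesis .
qed

lemma moment_form:
  assumes "continuous_on K c"
  shows "u \<bullet> (moment c *v w) = (LINT y:K|F. c y * ((y \<bullet> u) * (y \<bullet> w)))"
proof -
  have "linear (\<lambda>M :: real^'d^'d. u \<bullet> (M *v w))"
    by (intro linearI) (simp_all add: matrix_vector_mult_add_rdistrib inner_add_right scaleR_matrix_vector)
  from bounded_linear_integral_K[OF this assms] show ?thesis
    by (simp add: outer_dyad dyad_mult_vec inner_commute mult_ac)
qed

lemma moment_sym:
  assumes "continuous_on K c"
  shows "transpose (moment c) = moment c"
  unfolding symmetric_iff_inner by (auto simp: moment_form[OF assms] mult_ac)

lemma integral_K_mono:
  fixes f g :: "real^'d \<Rightarrow> real"
  assumes "continuous_on K f" "continuous_on K g" "\<And>y. y \<in> K \<Longrightarrow> f y \<le> g y"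
  shows "(LINT y:K|F. f y) \<le> (LINT y:K|F. g y)"
  unfolding set_lebesgue_integral_def
  using continuous_on_K_integrable[OF assms(1)] continuous_on_K_integrable[OF assms(2)] assms(3)
  by (intro integral_mono) (auto simp: indicator_def)

lemma trace_conjugate_moment:
  assumes "transpose B = B" "continuous_on K c"
  shows "trace (B ** moment c ** B) = (LINT y:K|F. c y * (norm (B *v y))\<^sup>2)"
  using bounded_linear_integral_K[OF linear_trace_conjugate assms(2), of B]
  by (simp add: trace_conjugate_outer[OF assms(1)])

lemma Delta_moment: "Delta_mat F = moment (\<lambda>_. 1)"
  unfolding Delta_mat_def moment_def by (subst set_integral_latent) (auto intro!: continuous_intros)

lemma G_moment:
  assumes "x \<in> latent_space" "0 \<le> r" "r \<le> 1"
  shows "G_mat F r x = moment (\<lambda>y. phi r (x \<bullet> y))"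
  unfolding G_mat_def moment_def phi_def
proof (rule set_integral_latent, intro continuous_intros ballI)
  fix y :: "real^'d" assume "y \<in> latent_space"
  then show "x \<bullet> y * (1 - r * (x \<bullet> y)) \<noteq> 0"
    using latent_inner[OF assms(1)] latent_weight_pos[OF assms(1) _ assms(2,3)] by (metis less_irrefl mult_eq_0_iff)
qed

lemma Sigma_moment:
  "Sigma_mat F r x = matrix_inv (Delta_mat F) ** moment (\<lambda>y. (y \<bullet> x) * (1 - r * (y \<bullet> x))) ** matrix_inv (Delta_mat F)"
  unfolding Sigma_mat_def moment_def by (subst set_integral_latent) (auto intro!: continuous_intros)

lemma phi_continuous:
  assumes "x \<in> latent_space" "0 \<le> r" "r \<le> 1"
  shows "continuous_on K (\<lambda>y. phi r (x \<bullet> y))"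
  unfolding phi_def
proof (intro continuous_intros ballI)
  fix y assume "y \<in> K"
  then have y: "y \<in> latent_space" by (rule K_in_latent)
  show "x \<bullet> y * (1 - r * (x \<bullet> y)) \<noteq> 0"
    using latent_inner[OF assms(1) y] latent_weight_pos[OF assms(1) y assms(2,3)] by (metis less_irrefl mult_eq_0_iff)
qed

text \<open>If the form vanishes at v, then y.v = 0 for almost all y, and the matrix maps v to 0.
  Nonsingularity therefore gives positivity, and compactness of the unit sphere makes it
  uniform.\<close>

lemma Delta_lower_bound:
  assumes inv: "invertible (Delta_mat F)"
  obtains l where "0 < l" "\<And>v. l * (norm v)\<^sup>2 \<le> v \<bullet> (Delta_mat F *v v)"
proof -
  define Q where "Q = (\<lambda>v. v \<bullet> (Delta_mat F *v v))"
  have c1: "continuous_on K (\<lambda>_. 1 :: real)" by (intro continuous_intros)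
  have form: "u \<bullet> (Delta_mat F *v w) = (LINT y:K|F. (y \<bullet> u) * (y \<bullet> w))" for u w
    unfolding Delta_moment by (simp add: moment_form[OF c1])
  have pos: "0 < Q v" if "v \<noteq> 0" for v
  proof -
    have cv: "continuous_on K (\<lambda>y. (y \<bullet> v) * (y \<bullet> v))" by (intro continuous_intros)
    note int = continuous_on_K_integrable[OF cv]
    have Q0: "0 \<le> Q v" unfolding Q_def form set_lebesgue_integral_def by (intro integral_nonneg_AE AE_I2) (simp add: indicator_def)
    have "Q v \<noteq> 0"
    proof
      assume "Q v = 0"
      then have "AE y in F. indicator K y *\<^sub>R ((y \<bullet> v) * (y \<bullet> v)) = 0"
        unfolding Q_def form set_lebesgue_integral_def
        by (subst (asm) integral_nonneg_eq_0_iff_AE[OF int]) (auto simp: indicator_def)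
      then have ae: "AE y in F. indicator K y *\<^sub>R ((y \<bullet> u) * (y \<bullet> v)) = 0" for u
        by (rule AE_mp) (auto simp: indicator_def)
      have "u \<bullet> (Delta_mat F *v v) = 0" for u
        unfolding form set_lebesgue_integral_def by (rule integral_eq_zero_AE[OF ae])
      then have "Delta_mat F *v v = 0" by (metis inner_eq_zero_iff)
      then show False using invertible_matrix_inv_mult(2)[OF inv, of v] that by simp
    qed
    then show ?thesis using Q0 by simp
  qed
  have "continuous_on (sphere 0 1) Q" unfolding Q_def by (intro continuous_intros continuous_on_matrix_vector)
  moreover have "sphere (0 :: real^'d) 1 \<noteq> {}" by (simp add: sphere_eq_empty)
  ultimately obtain w where w: "w \<in> sphere 0 1" "\<And>v. v \<in> sphere 0 1 \<Longrightarrow> Q w \<le> Q v"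
    using continuous_attains_inf[of "sphere (0 :: real^'d) 1" Q] by auto
  show thesis
  proof (rule that[of "Q w"])
    show "0 < Q w" using w(1) by (intro pos) auto
    fix v :: "real^'d"
    show "Q w * (norm v)\<^sup>2 \<le> v \<bullet> (Delta_mat F *v v)"
    proof (cases "v = 0")
      case False
      define u where "u = (1 / norm v) *\<^sub>R v"
      have "u \<in> sphere 0 1" using False by (simp add: u_def)
      from w(2)[OF this] have "Q w * (norm v)\<^sup>2 \<le> Q u * (norm v)\<^sup>2" by (intro mult_right_mono) auto
      also have "\<dots> = v \<bullet> (Delta_mat F *v v)"
        using False by (simp add: Q_def u_def matrix_vector_mult_scaleR power2_eq_square)
      finally show ?thesis .
    qed simp
  qed
qed

lemma G_lower_bound:
  assumes x: "x \<in> latent_space" and r: "0 \<le> r" "r \<le> 1"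
    and low: "\<And>v. l * (norm v)\<^sup>2 \<le> v \<bullet> (Delta_mat F *v v)"
  shows "l * (norm v)\<^sup>2 \<le> v \<bullet> (G_mat F r x *v v)"
proof -
  have "v \<bullet> (Delta_mat F *v v) = (LINT y:K|F. 1 * ((y \<bullet> v) * (y \<bullet> v)))"
    unfolding Delta_moment by (rule moment_form) (intro continuous_intros)
  also have "\<dots> \<le> (LINT y:K|F. phi r (x \<bullet> y) * ((y \<bullet> v) * (y \<bullet> v)))"
  proof (rule integral_K_mono)
    fix y assume "y \<in> K"
    then have "1 \<le> phi r (x \<bullet> y)" using latent_inner[OF x K_in_latent] r by (intro phi_ge_1) auto
    then show "1 * ((y \<bullet> v) * (y \<bullet> v)) \<le> phi r (x \<bullet> y) * ((y \<bullet> v) * (y \<bullet> v))" by (intro mult_right_mono) auto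
  qed (intro continuous_intros phi_continuous[OF x r])+
  also have "\<dots> = v \<bullet> (G_mat F r x *v v)" by (simp add: G_moment[OF x r] moment_form[OF phi_continuous[OF x r]])
  finally show ?thesis using low[of v] by linarith
qed

text \<open>For fixed v let p and g solve Delta p = v and G g = v, and let a(y) be the reciprocal of
  the weight in G. Integrating a(y) (y.p - y.g / a(y))^2 >= 0 gives three terms, equal to v.(Sigma
  v), - 2 v.g and v.g, and g is the inverse of G applied to v.\<close>

lemma Sigma_minus_G_psd:
  assumes x: "x \<in> K" and r: "0 \<le> r" "r \<le> 1" and inv: "invertible (Delta_mat F)"
  shows "psd_matrix (Sigma_mat F r x - matrix_inv (G_mat F r x))"
proof -
  define D where "D = Delta_mat F"
  define G where "G = G_mat F r x"
  define a where "a = (\<lambda>y. (y \<bullet> x) * (1 - r * (y \<bullet> x)))"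
  note xl = K_in_latent[OF x]
  obtain l where l: "0 < l" "\<And>v. l * (norm v)\<^sup>2 \<le> v \<bullet> (Delta_mat F *v v)"
    by (rule Delta_lower_bound[OF inv]) blast
  have G_low: "\<And>v. l * (norm v)\<^sup>2 \<le> v \<bullet> (G *v v)" unfolding G_def by (rule G_lower_bound[OF xl r l(2)])
  have Ginv: "invertible G" by (rule lower_bound_invertible[OF l(1) G_low])
  have ca: "continuous_on K a" unfolding a_def by (intro continuous_intros)
  have c1: "continuous_on K (\<lambda>_. 1 :: real)" by (intro continuous_intros)
  note cphi = phi_continuous[OF xl r]
  have Dsym: "transpose D = D" unfolding D_def Delta_moment by (rule moment_sym[OF c1])
  have Gsym: "transpose G = G" unfolding G_def G_moment[OF xl r] by (rule moment_sym[OF cphi])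
  have Disym: "transpose (matrix_inv D) = matrix_inv D" using inv Dsym by (intro symmetric_matrix_inv) (auto simp: D_def)
  have Gisym: "transpose (matrix_inv G) = matrix_inv G" by (rule symmetric_matrix_inv[OF Ginv Gsym])
  have Sform: "u \<bullet> (Sigma_mat F r x *v v) = (matrix_inv D *v u) \<bullet> (moment a *v (matrix_inv D *v v))" for u v
    unfolding Sigma_moment a_def[symmetric] D_def[symmetric] matrix_vector_mul_assoc[symmetric]
    by (rule symmetric_inner[OF Disym])
  have "u \<bullet> (Sigma_mat F r x *v v) = v \<bullet> (Sigma_mat F r x *v u)" for u v
    unfolding Sform by (simp add: moment_form[OF ca] mult_ac)
  moreover have "u \<bullet> (matrix_inv G *v v) = v \<bullet> (matrix_inv G *v u)" for u v
    using Gisym unfolding symmetric_iff_inner by blast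
  ultimately have "transpose (Sigma_mat F r x - matrix_inv G) = Sigma_mat F r x - matrix_inv G"
    unfolding symmetric_iff_inner by (simp add: matrix_vector_mult_diff_rdistrib inner_diff_right)
  moreover have "0 \<le> v \<bullet> ((Sigma_mat F r x - matrix_inv G) *v v)" for v
  proof -
    define p where "p = matrix_inv D *v v"
    define g where "g = matrix_inv G *v v"
    have Dp: "D *v p = v" using inv by (simp add: p_def D_def invertible_matrix_inv_mult)
    have Gg: "G *v g = v" by (simp add: g_def invertible_matrix_inv_mult[OF Ginv])
    have i1: "(LINT y:K|F. a y * ((y \<bullet> p) * (y \<bullet> p))) = v \<bullet> (Sigma_mat F r x *v v)"
      unfolding Sform p_def[symmetric] moment_form[OF ca] ..
    have i2: "(LINT y:K|F. 1 * ((y \<bullet> g) * (y \<bullet> p))) = v \<bullet> g"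
      using moment_form[OF c1, of g p] unfolding Delta_moment[symmetric] D_def[symmetric] Dp by (simp add: inner_commute)
    have i3: "(LINT y:K|F. phi r (x \<bullet> y) * ((y \<bullet> g) * (y \<bullet> g))) = v \<bullet> g"
      using moment_form[OF cphi, of g g] unfolding G_moment[OF xl r, symmetric] G_def[symmetric] Gg by (simp add: inner_commute)
    have k1: "continuous_on K (\<lambda>y. a y * ((y \<bullet> p) * (y \<bullet> p)))" by (intro continuous_intros ca)
    have k2: "continuous_on K (\<lambda>y. 1 * ((y \<bullet> g) * (y \<bullet> p)))" by (intro continuous_intros)
    have k3: "continuous_on K (\<lambda>y. phi r (x \<bullet> y) * ((y \<bullet> g) * (y \<bullet> g)))" by (intro continuous_intros cphi)
    note I1 = continuous_on_K_integrable[OF k1]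
    note I2 = continuous_on_K_integrable[OF k2]
    note I3 = continuous_on_K_integrable[OF k3]
    have nn: "0 \<le> (\<integral>y. indicator K y *\<^sub>R (a y * ((y \<bullet> p) * (y \<bullet> p))) - 2 * (indicator K y *\<^sub>R (1 * ((y \<bullet> g) * (y \<bullet> p))))
        + indicator K y *\<^sub>R (phi r (x \<bullet> y) * ((y \<bullet> g) * (y \<bullet> g))) \<partial>F)"
    proof (intro integral_nonneg_AE AE_I2)
      fix y
      show "0 \<le> indicator K y *\<^sub>R (a y * ((y \<bullet> p) * (y \<bullet> p))) - 2 * (indicator K y *\<^sub>R (1 * ((y \<bullet> g) * (y \<bullet> p))))
        + indicator K y *\<^sub>R (phi r (x \<bullet> y) * ((y \<bullet> g) * (y \<bullet> g)))"
      proof (cases "y \<in> K")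
        case True
        have "0 < x \<bullet> y" "0 < 1 - r * (x \<bullet> y)"
          using latent_inner[OF xl K_in_latent[OF True]] latent_weight_pos[OF xl K_in_latent[OF True] r] by auto
        then have ay: "0 < a y" "phi r (x \<bullet> y) = 1 / a y" by (auto simp: a_def phi_def inner_commute)
        have "0 \<le> a y * ((y \<bullet> p) - (y \<bullet> g) / a y)\<^sup>2" using ay by simp
        also have "\<dots> = a y * ((y \<bullet> p) * (y \<bullet> p)) - 2 * ((y \<bullet> g) * (y \<bullet> p)) + phi r (x \<bullet> y) * ((y \<bullet> g) * (y \<bullet> g))"
          using ay(1) unfolding ay(2) by (simp add: power2_eq_square field_simps)
        finally show ?thesis using True by simp
      qed simp
    qed
    have split: "(\<integral>y. indicator K y *\<^sub>R (a y * ((y \<bullet> p) * (y \<bullet> p))) - 2 * (indicator K y *\<^sub>R (1 * ((y \<bullet> g) * (y \<bullet> p))))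
        + indicator K y *\<^sub>R (phi r (x \<bullet> y) * ((y \<bullet> g) * (y \<bullet> g))) \<partial>F)
      = (\<integral>y. indicator K y *\<^sub>R (a y * ((y \<bullet> p) * (y \<bullet> p))) \<partial>F)
        - 2 * (\<integral>y. indicator K y *\<^sub>R (1 * ((y \<bullet> g) * (y \<bullet> p))) \<partial>F)
        + (\<integral>y. indicator K y *\<^sub>R (phi r (x \<bullet> y) * ((y \<bullet> g) * (y \<bullet> g))) \<partial>F)"
      by (subst Bochner_Integration.integral_add[OF Bochner_Integration.integrable_diff[OF I1 integrable_mult_right[OF I2]] I3],
          subst Bochner_Integration.integral_diff[OF I1 integrable_mult_right[OF I2]], subst integral_mult_right_zero, rule refl)
    have "0 \<le> v \<bullet> (Sigma_mat F r x *v v) - 2 * (v \<bullet> g) + v \<bullet> g"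
      using nn unfolding split i1[unfolded set_lebesgue_integral_def] i2[unfolded set_lebesgue_integral_def]
        i3[unfolded set_lebesgue_integral_def] .
    then show ?thesis by (simp add: matrix_vector_mult_diff_rdistrib inner_diff_right g_def)
  qed
  ultimately show ?thesis by (simp add: psd_matrix_def G_def)
qed

end

section \<open>Empirical versions of the limiting matrices and of their kernels\<close>

lemma phi_param_lipschitz:
  assumes "0 < e" "e \<le> s" "s \<le> 1 - e" "0 \<le> r" "r \<le> 1" "0 \<le> r'" "r' \<le> 1"
  shows "\<bar>phi r s - phi r' s\<bar> \<le> \<bar>r - r'\<bar> / e\<^sup>2"
proof -
  have a: "e \<le> 1 - r * s" "e \<le> 1 - r' * s" using assms by (auto intro!: one_minus_mult_ge)
  define A where "A = 1 - r * s"
  define C where "C = 1 - r' * s"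
  have AC: "e \<le> A" "e \<le> C" "0 < A" "0 < C" using a assms by (auto simp: A_def C_def)
  have "phi r s - phi r' s = (C - A) / (s * (A * C))"
    using AC assms by (simp add: phi_def flip: A_def C_def) (simp add: field_simps)
  also have "C - A = s * (r - r')" by (simp add: A_def C_def algebra_simps)
  also have "s * (r - r') / (s * (A * C)) = (r - r') / (A * C)" using assms by simp
  finally have "\<bar>phi r s - phi r' s\<bar> = \<bar>r - r'\<bar> / (A * C)" using AC by (simp add: abs_mult)
  also have "\<dots> \<le> \<bar>r - r'\<bar> / (e * e)" using AC assms by (intro divide_left_mono mult_mono mult_pos_pos) auto
  finally show ?thesis by (simp add: power2_eq_square)
qed

lemma weighted_square_diff:
  fixes u un :: "'a::real_normed_vector"
  assumes a: "\<bar>a\<bar> \<le> A" and u: "norm u \<le> C" "norm un \<le> C" "0 \<le> C"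
  shows "\<bar>an * (norm un)\<^sup>2 - a * (norm u)\<^sup>2\<bar> \<le> \<bar>an - a\<bar> * C\<^sup>2 + A * (2 * C * norm (un - u))"
proof -
  have "\<bar>(norm un)\<^sup>2 - (norm u)\<^sup>2\<bar> = \<bar>norm un - norm u\<bar> * (norm un + norm u)"
    by (simp add: power2_eq_square flip: abs_mult_pos) (metis (no_types) abs_mult abs_of_nonneg add_nonneg_nonneg mult.commute norm_ge_zero square_diff_square_factored)
  also have "\<dots> \<le> norm (un - u) * (C + C)" using u by (intro mult_mono norm_triangle_ineq3 add_mono) auto
  finally have 1: "\<bar>(norm un)\<^sup>2 - (norm u)\<^sup>2\<bar> \<le> 2 * C * norm (un - u)" by (simp add: mult_ac)
  have "an * (norm un)\<^sup>2 - a * (norm u)\<^sup>2 = (an - a) * (norm un)\<^sup>2 + a * ((norm un)\<^sup>2 - (norm u)\<^sup>2)"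
    by (simp add: algebra_simps)
  also have "\<bar>\<dots>\<bar> \<le> \<bar>an - a\<bar> * (norm un)\<^sup>2 + \<bar>a\<bar> * \<bar>(norm un)\<^sup>2 - (norm u)\<^sup>2\<bar>"
    by (rule order.trans[OF abs_triangle_ineq]) (simp add: abs_mult)
  also have "\<dots> \<le> \<bar>an - a\<bar> * C\<^sup>2 + A * (2 * C * norm (un - u))"
    using u 1 a by (intro add_mono mult_mono power_mono) (auto intro: order.trans[OF abs_ge_zero])
  finally show ?thesis .
qed

context latent_sample
begin

definition Dn :: "nat \<Rightarrow> real^'d^'d" where
  "Dn n = avg n (\<lambda>j. outer (x0 j))"

definition Gn :: "nat \<Rightarrow> real \<Rightarrow> real^'d \<Rightarrow> real^'d^'d" where
  "Gn n r x = avg n (\<lambda>j. phi r (x \<bullet> x0 j) *\<^sub>R outer (x0 j))"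

lemma Dn_limit:
  assumes "0 < \<epsilon>"
  shows "\<forall>\<^sub>F n in sequentially. norm (Dn n - Delta_mat F) \<le> \<epsilon>"
proof -
  have "continuous_on ({0} \<times> K) (\<lambda>(u :: real, y). outer y)"
    unfolding split_def by (intro continuous_intros)
  from uniform_LLN[OF compact_sing this assms] show ?thesis
    by (simp add: Dn_def Delta_moment moment_def)
qed

lemma phi_outer_continuous:
  "continuous_on (({0..1} \<times> K) \<times> K) (\<lambda>(\<theta>, y). (case \<theta> of (r, x) \<Rightarrow> phi r (x \<bullet> y)) *\<^sub>R outer y)"
proof -
  have "fst (snd p) \<in> K \<Longrightarrow> True" for p :: "real \<times> (real^'d) \<times> (real^'d)" by simp
  have nz: "snd (fst p) \<bullet> snd p * (1 - fst (fst p) * (snd (fst p) \<bullet> snd p)) \<noteq> 0"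
    if p: "p \<in> ({0..1} \<times> K) \<times> K" for p :: "(real \<times> (real^'d)) \<times> (real^'d)"
  proof -
    have "0 \<le> fst (fst p)" "fst (fst p) \<le> 1" "snd (fst p) \<in> latent_space" "snd p \<in> latent_space"
      using p K_in_latent by auto
    then show ?thesis
      using latent_inner(1)[of "snd (fst p)" "snd p"] latent_weight_pos[of "snd (fst p)" "snd p" "fst (fst p)"]
      by (metis less_irrefl mult_eq_0_iff)
  qed
  show ?thesis
    unfolding split_def phi_def using nz by (intro continuous_intros ballI) auto
qed

text \<open>The weight varies with n through \<open>\<rho>n n\<close>, so r joins x in the compact
  parameter space. The uniform law is applied at \<open>\<rho>n n\<close>, and uniform continuity of
  the integral then passes to the limit \<rho>.\<close>

lemma Gn_limit:
  assumes r: "\<rho>n \<longlonglongrightarrow> \<rho>" "\<forall>n\<ge>1. 0 \<le> \<rho>n n \<and> \<rho>n n \<le> 1" "0 \<le> \<rho>" "\<rho> \<le> 1" and \<epsilon>: "0 < \<epsilon>"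
  shows "\<forall>\<^sub>F n in sequentially. \<forall>x\<in>K. norm (Gn n (\<rho>n n) x - G_mat F \<rho> x) \<le> \<epsilon>"
proof -
  define H where "H = (\<lambda>\<theta>. LINT y:K|F. (case \<theta> of (r, x) \<Rightarrow> phi r (x \<bullet> y)) *\<^sub>R outer y)"
  have comp: "compact ({0..1 :: real} \<times> K)" by (intro compact_Times K_compact compact_Icc)
  have HG: "H (r, x) = G_mat F r x" if "0 \<le> r" "r \<le> 1" "x \<in> K" for r x
    using G_moment[OF K_in_latent[OF that(3)] that(1,2)] by (simp add: H_def moment_def)
  have Hc: "continuous_on ({0..1} \<times> K) H" unfolding H_def by (rule continuous_on_param_integral[OF comp phi_outer_continuous])
  obtain d where d: "0 < d" "\<And>u v. u \<in> {0..1} \<times> K \<Longrightarrow> v \<in> {0..1} \<times> K \<Longrightarrow> dist v u < d \<Longrightarrow> dist (H v) (H u) < \<epsilon> / 2"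
    using compact_uniformly_continuous[OF Hc comp] \<epsilon> unfolding uniformly_continuous_on_def by (metis half_gt_zero)
  have e2: "0 < \<epsilon> / 2" using \<epsilon> by simp
  show ?thesis
    using uniform_LLN[OF comp phi_outer_continuous e2] tendstoD[OF r(1) d(1)] eventually_ge_at_top[of 1]
  proof eventually_elim
    case (elim n)
    show ?case
    proof
      fix x assume x: "x \<in> K"
      note rn = r(2)[rule_format, OF elim(3)]
      have in1: "(\<rho>n n, x) \<in> {0..1} \<times> K" "(\<rho>, x) \<in> {0..1} \<times> K" using rn r x by auto
      have "norm (Gn n (\<rho>n n) x - H (\<rho>n n, x)) \<le> \<epsilon> / 2"
        using bspec[OF elim(1) in1(1)] by (simp add: Gn_def H_def)
      moreover have "dist (H (\<rho>n n, x)) (H (\<rho>, x)) < \<epsilon> / 2"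
        using d(2)[OF in1(2,1)] elim(2) by (simp add: dist_Pair_Pair)
      ultimately have "norm ((Gn n (\<rho>n n) x - H (\<rho>n n, x)) + (H (\<rho>n n, x) - H (\<rho>, x))) \<le> \<epsilon> / 2 + \<epsilon> / 2"
        by (intro norm_triangle_le add_mono) (auto simp: dist_norm)
      then show "norm (Gn n (\<rho>n n) x - G_mat F \<rho> x) \<le> \<epsilon>" using HG[OF r(3,4) x] by simp
    qed
  qed
qed

lemma K_phi_bound:
  assumes "x \<in> K" "y \<in> K" "0 \<le> r" "r \<le> 1"
  shows "\<bar>phi r (x \<bullet> y)\<bar> \<le> 2 / \<delta>"
  using abs_phi_le[OF delta(1) assms(3,4), of "x \<bullet> y" "x \<bullet> y"] K_inner[OF assms(1,2)] by simp

text \<open>The squared coefficient of one entry in the linear term of the embedding times the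
  variance of that entry, multiplied by n^2. Integrated over y it is the trace of
  \<open>Sigma_mat\<close> (\<open>trace_Sigma\<close>).\<close>

definition kernel_S :: "(real^'d^'d) \<Rightarrow> real \<Rightarrow> real^'d \<Rightarrow> real^'d \<Rightarrow> real" where
  "kernel_S D r x y = (x \<bullet> y) * (1 - r * (x \<bullet> y)) * (norm (matrix_inv D *v y))\<^sup>2"

text \<open>The corresponding quantity for the one-step estimator. Its coefficient carries a factor
  \<open>phi\<close>, and the variance s (1 - r s) cancels one of the two factors in the
  square.\<close>

definition kernel_G :: "(real^'d \<Rightarrow> real^'d^'d) \<Rightarrow> real \<Rightarrow> real^'d \<Rightarrow> real^'d \<Rightarrow> real" where
  "kernel_G G r x y = phi r (x \<bullet> y) * (norm (matrix_inv (G x) *v y))\<^sup>2"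

lemma kernel_S_limit:
  assumes r: "\<rho>n \<longlonglongrightarrow> \<rho>" "\<forall>n\<ge>1. 0 \<le> \<rho>n n \<and> \<rho>n n \<le> 1" "0 \<le> \<rho>" "\<rho> \<le> 1" and inv: "invertible (Delta_mat F)"
  shows "(\<lambda>n. (\<Sum>i<n. \<Sum>j\<in>{..<n} - {i}. kernel_S (Dn n) (\<rho>n n) (x0 i) (x0 j)) / (real n)\<^sup>2)
    \<longlonglongrightarrow> (LINT x:K|F. LINT y:K|F. kernel_S (Delta_mat F) \<rho> x y)"
proof (rule double_LLN)
  show "continuous_on (K \<times> K) (\<lambda>(x, y). kernel_S (Delta_mat F) \<rho> x y)"
    unfolding kernel_S_def split_def by (intro continuous_intros continuous_on_matrix_vector)
  fix \<epsilon> :: real assume \<epsilon>: "0 < \<epsilon>"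
  obtain l where l: "0 < l" "\<And>v. l * (norm v)\<^sup>2 \<le> v \<bullet> (Delta_mat F *v v)"
    by (rule Delta_lower_bound[OF inv]) blast
  define h where "h = l / 2"
  have h: "0 < h" using l by (simp add: h_def)
  have low: "h * (norm v)\<^sup>2 \<le> v \<bullet> (Delta_mat F *v v)" for v
    by (rule order.trans[OF mult_right_mono l(2)]) (use l(1) in \<open>auto simp: h_def\<close>)
  \<comment> \<open>The bound h keeps the empirical matrix above half of the lower bound l. The
    bound \<open>\<epsilon> * h ^ 3 / 4\<close> makes the error of the inverse, 2 / h times e1 /
    h^2, at most half of \<epsilon>.\<close>
  define e1 where "e1 = min h (\<epsilon> * h ^ 3 / 4)"
  have e1: "0 < e1" using \<epsilon> h by (simp add: e1_def)
  have e2: "0 < \<epsilon> * h\<^sup>2 / 2" using \<epsilon> h by simp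
  show "\<forall>\<^sub>F n in sequentially. \<forall>x\<in>K. \<forall>y\<in>K. \<bar>kernel_S (Dn n) (\<rho>n n) x y - kernel_S (Delta_mat F) \<rho> x y\<bar> \<le> \<epsilon>"
    using Dn_limit[OF e1] tendstoD[OF r(1) e2] eventually_ge_at_top[of 1]
  proof eventually_elim
    case (elim n)
    have lown: "h * (norm v)\<^sup>2 \<le> v \<bullet> (Dn n *v v)" for v
      unfolding h_def using elim(1) by (intro lower_bound_perturb[OF l(2)]) (simp add: e1_def h_def)
    show ?case
    proof (intro ballI)
      fix x y assume xy: "x \<in> K" "y \<in> K"
      define s where "s = x \<bullet> y"
      have s: "0 < s" "s < 1" using latent_inner[OF K_in_latent K_in_latent, OF xy] by (auto simp: s_def)
      have y1: "norm y \<le> 1" by (rule K_norm_le_1[OF xy(2)])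
      have bnd: "norm y / h \<le> 1 / h" using y1 h by (intro divide_right_mono) auto
      have "\<bar>kernel_S (Dn n) (\<rho>n n) x y - kernel_S (Delta_mat F) \<rho> x y\<bar>
        \<le> \<bar>s * (1 - \<rho>n n * s) - s * (1 - \<rho> * s)\<bar> * (1 / h)\<^sup>2
          + 1 * (2 * (1 / h) * norm (matrix_inv (Dn n) *v y - matrix_inv (Delta_mat F) *v y))"
        unfolding kernel_S_def s_def[symmetric]
      proof (rule weighted_square_diff)
        have "\<rho> * s \<le> 1" using s r(3,4) mult_le_one[of \<rho> s] by simp
        then have "\<bar>s\<bar> * \<bar>1 - \<rho> * s\<bar> \<le> 1 * 1" using s r(3) by (intro mult_mono) auto
        then show "\<bar>s * (1 - \<rho> * s)\<bar> \<le> 1" by (simp add: abs_mult)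
        show "norm (matrix_inv (Delta_mat F) *v y) \<le> 1 / h" by (rule order.trans[OF lower_bound_matrix_inv[OF h low] bnd])
        show "norm (matrix_inv (Dn n) *v y) \<le> 1 / h" by (rule order.trans[OF lower_bound_matrix_inv[OF h lown] bnd])
      qed (use h in auto)
      also have "\<dots> \<le> (\<epsilon> * h\<^sup>2 / 2) * (1 / h)\<^sup>2 + 1 * (2 * (1 / h) * (e1 * 1 / h\<^sup>2))"
      proof (intro add_mono mult_right_mono mult_left_mono)
        have "s * (1 - \<rho>n n * s) - s * (1 - \<rho> * s) = (\<rho> - \<rho>n n) * s\<^sup>2" by (simp add: power2_eq_square algebra_simps)
        then have "\<bar>s * (1 - \<rho>n n * s) - s * (1 - \<rho> * s)\<bar> = \<bar>\<rho> - \<rho>n n\<bar> * s\<^sup>2" by (simp add: abs_mult)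
        also have "\<dots> \<le> \<bar>\<rho> - \<rho>n n\<bar> * 1" using s by (intro mult_left_mono) (auto simp: power_le_one)
        finally show "\<bar>s * (1 - \<rho>n n * s) - s * (1 - \<rho> * s)\<bar> \<le> \<epsilon> * h\<^sup>2 / 2" using elim(2) by (simp add: dist_real_def abs_minus_commute)
        have "norm (matrix_inv (Dn n) *v y - matrix_inv (Delta_mat F) *v y) \<le> norm (Dn n - Delta_mat F) * norm y / h\<^sup>2"
          by (rule matrix_inv_diff[OF h lown low])
        also have "\<dots> \<le> e1 * 1 / h\<^sup>2" using elim(1) y1 e1 by (intro divide_right_mono mult_mono) auto
        finally show "norm (matrix_inv (Dn n) *v y - matrix_inv (Delta_mat F) *v y) \<le> e1 * 1 / h\<^sup>2" .
      qed (use h in auto)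
      also have "\<dots> \<le> \<epsilon> / 2 + \<epsilon> / 2"
      proof (intro add_mono)
        show "\<epsilon> * h\<^sup>2 / 2 * (1 / h)\<^sup>2 \<le> \<epsilon> / 2" using h by (simp add: power_divide)
        have "2 * (1 / h) * (e1 * 1 / h\<^sup>2) \<le> 2 * (1 / h) * ((\<epsilon> * h ^ 3 / 4) * 1 / h\<^sup>2)"
          using h by (intro mult_left_mono divide_right_mono mult_right_mono) (auto simp: e1_def)
        also have "\<dots> = \<epsilon> / 2" using h by (simp add: power2_eq_square power3_eq_cube)
        finally show "1 * (2 * (1 / h) * (e1 * 1 / h\<^sup>2)) \<le> \<epsilon> / 2" by simp
      qed
      finally show "\<bar>kernel_S (Dn n) (\<rho>n n) x y - kernel_S (Delta_mat F) \<rho> x y\<bar> \<le> \<epsilon>" by simp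
    qed
  qed
qed

lemma G_continuous:
  assumes r: "0 \<le> r" "r \<le> 1" and S: "compact S" "S \<subseteq> latent_space"
  shows "continuous_on S (\<lambda>x. G_mat F r x)"
proof -
  have nz: "fst p \<bullet> snd p * (1 - r * (fst p \<bullet> snd p)) \<noteq> 0" if p: "p \<in> S \<times> K" for p :: "(real^'d) \<times> (real^'d)"
  proof -
    have "fst p \<in> latent_space" "snd p \<in> latent_space" using p S K_in_latent by auto
    then show ?thesis
      using latent_inner(1)[of "fst p" "snd p"] latent_weight_pos[of "fst p" "snd p" r] r
      by (metis less_irrefl mult_eq_0_iff)
  qed
  have "continuous_on (S \<times> K) (\<lambda>(x, y). phi r (x \<bullet> y) *\<^sub>R outer y)"
    unfolding split_def phi_def using nz by (intro continuous_intros ballI) auto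
  from continuous_on_param_integral[OF S(1) this]
  have "continuous_on S (\<lambda>x. moment (\<lambda>y. phi r (x \<bullet> y)))" unfolding moment_def .
  then show ?thesis
    by (rule continuous_on_eq) (use S r in \<open>auto simp: G_moment\<close>)
qed

lemma kernel_G_continuous:
  assumes r: "0 \<le> \<rho>" "\<rho> \<le> 1" and inv: "invertible (Delta_mat F)"
  shows "continuous_on (K \<times> K) (\<lambda>(x, y). kernel_G (G_mat F \<rho>) \<rho> x y)"
proof -
  obtain l where l: "0 < l" "\<And>v. l * (norm v)\<^sup>2 \<le> v \<bullet> (Delta_mat F *v v)"
    by (rule Delta_lower_bound[OF inv]) blast
  have ci: "continuous_on K (\<lambda>x. matrix_inv (G_mat F \<rho> x))"
    by (rule continuous_on_matrix_inv[OF l(1) G_lower_bound[OF K_in_latent r l(2)] G_continuous[OF r K_compact K_latent]])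
  have "continuous_on (K \<times> K) (\<lambda>p. matrix_inv (G_mat F \<rho> (fst p)))"
    by (rule continuous_on_compose2[OF ci]) (auto intro: continuous_on_fst continuous_on_id)
  moreover have "fst p \<bullet> snd p * (1 - \<rho> * (fst p \<bullet> snd p)) \<noteq> 0" if p: "p \<in> K \<times> K" for p :: "(real^'d) \<times> (real^'d)"
  proof -
    have "fst p \<in> latent_space" "snd p \<in> latent_space" using p K_in_latent by auto
    then show ?thesis
      using latent_inner(1)[of "fst p" "snd p"] latent_weight_pos[of "fst p" "snd p" \<rho>] r
      by (metis less_irrefl mult_eq_0_iff)
  qed
  ultimately show ?thesis
    unfolding kernel_G_def split_def phi_def
    by (intro continuous_intros ballI continuous_on_matrix_vector) auto
qed

lemma kernel_G_limit:
  assumes r: "\<rho>n \<longlonglongrightarrow> \<rho>" "\<forall>n\<ge>1. 0 \<le> \<rho>n n \<and> \<rho>n n \<le> 1" "0 \<le> \<rho>" "\<rho> \<le> 1" and inv: "invertible (Delta_mat F)"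
  shows "(\<lambda>n. (\<Sum>i<n. \<Sum>j\<in>{..<n} - {i}. kernel_G (Gn n (\<rho>n n)) (\<rho>n n) (x0 i) (x0 j)) / (real n)\<^sup>2)
    \<longlonglongrightarrow> (LINT x:K|F. LINT y:K|F. kernel_G (G_mat F \<rho>) \<rho> x y)"
proof (rule double_LLN[OF kernel_G_continuous[OF r(3,4) inv]])
  fix \<epsilon> :: real assume \<epsilon>: "0 < \<epsilon>"
  obtain l where l: "0 < l" "\<And>v. l * (norm v)\<^sup>2 \<le> v \<bullet> (Delta_mat F *v v)"
    by (rule Delta_lower_bound[OF inv]) blast
  define h where "h = l / 2"
  have h: "0 < h" using l by (simp add: h_def)
  have lowl: "l * (norm v)\<^sup>2 \<le> v \<bullet> (G_mat F \<rho> x *v v)" if "x \<in> K" for x v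
    by (rule G_lower_bound[OF K_in_latent[OF that] r(3,4) l(2)])
  have low: "h * (norm v)\<^sup>2 \<le> v \<bullet> (G_mat F \<rho> x *v v)" if "x \<in> K" for x v
    by (rule order.trans[OF mult_right_mono lowl[OF that]]) (use l(1) in \<open>auto simp: h_def\<close>)
  define B where "B = 2 / \<delta>"
  have B: "0 < B" using delta by (simp add: B_def)
  \<comment> \<open>The factor \<open>B\<close>, a bound for \<open>phi\<close>, multiplies the
    error of the inverse and is divided out here. In \<open>e2\<close> the factor \<delta>^2 offsets
    the Lipschitz constant of \<open>phi\<close> in its parameter r.\<close>
  define e1 where "e1 = min h (\<epsilon> * h ^ 3 / (4 * B))"
  have e1: "0 < e1" using \<epsilon> h B by (simp add: e1_def)
  have e2: "0 < \<epsilon> * h\<^sup>2 * \<delta>\<^sup>2 / 2" using \<epsilon> h delta by simp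
  show "\<forall>\<^sub>F n in sequentially. \<forall>x\<in>K. \<forall>y\<in>K. \<bar>kernel_G (Gn n (\<rho>n n)) (\<rho>n n) x y - kernel_G (G_mat F \<rho>) \<rho> x y\<bar> \<le> \<epsilon>"
    using Gn_limit[OF r e1] tendstoD[OF r(1) e2] eventually_ge_at_top[of 1]
  proof eventually_elim
    case (elim n)
    note rn = r(2)[rule_format, OF elim(3)]
    show ?case
    proof (intro ballI)
      fix x y assume xy: "x \<in> K" "y \<in> K"
      have Gd: "norm (Gn n (\<rho>n n) x - G_mat F \<rho> x) \<le> e1" using elim(1) xy by blast
      have lown: "h * (norm v)\<^sup>2 \<le> v \<bullet> (Gn n (\<rho>n n) x *v v)" for v
        unfolding h_def using Gd by (intro lower_bound_perturb[OF lowl[OF xy(1)]]) (simp add: e1_def h_def)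
      have y1: "norm y \<le> 1" by (rule K_norm_le_1[OF xy(2)])
      have bnd: "norm y / h \<le> 1 / h" using y1 h by (intro divide_right_mono) auto
      have "\<bar>kernel_G (Gn n (\<rho>n n)) (\<rho>n n) x y - kernel_G (G_mat F \<rho>) \<rho> x y\<bar>
        \<le> \<bar>phi (\<rho>n n) (x \<bullet> y) - phi \<rho> (x \<bullet> y)\<bar> * (1 / h)\<^sup>2
          + B * (2 * (1 / h) * norm (matrix_inv (Gn n (\<rho>n n) x) *v y - matrix_inv (G_mat F \<rho> x) *v y))"
        unfolding kernel_G_def
      proof (rule weighted_square_diff)
        show "\<bar>phi \<rho> (x \<bullet> y)\<bar> \<le> B" unfolding B_def by (rule K_phi_bound[OF xy r(3,4)])
        show "norm (matrix_inv (G_mat F \<rho> x) *v y) \<le> 1 / h" by (rule order.trans[OF lower_bound_matrix_inv[OF h low[OF xy(1)]] bnd])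
        show "norm (matrix_inv (Gn n (\<rho>n n) x) *v y) \<le> 1 / h" by (rule order.trans[OF lower_bound_matrix_inv[OF h lown] bnd])
      qed (use h in auto)
      also have "\<dots> \<le> (\<epsilon> * h\<^sup>2 / 2) * (1 / h)\<^sup>2 + B * (2 * (1 / h) * (e1 * 1 / h\<^sup>2))"
      proof (intro add_mono mult_right_mono mult_left_mono)
        have "\<bar>phi (\<rho>n n) (x \<bullet> y) - phi \<rho> (x \<bullet> y)\<bar> \<le> \<bar>\<rho>n n - \<rho>\<bar> / \<delta>\<^sup>2"
          using K_inner[OF xy] delta rn r by (intro phi_param_lipschitz) auto
        also have "\<dots> \<le> (\<epsilon> * h\<^sup>2 * \<delta>\<^sup>2 / 2) / \<delta>\<^sup>2" using elim(2) by (intro divide_right_mono) (auto simp: dist_real_def)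
        also have "\<dots> = \<epsilon> * h\<^sup>2 / 2" using delta by simp
        finally show "\<bar>phi (\<rho>n n) (x \<bullet> y) - phi \<rho> (x \<bullet> y)\<bar> \<le> \<epsilon> * h\<^sup>2 / 2" .
        have "norm (matrix_inv (Gn n (\<rho>n n) x) *v y - matrix_inv (G_mat F \<rho> x) *v y) \<le> norm (Gn n (\<rho>n n) x - G_mat F \<rho> x) * norm y / h\<^sup>2"
          by (rule matrix_inv_diff[OF h lown low[OF xy(1)]])
        also have "\<dots> \<le> e1 * 1 / h\<^sup>2" using Gd y1 e1 by (intro divide_right_mono mult_mono) auto
        finally show "norm (matrix_inv (Gn n (\<rho>n n) x) *v y - matrix_inv (G_mat F \<rho> x) *v y) \<le> e1 * 1 / h\<^sup>2" .
      qed (use h B in auto)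
      also have "\<dots> \<le> \<epsilon> / 2 + \<epsilon> / 2"
      proof (intro add_mono)
        show "\<epsilon> * h\<^sup>2 / 2 * (1 / h)\<^sup>2 \<le> \<epsilon> / 2" using h by (simp add: power_divide)
        have "B * (2 * (1 / h) * (e1 * 1 / h\<^sup>2)) \<le> B * (2 * (1 / h) * ((\<epsilon> * h ^ 3 / (4 * B)) * 1 / h\<^sup>2))"
          using h B by (intro mult_left_mono divide_right_mono mult_right_mono) (auto simp: e1_def)
        also have "\<dots> = \<epsilon> / 2" using h B by (simp add: power2_eq_square power3_eq_cube)
        finally show "B * (2 * (1 / h) * (e1 * 1 / h\<^sup>2)) \<le> \<epsilon> / 2" .
      qed
      finally show "\<bar>kernel_G (Gn n (\<rho>n n)) (\<rho>n n) x y - kernel_G (G_mat F \<rho>) \<rho> x y\<bar> \<le> \<epsilon>" by simp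
    qed
  qed
qed

lemma trace_Sigma:
  assumes inv: "invertible (Delta_mat F)"
  shows "trace (Sigma_mat F r x) = (LINT y:K|F. kernel_S (Delta_mat F) r x y)"
proof -
  have c1: "continuous_on K (\<lambda>_. 1 :: real)" by (intro continuous_intros)
  have Dsym: "transpose (Delta_mat F) = Delta_mat F" unfolding Delta_moment by (rule moment_sym[OF c1])
  have ca: "continuous_on K (\<lambda>y. (y \<bullet> x) * (1 - r * (y \<bullet> x)))" by (intro continuous_intros)
  show ?thesis
    unfolding Sigma_moment trace_conjugate_moment[OF symmetric_matrix_inv[OF inv Dsym] ca] kernel_S_def
    by (simp add: inner_commute)
qed

text \<open>The inverse is written as a conjugate of G itself, so that
  \<open>trace_conjugate_moment\<close> applies to it.\<close>

lemma trace_G_inv: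
  assumes inv: "invertible (Delta_mat F)" and x: "x \<in> latent_space" and r: "0 \<le> r" "r \<le> 1"
  shows "trace (matrix_inv (G_mat F r x)) = (LINT y:K|F. kernel_G (G_mat F r) r x y)"
proof -
  obtain l where l: "0 < l" "\<And>v. l * (norm v)\<^sup>2 \<le> v \<bullet> (Delta_mat F *v v)"
    by (rule Delta_lower_bound[OF inv]) blast
  define G where "G = G_mat F r x"
  have Gi: "invertible G" unfolding G_def by (rule lower_bound_invertible[OF l(1) G_lower_bound[OF x r l(2)]])
  have Gm: "G = moment (\<lambda>y. phi r (x \<bullet> y))" unfolding G_def by (rule G_moment[OF x r])
  have Gsym: "transpose G = G" unfolding Gm by (rule moment_sym[OF phi_continuous[OF x r]])
  have "trace (matrix_inv G) = trace (matrix_inv G ** G ** matrix_inv G)"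
    by (simp add: invertible_matrix_inv[OF Gi])
  also have "\<dots> = (LINT y:K|F. phi r (x \<bullet> y) * (norm (matrix_inv G *v y))\<^sup>2)"
    by (subst (2) Gm) (rule trace_conjugate_moment[OF symmetric_matrix_inv[OF Gi Gsym] phi_continuous[OF x r]])
  finally show ?thesis by (simp add: kernel_G_def G_def)
qed

lemma trace_integral:
  assumes inv: "invertible (Delta_mat F)" and r: "0 \<le> r" "r \<le> 1"
  shows "(LINT x:latent_space|F. trace (Sigma_mat F r x - matrix_inv (G_mat F r x)))
    = (LINT x:K|F. LINT y:K|F. kernel_S (Delta_mat F) r x y) - (LINT x:K|F. LINT y:K|F. kernel_G (G_mat F r) r x y)"
    "0 \<le> (LINT x:latent_space|F. trace (Sigma_mat F r x - matrix_inv (G_mat F r x)))"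
proof -
  obtain l where l: "0 < l" "\<And>v. l * (norm v)\<^sup>2 \<le> v \<bullet> (Delta_mat F *v v)"
    by (rule Delta_lower_bound[OF inv]) blast
  define f where "f = (\<lambda>x. trace (Sigma_mat F r x - matrix_inv (G_mat F r x)))"
  have cS: "continuous_on S (\<lambda>x. Sigma_mat F r x)" if S: "compact S" for S
  proof -
    have "continuous_on (S \<times> K) (\<lambda>(x, y). ((y \<bullet> x) * (1 - r * (y \<bullet> x))) *\<^sub>R outer y)"
      unfolding split_def by (intro continuous_intros)
    from continuous_on_param_integral[OF S this]
    have "continuous_on S (\<lambda>x. moment (\<lambda>y. (y \<bullet> x) * (1 - r * (y \<bullet> x))))" unfolding moment_def .
    then show ?thesis unfolding Sigma_moment matrix_matrix_mult_def by (intro continuous_intros)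
  qed
  have cf: "continuous_on S f" if S: "compact S" "S \<subseteq> latent_space" for S
  proof -
    have "continuous_on S (\<lambda>x. matrix_inv (G_mat F r x))"
      using S by (intro continuous_on_matrix_inv[OF l(1) G_lower_bound[OF _ r l(2)] G_continuous[OF r S]]) auto
    then show ?thesis unfolding f_def trace_def using cS[OF S(1)] by (intro continuous_intros)
  qed
  \<comment> \<open>Parameter integrals are known to be continuous only over compact parameter sets;
    closed balls inside the open latent space give continuity at each of its points.\<close>
  have "continuous_on latent_space f"
    unfolding continuous_on_eq_continuous_at[OF open_latent_space]
  proof
    fix x :: "real^'d" assume "x \<in> latent_space"
    then obtain e where e: "0 < e" "cball x e \<subseteq> latent_space"
      using open_latent_space open_contains_cball by blast
    have "continuous_on (cball x e) f" by (rule cf[OF compact_cball e(2)])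
    then show "isCont f x" using e(1) by (intro continuous_on_interior[of "cball x e"]) auto
  qed
  then have eq: "(LINT x:latent_space|F. f x) = (LINT x:K|F. f x)" by (rule set_integral_latent)
  have fK: "f x = (LINT y:K|F. kernel_S (Delta_mat F) r x y) - (LINT y:K|F. kernel_G (G_mat F r) r x y)" if "x \<in> K" for x
    by (simp add: f_def trace_diff trace_Sigma[OF inv] trace_G_inv[OF inv K_in_latent[OF that] r])
  have c1: "continuous_on K (\<lambda>x. LINT y:K|F. kernel_S (Delta_mat F) r x y)"
    by (rule continuous_on_param_integral[OF K_compact])
       (unfold kernel_S_def split_def, intro continuous_intros continuous_on_matrix_vector)
  have c2: "continuous_on K (\<lambda>x. LINT y:K|F. kernel_G (G_mat F r) r x y)"
    by (rule continuous_on_param_integral[OF K_compact kernel_G_continuous[OF r inv]])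
  have "(LINT x:K|F. f x) = (\<integral>x. indicator K x *\<^sub>R (LINT y:K|F. kernel_S (Delta_mat F) r x y) - indicator K x *\<^sub>R (LINT y:K|F. kernel_G (G_mat F r) r x y) \<partial>F)"
    unfolding set_lebesgue_integral_def[of F K f]
    by (rule Bochner_Integration.integral_cong) (auto simp: fK indicator_def)
  also have "\<dots> = (LINT x:K|F. LINT y:K|F. kernel_S (Delta_mat F) r x y) - (LINT x:K|F. LINT y:K|F. kernel_G (G_mat F r) r x y)"
    unfolding set_lebesgue_integral_def[of F K "\<lambda>x. LINT y:K|F. kernel_S (Delta_mat F) r x y"]
      set_lebesgue_integral_def[of F K "\<lambda>x. LINT y:K|F. kernel_G (G_mat F r) r x y"]
    by (rule Bochner_Integration.integral_diff[OF continuous_on_K_integrable[OF c1] continuous_on_K_integrable[OF c2]])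
  finally show "(LINT x:latent_space|F. trace (Sigma_mat F r x - matrix_inv (G_mat F r x)))
    = (LINT x:K|F. LINT y:K|F. kernel_S (Delta_mat F) r x y) - (LINT x:K|F. LINT y:K|F. kernel_G (G_mat F r) r x y)"
    using eq by (simp add: f_def)
  have "0 \<le> (LINT x:K|F. f x)"
    unfolding set_lebesgue_integral_def
  proof (intro integral_nonneg_AE AE_I2)
    fix x show "0 \<le> indicator K x *\<^sub>R f x"
      using trace_psd_nonneg[OF Sigma_minus_G_psd[OF _ r inv, of x]] by (cases "x \<in> K") (auto simp: f_def)
  qed
  then show "0 \<le> (LINT x:latent_space|F. trace (Sigma_mat F r x - matrix_inv (G_mat F r x)))"
    using eq by (simp add: f_def)
qed

end

subsection \<open>Convergence in probability from tightness\<close>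

lemma pmf_markov:
  assumes em: "edge_model n q p" and f: "\<And>a. 0 \<le> f a" and b: "measure_pmf.expectation p f \<le> b" and C: "0 < C"
  shows "measure_pmf.prob p {a. \<not> f a \<le> C} \<le> b / C"
proof -
  have "measure_pmf.prob p {a. \<not> f a \<le> C} \<le> measure_pmf.prob p {a \<in> space (measure_pmf p). C \<le> f a}"
    by (intro measure_pmf.finite_measure_mono) auto
  also have "\<dots> \<le> measure_pmf.expectation p f / C"
    using em f C by (intro integral_Markov_inequality_measure[of _ _ "{}"]) auto
  also have "\<dots> \<le> b / C" using b C by (intro divide_right_mono) auto
  finally show ?thesis .
qed

text \<open>Boundedness in probability in abstract form: \<open>Good C n\<close> is the event on
  which a bound with constant \<open>C\<close> holds. Several bounds can be joined, and the analysis
  on the event is then deterministic.\<close>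

definition tight :: "(nat \<Rightarrow> (nat \<Rightarrow> nat \<Rightarrow> real) pmf) \<Rightarrow> (real \<Rightarrow> nat \<Rightarrow> (nat \<Rightarrow> nat \<Rightarrow> real) \<Rightarrow> bool) \<Rightarrow> bool" where
  "tight P Good \<longleftrightarrow> (\<forall>\<epsilon>>0. \<exists>C. \<forall>\<^sub>F n in sequentially. measure_pmf.prob (P n) {a. \<not> Good C n a} \<le> \<epsilon>)"

definition pmf_lim :: "(nat \<Rightarrow> (nat \<Rightarrow> nat \<Rightarrow> real) pmf) \<Rightarrow> (nat \<Rightarrow> (nat \<Rightarrow> nat \<Rightarrow> real) \<Rightarrow> real) \<Rightarrow> real \<Rightarrow> bool" where
  "pmf_lim P Z l \<longleftrightarrow> (\<forall>\<epsilon>>0. (\<lambda>n. measure_pmf.prob (P n) {a. \<epsilon> < \<bar>Z n a - l\<bar>}) \<longlonglongrightarrow> 0)"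

lemma tight_expectation:
  assumes em: "\<forall>\<^sub>F n in sequentially. edge_model n (q n) (P n)" and f: "\<And>n a. 0 \<le> f n a"
    and b: "\<forall>\<^sub>F n in sequentially. measure_pmf.expectation (P n) (f n) \<le> b"
  shows "tight P (\<lambda>C n a. f n a \<le> C)"
  unfolding tight_def
proof (intro allI impI)
  fix \<epsilon> :: real assume \<epsilon>: "0 < \<epsilon>"
  define C where "C = (\<bar>b\<bar> + 1) / \<epsilon>"
  have C: "0 < C" using \<epsilon> by (simp add: C_def)
  have "b / C \<le> (\<bar>b\<bar> + 1) / C" using C by (intro divide_right_mono) auto
  also have "\<dots> = \<epsilon>" using \<epsilon> by (simp add: C_def)
  finally have bC: "b / C \<le> \<epsilon>" .
  have "\<forall>\<^sub>F n in sequentially. measure_pmf.prob (P n) {a. \<not> f n a \<le> C} \<le> \<epsilon>"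
    using em b
  proof eventually_elim
    case (elim n)
    show ?case using pmf_markov[OF elim(1) f elim(2) C] bC by linarith
  qed
  then show "\<exists>C. \<forall>\<^sub>F n in sequentially. measure_pmf.prob (P n) {a. \<not> f n a \<le> C} \<le> \<epsilon>" by blast
qed

lemma tight_conj:
  assumes "tight P G1" "tight P G2"
    and mono: "\<And>C C' n a. C \<le> C' \<Longrightarrow> G1 C n a \<Longrightarrow> G1 C' n a" "\<And>C C' n a. C \<le> C' \<Longrightarrow> G2 C n a \<Longrightarrow> G2 C' n a"
  shows "tight P (\<lambda>C n a. G1 C n a \<and> G2 C n a)"
  unfolding tight_def
proof (intro allI impI)
  fix \<epsilon> :: real assume "0 < \<epsilon>"
  then have e: "0 < \<epsilon> / 2" by simp
  obtain C1 C2 where C: "\<forall>\<^sub>F n in sequentially. measure_pmf.prob (P n) {a. \<not> G1 C1 n a} \<le> \<epsilon> / 2"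
     "\<forall>\<^sub>F n in sequentially. measure_pmf.prob (P n) {a. \<not> G2 C2 n a} \<le> \<epsilon> / 2"
    using assms(1,2) e unfolding tight_def by meson
  define C where "C = max C1 C2"
  have "\<forall>\<^sub>F n in sequentially. measure_pmf.prob (P n) {a. \<not> (G1 C n a \<and> G2 C n a)} \<le> \<epsilon>"
    using C
  proof eventually_elim
    case (elim n)
    have "measure_pmf.prob (P n) {a. \<not> (G1 C n a \<and> G2 C n a)} \<le> measure_pmf.prob (P n) ({a. \<not> G1 C1 n a} \<union> {a. \<not> G2 C2 n a})"
      using mono(1)[of C1 C] mono(2)[of C2 C] by (intro measure_pmf.finite_measure_mono) (auto simp: C_def)
    also have "\<dots> \<le> measure_pmf.prob (P n) {a. \<not> G1 C1 n a} + measure_pmf.prob (P n) {a. \<not> G2 C2 n a}"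
      by (intro measure_Un_le) auto
    finally show ?case using elim by simp
  qed
  then show "\<exists>C. \<forall>\<^sub>F n in sequentially. measure_pmf.prob (P n) {a. \<not> (G1 C n a \<and> G2 C n a)} \<le> \<epsilon>" by blast
qed

text \<open>For fixed \<open>C\<close> the deviation is small on the whole good event once n is
  large. Choosing \<open>C\<close> for a prescribed failure probability first and n afterwards gives
  convergence in probability.\<close>

lemma pmf_lim_tight:
  assumes "tight P Good"
    and det: "\<And>C \<eta>. 0 < \<eta> \<Longrightarrow> \<forall>\<^sub>F n in sequentially. \<forall>a\<in>set_pmf (P n). Good C n a \<longrightarrow> \<bar>Z n a - l\<bar> \<le> \<eta>"
  shows "pmf_lim P Z l"
  unfolding pmf_lim_def
proof (intro allI impI tendstoI)
  fix \<eta> \<epsilon> :: real assume \<eta>: "0 < \<eta>" and \<epsilon>: "0 < \<epsilon>"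
  then have "0 < \<epsilon> / 2" by simp
  then obtain C where C: "\<forall>\<^sub>F n in sequentially. measure_pmf.prob (P n) {a. \<not> Good C n a} \<le> \<epsilon> / 2"
    using assms(1) unfolding tight_def by blast
  show "\<forall>\<^sub>F n in sequentially. dist (measure_pmf.prob (P n) {a. \<eta> < \<bar>Z n a - l\<bar>}) 0 < \<epsilon>"
    using C det[OF \<eta>, of C]
  proof eventually_elim
    case (elim n)
    have "measure_pmf.prob (P n) {a. \<eta> < \<bar>Z n a - l\<bar>} \<le> measure_pmf.prob (P n) {a. \<not> Good C n a}"
      using elim(2) by (intro measure_pmf.finite_measure_mono_AE AE_pmfI) (auto simp: not_less)
    then show ?case using elim(1) \<epsilon> by simp
  qed
qed

lemma pmf_lim_diff:
  assumes "pmf_lim P Z l" "pmf_lim P Y k"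
  shows "pmf_lim P (\<lambda>n a. Z n a - Y n a) (l - k)"
  unfolding pmf_lim_def
proof (intro allI impI)
  fix \<epsilon> :: real assume "0 < \<epsilon>"
  then have e: "0 < \<epsilon> / 2" by simp
  have "(\<lambda>n. measure_pmf.prob (P n) {a. \<epsilon> / 2 < \<bar>Z n a - l\<bar>} + measure_pmf.prob (P n) {a. \<epsilon> / 2 < \<bar>Y n a - k\<bar>}) \<longlonglongrightarrow> 0 + 0"
    (is "?g \<longlonglongrightarrow> _")
    using assms e unfolding pmf_lim_def by (intro tendsto_add) blast+
  then have g: "?g \<longlonglongrightarrow> 0" by simp
  show "(\<lambda>n. measure_pmf.prob (P n) {a. \<epsilon> < \<bar>Z n a - Y n a - (l - k)\<bar>}) \<longlonglongrightarrow> 0"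
  proof (rule Lim_null_comparison[OF _ g], intro always_eventually allI)
    fix n
    have "measure_pmf.prob (P n) {a. \<epsilon> < \<bar>Z n a - Y n a - (l - k)\<bar>}
       \<le> measure_pmf.prob (P n) ({a. \<epsilon> / 2 < \<bar>Z n a - l\<bar>} \<union> {a. \<epsilon> / 2 < \<bar>Y n a - k\<bar>})"
    proof (intro measure_pmf.finite_measure_mono subsetI)
      fix a assume "a \<in> {a. \<epsilon> < \<bar>Z n a - Y n a - (l - k)\<bar>}"
      moreover have "\<bar>Z n a - Y n a - (l - k)\<bar> \<le> \<bar>Z n a - l\<bar> + \<bar>Y n a - k\<bar>" by linarith
      ultimately show "a \<in> {a. \<epsilon> / 2 < \<bar>Z n a - l\<bar>} \<union> {a. \<epsilon> / 2 < \<bar>Y n a - k\<bar>}"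
        by (simp only: mem_Collect_eq Un_iff) linarith
    qed simp
    also have "\<dots> \<le> measure_pmf.prob (P n) {a. \<epsilon> / 2 < \<bar>Z n a - l\<bar>} + measure_pmf.prob (P n) {a. \<epsilon> / 2 < \<bar>Y n a - k\<bar>}"
      by (intro measure_Un_le) auto
    finally show "norm (measure_pmf.prob (P n) {a. \<epsilon> < \<bar>Z n a - Y n a - (l - k)\<bar>})
      \<le> measure_pmf.prob (P n) {a. \<epsilon> / 2 < \<bar>Z n a - l\<bar>} + measure_pmf.prob (P n) {a. \<epsilon> / 2 < \<bar>Y n a - k\<bar>}" by simp
  qed
qed

text \<open>The difference of the squares is |d - f| (d + f), and f <= 1 + f^2 bounds f by its own
  square, which is close to \<open>e n\<close>. The quantifier over all \<open>D\<close> and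
  \<open>m\<close> stands inside the eventuality, so that one n serves for all matrices in the
  support.\<close>

lemma fnorm_sq_limit:
  assumes \<tau>: "\<tau> \<longlonglongrightarrow> 0" and \<kappa>: "\<kappa> \<longlonglongrightarrow> 0" and e: "e \<longlonglongrightarrow> L" and \<eta>: "0 < \<eta>"
  shows "\<forall>\<^sub>F n in sequentially. \<forall>D m :: nat \<Rightarrow> 'a::real_normed_vector. fnorm n (\<lambda>i. D i - m i) \<le> \<tau> n \<longrightarrow>
    \<bar>(fnorm n m)\<^sup>2 - e n\<bar> \<le> \<kappa> n \<longrightarrow> \<bar>(fnorm n D)\<^sup>2 - L\<bar> \<le> \<eta>"
proof -
  have "(\<lambda>n. \<tau> n * (\<tau> n + 2 * (1 + \<bar>e n\<bar> + \<kappa> n)) + \<kappa> n + \<bar>e n - L\<bar>) \<longlonglongrightarrow> 0 * (0 + 2 * (1 + \<bar>L\<bar> + 0)) + 0 + \<bar>L - L\<bar>"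
    by (intro tendsto_intros assms)
  then have "\<forall>\<^sub>F n in sequentially. \<tau> n * (\<tau> n + 2 * (1 + \<bar>e n\<bar> + \<kappa> n)) + \<kappa> n + \<bar>e n - L\<bar> < \<eta>"
    using \<eta> by (intro order_tendstoD(2)) auto
  then show ?thesis
  proof eventually_elim
    case (elim n)
    show ?case
    proof (intro allI impI)
      fix D m :: "nat \<Rightarrow> 'a"
      assume 1: "fnorm n (\<lambda>i. D i - m i) \<le> \<tau> n" and 2: "\<bar>(fnorm n m)\<^sup>2 - e n\<bar> \<le> \<kappa> n"
      define d where "d = fnorm n D"
      define f where "f = fnorm n m"
      have t0: "0 \<le> \<tau> n" using 1 fnorm_nonneg order.trans by blast
      have "d \<le> f + \<tau> n" using fnorm_triangle[of n m "\<lambda>i. D i - m i"] 1 by (simp add: d_def f_def)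
      moreover have "f \<le> d + \<tau> n" using fnorm_triangle_diff[of n D "\<lambda>i. D i - m i"] 1 by (simp add: d_def f_def)
      ultimately have df: "\<bar>d - f\<bar> \<le> \<tau> n" by linarith
      have f0: "0 \<le> f" "0 \<le> d" by (auto simp: f_def d_def)
      have "f \<le> 1 + f\<^sup>2" using sum_squares_bound[of f 1] f0 by (simp add: power2_eq_square)
      also have "f\<^sup>2 \<le> \<bar>e n\<bar> + \<kappa> n" using 2 unfolding f_def[symmetric] by linarith
      finally have fb: "f \<le> 1 + \<bar>e n\<bar> + \<kappa> n" by simp
      have "\<bar>d\<^sup>2 - f\<^sup>2\<bar> = \<bar>d - f\<bar> * (d + f)" using f0 by (simp add: power2_eq_square square_diff_square_factored abs_mult mult.commute)
      also have "\<dots> \<le> \<tau> n * (\<tau> n + 2 * (1 + \<bar>e n\<bar> + \<kappa> n))"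
        using df fb f0 t0 by (intro mult_mono) auto
      finally have "\<bar>d\<^sup>2 - f\<^sup>2\<bar> \<le> \<tau> n * (\<tau> n + 2 * (1 + \<bar>e n\<bar> + \<kappa> n))" .
      moreover have "\<bar>f\<^sup>2 - e n\<bar> \<le> \<kappa> n" using 2 by (simp add: f_def)
      moreover have "\<bar>d\<^sup>2 - L\<bar> \<le> \<bar>d\<^sup>2 - f\<^sup>2\<bar> + \<bar>f\<^sup>2 - e n\<bar> + \<bar>e n - L\<bar>" by linarith
      ultimately show "\<bar>(fnorm n D)\<^sup>2 - L\<bar> \<le> \<eta>" using elim unfolding d_def[symmetric] by linarith
    qed
  qed
qed

text \<open>The operator norm is bounded by the square root of the Frobenius norm of the square.\<close>
lemma noise_operator_bound:
  fixes U :: "nat \<Rightarrow> 'b::real_inner"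
  assumes sym: "\<And>i j. E i j = E j i"
    and S: "(\<Sum>i<n. \<Sum>k<n. (\<Sum>j<n. E i j * E j k)\<^sup>2) \<le> S"
  shows "fnorm n (\<lambda>i. \<Sum>j<n. E i j *\<^sub>R U j) \<le> sqrt (sqrt S) * fnorm n U"
proof -
  \<comment> \<open>The square of E, by symmetry. The squared norm of E U is the inner product of
    this matrix with the Gram matrix of U, whose Frobenius norm is at most the squared norm of
    U.\<close>
  define T where "T = (\<lambda>j k. \<Sum>i<n. E j i * E i k)"
  have S0: "0 \<le> S" by (rule order.trans[OF _ S]) (intro sum_nonneg zero_le_power2)
  have "(fnorm n (\<lambda>i. \<Sum>j<n. E i j *\<^sub>R U j))\<^sup>2 = (\<Sum>i<n. \<Sum>j<n. \<Sum>k<n. (E i j * E i k) * (U j \<bullet> U k))"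
    unfolding fnorm_sq power2_norm_eq_inner
  proof (rule sum.cong[OF refl])
    fix i
    have "(\<Sum>j<n. E i j *\<^sub>R U j) \<bullet> (\<Sum>j<n. E i j *\<^sub>R U j) = (\<Sum>j<n. \<Sum>k<n. (E i j *\<^sub>R U j) \<bullet> (E i k *\<^sub>R U k))"
      by (subst inner_sum_left, subst inner_sum_right, rule refl)
    then show "(\<Sum>j<n. E i j *\<^sub>R U j) \<bullet> (\<Sum>j<n. E i j *\<^sub>R U j) = (\<Sum>j<n. \<Sum>k<n. (E i j * E i k) * (U j \<bullet> U k))"
      by (simp add: mult_ac)
  qed
  also have "\<dots> = (\<Sum>j<n. \<Sum>i<n. \<Sum>k<n. (E i j * E i k) * (U j \<bullet> U k))" by (rule sum.swap)
  also have "\<dots> = (\<Sum>j<n. \<Sum>k<n. \<Sum>i<n. (E i j * E i k) * (U j \<bullet> U k))" by (intro sum.cong refl sum.swap)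
  also have "\<dots> = (\<Sum>j<n. \<Sum>k<n. T j k * (U j \<bullet> U k))"
  proof (rule sum.cong[OF refl], rule sum.cong[OF refl])
    fix j k
    have "T j k = (\<Sum>i<n. E i j * E i k)" unfolding T_def by (rule sum.cong[OF refl]) (simp only: sym[of j])
    then show "(\<Sum>i<n. (E i j * E i k) * (U j \<bullet> U k)) = T j k * (U j \<bullet> U k)" by (simp only: sum_distrib_right)
  qed
  also have "\<dots> = (\<Sum>t\<in>{..<n} \<times> {..<n}. T (fst t) (snd t) * (U (fst t) \<bullet> U (snd t)))"
    by (simp add: sum.cartesian_product')
  also have "\<dots> \<le> (\<Sum>t\<in>{..<n} \<times> {..<n}. \<bar>T (fst t) (snd t)\<bar> * \<bar>norm (U (fst t)) * norm (U (snd t))\<bar>)"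
  proof (rule sum_mono)
    fix t :: "nat \<times> nat"
    have "T (fst t) (snd t) * (U (fst t) \<bullet> U (snd t)) \<le> \<bar>T (fst t) (snd t)\<bar> * \<bar>U (fst t) \<bullet> U (snd t)\<bar>"
      unfolding abs_mult[symmetric] by (rule abs_ge_self)
    also have "\<dots> \<le> \<bar>T (fst t) (snd t)\<bar> * \<bar>norm (U (fst t)) * norm (U (snd t))\<bar>"
      using Cauchy_Schwarz_ineq2[of "U (fst t)" "U (snd t)"] by (intro mult_left_mono) auto
    finally show "T (fst t) (snd t) * (U (fst t) \<bullet> U (snd t)) \<le> \<bar>T (fst t) (snd t)\<bar> * \<bar>norm (U (fst t)) * norm (U (snd t))\<bar>" .
  qed
  also have "\<dots> \<le> L2_set (\<lambda>t. T (fst t) (snd t)) ({..<n} \<times> {..<n}) * L2_set (\<lambda>t. norm (U (fst t)) * norm (U (snd t))) ({..<n} \<times> {..<n})"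
    by (rule L2_set_mult_ineq)
  also have "L2_set (\<lambda>t. norm (U (fst t)) * norm (U (snd t))) ({..<n} \<times> {..<n}) = (fnorm n U)\<^sup>2"
  proof -
    have "(\<Sum>t\<in>{..<n} \<times> {..<n}. (norm (U (fst t)) * norm (U (snd t)))\<^sup>2) = ((fnorm n U)\<^sup>2)\<^sup>2"
    proof -
      have "(\<Sum>t\<in>{..<n} \<times> {..<n}. (norm (U (fst t)) * norm (U (snd t)))\<^sup>2) = (\<Sum>i<n. \<Sum>j<n. (norm (U i))\<^sup>2 * (norm (U j))\<^sup>2)"
        by (simp add: sum.cartesian_product' power_mult_distrib)
      also have "\<dots> = (\<Sum>i<n. (norm (U i))\<^sup>2) * (\<Sum>j<n. (norm (U j))\<^sup>2)" by (rule sum_product[symmetric])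
      finally show ?thesis by (simp only: fnorm_sq power2_eq_square[of "sum _ _"])
    qed
    then show ?thesis unfolding L2_set_def by (simp only: real_sqrt_abs abs_power2)
  qed
  also have "L2_set (\<lambda>t. T (fst t) (snd t)) ({..<n} \<times> {..<n}) \<le> sqrt S"
    unfolding L2_set_def using S by (intro real_sqrt_le_mono) (simp add: sum.cartesian_product' T_def)
  finally have "(fnorm n (\<lambda>i. \<Sum>j<n. E i j *\<^sub>R U j))\<^sup>2 \<le> sqrt S * (fnorm n U)\<^sup>2"
    by (simp add: mult_right_mono)
  also have "\<dots> = (sqrt (sqrt S) * fnorm n U)\<^sup>2" using S0 by (simp add: power_mult_distrib)
  finally show ?thesis by (rule power2_le_imp_le) (simp add: S0)
qed

lemma le_sqrt_sqrt: "0 \<le> x \<Longrightarrow> x ^ 4 \<le> y \<Longrightarrow> x \<le> sqrt (sqrt y)" for x y :: real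
proof -
  assume x: "0 \<le> x" "x ^ 4 \<le> y"
  have "sqrt (sqrt (x ^ 4)) \<le> sqrt (sqrt y)" using x by (intro real_sqrt_le_mono)
  moreover have "x ^ 4 = (x\<^sup>2)\<^sup>2" by (simp flip: power_mult)
  then have "sqrt (x ^ 4) = x\<^sup>2" by (simp only: real_sqrt_abs abs_power2)
  then have "sqrt (sqrt (x ^ 4)) = x" using x by simp
  ultimately show ?thesis by simp
qed

subsection \<open>Limits of the squared estimation errors\<close>

lemma sqrt_sqrt_mult_power4: "0 \<le> t \<Longrightarrow> sqrt (sqrt (A * t ^ 4)) = sqrt (sqrt A) * t"
proof -
  assume t: "0 \<le> t"
  have "sqrt (t ^ 4) = t\<^sup>2" using t real_sqrt_unique[of "t\<^sup>2" "t ^ 4"] by (simp flip: power_mult)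
  then show ?thesis using t by (simp add: real_sqrt_mult)
qed

locale sparse_sample = latent_sample F \<delta> K x0
  for F :: "(real^'d) measure" and \<delta> K and x0 :: "nat \<Rightarrow> real^'d" +
  fixes \<rho>n :: "nat \<Rightarrow> real" and \<rho> :: real and P :: "nat \<Rightarrow> (nat \<Rightarrow> nat \<Rightarrow> real) pmf"
  assumes Delta_inv: "invertible (Delta_mat F)"
    and rho_n: "\<And>n. 1 \<le> n \<Longrightarrow> 0 < \<rho>n n \<and> \<rho>n n \<le> 1" and rho_lim: "\<rho>n \<longlonglongrightarrow> \<rho>"
    and model: "\<And>n. 1 \<le> n \<Longrightarrow> sparse_model n (\<lambda>i j. \<rho>n n * (x0 i \<bullet> x0 j)) (\<rho>n n) (P n)"
    and rate: "(\<lambda>n. 1 / (real n * \<rho>n n ^ 5)) \<longlonglongrightarrow> 0"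
begin

abbreviation q :: "nat \<Rightarrow> nat \<Rightarrow> nat \<Rightarrow> real" where
  "q n i j \<equiv> \<rho>n n * (x0 i \<bullet> x0 j)"

lemma rho01: "0 \<le> \<rho>" "\<rho> \<le> 1"
proof -
  show "0 \<le> \<rho>" by (rule LIMSEQ_le_const[OF rho_lim]) (use rho_n less_imp_le in blast)
  show "\<rho> \<le> 1" by (rule LIMSEQ_le_const2[OF rho_lim]) (use rho_n in blast)
qed

lemma rho_n': "\<forall>n\<ge>1. 0 \<le> \<rho>n n \<and> \<rho>n n \<le> 1"
  using rho_n less_imp_le by blast

lemma rates:
  assumes "k \<le> 5"
  shows "(\<lambda>n. 1 / (real n * \<rho>n n ^ k)) \<longlonglongrightarrow> 0"
proof (rule Lim_null_comparison[OF _ rate])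
  show "\<forall>\<^sub>F n in sequentially. norm (1 / (real n * \<rho>n n ^ k)) \<le> 1 / (real n * \<rho>n n ^ 5)"
    using eventually_ge_at_top[of 1]
  proof eventually_elim
    case (elim n)
    have r: "0 < \<rho>n n" "\<rho>n n \<le> 1" using rho_n[OF elim] by auto
    have "real n * \<rho>n n ^ 5 \<le> real n * \<rho>n n ^ k" using r assms by (intro mult_left_mono power_decreasing) auto
    then have "1 / (real n * \<rho>n n ^ k) \<le> 1 / (real n * \<rho>n n ^ 5)" using r elim by (intro divide_left_mono) auto
    then show ?case using r by simp
  qed
qed

lemma rate1: "(\<lambda>n. 1 / (real n * \<rho>n n)) \<longlonglongrightarrow> 0" using rates[of 1] by simp
lemma rate0: "(\<lambda>n. 1 / real n) \<longlonglongrightarrow> 0" using rates[of 0] by simp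

lemma eventually_nr: "\<forall>\<^sub>F n in sequentially. 1 \<le> real n * \<rho>n n"
  using order_tendstoD(2)[OF rate1 zero_less_one] eventually_ge_at_top[of 1]
proof eventually_elim
  case (elim n)
  then have "0 < real n * \<rho>n n" using rho_n[of n] by simp
  then show ?case using elim by (simp add: divide_less_eq)
qed

lemma x0_bounds: "\<delta> \<le> x0 i \<bullet> x0 j" "x0 i \<bullet> x0 j \<le> 1 - \<delta>" "0 < x0 i \<bullet> x0 j" "x0 i \<bullet> x0 j \<le> 1" "norm (x0 i) \<le> 1"
  using K_inner[OF x0_K x0_K, of i j] delta K_norm_le_1[OF x0_K, of i] by auto

lemma Dn_form: "real n * (v \<bullet> (Dn n *v v)) = (\<Sum>j<n. (x0 j \<bullet> v)\<^sup>2)"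
  by (simp add: Dn_def avg_def scaleR_matrix_vector sum_matrix_vector outer_dyad dyad_mult_vec inner_sum_right
        power2_eq_square inner_commute)

lemma Dn_mult: "real n *\<^sub>R (Dn n *v v) = (\<Sum>j<n. (x0 j \<bullet> v) *\<^sub>R x0 j)"
  by (simp add: Dn_def avg_def scaleR_matrix_vector sum_matrix_vector outer_dyad dyad_mult_vec)

lemma Gn_mult: "real n *\<^sub>R (Gn n r x *v v) = (\<Sum>j<n. phi r (x \<bullet> x0 j) *\<^sub>R (x0 j \<bullet> v) *\<^sub>R x0 j)"
  by (simp add: Gn_def avg_def scaleR_matrix_vector sum_matrix_vector outer_dyad dyad_mult_vec)

lemma Dn_lower_bound:
  obtains l where "0 < l" "\<forall>\<^sub>F n in sequentially. \<forall>v. l * (norm v)\<^sup>2 \<le> v \<bullet> (Dn n *v v)"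
proof -
  obtain l where l: "0 < l" "\<And>v. l * (norm v)\<^sup>2 \<le> v \<bullet> (Delta_mat F *v v)"
    by (rule Delta_lower_bound[OF Delta_inv]) blast
  show thesis
  proof (rule that[of "l / 2"])
    show "0 < l / 2" using l by simp
    show "\<forall>\<^sub>F n in sequentially. \<forall>v. l / 2 * (norm v)\<^sup>2 \<le> v \<bullet> (Dn n *v v)"
      using Dn_limit[OF \<open>0 < l / 2\<close>] by eventually_elim (intro allI lower_bound_perturb[OF l(2)])
  qed
qed

lemma Gn_lower_bound:
  assumes r: "0 \<le> r" "r \<le> 1" and x: "x \<in> K" and low: "\<And>v. l * (norm v)\<^sup>2 \<le> v \<bullet> (Dn n *v v)" and n: "0 < n"
  shows "l * (norm v)\<^sup>2 \<le> v \<bullet> (Gn n r x *v v)"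
proof -
  have "real n * (v \<bullet> (Dn n *v v)) \<le> (\<Sum>j<n. phi r (x \<bullet> x0 j) * (x0 j \<bullet> v)\<^sup>2)"
    unfolding Dn_form
  proof (rule sum_mono)
    fix j
    have "1 \<le> phi r (x \<bullet> x0 j)" using latent_inner[OF K_in_latent[OF x] K_in_latent[OF x0_K]] r by (intro phi_ge_1) auto
    then show "(x0 j \<bullet> v)\<^sup>2 \<le> phi r (x \<bullet> x0 j) * (x0 j \<bullet> v)\<^sup>2"
      using mult_right_mono[of 1 "phi r (x \<bullet> x0 j)" "(x0 j \<bullet> v)\<^sup>2"] by simp
  qed
  also have "\<dots> = v \<bullet> (real n *\<^sub>R (Gn n r x *v v))"
    unfolding Gn_mult by (simp add: inner_sum_right power2_eq_square inner_commute mult_ac)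
  finally show ?thesis using low[of v] n by (simp del: inner_scaleR_right add: inner_scaleR_right)
qed

section \<open>The limit for the spectral embedding\<close>

text \<open>The embedding is aligned by the optimal rotation, for which \<open>X\<^sup>T Z\<close> is symmetric and positive semidefinite.\<close>
definition ase_rotation :: "nat \<Rightarrow> (nat \<Rightarrow> real^'d) \<Rightarrow> real^'d^'d" where
  "ase_rotation n X = (SOME W. orthogonal_matrix W \<and>
     (\<forall>u v. (\<Sum>i<n. ((sqrt (\<rho>n n) *\<^sub>R x0 i) \<bullet> u) * ((X i v* W) \<bullet> v)) = (\<Sum>i<n. ((sqrt (\<rho>n n) *\<^sub>R x0 i) \<bullet> v) * ((X i v* W) \<bullet> u))) \<and>
     (\<forall>v. 0 \<le> (\<Sum>i<n. ((sqrt (\<rho>n n) *\<^sub>R x0 i) \<bullet> v) * ((X i v* W) \<bullet> v))))"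

lemma ase_rotation:
  "orthogonal_matrix (ase_rotation n X)"
  "(\<Sum>i<n. ((sqrt (\<rho>n n) *\<^sub>R x0 i) \<bullet> u) * ((X i v* ase_rotation n X) \<bullet> v)) = (\<Sum>i<n. ((sqrt (\<rho>n n) *\<^sub>R x0 i) \<bullet> v) * ((X i v* ase_rotation n X) \<bullet> u))"
  "0 \<le> (\<Sum>i<n. ((sqrt (\<rho>n n) *\<^sub>R x0 i) \<bullet> v) * ((X i v* ase_rotation n X) \<bullet> v))"
proof -
  obtain W :: "real^'d^'d" where "orthogonal_matrix W \<and>
     (\<forall>u v. (\<Sum>i<n. ((sqrt (\<rho>n n) *\<^sub>R x0 i) \<bullet> u) * ((X i v* W) \<bullet> v)) = (\<Sum>i<n. ((sqrt (\<rho>n n) *\<^sub>R x0 i) \<bullet> v) * ((X i v* W) \<bullet> u))) \<and>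
     (\<forall>v. 0 \<le> (\<Sum>i<n. ((sqrt (\<rho>n n) *\<^sub>R x0 i) \<bullet> v) * ((X i v* W) \<bullet> v)))"
    by (rule procrustes[where x = "\<lambda>i. sqrt (\<rho>n n) *\<^sub>R x0 i" and y = X and n = n]) blast
  from someI[of "\<lambda>W. orthogonal_matrix W \<and>
     (\<forall>u v. (\<Sum>i<n. ((sqrt (\<rho>n n) *\<^sub>R x0 i) \<bullet> u) * ((X i v* W) \<bullet> v)) = (\<Sum>i<n. ((sqrt (\<rho>n n) *\<^sub>R x0 i) \<bullet> v) * ((X i v* W) \<bullet> u))) \<and>
     (\<forall>v. 0 \<le> (\<Sum>i<n. ((sqrt (\<rho>n n) *\<^sub>R x0 i) \<bullet> v) * ((X i v* W) \<bullet> v)))", OF this, folded ase_rotation_def]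
  show "orthogonal_matrix (ase_rotation n X)"
  "(\<Sum>i<n. ((sqrt (\<rho>n n) *\<^sub>R x0 i) \<bullet> u) * ((X i v* ase_rotation n X) \<bullet> v)) = (\<Sum>i<n. ((sqrt (\<rho>n n) *\<^sub>R x0 i) \<bullet> v) * ((X i v* ase_rotation n X) \<bullet> u))"
  "0 \<le> (\<Sum>i<n. ((sqrt (\<rho>n n) *\<^sub>R x0 i) \<bullet> v) * ((X i v* ase_rotation n X) \<bullet> v))"
    by blast+
qed

lemma full_noise:
  assumes n: "1 \<le> n" and a: "a \<in> set_pmf (P n)"
  shows "a i j - q n i j = noise (q n) a i j - (if i = j then q n i j else 0)" "a i j = a j i"
proof -
  have "a i i = 0" "a i j = a j i" using sparse_modelD(1)[OF model[OF n]] a by (auto simp: edge_model_def)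
  then show "a i j - q n i j = noise (q n) a i j - (if i = j then q n i j else 0)" "a i j = a j i"
    by (auto simp: noise_def)
qed

text \<open>Row j of X (X^T X)^-1 for X = sqrt r X0, since X^T X = n r \<open>Dn n\<close>. It is
  the coefficient of the entry (i, j) in the linear term.\<close>

definition ase_coef :: "nat \<Rightarrow> nat \<Rightarrow> nat \<Rightarrow> real^'d" where
  "ase_coef n i j = (1 / (real n * sqrt (\<rho>n n))) *\<^sub>R (matrix_inv (Dn n) *v x0 j)"

text \<open>With coefficients of size B / (n sqrt r) the squared norm of a linear term deviates from
  its mean by the order of 1 / sqrt n in L2, which the factor n normalises.\<close>

lemma quadratic_tight:
  fixes v :: "nat \<Rightarrow> nat \<Rightarrow> nat \<Rightarrow> real^'d"
  assumes n: "1 \<le> n" and nr: "1 \<le> real n * \<rho>n n" and B: "\<And>i j. i < n \<Longrightarrow> j < n \<Longrightarrow> norm (v n i j) \<le> B / (real n * sqrt (\<rho>n n))"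
    and B0: "0 \<le> B"
  shows "measure_pmf.expectation (P n) (\<lambda>a. real n * ((\<Sum>i<n. (norm (\<Sum>j<n. noise (q n) a i j *\<^sub>R v n i j))\<^sup>2)
       - (\<Sum>i<n. \<Sum>j\<in>{..<n} - {i}. q n i j * (1 - q n i j) * (norm (v n i j))\<^sup>2))\<^sup>2) \<le> 8 * B ^ 4"
proof -
  define r where "r = \<rho>n n"
  define N where "N = real n"
  have r: "0 < r" "r \<le> 1" using rho_n[OF n] by (auto simp: r_def)
  have N: "0 < N" "1 \<le> N * r" using n nr by (auto simp: N_def r_def)
  have "measure_pmf.expectation (P n) (\<lambda>a. real n * ((\<Sum>i<n. (norm (\<Sum>j<n. noise (q n) a i j *\<^sub>R v n i j))\<^sup>2)
       - (\<Sum>i<n. \<Sum>j\<in>{..<n} - {i}. q n i j * (1 - q n i j) * (norm (v n i j))\<^sup>2))\<^sup>2)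
     \<le> real n * (4 * r\<^sup>2 * real n ^ 3 * (B / (real n * sqrt r)) ^ 4 + 4 * r * real n ^ 2 * (B / (real n * sqrt r)) ^ 4)"
    using rows_square_concentration[OF model[OF n] _ B] r by (simp add: r_def mult_left_mono)
  also have "\<dots> = 4 * B ^ 4 + 4 * B ^ 4 / (N * r)"
  proof -
    have s4: "sqrt r ^ 4 = r\<^sup>2" using r by (metis less_imp_le numeral_Bit0 power_add power2_eq_square real_sqrt_pow2)
    show ?thesis
      unfolding N_def[symmetric] power_divide power_mult_distrib s4 using N r
      by (simp add: field_simps power2_eq_square power3_eq_cube power4_eq_xxxx)
  qed
  also have "\<dots> \<le> 4 * B ^ 4 + 4 * B ^ 4 / 1"
    using N B0 by (intro add_left_mono divide_left_mono) auto
  finally show ?thesis by simp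
qed

text \<open>Four nonnegative noise polynomials, each scaled to bounded expectation: the squared
  norms of E X0, of X0^T E X0 and of E^2, and the fluctuation of the linear term. A single
  application of Markov's inequality to the sum controls all of them.\<close>

definition ase_stat :: "nat \<Rightarrow> (nat \<Rightarrow> nat \<Rightarrow> real) \<Rightarrow> real" where
  "ase_stat n a =
     (\<Sum>i<n. (norm (\<Sum>j<n. noise (q n) a i j *\<^sub>R x0 j))\<^sup>2) / ((real n)\<^sup>2 * \<rho>n n)
     + (norm (\<Sum>i<n. \<Sum>j<n. noise (q n) a i j *\<^sub>R dyad (x0 i) (x0 j)))\<^sup>2 / ((real n)\<^sup>2 * \<rho>n n)
     + (\<Sum>i<n. \<Sum>k<n. (\<Sum>j<n. noise (q n) a i j * noise (q n) a j k)\<^sup>2) / (real n ^ 3 * (\<rho>n n)\<^sup>2)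
     + real n * ((\<Sum>i<n. (norm (\<Sum>j<n. noise (q n) a i j *\<^sub>R ase_coef n i j))\<^sup>2)
       - (\<Sum>i<n. \<Sum>j\<in>{..<n} - {i}. q n i j * (1 - q n i j) * (norm (ase_coef n i j))\<^sup>2))\<^sup>2"

lemma ase_coef_bound:
  assumes n: "1 \<le> n" and l: "0 < l" and low: "\<And>v. l * (norm v)\<^sup>2 \<le> v \<bullet> (Dn n *v v)"
  shows "norm (ase_coef n i j) \<le> (1 / l) / (real n * sqrt (\<rho>n n))"
proof -
  have "norm (matrix_inv (Dn n) *v x0 j) \<le> norm (x0 j) / l" by (rule lower_bound_matrix_inv[OF l low])
  also have "\<dots> \<le> 1 / l" using l x0_bounds(5) by (intro divide_right_mono) auto
  finally have "norm (matrix_inv (Dn n) *v x0 j) / (real n * sqrt (\<rho>n n)) \<le> (1 / l) / (real n * sqrt (\<rho>n n))"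
    using n rho_n[OF n] by (intro divide_right_mono) auto
  then show ?thesis using n rho_n[OF n] by (simp add: ase_coef_def abs_mult)
qed

lemma ase_stat_tight: "tight P (\<lambda>C n a. ase_stat n a \<le> C)"
proof -
  obtain l where l: "0 < l" "\<forall>\<^sub>F n in sequentially. \<forall>v. l * (norm v)\<^sup>2 \<le> v \<bullet> (Dn n *v v)"
    by (rule Dn_lower_bound) blast
  show ?thesis
  proof (rule tight_expectation)
    show "\<forall>\<^sub>F n in sequentially. edge_model n (q n) (P n)"
      using eventually_ge_at_top[of 1] by eventually_elim (rule sparse_modelD(1)[OF model])
    show "0 \<le> ase_stat n a" for n a
    proof (cases "1 \<le> n")
      case True
      then show ?thesis using rho_n[OF True] unfolding ase_stat_def
        by (auto intro!: add_nonneg_nonneg divide_nonneg_nonneg sum_nonneg mult_nonneg_nonneg)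
    qed (simp add: ase_stat_def not_le)
    show "\<forall>\<^sub>F n in sequentially. measure_pmf.expectation (P n) (ase_stat n) \<le> 2 + 2 + 16 + 8 * (1 / l) ^ 4"
      using l(2) eventually_nr eventually_ge_at_top[of 1]
    proof eventually_elim
      case (elim n)
      define N where "N = real n"
      define r where "r = \<rho>n n"
      have r: "0 < r" "r \<le> 1" using rho_n[OF elim(3)] by (auto simp: r_def)
      have N: "0 < N" using elim(3) by (simp add: N_def)
      note sm = model[OF elim(3)]
      note em = sparse_modelD(1)[OF sm]
      have r0: "0 \<le> \<rho>n n" using r by (simp add: r_def)
      have n1: "(norm (x0 j))\<^sup>2 \<le> 1" for j using x0_bounds(5)[of j] by (simp add: power_le_one)
      have d1: "(norm (dyad (x0 i) (x0 j)))\<^sup>2 \<le> 1" for i j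
        using x0_bounds(5)[of j] x0_bounds(5)[of i] by (simp add: norm_dyad power_le_one mult_le_one)
      have b1: "measure_pmf.expectation (P n) (\<lambda>a. \<Sum>i<n. (norm (\<Sum>j<n. noise (q n) a i j *\<^sub>R x0 j))\<^sup>2) / (N\<^sup>2 * r) \<le> 2"
      proof -
        have "measure_pmf.expectation (P n) (\<lambda>a. \<Sum>i<n. (norm (\<Sum>j<n. noise (q n) a i j *\<^sub>R x0 j))\<^sup>2) \<le> 2 * r * (\<Sum>i<n. \<Sum>j<n. (norm (x0 j))\<^sup>2)"
          unfolding r_def by (rule rows_second_moment[OF sm r0])
        also have "\<dots> \<le> 2 * r * (\<Sum>i<n. \<Sum>j<n. 1)" using r n1 by (intro mult_left_mono sum_mono) auto
        also have "\<dots> = 2 * (N\<^sup>2 * r)" by (simp add: N_def power2_eq_square)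
        finally show ?thesis using N r by (simp add: divide_le_eq)
      qed
      have b2: "measure_pmf.expectation (P n) (\<lambda>a. (norm (\<Sum>i<n. \<Sum>j<n. noise (q n) a i j *\<^sub>R dyad (x0 i) (x0 j)))\<^sup>2) / (N\<^sup>2 * r) \<le> 2"
      proof -
        have "measure_pmf.expectation (P n) (\<lambda>a. (norm (\<Sum>i<n. \<Sum>j<n. noise (q n) a i j *\<^sub>R dyad (x0 i) (x0 j)))\<^sup>2) \<le> 2 * r * (\<Sum>i<n. \<Sum>j<n. (norm (dyad (x0 i) (x0 j)))\<^sup>2)"
          unfolding r_def by (rule second_moment_linear[OF sm r0])
        also have "\<dots> \<le> 2 * r * (\<Sum>i<n. \<Sum>j<n. 1)" using r d1 by (intro mult_left_mono sum_mono) auto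
        also have "\<dots> = 2 * (N\<^sup>2 * r)" by (simp add: N_def power2_eq_square)
        finally show ?thesis using N r by (simp add: divide_le_eq)
      qed
      have b3: "measure_pmf.expectation (P n) (\<lambda>a. \<Sum>i<n. \<Sum>k<n. (\<Sum>j<n. noise (q n) a i j * noise (q n) a j k)\<^sup>2) / (N ^ 3 * r\<^sup>2) \<le> 16"
      proof -
        have "measure_pmf.expectation (P n) (\<lambda>a. \<Sum>i<n. \<Sum>k<n. (\<Sum>j<n. noise (q n) a i j * noise (q n) a j k)\<^sup>2) \<le> 16 * (N ^ 3 * r\<^sup>2)"
          using noise_square_frobenius[OF sm r0 elim(2)] by (simp add: N_def r_def mult_ac)
        then show ?thesis using N r by (simp add: divide_le_eq)
      qed
      have b4: "measure_pmf.expectation (P n) (\<lambda>a. N * ((\<Sum>i<n. (norm (\<Sum>j<n. noise (q n) a i j *\<^sub>R ase_coef n i j))\<^sup>2)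
         - (\<Sum>i<n. \<Sum>j\<in>{..<n} - {i}. q n i j * (1 - q n i j) * (norm (ase_coef n i j))\<^sup>2))\<^sup>2) \<le> 8 * (1 / l) ^ 4"
        unfolding N_def using elim l(1) by (intro quadratic_tight ase_coef_bound) auto
      have "measure_pmf.expectation (P n) (ase_stat n)
         = measure_pmf.expectation (P n) (\<lambda>a. \<Sum>i<n. (norm (\<Sum>j<n. noise (q n) a i j *\<^sub>R x0 j))\<^sup>2) / (N\<^sup>2 * r)
         + measure_pmf.expectation (P n) (\<lambda>a. (norm (\<Sum>i<n. \<Sum>j<n. noise (q n) a i j *\<^sub>R dyad (x0 i) (x0 j)))\<^sup>2) / (N\<^sup>2 * r)
         + measure_pmf.expectation (P n) (\<lambda>a. \<Sum>i<n. \<Sum>k<n. (\<Sum>j<n. noise (q n) a i j * noise (q n) a j k)\<^sup>2) / (N ^ 3 * r\<^sup>2)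
         + measure_pmf.expectation (P n) (\<lambda>a. N * ((\<Sum>i<n. (norm (\<Sum>j<n. noise (q n) a i j *\<^sub>R ase_coef n i j))\<^sup>2)
         - (\<Sum>i<n. \<Sum>j\<in>{..<n} - {i}. q n i j * (1 - q n i j) * (norm (ase_coef n i j))\<^sup>2))\<^sup>2)"
        unfolding ase_stat_def N_def r_def integral_divide_zero[symmetric]
        by (simp only: Bochner_Integration.integral_add[OF edge_model_integrable edge_model_integrable, OF em em])
      then show ?case using b1 b2 b3 b4 by linarith
    qed
  qed
qed

lemma ase_limit:
  assumes ase: "\<And>n a. 1 \<le> n \<Longrightarrow> a \<in> set_pmf (P n) \<Longrightarrow> is_ase n a (X n a)"
  shows "pmf_lim P (\<lambda>n a. frob_sq n (\<lambda>i. X n a i v* ase_rotation n (X n a) - sqrt (\<rho>n n) *\<^sub>R x0 i))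
    (LINT x:K|F. LINT y:K|F. kernel_S (Delta_mat F) \<rho> x y)"
proof (rule pmf_lim_tight[OF ase_stat_tight])
  fix C0 \<eta> :: real assume \<eta>: "0 < \<eta>"
  obtain l where l: "0 < l" "\<forall>\<^sub>F n in sequentially. \<forall>v. l * (norm v)\<^sup>2 \<le> v \<bullet> (Dn n *v v)"
    by (rule Dn_lower_bound) blast
  define C where "C = max C0 0"
  have C: "0 \<le> C" "C0 \<le> C" by (auto simp: C_def)
  \<comment> \<open>sqrt C bounds the contributions of the off-diagonal noise to E X and X^T E X
    relative to s = n r; the added 1 pays for the diagonal bias.\<close>
  define B where "B = sqrt C + 1"
  define b where "b = 16 * B / l"
  define k where "k = (B + B * b + b\<^sup>2) / l"
  have B: "0 \<le> B" using C by (simp add: B_def)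
  \<comment> \<open>The size of the full noise as an operator relative to n r: the fourth root of C
    n^3 r^2 from \<open>noise_operator_bound\<close>, divided by n r, plus the diagonal bias, which
    is at most 1.\<close>
  define eps where "eps = (\<lambda>n. sqrt (sqrt (C * (1 / (real n * \<rho>n n ^ 2)))) + 1 / (real n * \<rho>n n))"
  have eps_lim: "eps \<longlonglongrightarrow> sqrt (sqrt (C * 0)) + 0"
    unfolding eps_def using rates[of 2] rate1 by (intro tendsto_intros) auto
  define \<tau> where "\<tau> = (\<lambda>n. (eps n * b + (3 * b\<^sup>2 + b ^ 3 + k) * sqrt (1 / (real n * \<rho>n n))) / l + (1 / l) * sqrt (1 / real n))"
  have "\<tau> \<longlonglongrightarrow> (0 * b + (3 * b\<^sup>2 + b ^ 3 + k) * sqrt 0) / l + (1 / l) * sqrt 0"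
    unfolding \<tau>_def using eps_lim l by (intro tendsto_intros rate1 rate0) auto
  then have \<tau>: "\<tau> \<longlonglongrightarrow> 0" by simp
  define \<kappa> where "\<kappa> = (\<lambda>n. sqrt (C * (1 / real n)))"
  have "\<kappa> \<longlonglongrightarrow> sqrt (C * 0)" unfolding \<kappa>_def by (intro tendsto_intros rate0)
  then have \<kappa>: "\<kappa> \<longlonglongrightarrow> 0" by simp
  note e = kernel_S_limit[OF rho_lim rho_n' rho01 Delta_inv]
  have "\<forall>\<^sub>F n in sequentially. eps n < l / 8" using eps_lim l by (intro order_tendstoD(2)) auto
  from fnorm_sq_limit[where 'a = "real^'d", OF \<tau> \<kappa> e \<eta>] this l(2) eventually_nr eventually_ge_at_top[of 1]
  show "\<forall>\<^sub>F n in sequentially. \<forall>a\<in>set_pmf (P n). ase_stat n a \<le> C0 \<longrightarrow>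
    \<bar>frob_sq n (\<lambda>i. X n a i v* ase_rotation n (X n a) - sqrt (\<rho>n n) *\<^sub>R x0 i)
      - (LINT x:K|F. LINT y:K|F. kernel_S (Delta_mat F) \<rho> x y)\<bar> \<le> \<eta>"
  proof eventually_elim
    case (elim n)
    show ?case
    proof (intro ballI impI)
      fix a assume a: "a \<in> set_pmf (P n)" and good: "ase_stat n a \<le> C0"
      define N where "N = real n"
      define r where "r = \<rho>n n"
      define sr where "sr = sqrt r"
      have r: "0 < r" "r \<le> 1" using rho_n[OF elim(5)] by (auto simp: r_def)
      have sr: "0 < sr" "sr * sr = r" "sr \<le> 1" using r by (auto simp: sr_def)
      have N: "1 \<le> N" "1 \<le> N * r" using elim(5,4) by (auto simp: N_def r_def)
      define E where "E = noise (q n) a"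
      \<comment> \<open>The deviation of \<open>a\<close> from \<open>q n\<close> with its diagonal.
        Minimality and stationarity involve all entries of \<open>a\<close>, whereas the moment
        bounds concern \<open>E\<close>.\<close>
      define Ef where "Ef = (\<lambda>i j. E i j - (if i = j then q n i j else 0))"
      note sm = model[OF elim(5)]
      have E_sym: "E i j = E j i" for i j unfolding E_def by (rule noise_sym[OF sm a])
      have Ef_sym: "Ef i j = Ef j i" for i j unfolding Ef_def by (simp add: E_sym)
      have aEf: "a i j = q n i j + Ef i j" for i j
        using full_noise(1)[OF elim(5) a, of i j] by (simp add: Ef_def E_def)
      define x where "x = (\<lambda>i. sr *\<^sub>R x0 i)"
      define W where "W = ase_rotation n (X n a)"
      define z where "z = (\<lambda>i. X n a i v* W)"
      have xx: "x i \<bullet> x j = q n i j" for i j by (simp add: x_def sr(2) r_def flip: mult.assoc)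
      have W: "orthogonal_matrix W" unfolding W_def by (rule ase_rotation(1))
      have wsym: "(\<Sum>i<n. (x i \<bullet> u) * (z i \<bullet> v)) = (\<Sum>i<n. (x i \<bullet> v) * (z i \<bullet> u))" for u v
        unfolding x_def z_def W_def sr_def r_def by (rule ase_rotation(2))
      have wpsd: "0 \<le> (\<Sum>i<n. (x i \<bullet> v) * (z i \<bullet> v))" for v
        unfolding x_def z_def W_def sr_def r_def by (rule ase_rotation(3))
      note is_a = ase[OF elim(5) a]
      have opt: "(\<Sum>i<n. \<Sum>j<n. (x i \<bullet> x j + Ef i j - z i \<bullet> z j)\<^sup>2) \<le> (\<Sum>i<n. \<Sum>j<n. (Ef i j)\<^sup>2)"
        using ase_optimality[OF is_a W, of x] by (simp add: aEf xx z_def)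
      have stat: "(\<Sum>j<n. (x i \<bullet> x j + Ef i j - z i \<bullet> z j) *\<^sub>R z j) = 0" if "i < n" for i
        using ase_stationarity[OF is_a W full_noise(2)[OF elim(5) a] that] by (simp add: aEf xx z_def)
      define f1 where "f1 = (\<Sum>i<n. (norm (\<Sum>j<n. E i j *\<^sub>R x0 j))\<^sup>2)"
      define f2 where "f2 = (norm (\<Sum>i<n. \<Sum>j<n. E i j *\<^sub>R dyad (x0 i) (x0 j)))\<^sup>2"
      define f3 where "f3 = (\<Sum>i<n. \<Sum>k<n. (\<Sum>j<n. E i j * E j k)\<^sup>2)"
      define f4 where "f4 = ((\<Sum>i<n. (norm (\<Sum>j<n. E i j *\<^sub>R ase_coef n i j))\<^sup>2)
       - (\<Sum>i<n. \<Sum>j\<in>{..<n} - {i}. q n i j * (1 - q n i j) * (norm (ase_coef n i j))\<^sup>2))\<^sup>2"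
      have f0: "0 \<le> f1" "0 \<le> f2" "0 \<le> f3" "0 \<le> f4" by (auto simp: f1_def f2_def f3_def f4_def intro!: sum_nonneg)
      have fsum: "f1 / (N\<^sup>2 * r) + f2 / (N\<^sup>2 * r) + f3 / (N ^ 3 * r\<^sup>2) + N * f4 \<le> C"
        using good C(2) by (simp add: ase_stat_def f1_def f2_def f3_def f4_def N_def r_def E_def)
      have g0: "0 \<le> f1 / (N\<^sup>2 * r)" "0 \<le> f2 / (N\<^sup>2 * r)" "0 \<le> f3 / (N ^ 3 * r\<^sup>2)" "0 \<le> N * f4"
        using f0 N r by auto
      have "f1 / (N\<^sup>2 * r) \<le> C" "f2 / (N\<^sup>2 * r) \<le> C" "f3 / (N ^ 3 * r\<^sup>2) \<le> C" "N * f4 \<le> C"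
        using fsum g0 by linarith+
      then have fb: "f1 \<le> C * (N\<^sup>2 * r)" "f2 \<le> C * (N\<^sup>2 * r)" "f3 \<le> C * (N ^ 3 * r\<^sup>2)" "f4 \<le> C / N"
        using N r by (simp_all add: field_simps)
      have EfU: "(\<Sum>j<n. Ef i j *\<^sub>R U j) = (\<Sum>j<n. E i j *\<^sub>R U j) - q n i i *\<^sub>R U i" if "i < n" for i and U :: "nat \<Rightarrow> real^'d"
      proof -
        have "(\<Sum>j<n. Ef i j *\<^sub>R U j) = (\<Sum>j<n. E i j *\<^sub>R U j) - (\<Sum>j<n. if i = j then q n i j *\<^sub>R U j else 0)"
          unfolding sum_subtractf[symmetric] by (intro sum.cong) (auto simp: Ef_def algebra_simps)
        then show ?thesis using that by simp
      qed
      have qii: "\<bar>q n i i\<bar> \<le> r" for i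
        using x0_bounds(3,4)[of i i] r by (simp add: r_def[symmetric] abs_mult mult_left_le)
      have sN1: "1 \<le> sqrt N" "sqrt N * sqrt N = N" using N by auto
      have sN2: "sqrt N \<le> N" using mult_left_mono[of 1 "sqrt N" "sqrt N"] sN1 by simp
      note sN = sN1(1) sN2 sN1(2)
      have EX: "fnorm n (\<lambda>i. \<Sum>j<n. E i j *\<^sub>R x0 j) \<le> sqrt C * (N * sr)"
      proof -
        have "fnorm n (\<lambda>i. \<Sum>j<n. E i j *\<^sub>R x0 j) \<le> sqrt (C * (N\<^sup>2 * r))"
          using fb(1) by (intro real_le_rsqrt) (simp add: fnorm_sq f1_def)
        also have "\<dots> = sqrt C * (N * sr)" using N by (simp add: real_sqrt_mult sr_def)
        finally show ?thesis .
      qed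
      have x0f: "fnorm n x0 \<le> sqrt N" unfolding N_def using fnorm_le_const'[of 1 n x0] x0_bounds(5) by simp
      have EYb: "fnorm n (\<lambda>i. \<Sum>j<n. Ef i j *\<^sub>R x j) \<le> B * (N * r)"
      proof -
        have "fnorm n (\<lambda>i. \<Sum>j<n. Ef i j *\<^sub>R x j) = fnorm n (\<lambda>i. sr *\<^sub>R (\<Sum>j<n. E i j *\<^sub>R x0 j) - (sr * q n i i) *\<^sub>R x0 i)"
        proof (rule fnorm_cong)
          fix i assume i: "i < n"
          have "(\<Sum>j<n. Ef i j *\<^sub>R x j) = sr *\<^sub>R (\<Sum>j<n. Ef i j *\<^sub>R x0 j)"
            by (simp add: x_def scaleR_sum_right mult.commute)
          then show "(\<Sum>j<n. Ef i j *\<^sub>R x j) = sr *\<^sub>R (\<Sum>j<n. E i j *\<^sub>R x0 j) - (sr * q n i i) *\<^sub>R x0 i"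
            by (simp add: EfU[OF i, of x0] scaleR_diff_right)
        qed
        also have "\<dots> \<le> fnorm n (\<lambda>i. sr *\<^sub>R (\<Sum>j<n. E i j *\<^sub>R x0 j)) + fnorm n (\<lambda>i. (sr * q n i i) *\<^sub>R x0 i)"
          by (rule fnorm_triangle_diff)
        also have "\<dots> \<le> sr * (sqrt C * (N * sr)) + r * sqrt N"
        proof (intro add_mono)
          have "fnorm n (\<lambda>i. sr *\<^sub>R (\<Sum>j<n. E i j *\<^sub>R x0 j)) \<le> sr * fnorm n (\<lambda>i. \<Sum>j<n. E i j *\<^sub>R x0 j)"
            using sr by (intro fnorm_le_mult) auto
          then show "fnorm n (\<lambda>i. sr *\<^sub>R (\<Sum>j<n. E i j *\<^sub>R x0 j)) \<le> sr * (sqrt C * (N * sr))"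
            using mult_left_mono[OF EX, of sr] sr by linarith
          have "fnorm n (\<lambda>i. (sr * q n i i) *\<^sub>R x0 i) \<le> r * fnorm n x0"
          proof (rule fnorm_le_mult)
            fix i
            have "\<bar>sr * q n i i\<bar> \<le> 1 * r" unfolding abs_mult[of sr] using sr qii by (intro mult_mono) auto
            then have "\<bar>sr * q n i i\<bar> * norm (x0 i) \<le> r * norm (x0 i)" by (intro mult_right_mono) auto
            then show "norm ((sr * q n i i) *\<^sub>R x0 i) \<le> r * norm (x0 i)" by simp
          qed (use r in auto)
          then show "fnorm n (\<lambda>i. (sr * q n i i) *\<^sub>R x0 i) \<le> r * sqrt N"
            using mult_left_mono[OF x0f, of r] r by linarith
        qed
        also have "\<dots> \<le> sqrt C * (N * r) + r * N"
          using sN r unfolding sr(2)[symmetric] by (intro add_mono mult_left_mono) auto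
        finally show ?thesis by (simp add: B_def algebra_simps)
      qed
      have XEX: "norm (\<Sum>i<n. \<Sum>j<n. Ef i j *\<^sub>R dyad (x i) (x j)) \<le> B * (N * r)"
      proof -
        have dx: "dyad (x i) (x j) = r *\<^sub>R dyad (x0 i) (x0 j)" for i j
          by (simp add: dyad_def x_def vec_eq_iff sr(2)[symmetric] mult_ac)
        have "(\<Sum>i<n. \<Sum>j<n. Ef i j *\<^sub>R dyad (x i) (x j))
          = (\<Sum>i<n. \<Sum>j<n. r *\<^sub>R (E i j *\<^sub>R dyad (x0 i) (x0 j)) - (if i = j then (r * q n i j) *\<^sub>R dyad (x0 i) (x0 j) else 0))"
          unfolding dx by (intro sum.cong refl) (auto simp: Ef_def algebra_simps)
        also have "\<dots> = r *\<^sub>R (\<Sum>i<n. \<Sum>j<n. E i j *\<^sub>R dyad (x0 i) (x0 j)) - (\<Sum>i<n. (r * q n i i) *\<^sub>R dyad (x0 i) (x0 i))"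
          by (simp add: sum_subtractf scaleR_sum_right)
        also have "norm \<dots> \<le> r * sqrt f2 + (\<Sum>i<n. r)"
        proof (rule order.trans[OF norm_triangle_ineq4 add_mono])
          show "norm (r *\<^sub>R (\<Sum>i<n. \<Sum>j<n. E i j *\<^sub>R dyad (x0 i) (x0 j))) \<le> r * sqrt f2"
            using r by (simp add: f2_def)
          show "norm (\<Sum>i<n. (r * q n i i) *\<^sub>R dyad (x0 i) (x0 i)) \<le> (\<Sum>i<n. r)"
          proof (intro sum_norm_le)
            fix i
            have "\<bar>r * q n i i\<bar> * (norm (x0 i) * norm (x0 i)) \<le> r * (1 * 1)"
            proof (intro mult_mono)
              show "\<bar>r * q n i i\<bar> \<le> r" unfolding abs_mult using r qii[of i] mult_left_le[of "\<bar>q n i i\<bar>" r] by (simp add: abs_mult)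
            qed (use r x0_bounds(5) in auto)
            then show "norm ((r * q n i i) *\<^sub>R dyad (x0 i) (x0 i)) \<le> r" by (simp add: norm_dyad)
          qed
        qed
        also have "\<dots> \<le> r * (sqrt C * (N * 1)) + N * r"
        proof (rule add_mono)
          have "sqrt f2 \<le> sqrt (C * (N\<^sup>2 * r))" using fb(2) by (rule real_sqrt_le_mono)
          also have "\<dots> = sqrt C * (N * sr)" using N by (simp add: real_sqrt_mult sr_def)
          also have "\<dots> \<le> sqrt C * (N * 1)" using N C sr by (intro mult_left_mono) auto
          finally show "r * sqrt f2 \<le> r * (sqrt C * (N * 1))" using r by (intro mult_left_mono) auto
        qed (simp add: N_def)
        finally show ?thesis by (simp add: B_def algebra_simps)
      qed
      have Eop: "fnorm n (\<lambda>i. \<Sum>j<n. Ef i j *\<^sub>R U j) \<le> eps n * (N * r) * fnorm n U" for U :: "nat \<Rightarrow> real^'d"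
      proof -
        have "fnorm n (\<lambda>i. \<Sum>j<n. Ef i j *\<^sub>R U j) = fnorm n (\<lambda>i. (\<Sum>j<n. E i j *\<^sub>R U j) - q n i i *\<^sub>R U i)"
          by (intro fnorm_cong EfU)
        also have "\<dots> \<le> fnorm n (\<lambda>i. \<Sum>j<n. E i j *\<^sub>R U j) + fnorm n (\<lambda>i. q n i i *\<^sub>R U i)"
          by (rule fnorm_triangle_diff)
        also have "\<dots> \<le> sqrt (sqrt (C * (N ^ 3 * r\<^sup>2))) * fnorm n U + 1 * fnorm n U"
        proof (intro add_mono)
          show "fnorm n (\<lambda>i. \<Sum>j<n. E i j *\<^sub>R U j) \<le> sqrt (sqrt (C * (N ^ 3 * r\<^sup>2))) * fnorm n U"
            by (rule noise_operator_bound[OF E_sym fb(3)[unfolded f3_def]])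
          show "fnorm n (\<lambda>i. q n i i *\<^sub>R U i) \<le> 1 * fnorm n U"
          proof (rule fnorm_le_mult)
            fix i
            have "\<bar>q n i i\<bar> \<le> 1" using qii[of i] r by linarith
            then have "\<bar>q n i i\<bar> * norm (U i) \<le> 1 * norm (U i)" by (intro mult_right_mono) auto
            then show "norm (q n i i *\<^sub>R U i) \<le> 1 * norm (U i)" by simp
          qed simp
        qed
        also have "C * (N ^ 3 * r\<^sup>2) = (C * (1 / (N * r ^ 2))) * (N * r) ^ 4"
          using N r by (simp add: field_simps power2_eq_square power3_eq_cube power4_eq_xxxx)
        also have "sqrt (sqrt ((C * (1 / (N * r ^ 2))) * (N * r) ^ 4)) = sqrt (sqrt (C * (1 / (N * r ^ 2)))) * (N * r)"
          using N by (intro sqrt_sqrt_mult_power4) auto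
        also have "sqrt (sqrt (C * (1 / (N * r ^ 2)))) * (N * r) * fnorm n U + 1 * fnorm n U = eps n * (N * r) * fnorm n U"
        proof -
          have "eps n * (N * r) = sqrt (sqrt (C * (1 / (N * r ^ 2)))) * (N * r) + 1 / (N * r) * (N * r)"
            by (simp only: eps_def N_def r_def distrib_right)
          also have "1 / (N * r) * (N * r) = 1" using N r by simp
          finally show ?thesis by (simp only: distrib_right)
        qed
        finally show ?thesis .
      qed
      have low: "l * (N * r) * (norm v)\<^sup>2 \<le> (\<Sum>j<n. (x j \<bullet> v)\<^sup>2)" for v
      proof -
        have "N * (l * (norm v)\<^sup>2) \<le> N * (v \<bullet> (Dn n *v v))" using elim(3) N by (intro mult_left_mono) auto
        also have "\<dots> = (\<Sum>j<n. (x0 j \<bullet> v)\<^sup>2)" unfolding N_def by (rule Dn_form)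
        finally have "r * (N * (l * (norm v)\<^sup>2)) \<le> r * (\<Sum>j<n. (x0 j \<bullet> v)\<^sup>2)" using r by (intro mult_left_mono) auto
        also have "\<dots> = (\<Sum>j<n. (x j \<bullet> v)\<^sup>2)"
          by (simp add: x_def power_mult_distrib sum_distrib_left power2_eq_square[of sr] sr(2))
        finally show ?thesis by (simp add: mult_ac)
      qed
      have up: "(fnorm n x)\<^sup>2 \<le> N * r"
      proof -
        have "(fnorm n x)\<^sup>2 \<le> real n * sr\<^sup>2"
          using sr x0_bounds(5) by (intro fnorm_le_const) (auto simp: x_def mult_left_le)
        then show ?thesis using sr(2) by (simp add: N_def power2_eq_square)
      qed
      define Di where "Di = matrix_inv (Dn n)"
      define m where "m = (\<lambda>i. (1 / (N * sr)) *\<^sub>R (Di *v (\<Sum>j<n. Ef i j *\<^sub>R x0 j)))"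
      have Dinv: "invertible (Dn n)" using elim(3) by (intro lower_bound_invertible[OF l(1)]) auto
      have m: "(\<Sum>j<n. (x j \<bullet> m i) *\<^sub>R x j) = (\<Sum>j<n. Ef i j *\<^sub>R x j)" for i
      proof -
        have "(\<Sum>j<n. (x j \<bullet> m i) *\<^sub>R x j) = r *\<^sub>R (\<Sum>j<n. (x0 j \<bullet> m i) *\<^sub>R x0 j)"
          by (simp add: x_def scaleR_sum_right sr(2)[symmetric] mult_ac)
        also have "\<dots> = (r * N) *\<^sub>R (Dn n *v m i)" by (simp add: Dn_mult[symmetric] N_def)
        also have "\<dots> = (r * N * (1 / (N * sr))) *\<^sub>R (\<Sum>j<n. Ef i j *\<^sub>R x0 j)"
          by (simp add: m_def Di_def matrix_vector_mult_scaleR invertible_matrix_inv_mult[OF Dinv])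
        also have "r * N * (1 / (N * sr)) = sr" using N sr(1) by (simp add: sr(2)[symmetric])
        finally show ?thesis by (simp add: x_def scaleR_sum_right mult.commute)
      qed
      have lin: "fnorm n (\<lambda>i. z i - x i - m i) \<le> (eps n * b + (3 * b\<^sup>2 + b ^ 3 + k) / sqrt (N * r)) / l"
      proof -
        have e: "0 \<le> eps n" using C N r by (auto simp: eps_def N_def r_def[symmetric] intro!: add_nonneg_nonneg)
        have e8: "eps n \<le> l / 8" using elim(2) by simp
        show ?thesis
          by (rule embedding_linearization(2)[where x = x and z = z and m = m and E = Ef and n = n and B = B and b = b and k = k
              and l = l and s = "N * r" and \<epsilon> = "eps n",
              OF Ef_sym wsym wpsd opt stat l(1) N(2) B e e8 low up EYb XEX Eop m b_def k_def])
      qed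
      \<comment> \<open>The linear term without the diagonal bias. Its squared norm is the quantity
        that concentrates; the difference to \<open>m\<close> is of order 1 / sqrt n and is the last
        summand of \<tau>.\<close>
      define m0 where "m0 = (\<lambda>i. \<Sum>j<n. E i j *\<^sub>R ase_coef n i j)"
      have mm0: "m i - m0 i = - (q n i i *\<^sub>R ase_coef n i i)" if i: "i < n" for i
      proof -
        have "m i = (\<Sum>j<n. Ef i j *\<^sub>R ase_coef n i j)"
          by (simp add: m_def ase_coef_def Di_def N_def sr_def r_def linear_sum[OF matrix_vector_mul_linear]
                matrix_vector_mult_scaleR scaleR_sum_right mult_ac)
        then show ?thesis using EfU[OF i, of "ase_coef n i"] by (simp add: m0_def)
      qed
      have m0b: "fnorm n (\<lambda>i. m i - m0 i) \<le> sqrt N * (sr / (l * N))"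
        unfolding N_def
      proof (rule fnorm_le_const')
        fix i assume "i < n"
        have "norm (m i - m0 i) \<le> r * ((1 / l) / (N * sr))"
          unfolding mm0[OF \<open>i < n\<close>] norm_minus_cancel norm_scaleR
          using qii[of i] ase_coef_bound[OF elim(5) l(1), of i i] elim(3) r
          by (intro mult_mono) (auto simp: N_def sr_def r_def)
        also have "\<dots> = sr / (l * N)" using sr(1) by (simp add: sr(2)[symmetric])
        finally show "norm (m i - m0 i) \<le> sr / (l * real n)" by (simp add: N_def)
      qed (use sr l in auto)
      have t: "fnorm n (\<lambda>i. (z i - x i) - m0 i) \<le> \<tau> n"
      proof -
        have "fnorm n (\<lambda>i. (z i - x i) - m0 i) \<le> fnorm n (\<lambda>i. z i - x i - m i) + fnorm n (\<lambda>i. m i - m0 i)"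
          using fnorm_triangle[of n "\<lambda>i. z i - x i - m i" "\<lambda>i. m i - m0 i"] by (simp add: algebra_simps)
        also have "\<dots> \<le> (eps n * b + (3 * b\<^sup>2 + b ^ 3 + k) / sqrt (N * r)) / l + (1 / l) * sqrt (1 / N)"
        proof (rule add_mono[OF lin order.trans[OF m0b]])
          have "sqrt N * (sr / (l * N)) \<le> sqrt N * (1 / (l * N))"
            using sr l N sN by (intro mult_left_mono divide_right_mono) auto
          also have "\<dots> = (1 / l) * (sqrt N / N)" by simp
          also have "\<dots> = (1 / l) * sqrt (1 / N)"
            using sqrt_divide_self_eq[of N] N by (simp add: real_sqrt_divide inverse_eq_divide)
          finally show "sqrt N * (sr / (l * N)) \<le> (1 / l) * sqrt (1 / N)" .
        qed
        also have "\<dots> = \<tau> n" by (simp add: \<tau>_def N_def r_def real_sqrt_divide)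
        finally show ?thesis .
      qed
      have conc: "\<bar>(fnorm n m0)\<^sup>2 - (\<Sum>i<n. \<Sum>j\<in>{..<n} - {i}. kernel_S (Dn n) (\<rho>n n) (x0 i) (x0 j)) / (real n)\<^sup>2\<bar> \<le> \<kappa> n"
      proof -
        have e1: "(norm (ase_coef n i j))\<^sup>2 = (norm (Di *v x0 j))\<^sup>2 / (N\<^sup>2 * r)" for i j
        proof -
          have "norm (ase_coef n i j) = norm (Di *v x0 j) / (N * sr)"
            using N sr by (simp add: ase_coef_def Di_def N_def r_def sr_def)
          then show ?thesis using sr(2) by (simp add: power_mult_distrib power_divide power2_eq_square[of sr])
        qed
        have e2: "r * s * (1 - r * s) * (w / (N\<^sup>2 * r)) = s * (1 - r * s) * w / N\<^sup>2" for s w using r by simp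
        have e3: "q n i j * (1 - q n i j) * (norm (ase_coef n i j))\<^sup>2 = kernel_S (Dn n) (\<rho>n n) (x0 i) (x0 j) / (real n)\<^sup>2" for i j
          using e2[of "x0 i \<bullet> x0 j" "(norm (Di *v x0 j))\<^sup>2"] by (simp only: e1 kernel_S_def Di_def N_def r_def)
        have "(\<Sum>i<n. \<Sum>j\<in>{..<n} - {i}. q n i j * (1 - q n i j) * (norm (ase_coef n i j))\<^sup>2)
          = (\<Sum>i<n. \<Sum>j\<in>{..<n} - {i}. kernel_S (Dn n) (\<rho>n n) (x0 i) (x0 j)) / (real n)\<^sup>2"
          by (simp only: e3 sum_divide_distrib)
        then have "((fnorm n m0)\<^sup>2 - (\<Sum>i<n. \<Sum>j\<in>{..<n} - {i}. kernel_S (Dn n) (\<rho>n n) (x0 i) (x0 j)) / (real n)\<^sup>2)\<^sup>2 \<le> C * (1 / real n)"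
          using fb(4) unfolding f4_def fnorm_sq m0_def N_def by simp
        from real_sqrt_le_mono[OF this] show ?thesis by (simp only: \<kappa>_def real_sqrt_abs)
      qed
      have "\<bar>(fnorm n (\<lambda>i. z i - x i))\<^sup>2 - (LINT x:K|F. LINT y:K|F. kernel_S (Delta_mat F) \<rho> x y)\<bar> \<le> \<eta>"
        by (rule elim(1)[rule_format, OF t conc])
      then show "\<bar>frob_sq n (\<lambda>i. X n a i v* ase_rotation n (X n a) - sqrt (\<rho>n n) *\<^sub>R x0 i)
        - (LINT x:K|F. LINT y:K|F. kernel_S (Delta_mat F) \<rho> x y)\<bar> \<le> \<eta>"
        by (simp add: frob_sq_fnorm z_def x_def W_def sr_def r_def)
    qed
  qed
qed

section \<open>The limit for the one-step estimator\<close>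

lemma phi_x0:
  assumes "1 \<le> n"
  shows "\<bar>phi (\<rho>n n) (x0 i \<bullet> x0 j)\<bar> \<le> 4 / \<delta>" "\<bar>dphi (\<rho>n n) (x0 i \<bullet> x0 j)\<bar> \<le> (4 / \<delta>)\<^sup>2"
  using weight_perturbation(6,7)[OF delta, of "\<rho>n n" "x0 i" "x0 j" 0 0 0] rho_n[OF assms] x0_bounds delta by auto

text \<open>The coefficient of the entry (i, j) in the solution of the weighted least squares
  equation of row i when weights and design are taken at the true positions.\<close>

definition one_step_coef :: "nat \<Rightarrow> nat \<Rightarrow> nat \<Rightarrow> real^'d" where
  "one_step_coef n i j =
     (phi (\<rho>n n) (x0 i \<bullet> x0 j) / (real n * sqrt (\<rho>n n))) *\<^sub>R (matrix_inv (Gn n (\<rho>n n) (x0 i)) *v x0 j)"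

text \<open>The coefficient of the product of the entries (i, j) and (j, k) that arises when the
  noise in row i meets the linear part of the initial error of row j.\<close>

definition pair_coef :: "(nat \<Rightarrow> nat \<Rightarrow> nat \<Rightarrow> real^'d) \<Rightarrow> nat \<Rightarrow> nat \<Rightarrow> nat \<Rightarrow> nat \<Rightarrow> real^'d" where
  "pair_coef \<zeta> n i j k =
     dphi (\<rho>n n) (x0 i \<bullet> x0 j) *\<^sub>R (x0 i \<bullet> \<zeta> n j k) *\<^sub>R x0 j + phi (\<rho>n n) (x0 i \<bullet> x0 j) *\<^sub>R \<zeta> n j k"

text \<open>In order, the scaled summands control: the Frobenius norm of the linear initial error,
  its largest row, the row sums of the noise, the noise averages that multiply the error of the same
  row, the weighted averages of the linear errors, their products with the noise, and the
  fluctuation of the new linear term.\<close>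

definition one_step_stat :: "(nat \<Rightarrow> nat \<Rightarrow> nat \<Rightarrow> real^'d) \<Rightarrow> nat \<Rightarrow> (nat \<Rightarrow> nat \<Rightarrow> real) \<Rightarrow> real" where
  "one_step_stat \<zeta> n a =
     (\<Sum>i<n. (norm (\<Sum>j<n. noise (q n) a i j *\<^sub>R \<zeta> n i j))\<^sup>2) / \<rho>n n
     + (\<Sum>i<n. (norm (\<Sum>j<n. noise (q n) a i j *\<^sub>R \<zeta> n i j)) ^ 4) / ((\<rho>n n)\<^sup>2 / real n)
     + (\<Sum>i<n. (norm (\<Sum>j<n. noise (q n) a i j *\<^sub>R (1::real))) ^ 4) / (real n ^ 3 * (\<rho>n n)\<^sup>2)
     + (\<Sum>i<n. (norm (\<Sum>j<n. noise (q n) a i j *\<^sub>R dphi (\<rho>n n) (x0 i \<bullet> x0 j) *\<^sub>R dyad (x0 j) (x0 j))) ^ 4)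
         / (real n ^ 3 * (\<rho>n n)\<^sup>2)
     + (\<Sum>i<n. (norm (\<Sum>j<n. \<Sum>k<n. noise (q n) a j k *\<^sub>R phi (\<rho>n n) (x0 i \<bullet> x0 j) *\<^sub>R (x0 i \<bullet> \<zeta> n j k) *\<^sub>R x0 j))\<^sup>2)
         / (real n * \<rho>n n)
     + (\<Sum>i<n. (norm (\<Sum>j<n. \<Sum>k<n. (noise (q n) a i j * noise (q n) a j k) *\<^sub>R pair_coef \<zeta> n i j k))\<^sup>2)
         / (real n * (\<rho>n n)\<^sup>2)
     + real n * ((\<Sum>i<n. (norm (\<Sum>j<n. noise (q n) a i j *\<^sub>R one_step_coef n i j))\<^sup>2)
         - (\<Sum>i<n. \<Sum>j\<in>{..<n} - {i}. q n i j * (1 - q n i j) * (norm (one_step_coef n i j))\<^sup>2))\<^sup>2"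

lemma one_step_coef_bound:
  assumes n: "1 \<le> n" and l: "0 < l" and low: "\<And>v. l * (norm v)\<^sup>2 \<le> v \<bullet> (Dn n *v v)"
  shows "norm (one_step_coef n i j) \<le> (4 / \<delta> / l) / (real n * sqrt (\<rho>n n))"
proof -
  have r: "0 < \<rho>n n" "\<rho>n n \<le> 1" using rho_n[OF n] by auto
  have "norm (matrix_inv (Gn n (\<rho>n n) (x0 i)) *v x0 j) \<le> norm (x0 j) / l"
    using n r by (intro lower_bound_matrix_inv[OF l] Gn_lower_bound[OF _ _ x0_K low]) auto
  also have "\<dots> \<le> 1 / l" using l x0_bounds(5) by (intro divide_right_mono) auto
  finally have "\<bar>phi (\<rho>n n) (x0 i \<bullet> x0 j)\<bar> * norm (matrix_inv (Gn n (\<rho>n n) (x0 i)) *v x0 j) \<le> 4 / \<delta> * (1 / l)"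
    using phi_x0(1)[OF n, of i j] delta by (intro mult_mono) auto
  then have "\<bar>phi (\<rho>n n) (x0 i \<bullet> x0 j)\<bar> * norm (matrix_inv (Gn n (\<rho>n n) (x0 i)) *v x0 j) / (real n * sqrt (\<rho>n n))
    \<le> 4 / \<delta> * (1 / l) / (real n * sqrt (\<rho>n n))"
    using n r by (intro divide_right_mono) auto
  then show ?thesis using n r by (simp add: one_step_coef_def abs_mult)
qed

lemma pair_coef_bound:
  assumes n: "1 \<le> n" and z: "norm (\<zeta> n j k) \<le> z"
  shows "norm (pair_coef \<zeta> n i j k) \<le> ((4 / \<delta>)\<^sup>2 + 4 / \<delta>) * z"
    "norm (phi (\<rho>n n) (x0 i \<bullet> x0 j) *\<^sub>R (x0 i \<bullet> \<zeta> n j k) *\<^sub>R x0 j) \<le> 4 / \<delta> * z"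
proof -
  have z0: "0 \<le> z" using z norm_ge_zero order.trans by blast
  have in1: "\<bar>x0 i \<bullet> \<zeta> n j k\<bar> \<le> 1 * z"
    using x0_bounds(5)[of i] z by (intro order.trans[OF Cauchy_Schwarz_ineq2] mult_mono) auto
  have in2: "\<bar>x0 i \<bullet> \<zeta> n j k\<bar> * norm (x0 j) \<le> (1 * z) * 1"
    using z0 x0_bounds(5)[of j] by (intro mult_mono in1) auto
  have a: "\<bar>c\<bar> * (\<bar>x0 i \<bullet> \<zeta> n j k\<bar> * norm (x0 j)) \<le> D * z" if "\<bar>c\<bar> \<le> D" for c D :: real
    using that in2 z0 by (intro mult_mono) auto
  show "norm (phi (\<rho>n n) (x0 i \<bullet> x0 j) *\<^sub>R (x0 i \<bullet> \<zeta> n j k) *\<^sub>R x0 j) \<le> 4 / \<delta> * z"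
    using a[OF phi_x0(1)[OF n, of i j]] by (simp add: mult_ac abs_mult)
  have "\<bar>phi (\<rho>n n) (x0 i \<bullet> x0 j)\<bar> * norm (\<zeta> n j k) \<le> 4 / \<delta> * z"
    using phi_x0(1)[OF n, of i j] z delta by (intro mult_mono) auto
  with a[OF phi_x0(2)[OF n, of i j]]
  have "norm (dphi (\<rho>n n) (x0 i \<bullet> x0 j) *\<^sub>R (x0 i \<bullet> \<zeta> n j k) *\<^sub>R x0 j) + norm (phi (\<rho>n n) (x0 i \<bullet> x0 j) *\<^sub>R \<zeta> n j k)
    \<le> (4 / \<delta>)\<^sup>2 * z + 4 / \<delta> * z"
    by (intro add_mono) (simp_all add: mult_ac abs_mult)
  then show "norm (pair_coef \<zeta> n i j k) \<le> ((4 / \<delta>)\<^sup>2 + 4 / \<delta>) * z"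
    unfolding pair_coef_def distrib_right by (rule order.trans[OF norm_triangle_ineq])
qed

lemma one_step_stat_tight:
  fixes \<zeta> :: "nat \<Rightarrow> nat \<Rightarrow> nat \<Rightarrow> real^'d"
  assumes z: "\<And>n i j. i < n \<Longrightarrow> j < n \<Longrightarrow> norm (\<zeta> n i j) \<le> Cz / real n" and Cz: "0 \<le> Cz"
  shows "tight P (\<lambda>C n a. one_step_stat \<zeta> n a \<le> C)"
proof -
  obtain l where l: "0 < l" "\<forall>\<^sub>F n in sequentially. \<forall>v. l * (norm v)\<^sup>2 \<le> v \<bullet> (Dn n *v v)"
    by (rule Dn_lower_bound) blast
  define \<kappa> where "\<kappa> = 4 / \<delta>"
  have \<kappa>: "0 < \<kappa>" using delta by (simp add: \<kappa>_def)
  show ?thesis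
  proof (rule tight_expectation)
    show "\<forall>\<^sub>F n in sequentially. edge_model n (q n) (P n)"
      using eventually_ge_at_top[of 1] by eventually_elim (rule sparse_modelD(1)[OF model])
    show "0 \<le> one_step_stat \<zeta> n a" for n a
    proof (cases "1 \<le> n")
      case True
      then show ?thesis using rho_n[OF True] unfolding one_step_stat_def
        by (auto intro!: add_nonneg_nonneg divide_nonneg_nonneg sum_nonneg mult_nonneg_nonneg)
    qed (simp add: one_step_stat_def not_le)
    show "\<forall>\<^sub>F n in sequentially. measure_pmf.expectation (P n) (one_step_stat \<zeta> n)
      \<le> 2 * Cz\<^sup>2 + 15 * Cz ^ 4 + 15 + 15 * (\<kappa>\<^sup>2) ^ 4 + 2 * (\<kappa> * Cz)\<^sup>2 + 16 * ((\<kappa>\<^sup>2 + \<kappa>) * Cz)\<^sup>2 + 8 * (\<kappa> / l) ^ 4"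
      using l(2) eventually_nr eventually_ge_at_top[of 1]
    proof eventually_elim
      case (elim n)
      define N where "N = real n"
      define r where "r = \<rho>n n"
      have r: "0 < r" "r \<le> 1" using rho_n[OF elim(3)] by (auto simp: r_def)
      have N: "0 < N" using elim(3) by (simp add: N_def)
      note sm = model[OF elim(3)]
      note em = sparse_modelD(1)[OF sm]
      have r0: "0 \<le> \<rho>n n" using r by (simp add: r_def)
      have zN: "norm (\<zeta> n i j) \<le> Cz / N" if "i < n" "j < n" for i j using z[OF that] by (simp add: N_def)
      have z2: "(norm (\<zeta> n i j))\<^sup>2 \<le> (Cz / N)\<^sup>2" if "i < n" "j < n" for i j using zN[OF that] by (intro power_mono) auto
      have dv: "A / S \<le> c" if "A \<le> c * S" "0 < S" for A S c :: real using that by (simp add: divide_le_eq)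
      have b1: "measure_pmf.expectation (P n) (\<lambda>a. \<Sum>i<n. (norm (\<Sum>j<n. noise (q n) a i j *\<^sub>R \<zeta> n i j))\<^sup>2) / r \<le> 2 * Cz\<^sup>2"
      proof (rule dv)
        have "measure_pmf.expectation (P n) (\<lambda>a. \<Sum>i<n. (norm (\<Sum>j<n. noise (q n) a i j *\<^sub>R \<zeta> n i j))\<^sup>2) \<le> 2 * r * (\<Sum>i<n. \<Sum>j<n. (norm (\<zeta> n i j))\<^sup>2)"
          unfolding r_def by (rule rows_second_moment[OF sm r0])
        also have "\<dots> \<le> 2 * r * (\<Sum>i<n. \<Sum>j<n. (Cz / N)\<^sup>2)" using r z2 by (intro mult_left_mono sum_mono) auto
        also have "\<dots> = 2 * Cz\<^sup>2 * r" using N by (simp add: N_def[symmetric] power2_eq_square)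
        finally show "measure_pmf.expectation (P n) (\<lambda>a. \<Sum>i<n. (norm (\<Sum>j<n. noise (q n) a i j *\<^sub>R \<zeta> n i j))\<^sup>2) \<le> 2 * Cz\<^sup>2 * r" .
      qed (rule r)
      have f4: "measure_pmf.expectation (P n) (\<lambda>a. \<Sum>i<n. (norm (\<Sum>j<n. noise (q n) a i j *\<^sub>R v i j)) ^ 4) \<le> 15 * B ^ 4 * (N ^ 3 * r\<^sup>2)"
        if "\<And>i j. i < n \<Longrightarrow> j < n \<Longrightarrow> norm (v i j) \<le> B" for v :: "nat \<Rightarrow> nat \<Rightarrow> 'b::real_inner" and B
        using rows_fourth_moment[OF sm r0 elim(2), of v B, OF that] by (simp add: N_def r_def mult_ac)
      have b2: "measure_pmf.expectation (P n) (\<lambda>a. \<Sum>i<n. (norm (\<Sum>j<n. noise (q n) a i j *\<^sub>R \<zeta> n i j)) ^ 4) / (r\<^sup>2 / N) \<le> 15 * Cz ^ 4"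
      proof (rule dv)
        have "15 * (Cz / N) ^ 4 * (N ^ 3 * r\<^sup>2) = 15 * Cz ^ 4 * (r\<^sup>2 / N)"
          using N by (simp add: power_divide power3_eq_cube power4_eq_xxxx)
        then show "measure_pmf.expectation (P n) (\<lambda>a. \<Sum>i<n. (norm (\<Sum>j<n. noise (q n) a i j *\<^sub>R \<zeta> n i j)) ^ 4) \<le> 15 * Cz ^ 4 * (r\<^sup>2 / N)"
          using f4[of "\<zeta> n" "Cz / N"] zN by simp
      qed (use r N in auto)
      have b3: "measure_pmf.expectation (P n) (\<lambda>a. \<Sum>i<n. (norm (\<Sum>j<n. noise (q n) a i j *\<^sub>R (1::real))) ^ 4) / (N ^ 3 * r\<^sup>2) \<le> 15"
        using f4[of "\<lambda>i j. 1::real" 1] r N by (intro dv) auto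
      have b4: "measure_pmf.expectation (P n) (\<lambda>a. \<Sum>i<n. (norm (\<Sum>j<n. noise (q n) a i j *\<^sub>R dphi (\<rho>n n) (x0 i \<bullet> x0 j) *\<^sub>R dyad (x0 j) (x0 j))) ^ 4)
          / (N ^ 3 * r\<^sup>2) \<le> 15 * (\<kappa>\<^sup>2) ^ 4"
      proof (rule dv[OF f4])
        fix i j
        have "\<bar>dphi (\<rho>n n) (x0 i \<bullet> x0 j)\<bar> * (norm (x0 j) * norm (x0 j)) \<le> \<kappa>\<^sup>2 * (1 * 1)"
          using phi_x0(2)[OF elim(3), of i j] x0_bounds(5)[of j] by (intro mult_mono) (auto simp: \<kappa>_def)
        then show "norm (dphi (\<rho>n n) (x0 i \<bullet> x0 j) *\<^sub>R dyad (x0 j) (x0 j)) \<le> \<kappa>\<^sup>2" by (simp add: norm_dyad)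
      qed (use r N in auto)
      have pc: "norm (pair_coef \<zeta> n i j k) \<le> (\<kappa>\<^sup>2 + \<kappa>) * (Cz / N)"
        "norm (phi (\<rho>n n) (x0 i \<bullet> x0 j) *\<^sub>R (x0 i \<bullet> \<zeta> n j k) *\<^sub>R x0 j) \<le> \<kappa> * (Cz / N)" if "j < n" "k < n" for i j k
        unfolding \<kappa>_def
        by (rule pair_coef_bound[where \<zeta> = \<zeta> and n = n and j = j and k = k, OF elim(3) zN[OF that]])+
      have b5: "measure_pmf.expectation (P n) (\<lambda>a. \<Sum>i<n. (norm (\<Sum>j<n. \<Sum>k<n. noise (q n) a j k *\<^sub>R phi (\<rho>n n) (x0 i \<bullet> x0 j) *\<^sub>R (x0 i \<bullet> \<zeta> n j k) *\<^sub>R x0 j))\<^sup>2)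
          / (N * r) \<le> 2 * (\<kappa> * Cz)\<^sup>2"
      proof (rule dv)
        have "measure_pmf.expectation (P n) (\<lambda>a. \<Sum>i<n. (norm (\<Sum>j<n. \<Sum>k<n. noise (q n) a j k *\<^sub>R phi (\<rho>n n) (x0 i \<bullet> x0 j) *\<^sub>R (x0 i \<bullet> \<zeta> n j k) *\<^sub>R x0 j))\<^sup>2)
          = (\<Sum>i<n. measure_pmf.expectation (P n) (\<lambda>a. (norm (\<Sum>j<n. \<Sum>k<n. noise (q n) a j k *\<^sub>R phi (\<rho>n n) (x0 i \<bullet> x0 j) *\<^sub>R (x0 i \<bullet> \<zeta> n j k) *\<^sub>R x0 j))\<^sup>2))"
          by (rule Bochner_Integration.integral_sum) (rule edge_model_integrable[OF em])
        also have "\<dots> \<le> (\<Sum>i<n. 2 * r * (\<kappa> * Cz)\<^sup>2)"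
        proof (rule sum_mono)
          fix i
          have "measure_pmf.expectation (P n) (\<lambda>a. (norm (\<Sum>j<n. \<Sum>k<n. noise (q n) a j k *\<^sub>R phi (\<rho>n n) (x0 i \<bullet> x0 j) *\<^sub>R (x0 i \<bullet> \<zeta> n j k) *\<^sub>R x0 j))\<^sup>2)
            \<le> 2 * r * (\<Sum>j<n. \<Sum>k<n. (norm (phi (\<rho>n n) (x0 i \<bullet> x0 j) *\<^sub>R (x0 i \<bullet> \<zeta> n j k) *\<^sub>R x0 j))\<^sup>2)"
            unfolding r_def by (rule second_moment_linear[OF sm r0])
          also have "\<dots> \<le> 2 * r * (\<Sum>j<n. \<Sum>k<n. (\<kappa> * (Cz / N))\<^sup>2)"
            by (intro mult_left_mono sum_mono power_mono pc(2)) (use r in auto)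
          also have "\<dots> = 2 * r * (\<kappa> * Cz)\<^sup>2" using N by (simp add: N_def[symmetric] power2_eq_square)
          finally show "measure_pmf.expectation (P n) (\<lambda>a. (norm (\<Sum>j<n. \<Sum>k<n. noise (q n) a j k *\<^sub>R phi (\<rho>n n) (x0 i \<bullet> x0 j) *\<^sub>R (x0 i \<bullet> \<zeta> n j k) *\<^sub>R x0 j))\<^sup>2)
            \<le> 2 * r * (\<kappa> * Cz)\<^sup>2" .
        qed
        also have "\<dots> = 2 * (\<kappa> * Cz)\<^sup>2 * (N * r)" by (simp add: N_def)
        finally show "measure_pmf.expectation (P n) (\<lambda>a. \<Sum>i<n. (norm (\<Sum>j<n. \<Sum>k<n. noise (q n) a j k *\<^sub>R phi (\<rho>n n) (x0 i \<bullet> x0 j) *\<^sub>R (x0 i \<bullet> \<zeta> n j k) *\<^sub>R x0 j))\<^sup>2)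
          \<le> 2 * (\<kappa> * Cz)\<^sup>2 * (N * r)" .
      qed (use r N in auto)
      have b6: "measure_pmf.expectation (P n) (\<lambda>a. \<Sum>i<n. (norm (\<Sum>j<n. \<Sum>k<n. (noise (q n) a i j * noise (q n) a j k) *\<^sub>R pair_coef \<zeta> n i j k))\<^sup>2)
          / (N * r\<^sup>2) \<le> 16 * ((\<kappa>\<^sup>2 + \<kappa>) * Cz)\<^sup>2"
      proof (rule dv)
        have "measure_pmf.expectation (P n) (\<lambda>a. \<Sum>i<n. (norm (\<Sum>j<n. \<Sum>k<n. (noise (q n) a i j * noise (q n) a j k) *\<^sub>R pair_coef \<zeta> n i j k))\<^sup>2)
          \<le> 16 * r\<^sup>2 * N ^ 3 * ((\<kappa>\<^sup>2 + \<kappa>) * (Cz / N))\<^sup>2"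
          unfolding r_def N_def
          by (rule two_step_rows_second_moment[OF sm r0 elim(2)])
             (rule pc(1)[unfolded N_def])
        also have "\<dots> = 16 * ((\<kappa>\<^sup>2 + \<kappa>) * Cz)\<^sup>2 * (N * r\<^sup>2)"
          using N by (simp add: power_mult_distrib power_divide power3_eq_cube power2_eq_square[of N])
        finally show "measure_pmf.expectation (P n) (\<lambda>a. \<Sum>i<n. (norm (\<Sum>j<n. \<Sum>k<n. (noise (q n) a i j * noise (q n) a j k) *\<^sub>R pair_coef \<zeta> n i j k))\<^sup>2)
          \<le> 16 * ((\<kappa>\<^sup>2 + \<kappa>) * Cz)\<^sup>2 * (N * r\<^sup>2)" .
      qed (use r N in auto)
      have b7: "measure_pmf.expectation (P n) (\<lambda>a. N * ((\<Sum>i<n. (norm (\<Sum>j<n. noise (q n) a i j *\<^sub>R one_step_coef n i j))\<^sup>2)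
         - (\<Sum>i<n. \<Sum>j\<in>{..<n} - {i}. q n i j * (1 - q n i j) * (norm (one_step_coef n i j))\<^sup>2))\<^sup>2) \<le> 8 * (\<kappa> / l) ^ 4"
        unfolding N_def \<kappa>_def using elim l(1) delta by (intro quadratic_tight one_step_coef_bound) auto
      have "measure_pmf.expectation (P n) (one_step_stat \<zeta> n)
         = measure_pmf.expectation (P n) (\<lambda>a. \<Sum>i<n. (norm (\<Sum>j<n. noise (q n) a i j *\<^sub>R \<zeta> n i j))\<^sup>2) / r
         + measure_pmf.expectation (P n) (\<lambda>a. \<Sum>i<n. (norm (\<Sum>j<n. noise (q n) a i j *\<^sub>R \<zeta> n i j)) ^ 4) / (r\<^sup>2 / N)
         + measure_pmf.expectation (P n) (\<lambda>a. \<Sum>i<n. (norm (\<Sum>j<n. noise (q n) a i j *\<^sub>R (1::real))) ^ 4) / (N ^ 3 * r\<^sup>2)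
         + measure_pmf.expectation (P n) (\<lambda>a. \<Sum>i<n. (norm (\<Sum>j<n. noise (q n) a i j *\<^sub>R dphi (\<rho>n n) (x0 i \<bullet> x0 j) *\<^sub>R dyad (x0 j) (x0 j))) ^ 4) / (N ^ 3 * r\<^sup>2)
         + measure_pmf.expectation (P n) (\<lambda>a. \<Sum>i<n. (norm (\<Sum>j<n. \<Sum>k<n. noise (q n) a j k *\<^sub>R phi (\<rho>n n) (x0 i \<bullet> x0 j) *\<^sub>R (x0 i \<bullet> \<zeta> n j k) *\<^sub>R x0 j))\<^sup>2) / (N * r)
         + measure_pmf.expectation (P n) (\<lambda>a. \<Sum>i<n. (norm (\<Sum>j<n. \<Sum>k<n. (noise (q n) a i j * noise (q n) a j k) *\<^sub>R pair_coef \<zeta> n i j k))\<^sup>2) / (N * r\<^sup>2)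
         + measure_pmf.expectation (P n) (\<lambda>a. N * ((\<Sum>i<n. (norm (\<Sum>j<n. noise (q n) a i j *\<^sub>R one_step_coef n i j))\<^sup>2)
         - (\<Sum>i<n. \<Sum>j\<in>{..<n} - {i}. q n i j * (1 - q n i j) * (norm (one_step_coef n i j))\<^sup>2))\<^sup>2)"
        unfolding one_step_stat_def N_def r_def integral_divide_zero[symmetric]
        by (simp only: Bochner_Integration.integral_add[OF edge_model_integrable edge_model_integrable, OF em em])
      then show ?case using b1 b2 b3 b4 b5 b6 b7 by linarith
    qed
  qed
qed

lemma one_step_limit:
  fixes X Y R :: "nat \<Rightarrow> (nat \<Rightarrow> nat \<Rightarrow> real) \<Rightarrow> nat \<Rightarrow> real^'d"
    and W :: "nat \<Rightarrow> (nat \<Rightarrow> nat \<Rightarrow> real) \<Rightarrow> real^'d^'d" and \<zeta> :: "nat \<Rightarrow> nat \<Rightarrow> nat \<Rightarrow> real^'d"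
  assumes W: "\<And>n a. orthogonal_matrix (W n a)"
    and z: "\<And>n i j. i < n \<Longrightarrow> j < n \<Longrightarrow> norm (\<zeta> n i j) \<le> Cz / real n" and Cz: "0 \<le> Cz"
    and lin: "\<And>n a i. 1 \<le> n \<Longrightarrow> a \<in> set_pmf (P n) \<Longrightarrow> i < n \<Longrightarrow>
      transpose (W n a) *v X n a i - sqrt (\<rho>n n) *\<^sub>R x0 i
        = (1 / sqrt (\<rho>n n)) *\<^sub>R (\<Sum>j<n. (a i j - q n i j) *\<^sub>R \<zeta> n i j) + R n a i"
    and R: "tight P (\<lambda>C n a. frob_sq n (R n a) \<le> C * rr n)"
    and rr: "(\<lambda>n. rr n / \<rho>n n) \<longlonglongrightarrow> 0" "\<And>n. 0 \<le> rr n"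
    and os: "\<And>n a. 1 \<le> n \<Longrightarrow> a \<in> set_pmf (P n) \<Longrightarrow> is_one_step n a (X n a) (Y n a)"
  shows "pmf_lim P (\<lambda>n a. frob_sq n (\<lambda>i. transpose (W n a) *v Y n a i - sqrt (\<rho>n n) *\<^sub>R x0 i))
    (LINT x:K|F. LINT y:K|F. kernel_G (G_mat F \<rho>) \<rho> x y)"
proof (rule pmf_lim_tight)
  show "tight P (\<lambda>C n a. one_step_stat \<zeta> n a \<le> C \<and> frob_sq n (R n a) \<le> C * rr n)"
  proof (rule tight_conj[OF one_step_stat_tight[OF z Cz] R])
    fix C C' n a assume "C \<le> C'" "frob_sq n (R n a) \<le> C * rr n"
    then show "frob_sq n (R n a) \<le> C' * rr n" using rr(2)[of n] by (meson mult_right_mono order.trans)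
  qed auto
next
  fix C0 \<eta>0 :: real assume \<eta>0: "0 < \<eta>0"
  obtain l where l: "0 < l" "\<forall>\<^sub>F n in sequentially. \<forall>v. l * (norm v)\<^sup>2 \<le> v \<bullet> (Dn n *v v)"
    by (rule Dn_lower_bound) blast
  define C where "C = max C0 0"
  have C: "0 \<le> C" "C0 \<le> C" by (auto simp: C_def)
  define \<kappa> where "\<kappa> = 4 / \<delta>"
  have \<kappa>: "0 < \<kappa>" using delta by (simp add: \<kappa>_def)
  \<comment> \<open>Bounds the initial error times sqrt r in Frobenius norm: sqrt C for its linear
    part and 1 for the remainder.\<close>
  define b where "b = sqrt C + 1"
  have b: "0 \<le> b" using C by (simp add: b_def)
  \<comment> \<open>\<open>u n\<close> is the largest relative size of a row of noise averages, from
    the fourth moments. \<open>v n\<close> is the norm of the initial remainder relative to sqrt r;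
    its second summand is the diagonal bias.\<close>
  define u where "u = (\<lambda>n. sqrt (sqrt (C * (1 / (real n * \<rho>n n ^ 2)))))"
  define v where "v = (\<lambda>n. sqrt (C * (rr n / \<rho>n n)) + Cz * sqrt (1 / real n))"
  have "u \<longlonglongrightarrow> sqrt (sqrt (C * 0))" unfolding u_def using rates[of 2] by (intro tendsto_intros) auto
  then have u_lim: "u \<longlonglongrightarrow> 0" by simp
  have "v \<longlonglongrightarrow> sqrt (C * 0) + Cz * sqrt 0" unfolding v_def by (intro tendsto_intros rr(1) rate0)
  then have v_lim: "v \<longlonglongrightarrow> 0" by simp
  define e where "e = (\<lambda>n. (\<Sum>i<n. \<Sum>j\<in>{..<n} - {i}. kernel_G (Gn n (\<rho>n n)) (\<rho>n n) (x0 i) (x0 j)) / (real n)\<^sup>2)"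
  note e_lim = kernel_G_limit[OF rho_lim rho_n' rho01 Delta_inv, folded e_def]
  define \<theta> where "\<theta> = (\<lambda>n. sqrt (C * (1 / real n)))"
  have "\<theta> \<longlonglongrightarrow> sqrt (C * 0)" unfolding \<theta>_def by (intro tendsto_intros rate0)
  then have \<theta>_lim: "\<theta> \<longlonglongrightarrow> 0" by simp
  \<comment> \<open>The bound of \<open>one_step_linearization\<close> with \<eta> = u + v,
    \<alpha>1 = u r, \<alpha>2 = sqrt(C / (n r)), \<alpha>4 = \<theta> and \<alpha>5 = sqrt 3, where
    the norm of the linear term is bounded by 1 + e + \<theta>.\<close>
  define \<tau> where "\<tau> = (\<lambda>n. (4 / l) *
     (2 * \<kappa> * sqrt (1 / real n) + u n * b + (sqrt (C * (1 / (real n * \<rho>n n))) + 2 * \<kappa>\<^sup>2 * sqrt 3 * v n)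
      + (27 * \<kappa> ^ 3 * (u n + v n) * b + 9 * \<kappa> ^ 3 * b\<^sup>2 * sqrt (1 / (real n * \<rho>n n ^ 3)))
      + (\<theta> n + \<kappa> * v n) + 10 * \<kappa>\<^sup>2 * b\<^sup>2 * sqrt (1 / (real n * \<rho>n n))
      + 21 * \<kappa>\<^sup>2 * (u n + v n) * (1 + (e n + \<theta> n))))"
  have "\<tau> \<longlonglongrightarrow> (4 / l) *
     (2 * \<kappa> * sqrt 0 + 0 * b + (sqrt (C * 0) + 2 * \<kappa>\<^sup>2 * sqrt 3 * 0)
      + (27 * \<kappa> ^ 3 * (0 + 0) * b + 9 * \<kappa> ^ 3 * b\<^sup>2 * sqrt 0)
      + (0 + \<kappa> * 0) + 10 * \<kappa>\<^sup>2 * b\<^sup>2 * sqrt 0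
      + 21 * \<kappa>\<^sup>2 * (0 + 0) * (1 + ((LINT x:K|F. LINT y:K|F. kernel_G (G_mat F \<rho>) \<rho> x y) + 0)))"
    unfolding \<tau>_def by (intro tendsto_intros rate0 rate1 rates u_lim v_lim \<theta>_lim e_lim) simp
  then have \<tau>_lim: "\<tau> \<longlonglongrightarrow> 0" by simp
  have uv_lim: "(\<lambda>n. u n + v n) \<longlonglongrightarrow> 0" using tendsto_add[OF u_lim v_lim] by simp
  \<comment> \<open>The two thresholds for u + v: \<delta> / 6 keeps the perturbed inner products
    away from 0 and 1, and sqrt l / 2 keeps the perturbed Gram matrix coercive.\<close>
  have m0: "0 < min (\<delta> / 6) (sqrt l / 2)" using delta l by simp
  from fnorm_sq_limit[where 'a = "real^'d", OF \<tau>_lim \<theta>_lim e_lim \<eta>0] order_tendstoD(2)[OF uv_lim m0] l(2) eventually_nr eventually_ge_at_top[of 1]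
  show "\<forall>\<^sub>F n in sequentially. \<forall>a\<in>set_pmf (P n). one_step_stat \<zeta> n a \<le> C0 \<and> frob_sq n (R n a) \<le> C0 * rr n \<longrightarrow>
    \<bar>frob_sq n (\<lambda>i. transpose (W n a) *v Y n a i - sqrt (\<rho>n n) *\<^sub>R x0 i)
      - (LINT x:K|F. LINT y:K|F. kernel_G (G_mat F \<rho>) \<rho> x y)\<bar> \<le> \<eta>0"
  proof eventually_elim
    case (elim n)
    show ?case
    proof (intro ballI impI)
      fix a assume a: "a \<in> set_pmf (P n)" and "one_step_stat \<zeta> n a \<le> C0 \<and> frob_sq n (R n a) \<le> C0 * rr n"
      then have good: "one_step_stat \<zeta> n a \<le> C0" and "frob_sq n (R n a) \<le> C0 * rr n" by auto
      then have Rb: "frob_sq n (R n a) \<le> C * rr n" using rr(2)[of n] C(2) by (meson mult_right_mono order.trans)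
      define N where "N = real n"
      define r where "r = \<rho>n n"
      define sr where "sr = sqrt r"
      have n: "0 < n" using elim(5) by simp
      have r: "0 < r" "r \<le> 1" using rho_n[OF elim(5)] by (auto simp: r_def)
      have sr: "0 < sr" "sr * sr = r" "sr \<le> 1" using r by (auto simp: sr_def)
      have N: "1 \<le> N" "1 \<le> N * r" "0 < N" using elim(5,4) by (auto simp: N_def r_def)
      have u0: "0 \<le> u n" using C N r by (simp add: u_def)
      have v0: "0 \<le> v n" using C Cz rr(2)[of n] r by (simp add: v_def r_def)
      have uv: "u n + v n \<le> \<delta> / 6" "u n + v n \<le> sqrt l / 2" using elim(2) by auto
      have uv1: "u n \<le> 1" "v n \<le> 1" using uv(1) u0 v0 delta by auto
      have uvl: "(u n + v n)\<^sup>2 \<le> l / 4"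
      proof -
        have "(u n + v n)\<^sup>2 \<le> (sqrt l / 2)\<^sup>2" using uv(2) u0 v0 by (intro power_mono) auto
        then show ?thesis using l by (simp add: power_divide)
      qed
      define E where "E = noise (q n) a"
      note sm = model[OF elim(5)]

      define V where "V = W n a"
      have V: "orthogonal_matrix V" unfolding V_def by (rule W)
      define L where "L = (\<lambda>i. (1 / sr) *\<^sub>R (\<Sum>j<n. E i j *\<^sub>R \<zeta> n i j))"
      \<comment> \<open>The diagonal bias of the linear sum is moved into the remainder, so that
        \<open>L\<close> contains only centred entries.\<close>
      define R' where "R' = (\<lambda>i. R n a i - (sr * (x0 i \<bullet> x0 i)) *\<^sub>R \<zeta> n i i)"
      define y where "y = (\<lambda>i. (1 / sr) *\<^sub>R (transpose V *v X n a i))"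
      define d where "d = (\<lambda>i. y i - x0 i)"
      define t where "t = (\<lambda>i. transpose V *v Y n a i - sr *\<^sub>R x0 i)"
      define m where "m = (\<lambda>i. \<Sum>j<n. E i j *\<^sub>R one_step_coef n i j)"
      have yd: "y i = x0 i + d i" for i by (simp add: d_def)
      have vy: "transpose V *v X n a i = sr *\<^sub>R y i" for i using sr(1) by (simp add: y_def)
      have LR: "sr *\<^sub>R d i = L i + R' i" if i: "i < n" for i
      proof -
        have "(\<Sum>j<n. (a i j - q n i j) *\<^sub>R \<zeta> n i j) = (\<Sum>j<n. E i j *\<^sub>R \<zeta> n i j - (if i = j then q n i j *\<^sub>R \<zeta> n i j else 0))"
          unfolding full_noise(1)[OF elim(5) a] by (intro sum.cong) (auto simp: E_def algebra_simps)
        also have "\<dots> = (\<Sum>j<n. E i j *\<^sub>R \<zeta> n i j) - q n i i *\<^sub>R \<zeta> n i i" using i by (simp add: sum_subtractf)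
        finally have s: "(\<Sum>j<n. (a i j - q n i j) *\<^sub>R \<zeta> n i j) = (\<Sum>j<n. E i j *\<^sub>R \<zeta> n i j) - q n i i *\<^sub>R \<zeta> n i i" .
        have "sr *\<^sub>R d i = transpose V *v X n a i - sr *\<^sub>R x0 i" unfolding vy by (simp add: d_def scaleR_diff_right)
        also have "\<dots> = (1 / sr) *\<^sub>R ((\<Sum>j<n. E i j *\<^sub>R \<zeta> n i j) - q n i i *\<^sub>R \<zeta> n i i) + R n a i"
          using lin[OF elim(5) a i] unfolding s by (simp only: V_def sr_def r_def)
        also have "\<dots> = L i - (q n i i / sr) *\<^sub>R \<zeta> n i i + R n a i" by (simp add: L_def scaleR_diff_right)
        also have "q n i i / sr = sr * (x0 i \<bullet> x0 i)" using sr(1) unfolding r_def[symmetric] sr(2)[symmetric] by simp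
        finally show ?thesis by (simp add: R'_def)
      qed
      define f1 where "f1 = (\<Sum>i<n. (norm (\<Sum>j<n. E i j *\<^sub>R \<zeta> n i j))\<^sup>2)"
      define f2 where "f2 = (\<Sum>i<n. (norm (\<Sum>j<n. E i j *\<^sub>R \<zeta> n i j)) ^ 4)"
      define f3 where "f3 = (\<Sum>i<n. (norm (\<Sum>j<n. E i j *\<^sub>R (1::real))) ^ 4)"
      define f4 where "f4 = (\<Sum>i<n. (norm (\<Sum>j<n. E i j *\<^sub>R dphi r (x0 i \<bullet> x0 j) *\<^sub>R dyad (x0 j) (x0 j))) ^ 4)"
      define f5 where "f5 = (\<Sum>i<n. (norm (\<Sum>j<n. \<Sum>k<n. E j k *\<^sub>R phi r (x0 i \<bullet> x0 j) *\<^sub>R (x0 i \<bullet> \<zeta> n j k) *\<^sub>R x0 j))\<^sup>2)"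
      define f6 where "f6 = (\<Sum>i<n. (norm (\<Sum>j<n. \<Sum>k<n. (E i j * E j k) *\<^sub>R pair_coef \<zeta> n i j k))\<^sup>2)"
      define f7 where "f7 = ((\<Sum>i<n. (norm (\<Sum>j<n. E i j *\<^sub>R one_step_coef n i j))\<^sup>2)
         - (\<Sum>i<n. \<Sum>j\<in>{..<n} - {i}. q n i j * (1 - q n i j) * (norm (one_step_coef n i j))\<^sup>2))\<^sup>2"
      have f0: "0 \<le> f1" "0 \<le> f2" "0 \<le> f3" "0 \<le> f4" "0 \<le> f5" "0 \<le> f6" "0 \<le> f7"
        by (auto simp: f1_def f2_def f3_def f4_def f5_def f6_def f7_def intro!: sum_nonneg)
      have fsum: "f1 / r + f2 / (r\<^sup>2 / N) + f3 / (N ^ 3 * r\<^sup>2) + f4 / (N ^ 3 * r\<^sup>2) + f5 / (N * r) + f6 / (N * r\<^sup>2) + N * f7 \<le> C"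
        unfolding f1_def f2_def f3_def f4_def f5_def f6_def f7_def N_def r_def E_def
        by (rule order.trans[OF good[unfolded one_step_stat_def] C(2)])
      have g0: "0 \<le> f1 / r" "0 \<le> f2 / (r\<^sup>2 / N)" "0 \<le> f3 / (N ^ 3 * r\<^sup>2)" "0 \<le> f4 / (N ^ 3 * r\<^sup>2)"
        "0 \<le> f5 / (N * r)" "0 \<le> f6 / (N * r\<^sup>2)" "0 \<le> N * f7"
        using f0 N r by auto
      have gC: "f1 / r \<le> C" "f2 / (r\<^sup>2 / N) \<le> C" "f3 / (N ^ 3 * r\<^sup>2) \<le> C" "f4 / (N ^ 3 * r\<^sup>2) \<le> C"
        "f5 / (N * r) \<le> C" "f6 / (N * r\<^sup>2) \<le> C" "N * f7 \<le> C"
        using fsum g0 by linarith+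
      have mult: "A \<le> C * S" if "A / S \<le> C" "0 < S" for A S using that by (simp add: divide_le_eq)
      have fb: "f1 \<le> C * r" "f2 \<le> C * (r\<^sup>2 / N)" "f3 \<le> C * (N ^ 3 * r\<^sup>2)" "f4 \<le> C * (N ^ 3 * r\<^sup>2)"
        "f5 \<le> C * (N * r)" "f6 \<le> C * (N * r\<^sup>2)"
        by (rule mult[OF gC(1)] mult[OF gC(2)] mult[OF gC(3)] mult[OF gC(4)] mult[OF gC(5)] mult[OF gC(6)];
            use N r in simp)+
      have row4: "norm (Z i) \<le> sqrt (sqrt S)" if "(\<Sum>i<n. (norm (Z i)) ^ 4) \<le> S" "i < n" for Z :: "nat \<Rightarrow> 'b::real_normed_vector" and S i
      proof (rule le_sqrt_sqrt)
        have "(norm (Z i)) ^ 4 \<le> (\<Sum>i<n. (norm (Z i)) ^ 4)" using that(2) by (intro member_le_sum) auto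
        then show "(norm (Z i)) ^ 4 \<le> S" using that(1) by simp
      qed simp
      \<comment> \<open>The identity n^3 r^2 = (n r)^4 / (n r^2) turns fourth roots of the moment
        bounds into n r times the small factor \<open>u n\<close>.\<close>
      have su: "sqrt (sqrt (C * (N ^ 3 * r\<^sup>2))) = u n * (N * r)"
      proof -
        have "C * (N ^ 3 * r\<^sup>2) = (C * (1 / (N * r ^ 2))) * (N * r) ^ 4"
          using N r by (simp add: field_simps power2_eq_square power3_eq_cube power4_eq_xxxx)
        moreover have "sqrt (sqrt ((C * (1 / (N * r ^ 2))) * (N * r) ^ 4)) = sqrt (sqrt (C * (1 / (N * r ^ 2)))) * (N * r)"
          using N by (intro sqrt_sqrt_mult_power4) auto
        ultimately show ?thesis by (simp only: u_def N_def r_def)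
      qed
      have su2: "sqrt (sqrt (C * (r\<^sup>2 / N))) = u n * r"
      proof -
        have "C * (r\<^sup>2 / N) = (C * (1 / (N * r ^ 2))) * r ^ 4"
          using N r by (simp add: field_simps power2_eq_square power4_eq_xxxx)
        moreover have "sqrt (sqrt ((C * (1 / (N * r ^ 2))) * r ^ 4)) = sqrt (sqrt (C * (1 / (N * r ^ 2)))) * r"
          using r by (intro sqrt_sqrt_mult_power4) auto
        ultimately show ?thesis by (simp only: u_def N_def r_def)
      qed
      have Lb: "norm (L i) \<le> u n * sr" if i: "i < n" for i
      proof -
        have "norm (\<Sum>j<n. E i j *\<^sub>R \<zeta> n i j) \<le> u n * r"
          using row4[OF fb(2)[unfolded f2_def] i] unfolding su2 .
        then have "norm (\<Sum>j<n. E i j *\<^sub>R \<zeta> n i j) / sr \<le> u n * r / sr" using sr(1) by (intro divide_right_mono) auto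
        also have "u n * r / sr = u n * sr" using sr(1) unfolding sr(2)[symmetric] by simp
        finally show ?thesis using sr(1) by (simp add: L_def)
      qed
      have Lf: "fnorm n L \<le> sqrt C"
      proof -
        have "fnorm n (\<lambda>i. \<Sum>j<n. E i j *\<^sub>R \<zeta> n i j) \<le> sqrt (C * r)"
          using fb(1) unfolding f1_def by (rule fnorm_le_sqrt)
        also have "\<dots> = sqrt C * sr" by (simp add: real_sqrt_mult sr_def)
        finally show ?thesis unfolding L_def fnorm_scaleR using sr(1) by (simp add: divide_le_eq)
      qed
      have Rf: "fnorm n R' \<le> v n * sr"
      proof -
        have "fnorm n R' \<le> fnorm n (R n a) + fnorm n (\<lambda>i. (sr * (x0 i \<bullet> x0 i)) *\<^sub>R \<zeta> n i i)"
          unfolding R'_def by (rule fnorm_triangle_diff)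
        also have "\<dots> \<le> sqrt (C * (rr n / r)) * sr + sqrt N * (sr * (Cz / N))"
        proof (rule add_mono)
          have "fnorm n (R n a) \<le> sqrt (C * rr n)" using Rb unfolding frob_sq_def by (rule fnorm_le_sqrt)
          also have "C * rr n = C * (rr n / r) * r" using r by simp
          also have "sqrt \<dots> = sqrt (C * (rr n / r)) * sr" by (simp only: real_sqrt_mult sr_def)
          finally show "fnorm n (R n a) \<le> sqrt (C * (rr n / r)) * sr" .
          show "fnorm n (\<lambda>i. (sr * (x0 i \<bullet> x0 i)) *\<^sub>R \<zeta> n i i) \<le> sqrt N * (sr * (Cz / N))"
            unfolding N_def
          proof (rule fnorm_le_const')
            fix i assume i: "i < n"
            have "\<bar>sr * (x0 i \<bullet> x0 i)\<bar> \<le> sr * 1"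
              unfolding abs_mult using sr x0_bounds(3,4)[of i i] by (intro mult_mono) auto
            then have "\<bar>sr * (x0 i \<bullet> x0 i)\<bar> * norm (\<zeta> n i i) \<le> (sr * 1) * (Cz / real n)"
              using z[OF i i] sr by (intro mult_mono) auto
            then show "norm ((sr * (x0 i \<bullet> x0 i)) *\<^sub>R \<zeta> n i i) \<le> sr * (Cz / real n)" by simp
          qed (use sr Cz in auto)
        qed
        also have "sqrt N * (sr * (Cz / N)) = Cz * (sqrt N / N) * sr" by simp
        also have "sqrt N / N = sqrt (1 / N)" using sqrt_divide_self_eq[of N] N by (simp add: real_sqrt_divide inverse_eq_divide)
        finally show ?thesis by (simp add: v_def N_def r_def distrib_right)
      qed
      \<comment> \<open>The remainder is controlled only as a whole, so a single row is bounded by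
        the full Frobenius norm. Uniform smallness after division by sqrt r is where
        \<open>rr n / \<rho>n n\<close> tending to 0 enters.\<close>
      have dn: "norm (d i) \<le> u n + v n" if i: "i < n" for i
      proof -
        have "sr * norm (d i) = norm (L i + R' i)" unfolding LR[OF i, symmetric] using sr by simp
        also have "\<dots> \<le> norm (L i) + norm (R' i)" by (rule norm_triangle_ineq)
        also have "\<dots> \<le> u n * sr + v n * sr"
          by (intro add_mono Lb[OF i] order.trans[OF norm_le_fnorm[OF i] Rf])
        also have "\<dots> = sr * (u n + v n)" by (simp add: algebra_simps)
        finally show ?thesis using sr(1) by simp
      qed
      have db: "sqrt r * fnorm n d \<le> b"
      proof -
        have "sqrt r * fnorm n d = fnorm n (\<lambda>i. sr *\<^sub>R d i)" unfolding fnorm_scaleR sr_def using r by simp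
        also have "\<dots> = fnorm n (\<lambda>i. L i + R' i)" by (rule fnorm_cong) (rule LR)
        also have "\<dots> \<le> fnorm n L + fnorm n R'" by (rule fnorm_triangle)
        also have "\<dots> \<le> sqrt C + 1"
          using sr v0 uv1 by (intro add_mono Lf order.trans[OF Rf] mult_le_one) auto
        finally show ?thesis by (simp add: b_def)
      qed
      have low: "l * real n * (norm w)\<^sup>2 \<le> (\<Sum>j<n. (x0 j \<bullet> w)\<^sup>2)" for w
      proof -
        have "real n * (l * (norm w)\<^sup>2) \<le> real n * (w \<bullet> (Dn n *v w))" using elim(3) by (intro mult_left_mono) auto
        then show ?thesis unfolding Dn_form by (simp add: mult_ac)
      qed
      \<comment> \<open>An entry of \<open>a\<close> is 0 or 1, so a negative noise entry is exactly
        - q. Hence row sums of absolute values are bounded through row sums of the noise itself,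
        which are linear and have a moment bound.\<close>
      have Ea: "\<bar>E i j\<bar> \<le> E i j + 2 * q n i j" "\<bar>E i j\<bar> \<le> 1" if "i < n" "j < n" for i j
      proof -
        have "a i j \<in> {0, 1}" using sparse_modelD(1)[OF sm] a by (simp add: edge_model_def)
        moreover have "0 \<le> q n i j" "q n i j \<le> r" using sparse_modelD(4,5)[OF sm that] by (auto simp: r_def)
        ultimately show "\<bar>E i j\<bar> \<le> E i j + 2 * q n i j" "\<bar>E i j\<bar> \<le> 1" using r by (auto simp: E_def noise_def)
      qed
      have A3: "(\<Sum>j<n. \<bar>E i j\<bar>) \<le> 3 * real n * r" if i: "i < n" for i
      proof -
        have "norm (\<Sum>j<n. E i j *\<^sub>R (1::real)) \<le> u n * (N * r)"
          using row4[OF fb(3)[unfolded f3_def] i] unfolding su .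
        also have "\<dots> \<le> 1 * (N * r)" using N uv1 by (intro mult_right_mono) auto
        finally have s: "(\<Sum>j<n. E i j) \<le> N * r" by simp
        have "(\<Sum>j<n. \<bar>E i j\<bar>) \<le> (\<Sum>j<n. E i j + 2 * r)"
        proof (intro sum_mono)
          fix j assume "j \<in> {..<n}"
          then show "\<bar>E i j\<bar> \<le> E i j + 2 * r" using Ea(1)[OF i, of j] sparse_modelD(5)[OF sm i, of j] by (simp add: r_def)
        qed
        also have "\<dots> = (\<Sum>j<n. E i j) + 2 * (N * r)" by (simp add: sum.distrib N_def)
        finally show ?thesis using s by (simp add: N_def)
      qed
      \<comment> \<open>Entries of absolute value at most 1 have squares below their absolute
        values, and \<open>A3\<close> sums these to 3 n^2 r; this is the origin of \<alpha>5 = sqrt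
        3.\<close>
      have A5: "(\<Sum>i<n. \<Sum>j<n. (E i j)\<^sup>2) \<le> (real n)\<^sup>2 * r * (sqrt 3)\<^sup>2"
      proof -
        have "(\<Sum>i<n. \<Sum>j<n. (E i j)\<^sup>2) \<le> (\<Sum>i<n. \<Sum>j<n. \<bar>E i j\<bar>)"
        proof (intro sum_mono)
          fix i j assume "i \<in> {..<n}" "j \<in> {..<n}"
          then have "\<bar>E i j\<bar> * \<bar>E i j\<bar> \<le> \<bar>E i j\<bar> * 1" using Ea(2) by (intro mult_left_mono) auto
          then show "(E i j)\<^sup>2 \<le> \<bar>E i j\<bar>" by (simp add: power2_eq_square)
        qed
        also have "\<dots> \<le> (\<Sum>i<n. 3 * real n * r)" using A3 by (intro sum_mono) auto
        finally show ?thesis by (simp add: power2_eq_square[of "real n"])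
      qed
      have A1: "norm (\<Sum>j<n. E i j *\<^sub>R dphi r (x0 i \<bullet> x0 j) *\<^sub>R dyad (x0 j) (x0 j)) \<le> real n * (u n * r)" if i: "i < n" for i
        using row4[OF fb(4)[unfolded f4_def] i] unfolding su by (simp add: N_def mult_ac)
      have A2: "fnorm n (\<lambda>i. \<Sum>j<n. E i j *\<^sub>R (dphi r (x0 i \<bullet> x0 j) *\<^sub>R (x0 i \<bullet> L j) *\<^sub>R x0 j + phi r (x0 i \<bullet> x0 j) *\<^sub>R L j))
          \<le> real n * r * sqrt (C * (1 / (N * r)))"
      proof -
        have "E i j *\<^sub>R (dphi r (x0 i \<bullet> x0 j) *\<^sub>R (x0 i \<bullet> L j) *\<^sub>R x0 j + phi r (x0 i \<bullet> x0 j) *\<^sub>R L j)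
          = (1 / sr) *\<^sub>R (\<Sum>k<n. (E i j * E j k) *\<^sub>R pair_coef \<zeta> n i j k)" for i j
        proof -
          have "dphi r (x0 i \<bullet> x0 j) *\<^sub>R (x0 i \<bullet> L j) *\<^sub>R x0 j + phi r (x0 i \<bullet> x0 j) *\<^sub>R L j
            = (1 / sr) *\<^sub>R (\<Sum>k<n. E j k *\<^sub>R pair_coef \<zeta> n i j k)"
            by (simp add: L_def pair_coef_def r_def inner_sum_right scaleR_sum_left scaleR_sum_right sum_distrib_left
                sum.distrib scaleR_add_right mult_ac)
          then show ?thesis by (simp add: scaleR_sum_right mult_ac)
        qed
        then have "fnorm n (\<lambda>i. \<Sum>j<n. E i j *\<^sub>R (dphi r (x0 i \<bullet> x0 j) *\<^sub>R (x0 i \<bullet> L j) *\<^sub>R x0 j + phi r (x0 i \<bullet> x0 j) *\<^sub>R L j))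
          = (1 / sr) * fnorm n (\<lambda>i. \<Sum>j<n. \<Sum>k<n. (E i j * E j k) *\<^sub>R pair_coef \<zeta> n i j k)"
          using sr(1) by (simp only: scaleR_sum_right[symmetric] fnorm_scaleR) simp
        also have "\<dots> \<le> (1 / sr) * sqrt (C * (N * r\<^sup>2))"
          using fb(6) sr(1) unfolding f6_def by (intro mult_left_mono fnorm_le_sqrt) auto
        also have "C * (N * r\<^sup>2) = C * (1 / (N * r)) * (r * (N * r)\<^sup>2)" using N r by (simp add: power2_eq_square field_simps)
        also have "(1 / sr) * sqrt (C * (1 / (N * r)) * (r * (N * r)\<^sup>2)) = real n * r * sqrt (C * (1 / (N * r)))"
          unfolding real_sqrt_mult[of "C * (1 / (N * r))"] real_sqrt_mult[of r] real_sqrt_abs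
          using sr(1) N r by (simp add: sr_def[symmetric] abs_mult N_def)
        finally show ?thesis .
      qed
      have A4: "fnorm n (\<lambda>i. \<Sum>j<n. phi r (x0 i \<bullet> x0 j) *\<^sub>R (x0 i \<bullet> L j) *\<^sub>R x0 j) \<le> real n * \<theta> n"
      proof -
        have "phi r (x0 i \<bullet> x0 j) *\<^sub>R (x0 i \<bullet> L j) *\<^sub>R x0 j
          = (1 / sr) *\<^sub>R (\<Sum>k<n. E j k *\<^sub>R phi r (x0 i \<bullet> x0 j) *\<^sub>R (x0 i \<bullet> \<zeta> n j k) *\<^sub>R x0 j)" for i j
          by (simp add: L_def inner_sum_right scaleR_sum_left scaleR_sum_right sum_distrib_left mult_ac)
        then have "fnorm n (\<lambda>i. \<Sum>j<n. phi r (x0 i \<bullet> x0 j) *\<^sub>R (x0 i \<bullet> L j) *\<^sub>R x0 j)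
          = (1 / sr) * fnorm n (\<lambda>i. \<Sum>j<n. \<Sum>k<n. E j k *\<^sub>R phi r (x0 i \<bullet> x0 j) *\<^sub>R (x0 i \<bullet> \<zeta> n j k) *\<^sub>R x0 j)"
          using sr(1) by (simp only: scaleR_sum_right[symmetric] fnorm_scaleR) simp
        also have "\<dots> \<le> (1 / sr) * sqrt (C * (N * r))"
          using fb(5) sr(1) unfolding f5_def by (intro mult_left_mono fnorm_le_sqrt) auto
        also have "C * (N * r) = C * (1 / N) * (r * N\<^sup>2)" using N r by (simp add: power2_eq_square)
        also have "(1 / sr) * sqrt (C * (1 / N) * (r * N\<^sup>2)) = real n * \<theta> n"
          unfolding real_sqrt_mult[of "C * (1 / N)"] real_sqrt_mult[of r] real_sqrt_abs
          using sr(1) N by (simp add: sr_def[symmetric] \<theta>_def N_def)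
        finally show ?thesis .
      qed
      have Glow: "l * (norm w)\<^sup>2 \<le> w \<bullet> (Gn n r (x0 i) *v w)" for w i
        using elim(3) n r by (intro Gn_lower_bound[OF _ _ x0_K]) auto
      have Ginv: "invertible (Gn n r (x0 i))" for i by (rule lower_bound_invertible[OF l(1) Glow])
      have m: "(\<Sum>j<n. phi r (x0 i \<bullet> x0 j) *\<^sub>R (x0 j \<bullet> m i) *\<^sub>R x0 j) = (\<Sum>j<n. (E i j / sqrt r * phi r (x0 i \<bullet> x0 j)) *\<^sub>R x0 j)" for i
      proof -
        have "(\<Sum>j<n. phi r (x0 i \<bullet> x0 j) *\<^sub>R (x0 j \<bullet> m i) *\<^sub>R x0 j) = N *\<^sub>R (Gn n r (x0 i) *v m i)"
          unfolding N_def by (rule Gn_mult[symmetric])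
        also have "Gn n r (x0 i) *v m i = (\<Sum>j<n. (E i j * (phi r (x0 i \<bullet> x0 j) / (N * sr))) *\<^sub>R x0 j)"
          by (simp add: m_def one_step_coef_def linear_sum[OF matrix_vector_mul_linear] matrix_vector_mult_scaleR
              invertible_matrix_inv_mult[OF Ginv] flip: N_def r_def sr_def)
        also have "N *\<^sub>R \<dots> = (\<Sum>j<n. (E i j / sqrt r * phi r (x0 i \<bullet> x0 j)) *\<^sub>R x0 j)"
          unfolding scaleR_sum_right scaleR_scaleR
        proof (rule sum.cong[OF refl])
          fix j
          have "N * (E i j * (phi r (x0 i \<bullet> x0 j) / (N * sr))) = E i j / sr * phi r (x0 i \<bullet> x0 j)" using N sr(1) by simp
          then show "(N * (E i j * (phi r (x0 i \<bullet> x0 j) / (N * sr)))) *\<^sub>R x0 j = (E i j / sqrt r * phi r (x0 i \<bullet> x0 j)) *\<^sub>R x0 j"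
            by (simp only: sr_def)
        qed
        finally show ?thesis .
      qed
      have inner_y: "0 < y i \<bullet> y j \<and> y i \<bullet> y j < 1" if i: "i < n" and j: "j < n" for i j
        using weight_perturbation(1,2)[where xi = "x0 i" and xj = "x0 j" and di = "d i" and dj = "d j", OF delta less_imp_le[OF r(1)] r(2) x0_bounds(1,2) x0_bounds(5,5) dn[OF i] dn[OF j] uv(1) \<kappa>_def] delta
        unfolding yd by linarith
      have teq: "(\<Sum>j<n. phi r (y i \<bullet> y j) *\<^sub>R (y j \<bullet> t i) *\<^sub>R y j)
        = (\<Sum>j<n. (((E i j - (if i = j then r * (x0 i \<bullet> x0 j) else 0)) / sqrt r - sqrt r * (x0 i \<bullet> d j)) * phi r (y i \<bullet> y j)) *\<^sub>R y j)"
        if i: "i < n" for i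
      proof -
        have "(\<Sum>j<n. phi r (y i \<bullet> y j) *\<^sub>R (y j \<bullet> t i) *\<^sub>R y j)
          = (\<Sum>j<n. (((a i j - r * (x0 i \<bullet> x0 j)) / sqrt r - sqrt r * (x0 i \<bullet> (y j - x0 j))) * phi r (y i \<bullet> y j)) *\<^sub>R y j)"
          unfolding t_def sr_def
        proof (rule one_step_equation[OF os[OF elim(5) a] V _ inner_y r _ i])
          show "transpose V *v X n a i = sqrt r *\<^sub>R y i" for i using vy[of i] by (simp only: sr_def)
          show "0 < (\<Sum>j<n. (y j \<bullet> w)\<^sup>2)" if w: "w \<noteq> 0" for w
          proof -
            have "0 < real n * (l / 4 * (norm w)\<^sup>2)" using n l w by simp
            also have "\<dots> \<le> (\<Sum>j<n. (y j \<bullet> w)\<^sup>2)" unfolding yd by (rule gram_perturb[OF dn uvl low])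
            finally show ?thesis .
          qed
        qed
        also have "\<dots> = (\<Sum>j<n. (((E i j - (if i = j then r * (x0 i \<bullet> x0 j) else 0)) / sqrt r - sqrt r * (x0 i \<bullet> d j)) * phi r (y i \<bullet> y j)) *\<^sub>R y j)"
          by (simp only: r_def full_noise(1)[OF elim(5) a] E_def d_def)
        finally show ?thesis .
      qed
      have "fnorm n (\<lambda>i. t i - m i) \<le> (4 / l) *
         (2 * \<kappa> / sqrt (real n) + (u n * r) * b / r + (sqrt (C * (1 / (N * r))) + 2 * \<kappa>\<^sup>2 * sqrt 3 * fnorm n R' / sqrt r)
          + (27 * \<kappa> ^ 3 * (u n + v n) * b + 9 * \<kappa> ^ 3 * b\<^sup>2 / (sqrt (real n) * sqrt r ^ 3))
          + (\<theta> n + \<kappa> * fnorm n R') + 10 * \<kappa>\<^sup>2 * b\<^sup>2 / (sqrt r * sqrt (real n)) + 21 * \<kappa>\<^sup>2 * (u n + v n) * fnorm n m)"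
        by (rule one_step_linearization[where x = x0 and d = d and L = L and R = R' and t = t and m = m and E = E and n = n and r = r
              and \<eta> = "u n + v n", folded yd, OF delta r n _ x0_bounds(5) dn _ uv(1) uvl l(1) low LR[unfolded sr_def] Ea(2) teq m A1 A2 A3 A4 A5 _ db \<kappa>_def])
           (use x0_bounds(1,2) u0 v0 in auto)
      note bound = this
      have conc: "\<bar>(fnorm n m)\<^sup>2 - e n\<bar> \<le> \<theta> n"
      proof -
        \<comment> \<open>The edge variance cancels one of the two factors \<open>phi\<close>, which
          leaves the single factor in \<open>kernel_G\<close>.\<close>
        have e2: "r * s * (1 - r * s) * ((phi r s / (N * sr))\<^sup>2 * w) = phi r s * w / N\<^sup>2" if "0 < s" "s < 1" for s w
        proof -
          have "r * s < 1" using that r mult_le_one[of r s] mult_left_le_one_le[of s r] by linarith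
          then have p: "s * (1 - r * s) * phi r s = 1" using that by (simp add: phi_def)
          have "(N * sr)\<^sup>2 = N\<^sup>2 * r" using sr(2) by (simp add: power_mult_distrib power2_eq_square)
          then have "r * s * (1 - r * s) * ((phi r s / (N * sr))\<^sup>2 * w) = (s * (1 - r * s) * phi r s) * (phi r s * w / N\<^sup>2)"
            using r by (simp add: power_divide power2_eq_square[of "phi r s"])
          then show ?thesis by (simp add: p)
        qed
        have e3: "q n i j * (1 - q n i j) * (norm (one_step_coef n i j))\<^sup>2 = kernel_G (Gn n (\<rho>n n)) (\<rho>n n) (x0 i) (x0 j) / (real n)\<^sup>2" for i j
        proof -
          have "(norm (one_step_coef n i j))\<^sup>2 = (phi r (x0 i \<bullet> x0 j) / (N * sr))\<^sup>2 * (norm (matrix_inv (Gn n r (x0 i)) *v x0 j))\<^sup>2"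
            by (simp add: one_step_coef_def power_mult_distrib power_divide power2_abs flip: N_def r_def sr_def)
          then show ?thesis using e2[of "x0 i \<bullet> x0 j"] x0_bounds(2,3)[of i j] delta by (simp add: kernel_G_def r_def N_def)
        qed
        have "(\<Sum>i<n. \<Sum>j\<in>{..<n} - {i}. q n i j * (1 - q n i j) * (norm (one_step_coef n i j))\<^sup>2) = e n"
          by (simp only: e3 e_def sum_divide_distrib)
        then have "N * ((fnorm n m)\<^sup>2 - e n)\<^sup>2 \<le> C"
          using gC(7) unfolding f7_def m_def fnorm_sq by simp
        then have "((fnorm n m)\<^sup>2 - e n)\<^sup>2 \<le> C * (1 / real n)" using N unfolding N_def by (simp add: field_simps)
        from real_sqrt_le_mono[OF this] show ?thesis by (simp only: \<theta>_def real_sqrt_abs)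
      qed
      have fm: "fnorm n m \<le> 1 + (e n + \<theta> n)"
      proof -
        have "0 \<le> (fnorm n m - 1)\<^sup>2" by simp
        then have "2 * fnorm n m \<le> (fnorm n m)\<^sup>2 + 1" by (simp add: power2_eq_square algebra_simps)
        then show ?thesis using conc fnorm_nonneg[of n m] by linarith
      qed
      have t: "fnorm n (\<lambda>i. t i - m i) \<le> \<tau> n"
      proof (rule order.trans[OF bound])
        have s1: "1 / sqrt (real n) = sqrt (1 / real n)" by (simp add: real_sqrt_divide)
        have s3: "1 / (sqrt (real n) * sqrt r ^ 3) = sqrt (1 / (real n * r ^ 3))" by (simp add: real_sqrt_divide real_sqrt_mult real_sqrt_power)
        have s4: "1 / (sqrt r * sqrt (real n)) = sqrt (1 / (real n * r))" by (simp add: real_sqrt_divide real_sqrt_mult)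
        have fR: "fnorm n R' / sqrt r \<le> v n" "fnorm n R' \<le> v n"
          using Rf sr(1,3) v0 mult_left_le[of sr "v n"] by (auto simp: divide_le_eq sr_def[symmetric])
        show "(4 / l) *
         (2 * \<kappa> / sqrt (real n) + (u n * r) * b / r + (sqrt (C * (1 / (N * r))) + 2 * \<kappa>\<^sup>2 * sqrt 3 * fnorm n R' / sqrt r)
          + (27 * \<kappa> ^ 3 * (u n + v n) * b + 9 * \<kappa> ^ 3 * b\<^sup>2 / (sqrt (real n) * sqrt r ^ 3))
          + (\<theta> n + \<kappa> * fnorm n R') + 10 * \<kappa>\<^sup>2 * b\<^sup>2 / (sqrt r * sqrt (real n)) + 21 * \<kappa>\<^sup>2 * (u n + v n) * fnorm n m) \<le> \<tau> n"
          unfolding \<tau>_def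
        proof (intro mult_left_mono add_mono)
          show "2 * \<kappa> / sqrt (real n) \<le> 2 * \<kappa> * sqrt (1 / real n)" by (simp flip: s1)
          show "u n * r * b / r \<le> u n * b" using r by simp
          show "sqrt (C * (1 / (N * r))) \<le> sqrt (C * (1 / (real n * \<rho>n n)))" by (simp only: N_def r_def)
          have "2 * \<kappa>\<^sup>2 * sqrt 3 * (fnorm n R' / sqrt r) \<le> 2 * \<kappa>\<^sup>2 * sqrt 3 * v n" using fR by (intro mult_left_mono) auto
          then show "2 * \<kappa>\<^sup>2 * sqrt 3 * fnorm n R' / sqrt r \<le> 2 * \<kappa>\<^sup>2 * sqrt 3 * v n" by simp
          show "9 * \<kappa> ^ 3 * b\<^sup>2 / (sqrt (real n) * sqrt r ^ 3) \<le> 9 * \<kappa> ^ 3 * b\<^sup>2 * sqrt (1 / (real n * \<rho>n n ^ 3))"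
            unfolding r_def[symmetric] s3[symmetric] by simp
          show "10 * \<kappa>\<^sup>2 * b\<^sup>2 / (sqrt r * sqrt (real n)) \<le> 10 * \<kappa>\<^sup>2 * b\<^sup>2 * sqrt (1 / (real n * \<rho>n n))"
            unfolding r_def[symmetric] s4[symmetric] by simp
        qed (use fR fm u0 v0 \<kappa> l in auto)
      qed
      have "\<bar>(fnorm n t)\<^sup>2 - (LINT x:K|F. LINT y:K|F. kernel_G (G_mat F \<rho>) \<rho> x y)\<bar> \<le> \<eta>0"
        by (rule elim(1)[rule_format, OF t conc])
      then show "\<bar>frob_sq n (\<lambda>i. transpose (W n a) *v Y n a i - sqrt (\<rho>n n) *\<^sub>R x0 i)
        - (LINT x:K|F. LINT y:K|F. kernel_G (G_mat F \<rho>) \<rho> x y)\<bar> \<le> \<eta>0"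
        by (simp only: frob_sq_fnorm t_def V_def sr_def r_def)
    qed
  qed
qed

end

section \<open>Sparsity rates and the passage back to the given probability spaces\<close>

lemma ln_powr_over_nat: "(\<lambda>n. ln (real n) powr \<omega> / real n) \<longlonglongrightarrow> 0"
proof -
  \<comment> \<open>With a natural number k at least \<omega>, the quotient ln(n)^k / n is the k-th
    power of ln(n) / n^(1/k), which tends to 0. From n = 3 on ln n is at least 1, so powers of it
    grow with the exponent.\<close>
  obtain k :: nat where k: "max \<omega> 1 \<le> real k" using real_arch_simple by blast
  then have k0: "0 < real k" by simp
  have "(\<lambda>n. (ln (real n) / real n powr (1 / real k)) ^ k) \<longlonglongrightarrow> 0 ^ k"
    using k0 by (intro tendsto_power lim_ln_over_power) auto
  then have lim: "(\<lambda>n. (ln (real n) / real n powr (1 / real k)) ^ k) \<longlonglongrightarrow> 0" using k0 by (simp add: power_0_left)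
  show ?thesis
  proof (rule Lim_null_comparison[OF _ lim])
    show "\<forall>\<^sub>F n in sequentially. norm (ln (real n) powr \<omega> / real n) \<le> (ln (real n) / real n powr (1 / real k)) ^ k"
      using eventually_ge_at_top[of 3]
    proof eventually_elim
      case (elim n)
      then have n: "0 < real n" "1 \<le> ln (real n)" using exp_le by (auto simp: ln_ge_iff)
      have "(real n powr (1 / real k)) ^ k = real n" using n(1) k0 by (simp add: powr_realpow[symmetric] powr_powr)
      moreover have "ln (real n) powr \<omega> \<le> ln (real n) powr real k" using n k by (intro powr_mono) auto
      moreover have "ln (real n) powr real k = ln (real n) ^ k" by (rule powr_realpow) (use n in linarith)
      ultimately show ?case using n by (simp add: power_divide divide_right_mono)
    qed
  qed
qed

text \<open>The two sparsity regimes are merged: for constant \<rho>n the rate is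
  \<open>ln_powr_over_nat\<close>, otherwise it is assumed. Every rate used has a smaller power of
  ln n and at most the fifth power of \<rho>n, so it is dominated because ln n >= 1 for n >= 3 and
  \<rho>n <= 1.\<close>

lemma sparsity_rates:
  assumes r: "\<And>n. 1 \<le> n \<Longrightarrow> 0 < \<rho>n n \<and> \<rho>n n \<le> (1::real)"
    and rates: "(\<forall>n\<ge>1. \<rho>n n = 1) \<or> (\<lambda>n. (ln (real n)) powr (2 * max 1 \<omega>) / (real n * (\<rho>n n) ^ 5)) \<longlonglongrightarrow> 0"
  shows "(\<lambda>n. 1 / (real n * \<rho>n n ^ 5)) \<longlonglongrightarrow> 0"
    and "(\<lambda>n. ln (real n) powr \<omega> / (real n * \<rho>n n) / \<rho>n n) \<longlonglongrightarrow> 0"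
proof -
  have lim: "(\<lambda>n. (ln (real n)) powr (2 * max 1 \<omega>) / (real n * (\<rho>n n) ^ 5)) \<longlonglongrightarrow> 0"
  proof (cases "\<forall>n\<ge>1. \<rho>n n = 1")
    case True
    show ?thesis
    proof (rule Lim_transform_eventually[OF ln_powr_over_nat])
      show "\<forall>\<^sub>F n in sequentially. ln (real n) powr (2 * max 1 \<omega>) / real n = (ln (real n)) powr (2 * max 1 \<omega>) / (real n * (\<rho>n n) ^ 5)"
        using eventually_ge_at_top[of 1] by eventually_elim (simp add: True)
    qed
  qed (use rates in blast)
  have dom: "(\<lambda>n. ln (real n) powr s / (real n * \<rho>n n ^ k)) \<longlonglongrightarrow> 0" if s: "s \<le> 2 * max 1 \<omega>" and k: "k \<le> 5" for s k
  proof (rule Lim_null_comparison[OF _ lim])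
    show "\<forall>\<^sub>F n in sequentially. norm (ln (real n) powr s / (real n * \<rho>n n ^ k)) \<le> (ln (real n)) powr (2 * max 1 \<omega>) / (real n * (\<rho>n n) ^ 5)"
      using eventually_ge_at_top[of 3]
    proof eventually_elim
      case (elim n)
      then have n: "0 < real n" "1 \<le> ln (real n)" using exp_le by (auto simp: ln_ge_iff)
      have r: "0 < \<rho>n n" "\<rho>n n \<le> 1" using r[of n] elim by auto
      have "\<rho>n n ^ 5 \<le> \<rho>n n ^ k" using r k by (intro power_decreasing) auto
      then have "ln (real n) powr s / (real n * \<rho>n n ^ k) \<le> ln (real n) powr (2 * max 1 \<omega>) / (real n * \<rho>n n ^ 5)"
        using n r s by (intro frac_le powr_mono mult_left_mono) auto
      then show ?case using n r by simp
    qed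
  qed
  show "(\<lambda>n. 1 / (real n * \<rho>n n ^ 5)) \<longlonglongrightarrow> 0"
  proof (rule Lim_transform_eventually[OF dom[of 0 5]])
    show "\<forall>\<^sub>F n in sequentially. ln (real n) powr 0 / (real n * \<rho>n n ^ 5) = 1 / (real n * \<rho>n n ^ 5)"
      using eventually_ge_at_top[of 3]
    proof eventually_elim
      case (elim n)
      then have "1 \<le> ln (real n)" using exp_le by (auto simp: ln_ge_iff)
      then show ?case by simp
    qed
  qed auto
  show "(\<lambda>n. ln (real n) powr \<omega> / (real n * \<rho>n n) / \<rho>n n) \<longlonglongrightarrow> 0"
    using dom[of \<omega> 2] by (simp add: power2_eq_square mult.assoc)
qed

theorem mainTheorem4:
  fixes F :: "(real^'d) measure"
    and \<delta> \<rho> \<omega> :: real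
    and X\<delta> :: "(real^'d) set"
    and x0 :: "nat \<Rightarrow> real^'d"
    and \<rho>n :: "nat \<Rightarrow> real"
    and M :: "nat \<Rightarrow> 'w measure"
    and A :: "nat \<Rightarrow> 'w \<Rightarrow> nat \<Rightarrow> nat \<Rightarrow> real"
    and X_ase X_tilde X_hat :: "nat \<Rightarrow> (nat \<Rightarrow> nat \<Rightarrow> real) \<Rightarrow> nat \<Rightarrow> real^'d"
  assumes "prob_space F" and "sets F = sets borel" and "measure F latent_space = 1"
    and "invertible (Delta_mat F)"
    and "0 < \<delta>" and "\<delta> < 1 / 2"
    and "X\<delta> \<subseteq> latent_space" and "compact X\<delta>" and "convex X\<delta>"
    and "\<forall>x\<in>X\<delta>. \<forall>u\<in>X\<delta>. x \<bullet> u \<in> {\<delta>..1 - \<delta>}"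
    and "\<forall>i. x0 i \<in> X\<delta>"
    and "(\<lambda>n. SUP x\<in>latent_space. \<bar>empirical_cdf x0 n x - measure F {..x}\<bar>) \<longlonglongrightarrow> 0"
    and "\<forall>n\<ge>1. 0 < \<rho>n n \<and> \<rho>n n \<le> 1"
    and "(\<forall>n\<ge>1. \<rho>n n = 1) \<or> \<rho>n \<longlonglongrightarrow> 0"
    and "\<rho>n \<longlonglongrightarrow> \<rho>"
  shows "(\<forall>x\<in>X\<delta>. psd_matrix (Sigma_mat F \<rho> x - matrix_inv (G_mat F \<rho> x)))
    \<and> ((\<forall>n\<ge>1. rdpg (M n) n (\<rho>n n) x0 (A n)) \<and>
       (\<forall>x\<in>latent_space. pd_matrix (Sigma_mat F \<rho> x)) \<and>
       0 \<le> \<omega> \<and>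
       ((\<forall>n\<ge>1. \<rho>n n = 1) \<or>
        (\<rho>n \<longlonglongrightarrow> 0 \<and>
         (\<lambda>n. (ln (real n)) ^ 4 / (real n * \<rho>n n)) \<longlonglongrightarrow> 0 \<and>
         (\<lambda>n. (ln (real n)) powr (2 * max 1 \<omega>) / (real n * (\<rho>n n) ^ 5)) \<longlonglongrightarrow> 0)) \<and>
       (\<forall>n\<ge>1. \<forall>w\<in>space (M n). is_ase n (A n w) (X_ase n (A n w))) \<and>
       approx_linearization M A \<rho>n x0 \<omega> X_tilde \<and>
       (\<forall>n\<ge>1. \<forall>w\<in>space (M n). is_one_step n (A n w) (X_tilde n (A n w)) (X_hat n (A n w)))
       \<longrightarrow>
       (\<exists>W W' :: nat \<Rightarrow> (nat \<Rightarrow> nat \<Rightarrow> real) \<Rightarrow> real^'d^'d.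
          (\<forall>n a. orthogonal_matrix (W n a) \<and> orthogonal_matrix (W' n a)) \<and>
          tendsto_in_prob M
            (\<lambda>n w.
               frob_sq n (\<lambda>i. X_ase n (A n w) i v* W n (A n w) - sqrt (\<rho>n n) *\<^sub>R x0 i)
               - frob_sq n (\<lambda>i. X_hat n (A n w) i v* W' n (A n w) - sqrt (\<rho>n n) *\<^sub>R x0 i))
            (LINT x:latent_space|F. trace (Sigma_mat F \<rho> x - matrix_inv (G_mat F \<rho> x)))) \<and>
       0 \<le> (LINT x:latent_space|F. trace (Sigma_mat F \<rho> x - matrix_inv (G_mat F \<rho> x))))"
proof -
  interpret latent_sample F \<delta> X\<delta> x0
    by (rule latent_sample.intro[OF assms(1-3,5-8) _ _ assms(12)]) (use assms(10,11) in blast)+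
  have rho_n: "0 < \<rho>n n \<and> \<rho>n n \<le> 1" if "1 \<le> n" for n using assms(13) that by blast
  have "0 \<le> \<rho>" by (rule LIMSEQ_le_const[OF assms(15)]) (use rho_n less_imp_le in blast)
  moreover have "\<rho> \<le> 1" by (rule LIMSEQ_le_const2[OF assms(15)]) (use rho_n in blast)
  ultimately have \<rho>: "0 \<le> \<rho>" "\<rho> \<le> 1" .
  show ?thesis
  proof (intro conjI impI ballI)
    show "psd_matrix (Sigma_mat F \<rho> x - matrix_inv (G_mat F \<rho> x))" if "x \<in> X\<delta>" for x
      by (rule Sigma_minus_G_psd[OF that \<rho> assms(4)])
    show "0 \<le> (LINT x:latent_space|F. trace (Sigma_mat F \<rho> x - matrix_inv (G_mat F \<rho> x)))"
      by (rule trace_integral(2)[OF assms(4) \<rho>])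
  next
    assume H: "(\<forall>n\<ge>1. rdpg (M n) n (\<rho>n n) x0 (A n)) \<and>
       (\<forall>x\<in>latent_space. pd_matrix (Sigma_mat F \<rho> x)) \<and>
       0 \<le> \<omega> \<and>
       ((\<forall>n\<ge>1. \<rho>n n = 1) \<or>
        (\<rho>n \<longlonglongrightarrow> 0 \<and>
         (\<lambda>n. (ln (real n)) ^ 4 / (real n * \<rho>n n)) \<longlonglongrightarrow> 0 \<and>
         (\<lambda>n. (ln (real n)) powr (2 * max 1 \<omega>) / (real n * (\<rho>n n) ^ 5)) \<longlonglongrightarrow> 0)) \<and>
       (\<forall>n\<ge>1. \<forall>w\<in>space (M n). is_ase n (A n w) (X_ase n (A n w))) \<and>
       approx_linearization M A \<rho>n x0 \<omega> X_tilde \<and>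
       (\<forall>n\<ge>1. \<forall>w\<in>space (M n). is_one_step n (A n w) (X_tilde n (A n w)) (X_hat n (A n w)))"
    have rd: "rdpg (M n) n (\<rho>n n) x0 (A n)" if "1 \<le> n" for n using H that by blast
    have ase: "is_ase n (A n w) (X_ase n (A n w))" if "1 \<le> n" "w \<in> space (M n)" for n w using H that by blast
    have os: "is_one_step n (A n w) (X_tilde n (A n w)) (X_hat n (A n w))" if "1 \<le> n" "w \<in> space (M n)" for n w using H that by blast
    have lin: "approx_linearization M A \<rho>n x0 \<omega> X_tilde" using H by blast
    have rates: "(\<forall>n\<ge>1. \<rho>n n = 1) \<or> (\<lambda>n. (ln (real n)) powr (2 * max 1 \<omega>) / (real n * (\<rho>n n) ^ 5)) \<longlonglongrightarrow> 0" using H by blast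
    note lim = sparsity_rates[OF rho_n rates]
    have q01: "\<rho>n n * (x0 i \<bullet> x0 j) \<in> {0..\<rho>n n}" if "1 \<le> n" for n i j
      using K_inner[OF x0_K x0_K, of i j] rho_n[OF that] delta by (auto intro: mult_left_le)
    \<comment> \<open>The model is assumed from n = 1 on; the implication allows a law to be chosen
      for n = 0 as well.\<close>
    have "\<exists>p. 1 \<le> n \<longrightarrow> sparse_model n (\<lambda>i j. \<rho>n n * (x0 i \<bullet> x0 j)) (\<rho>n n) p \<and>
        (\<forall>Q. measure (M n) {w \<in> space (M n). Q (A n w)} = measure_pmf.prob p {a. Q a}) \<and>
        (\<forall>a\<in>set_pmf p. \<exists>w\<in>space (M n). A n w = a)" for n
    proof (cases "1 \<le> n")
      case True
      have "\<rho>n n * (x0 i \<bullet> x0 j) \<in> {0..1}" for i j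
        using q01[OF True, of i j] rho_n[OF True] by (meson atLeastAtMost_iff order.trans)
      from rdpg_pmf[OF rd[OF True] this] obtain p where p: "edge_model n (\<lambda>i j. \<rho>n n * (x0 i \<bullet> x0 j)) p"
        "\<And>Q. measure (M n) {w \<in> space (M n). Q (A n w)} = measure_pmf.prob p {a. Q a}"
        "\<And>a. a \<in> set_pmf p \<Longrightarrow> \<exists>w\<in>space (M n). A n w = a" by blast
      have "sparse_model n (\<lambda>i j. \<rho>n n * (x0 i \<bullet> x0 j)) (\<rho>n n) p"
        unfolding sparse_model_def
      proof (intro conjI allI impI)
        show "\<rho>n n * (x0 i \<bullet> x0 j) = \<rho>n n * (x0 j \<bullet> x0 i)" for i j by (simp only: inner_commute)
        show "0 \<le> \<rho>n n * (x0 i \<bullet> x0 j)" "\<rho>n n * (x0 i \<bullet> x0 j) \<le> \<rho>n n" for i j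
          using q01[OF True, of i j] by (simp_all only: atLeastAtMost_iff)
      qed (use p(1) rho_n[OF True] in simp_all)
      with p(2,3) show ?thesis by blast
    qed simp
    then have "\<forall>n. \<exists>p. 1 \<le> n \<longrightarrow> sparse_model n (\<lambda>i j. \<rho>n n * (x0 i \<bullet> x0 j)) (\<rho>n n) p \<and>
        (\<forall>Q. measure (M n) {w \<in> space (M n). Q (A n w)} = measure_pmf.prob p {a. Q a}) \<and>
        (\<forall>a\<in>set_pmf p. \<exists>w\<in>space (M n). A n w = a)" by (rule allI)
    from choice[OF this] obtain P where "\<forall>n. 1 \<le> n \<longrightarrow> sparse_model n (\<lambda>i j. \<rho>n n * (x0 i \<bullet> x0 j)) (\<rho>n n) (P n) \<and>
        (\<forall>Q. measure (M n) {w \<in> space (M n). Q (A n w)} = measure_pmf.prob (P n) {a. Q a}) \<and>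
        (\<forall>a\<in>set_pmf (P n). \<exists>w\<in>space (M n). A n w = a)" by (rule exE)
    then have P: "\<And>n. 1 \<le> n \<Longrightarrow> sparse_model n (\<lambda>i j. \<rho>n n * (x0 i \<bullet> x0 j)) (\<rho>n n) (P n)"
      "\<And>n Q. 1 \<le> n \<Longrightarrow> measure (M n) {w \<in> space (M n). Q (A n w)} = measure_pmf.prob (P n) {a. Q a}"
      "\<And>n a. 1 \<le> n \<Longrightarrow> a \<in> set_pmf (P n) \<Longrightarrow> \<exists>w\<in>space (M n). A n w = a"
      by blast+
    interpret sparse_sample F \<delta> X\<delta> x0 \<rho>n \<rho> P
      by (rule sparse_sample.intro[OF latent_sample_axioms sparse_sample_axioms.intro[OF assms(4) rho_n assms(15) P(1) lim(1)]])
    from lin[unfolded approx_linearization_def] obtain W' R and \<zeta> :: "nat \<Rightarrow> nat \<Rightarrow> nat \<Rightarrow> real^'d" where lin':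
      "(\<forall>n a. orthogonal_matrix (W' n a)) \<and>
        bigO_in_prob M (\<lambda>n w. frob_sq n (R n (A n w))) (\<lambda>n. (ln (real n)) powr \<omega> / (real n * \<rho>n n)) \<and>
        (\<exists>C>0. \<forall>n. \<forall>i<n. \<forall>j<n. norm (\<zeta> n i j) \<le> C / real n) \<and>
        (\<forall>n. \<forall>w\<in>space (M n). \<forall>i<n.
           transpose (W' n (A n w)) *v X_tilde n (A n w) i - sqrt (\<rho>n n) *\<^sub>R x0 i =
             (1 / sqrt (\<rho>n n)) *\<^sub>R (\<Sum>j<n. (A n w i j - \<rho>n n * (x0 i \<bullet> x0 j)) *\<^sub>R \<zeta> n i j) + R n (A n w) i)"
      by (elim exE)
    note W' = lin'[THEN conjunct1, rule_format] and R = lin'[THEN conjunct2, THEN conjunct1]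
      and eq = lin'[THEN conjunct2, THEN conjunct2, THEN conjunct2, rule_format]
    from lin'[THEN conjunct2, THEN conjunct2, THEN conjunct1] obtain Cz where Cz: "0 < Cz" and z: "\<And>n i j. i < n \<Longrightarrow> j < n \<Longrightarrow> norm (\<zeta> n i j) \<le> Cz / real n"
      by blast
    \<comment> \<open>Boundedness in probability of the remainder is carried over from the spaces
      \<open>M n\<close> to the laws \<open>P n\<close>.\<close>
    have tR: "tight P (\<lambda>C n a. frob_sq n (R n a) \<le> C * ((ln (real n)) powr \<omega> / (real n * \<rho>n n)))"
      unfolding tight_def
    proof (intro allI impI)
      fix \<epsilon> :: real assume "0 < \<epsilon>"
      then obtain C where C: "\<forall>\<^sub>F n in sequentially. measure (M n) {w \<in> space (M n).
          C * ((ln (real n)) powr \<omega> / (real n * \<rho>n n)) < \<bar>frob_sq n (R n (A n w))\<bar>} \<le> \<epsilon>"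
        using R unfolding bigO_in_prob_def by blast
      have "\<forall>\<^sub>F n in sequentially. measure_pmf.prob (P n) {a. \<not> frob_sq n (R n a) \<le> C * ((ln (real n)) powr \<omega> / (real n * \<rho>n n))} \<le> \<epsilon>"
        using C eventually_ge_at_top[of 1]
      proof eventually_elim
        case (elim n)
        have "0 \<le> frob_sq n X" for X :: "nat \<Rightarrow> real^'d" by (simp add: frob_sq_def sum_nonneg)
        then show ?case
          using elim(1) P(2)[OF elim(2), of "\<lambda>a. C * ((ln (real n)) powr \<omega> / (real n * \<rho>n n)) < \<bar>frob_sq n (R n a)\<bar>"]
          by (simp add: not_le)
      qed
      then show "\<exists>C. \<forall>\<^sub>F n in sequentially. measure_pmf.prob (P n) {a. \<not> frob_sq n (R n a) \<le> C * ((ln (real n)) powr \<omega> / (real n * \<rho>n n))} \<le> \<epsilon>"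
        by blast
    qed
    \<comment> \<open>The embedding is aligned by its optimal rotation, the one-step estimator by
      the matrices \<open>W'\<close> that linearize its initial estimator. Both are functions of the
      observed matrix.\<close>
    define W where "W = (\<lambda>n a. ase_rotation n (X_ase n a))"
    have L1: "pmf_lim P (\<lambda>n a. frob_sq n (\<lambda>i. X_ase n a i v* W n a - sqrt (\<rho>n n) *\<^sub>R x0 i))
      (LINT x:X\<delta>|F. LINT y:X\<delta>|F. kernel_S (Delta_mat F) \<rho> x y)"
      unfolding W_def
    proof (rule ase_limit)
      fix n a assume "1 \<le> n" "a \<in> set_pmf (P n)"
      then show "is_ase n a (X_ase n a)" using P(3) ase by blast
    qed
    have L2: "pmf_lim P (\<lambda>n a. frob_sq n (\<lambda>i. transpose (W' n a) *v X_hat n a i - sqrt (\<rho>n n) *\<^sub>R x0 i))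
      (LINT x:X\<delta>|F. LINT y:X\<delta>|F. kernel_G (G_mat F \<rho>) \<rho> x y)"
    proof (rule one_step_limit[where X = X_tilde and Y = X_hat and R = R and W = W' and \<zeta> = \<zeta> and Cz = Cz
          and rr = "\<lambda>n. ln (real n) powr \<omega> / (real n * \<rho>n n)", OF W' z less_imp_le[OF Cz] _ tR lim(2)])
      fix n a assume na: "1 \<le> n" "a \<in> set_pmf (P n)"
      show "is_one_step n a (X_tilde n a) (X_hat n a)" using P(3)[OF na] os[OF na(1)] by blast
      fix i assume "i < n"
      then show "transpose (W' n a) *v X_tilde n a i - sqrt (\<rho>n n) *\<^sub>R x0 i
        = (1 / sqrt (\<rho>n n)) *\<^sub>R (\<Sum>j<n. (a i j - \<rho>n n * (x0 i \<bullet> x0 j)) *\<^sub>R \<zeta> n i j) + R n a i"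
        using P(3)[OF na] eq by blast
    next
      show "0 \<le> ln (real n) powr \<omega> / (real n * \<rho>n n)" for n
        using rho_n[of n] by (cases "1 \<le> n") (auto simp: not_le)
    qed
    define Z where "Z = (\<lambda>n a. frob_sq n (\<lambda>i. X_ase n a i v* W n a - sqrt (\<rho>n n) *\<^sub>R x0 i)
        - frob_sq n (\<lambda>i. X_hat n a i v* W' n a - sqrt (\<rho>n n) *\<^sub>R x0 i))"
    define c where "c = (LINT x:latent_space|F. trace (Sigma_mat F \<rho> x - matrix_inv (G_mat F \<rho> x)))"
    have L: "pmf_lim P Z c"
      using pmf_lim_diff[OF L1 L2] unfolding c_def Z_def trace_integral(1)[OF assms(4) \<rho>] transpose_matrix_vector .
    have "tendsto_in_prob M (\<lambda>n w. Z n (A n w)) c"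
      unfolding tendsto_in_prob_def
    proof (intro allI impI)
      fix \<epsilon> :: real assume "0 < \<epsilon>"
      note l = L[unfolded pmf_lim_def, rule_format, OF this]
      show "(\<lambda>n. measure (M n) {w \<in> space (M n). \<epsilon> < \<bar>Z n (A n w) - c\<bar>}) \<longlonglongrightarrow> 0"
      proof (rule Lim_transform_eventually[OF l])
        show "\<forall>\<^sub>F n in sequentially. measure_pmf.prob (P n) {a. \<epsilon> < \<bar>Z n a - c\<bar>}
          = measure (M n) {w \<in> space (M n). \<epsilon> < \<bar>Z n (A n w) - c\<bar>}"
          using eventually_ge_at_top[of 1]
        proof eventually_elim
          case (elim n)
          show ?case using P(2)[OF elim, of "\<lambda>a. \<epsilon> < \<bar>Z n a - c\<bar>"] by simp
        qed
      qed
    qed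
    moreover have "orthogonal_matrix (W n a)" for n a unfolding W_def by (rule ase_rotation(1))
    ultimately show "\<exists>W W' :: nat \<Rightarrow> (nat \<Rightarrow> nat \<Rightarrow> real) \<Rightarrow> real^'d^'d.
          (\<forall>n a. orthogonal_matrix (W n a) \<and> orthogonal_matrix (W' n a)) \<and>
          tendsto_in_prob M
            (\<lambda>n w.
               frob_sq n (\<lambda>i. X_ase n (A n w) i v* W n (A n w) - sqrt (\<rho>n n) *\<^sub>R x0 i)
               - frob_sq n (\<lambda>i. X_hat n (A n w) i v* W' n (A n w) - sqrt (\<rho>n n) *\<^sub>R x0 i))
            (LINT x:latent_space|F. trace (Sigma_mat F \<rho> x - matrix_inv (G_mat F \<rho> x)))"
      unfolding Z_def c_def using W' by (intro exI[of _ W] exI[of _ W'] conjI allI) auto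
  qed
qed

end
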